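(* Let $R$ be a commutative ring with unity, let $\Gamma$ be a discrete group and let $\mathcal{H}$ be a set of subgroups of $\Gamma$ closed under conjugation such that there is a bound on the $\mathcal{H}$-lengths of the subgroups in $\mathcal{H}$. For each $H\in\mathcal{H}$ let $P_{H\bullet}$ be a resolution of the chain complex $\Sigma\widetilde{\mathcal{H}}_{H\bullet}$ by free $R[WH]$-modules. Then there is a projective resolution of $\underline{R}$ in the category of Bredon contramodules for $\mathcal{H}$ whose underlying graded object (i.e. regardless of the connecting maps) is $$\bigoplus_{H\in\mathcal{H}/\Gamma}\operatorname{ind}_\tau P_{H\bullet}=\bigoplus_{H\in\mathcal{H}/\Gamma}P^\Gamma_{H}(-)\otimes_{WH}P_{H\bullet},$$ where $\mathcal{H}/\Gamma$ is a set of representatives of the $\Gamma$-conjugacy classes in $\mathcal{H}$.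
   Context: The $\mathcal{H}$-length of a group $H\le\Gamma$ is the largest $s$ for which there is a chain $1\le H_0<H_1<\dots<H_s\le H$ with all $H_i\in\mathcal{H}$. For $H\le\Gamma$, $WH:=N_\Gamma(H)/H$. A Bredon contramodule (for $\mathcal{H}$) is a contravariant functor from the category of transitive $\Gamma$-sets with stabilizers in $\mathcal{H}$ and $\Gamma$-maps to the category of $R$-modules; the value at $\Gamma/T$ is written as the value at $T$. $\underline{R}$ is the constant functor with value $R$. For $H\in\mathcal{H}$, $P_H^\Gamma$ is the free contramodule based at $H$: $P_H^\Gamma(T)$ is the free $R$-module on the set of $\Gamma$-maps $\Gamma/T\to\Gamma/H$, i.e. $R\langle(\Gamma/H)^T\rangle$. For an $R[WH]$-module $U$, $\operatorname{ind}_\tau U$ is the Bredon contramodule $P_H^\Gamma(-)\otimes_{WH}U$; it is applied degreewise to complexes. For $H\le\Gamma$, $\mathcal{H}_H:=\{K\in\mathcal{H}\mid H<K\}$ (strict inclusion), a poset on which $WH$ acts by conjugation. $\mathcal{H}_{H\bullet}$ is the simplicial chain complex over $R$ of its geometric realization, $\widetilde{\mathcal{H}}_{H\bullet}$ is the augmented complex $\mathcal{H}_{H\bullet}\to R$ with $R$ in degree $-1$, and the suspension is $\Sigma\widetilde{\mathcal{H}}_{Hn}=\widetilde{\mathcal{H}}_{H,n-1}$. Chain complexes vanish in negative degrees. A free resolution of a complex $C_\bullet$ of $R[WH]$-modules is a complex $P_\bullet$ of free $R[WH]$-modules with a quasi-isomorphism $P_\bullet\to C_\bullet$. *)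

theory Defs
  imports
    "HOL-Algebra.Group_Action"
    "HOL-Algebra.Left_Coset"
    "HOL-Algebra.AbelCoset"
    "HOL-Algebra.Module"
    "HOL-Library.Extended_Nat"
begin

section \<open>Modules over a commutative ring\<close>

definition module_hom ::
    "('r, 'k) ring_scheme \<Rightarrow> ('r, 'a, 'c) module_scheme \<Rightarrow> ('r, 'b, 'd) module_scheme \<Rightarrow> ('a \<Rightarrow> 'b) set" where
  "module_hom R M N =
    {f \<in> hom (add_monoid M) (add_monoid N).
       \<forall>r \<in> carrier R. \<forall>x \<in> carrier M. f (r \<odot>\<^bsub>M\<^esub> x) = r \<odot>\<^bsub>N\<^esub> f x}"

text \<open>The record type of modules extends that of rings, so a module carries (meaningless) fields
  \<^const>\<open>monoid.mult\<close> and \<^const>\<open>monoid.one\<close>; they play no role anywhere below.\<close>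

definition regular_module :: "('r, 'k) ring_scheme \<Rightarrow> ('r, 'r) module" where
  "regular_module R =
    \<lparr>carrier = carrier R, monoid.mult = monoid.mult R, monoid.one = \<one>\<^bsub>R\<^esub>,
     ring.zero = \<zero>\<^bsub>R\<^esub>, ring.add = add R, module.smult = monoid.mult R\<rparr>"

definition direct_sum :: "'i set \<Rightarrow> ('i \<Rightarrow> ('r, 'm, 'c) module_scheme) \<Rightarrow> ('r, 'i \<Rightarrow> 'm) module" where
  "direct_sum I M =
    \<lparr>carrier = {x \<in> \<Pi>\<^sub>E i\<in>I. carrier (M i). finite {i \<in> I. x i \<noteq> \<zero>\<^bsub>M i\<^esub>}},
     monoid.mult = undefined, monoid.one = undefined,
     ring.zero = (\<lambda>i\<in>I. \<zero>\<^bsub>M i\<^esub>),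
     ring.add = (\<lambda>x y. \<lambda>i\<in>I. x i \<oplus>\<^bsub>M i\<^esub> y i),
     module.smult = (\<lambda>r x. \<lambda>i\<in>I. r \<odot>\<^bsub>M i\<^esub> x i)\<rparr>"

definition free_module :: "('r, 'k) ring_scheme \<Rightarrow> 's set \<Rightarrow> ('r, 's \<Rightarrow> 'r) module" where
  "free_module R S = direct_sum S (\<lambda>_. regular_module R)"

definition free_basis :: "('r, 'k) ring_scheme \<Rightarrow> 's set \<Rightarrow> 's \<Rightarrow> 's \<Rightarrow> 'r" where
  "free_basis R S s = (\<lambda>t\<in>S. if t = s then \<one>\<^bsub>R\<^esub> else \<zero>\<^bsub>R\<^esub>)"

text \<open>The \<open>R\<close>-linear extension of a map \<open>\<phi> : S \<rightarrow> T\<close> of bases.\<close>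

definition free_map ::
    "('r, 'k) ring_scheme \<Rightarrow> 's set \<Rightarrow> 't set \<Rightarrow> ('s \<Rightarrow> 't) \<Rightarrow> ('s \<Rightarrow> 'r) \<Rightarrow> 't \<Rightarrow> 'r" where
  "free_map R S T \<phi> c =
    (\<lambda>t\<in>T. finsum R c {s \<in> S. \<phi> s = t \<and> c s \<noteq> \<zero>\<^bsub>R\<^esub>})"

definition generated_submodule ::
    "('r, 'k) ring_scheme \<Rightarrow> ('r, 'm, 'c) module_scheme \<Rightarrow> 'm set \<Rightarrow> 'm set" where
  "generated_submodule R M S = \<Inter>{N. submodule N R M \<and> S \<subseteq> N}"

definition quotient_module :: "('r, 'm, 'c) module_scheme \<Rightarrow> 'm set \<Rightarrow> ('r, 'm set) module" where
  "quotient_module M N =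
    \<lparr>carrier = a_rcosets\<^bsub>M\<^esub> N, monoid.mult = undefined, monoid.one = undefined,
     ring.zero = N, add = set_add M,
     module.smult = (\<lambda>r X. \<Union>x\<in>X. N +>\<^bsub>M\<^esub> (r \<odot>\<^bsub>M\<^esub> x))\<rparr>"


section \<open>Modules over a group ring\<close>

text \<open>A (left) \<open>R[W]\<close>-module is an \<open>R\<close>-module together with an action of the group \<open>W\<close> by
  \<open>R\<close>-linear maps.\<close>

record ('r, 'm, 'w) group_module = "('r, 'm) module" +
  gact :: "'w \<Rightarrow> 'm \<Rightarrow> 'm"

definition is_group_module ::
    "('r, 'k) ring_scheme \<Rightarrow> ('w, 'l) monoid_scheme \<Rightarrow> ('r, 'm, 'w) group_module \<Rightarrow> bool" where
  "is_group_module R W M \<longleftrightarrow>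
     Module.module R M \<and>
     (\<forall>w \<in> carrier W. gact M w \<in> module_hom R M M) \<and>
     (\<forall>x \<in> carrier M. gact M \<one>\<^bsub>W\<^esub> x = x) \<and>
     (\<forall>v \<in> carrier W. \<forall>w \<in> carrier W. \<forall>x \<in> carrier M.
        gact M (v \<otimes>\<^bsub>W\<^esub> w) x = gact M v (gact M w x))"

definition group_module_hom ::
    "('r, 'k) ring_scheme \<Rightarrow> ('w, 'l) monoid_scheme \<Rightarrow>
     ('r, 'a, 'w) group_module \<Rightarrow> ('r, 'b, 'w) group_module \<Rightarrow> ('a \<Rightarrow> 'b) set" where
  "group_module_hom R W M N =
    {f \<in> module_hom R M N. \<forall>w \<in> carrier W. \<forall>x \<in> carrier M. f (gact M w x) = gact N w (f x)}"

text \<open>\<open>B\<close> is an \<open>R[W]\<close>-basis of \<open>M\<close> iff every element is \<open>\<Sum>\<^sub>b (\<Sum>\<^sub>w c(w,b) w) b\<close> for a unique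
  finitely supported family \<open>c\<close> of elements of \<open>R\<close>; here the inner sums are the coefficients in the
  group ring \<open>R[W]\<close>.\<close>

definition is_free_group_module ::
    "('r, 'k) ring_scheme \<Rightarrow> ('w, 'l) monoid_scheme \<Rightarrow> ('r, 'm, 'w) group_module \<Rightarrow> bool" where
  "is_free_group_module R W M \<longleftrightarrow>
     is_group_module R W M \<and>
     (\<exists>B \<subseteq> carrier M. \<forall>x \<in> carrier M.
        \<exists>!c. c \<in> carrier (free_module R (carrier W \<times> B)) \<and>
          x = finsum M (\<lambda>p. c p \<odot>\<^bsub>M\<^esub> gact M (fst p) (snd p))
                {p \<in> carrier W \<times> B. c p \<noteq> \<zero>\<^bsub>R\<^esub>})"

text \<open>The tensor product \<open>A \<otimes>\<^bsub>R[W]\<^esub> B\<close> of a right \<open>R[W]\<close>-module \<open>A\<close>, whose right action is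
  \<open>ract a w\<close>, and a left \<open>R[W]\<close>-module \<open>B\<close>: the free \<open>R\<close>-module on \<open>A \<times> B\<close> modulo bilinearity
  and the relations \<open>aw \<otimes> b = a \<otimes> wb\<close>. (The scalars of \<open>R\<close> act through the centre of \<open>R[W]\<close>, so
  the tensor product is an \<open>R\<close>-module.)\<close>

definition tensor_free ::
    "('r, 'k) ring_scheme \<Rightarrow> ('r, 'a) module \<Rightarrow> ('r, 'b, 'w) group_module \<Rightarrow>
     ('r, 'a \<times> 'b \<Rightarrow> 'r) module" where
  "tensor_free R A B = free_module R (carrier A \<times> carrier B)"

definition tensor_relations ::
    "('r, 'k) ring_scheme \<Rightarrow> ('w, 'l) monoid_scheme \<Rightarrow> ('r, 'a) module \<Rightarrow> ('a \<Rightarrow> 'w \<Rightarrow> 'a) \<Rightarrow>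
     ('r, 'b, 'w) group_module \<Rightarrow> ('a \<times> 'b \<Rightarrow> 'r) set" where
  "tensor_relations R W A ract B =
    (let F = tensor_free R A B;
         e = (\<lambda>a b. free_basis R (carrier A \<times> carrier B) (a, b))
     in generated_submodule R F
       ({e (a \<oplus>\<^bsub>A\<^esub> a') b \<ominus>\<^bsub>F\<^esub> (e a b \<oplus>\<^bsub>F\<^esub> e a' b) | a a' b.
           a \<in> carrier A \<and> a' \<in> carrier A \<and> b \<in> carrier B} \<union>
        {e a (b \<oplus>\<^bsub>B\<^esub> b') \<ominus>\<^bsub>F\<^esub> (e a b \<oplus>\<^bsub>F\<^esub> e a b') | a b b'.
           a \<in> carrier A \<and> b \<in> carrier B \<and> b' \<in> carrier B} \<union>
        {e (r \<odot>\<^bsub>A\<^esub> a) b \<ominus>\<^bsub>F\<^esub> (r \<odot>\<^bsub>F\<^esub> e a b) | r a b.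
           r \<in> carrier R \<and> a \<in> carrier A \<and> b \<in> carrier B} \<union>
        {e a (r \<odot>\<^bsub>B\<^esub> b) \<ominus>\<^bsub>F\<^esub> (r \<odot>\<^bsub>F\<^esub> e a b) | r a b.
           r \<in> carrier R \<and> a \<in> carrier A \<and> b \<in> carrier B} \<union>
        {e (ract a w) b \<ominus>\<^bsub>F\<^esub> e a (gact B w b) | w a b.
           w \<in> carrier W \<and> a \<in> carrier A \<and> b \<in> carrier B}))"

definition tensor ::
    "('r, 'k) ring_scheme \<Rightarrow> ('w, 'l) monoid_scheme \<Rightarrow> ('r, 'a) module \<Rightarrow> ('a \<Rightarrow> 'w \<Rightarrow> 'a) \<Rightarrow>
     ('r, 'b, 'w) group_module \<Rightarrow> ('r, ('a \<times> 'b \<Rightarrow> 'r) set) module" where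
  "tensor R W A ract B = quotient_module (tensor_free R A B) (tensor_relations R W A ract B)"

text \<open>The map \<open>f \<otimes> id : A \<otimes>\<^bsub>R[W]\<^esub> B \<rightarrow> A' \<otimes>\<^bsub>R[W]\<^esub> B\<close> induced by a map \<open>f\<close> of right
  \<open>R[W]\<close>-modules.\<close>

definition tensor_map ::
    "('r, 'k) ring_scheme \<Rightarrow> ('w, 'l) monoid_scheme \<Rightarrow> ('r, 'a) module \<Rightarrow>
     ('r, 'a1) module \<Rightarrow> ('a1 \<Rightarrow> 'w \<Rightarrow> 'a1) \<Rightarrow> ('r, 'b, 'w) group_module \<Rightarrow> ('a \<Rightarrow> 'a1) \<Rightarrow>
     ('a \<times> 'b \<Rightarrow> 'r) set \<Rightarrow> ('a1 \<times> 'b \<Rightarrow> 'r) set" where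
  "tensor_map R W A A' ract' B f Z =
    (\<Union>c\<in>Z. tensor_relations R W A' ract' B +>\<^bsub>tensor_free R A' B\<^esub>
       (free_map R (carrier A \<times> carrier B) (carrier A' \<times> carrier B) (\<lambda>(a, b). (f a, b)) c))"


section \<open>Chain complexes and free resolutions over a group ring\<close>

text \<open>Complexes in degrees \<open>\<ge> 0\<close>; \<open>cdiff C n\<close> is the differential from degree \<open>n + 1\<close> to
  degree \<open>n\<close>.\<close>

record ('r, 'm, 'w) group_complex =
  cterm :: "nat \<Rightarrow> ('r, 'm, 'w) group_module"
  cdiff :: "nat \<Rightarrow> 'm \<Rightarrow> 'm"

definition is_group_complex ::
    "('r, 'k) ring_scheme \<Rightarrow> ('w, 'l) monoid_scheme \<Rightarrow> ('r, 'm, 'w) group_complex \<Rightarrow> bool" where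
  "is_group_complex R W C \<longleftrightarrow>
     (\<forall>n. is_group_module R W (cterm C n)) \<and>
     (\<forall>n. cdiff C n \<in> group_module_hom R W (cterm C (Suc n)) (cterm C n)) \<and>
     (\<forall>n. \<forall>x \<in> carrier (cterm C (Suc (Suc n))).
        cdiff C n (cdiff C (Suc n) x) = \<zero>\<^bsub>cterm C n\<^esub>)"

primrec cycles :: "('r, 'm, 'w) group_complex \<Rightarrow> nat \<Rightarrow> 'm set" where
  "cycles C 0 = carrier (cterm C 0)"
| "cycles C (Suc n) = {x \<in> carrier (cterm C (Suc n)). cdiff C n x = \<zero>\<^bsub>cterm C n\<^esub>}"

definition boundaries :: "('r, 'm, 'w) group_complex \<Rightarrow> nat \<Rightarrow> 'm set" where
  "boundaries C n = cdiff C n ` carrier (cterm C (Suc n))"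

definition homology :: "('r, 'm, 'w) group_complex \<Rightarrow> nat \<Rightarrow> 'm set monoid" where
  "homology C n = (add_monoid (cterm C n))\<lparr>carrier := cycles C n\<rparr> Mod boundaries C n"

definition is_chain_map ::
    "('r, 'k) ring_scheme \<Rightarrow> ('w, 'l) monoid_scheme \<Rightarrow>
     ('r, 'a, 'w) group_complex \<Rightarrow> ('r, 'b, 'w) group_complex \<Rightarrow> (nat \<Rightarrow> 'a \<Rightarrow> 'b) \<Rightarrow> bool" where
  "is_chain_map R W C D f \<longleftrightarrow>
     (\<forall>n. f n \<in> group_module_hom R W (cterm C n) (cterm D n)) \<and>
     (\<forall>n. \<forall>x \<in> carrier (cterm C (Suc n)). f n (cdiff C n x) = cdiff D n (f (Suc n) x))"

text \<open>A homology class is a coset of the boundaries; the induced map sends the class of \<open>x\<close> to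
  that of \<open>f x\<close>.\<close>

definition homology_map ::
    "('r, 'b, 'w) group_complex \<Rightarrow> (nat \<Rightarrow> 'a \<Rightarrow> 'b) \<Rightarrow> nat \<Rightarrow> 'a set \<Rightarrow> 'b set" where
  "homology_map D f n X = boundaries D n <+>\<^bsub>cterm D n\<^esub> (f n ` X)"

definition is_quasi_iso ::
    "('r, 'a, 'w) group_complex \<Rightarrow> ('r, 'b, 'w) group_complex \<Rightarrow> (nat \<Rightarrow> 'a \<Rightarrow> 'b) \<Rightarrow> bool" where
  "is_quasi_iso C D f \<longleftrightarrow> (\<forall>n. homology_map D f n \<in> iso (homology C n) (homology D n))"

definition is_free_resolution ::
    "('r, 'k) ring_scheme \<Rightarrow> ('w, 'l) monoid_scheme \<Rightarrow>
     ('r, 'p, 'w) group_complex \<Rightarrow> ('r, 'c, 'w) group_complex \<Rightarrow> (nat \<Rightarrow> 'p \<Rightarrow> 'c) \<Rightarrow> bool" where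
  "is_free_resolution R W P C q \<longleftrightarrow>
     is_group_complex R W P \<and>
     (\<forall>n. is_free_group_module R W (cterm P n)) \<and>
     is_chain_map R W P C q \<and> is_quasi_iso P C q"


section \<open>Sets of subgroups\<close>

definition conjugate :: "('g, 'l) monoid_scheme \<Rightarrow> 'g \<Rightarrow> 'g set \<Rightarrow> 'g set" where
  "conjugate G g H = g <#\<^bsub>G\<^esub> H #>\<^bsub>G\<^esub> (inv\<^bsub>G\<^esub> g)"

text \<open>A chain \<open>H\<^sub>0 < \<dots> < H\<^sub>s \<le> H\<close> has length \<open>s\<close>; the supremum in \<^typ>\<open>enat\<close> is the largest
  such \<open>s\<close> when there is one.\<close>

definition subgroup_length :: "'g set set \<Rightarrow> 'g set \<Rightarrow> enat" where
  "subgroup_length \<H> H =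
    Sup {enat s | s. \<exists>c :: nat \<Rightarrow> 'g set.
      (\<forall>i \<le> s. c i \<in> \<H>) \<and> (\<forall>i < s. c i \<subset> c (Suc i)) \<and> c s \<subseteq> H}"

definition is_conjugacy_representatives ::
    "('g, 'l) monoid_scheme \<Rightarrow> 'g set set \<Rightarrow> 'g set set \<Rightarrow> bool" where
  "is_conjugacy_representatives G \<H> I \<longleftrightarrow>
     I \<subseteq> \<H> \<and> (\<forall>H \<in> \<H>. \<exists>!K. K \<in> I \<and> (\<exists>g \<in> carrier G. H = conjugate G g K))"

text \<open>The elements of \<open>WH\<close> are the cosets \<open>Hn = nH\<close> with \<open>n\<close> in the normalizer of \<open>H\<close>.\<close>

definition weyl_group :: "('g, 'l) monoid_scheme \<Rightarrow> 'g set \<Rightarrow> 'g set monoid" where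
  "weyl_group G H = (G\<lparr>carrier := normalizer G H\<rparr>) Mod H"

definition above :: "'g set set \<Rightarrow> 'g set \<Rightarrow> 'g set set" where
  "above \<H> H = {K \<in> \<H>. H \<subset> K}"

text \<open>For \<open>w = nH\<close> and \<open>H \<le> K\<close> this is \<open>nKn\<^sup>-\<^sup>1\<close>.\<close>

definition weyl_conjugate :: "('g, 'l) monoid_scheme \<Rightarrow> 'g set \<Rightarrow> 'g set \<Rightarrow> 'g set" where
  "weyl_conjugate G w K = w <#>\<^bsub>G\<^esub> K <#>\<^bsub>G\<^esub> (set_inv\<^bsub>G\<^esub> w)"

text \<open>The simplices of the geometric realization of a poset of subgroups, as strictly increasing
  lists; \<open>simplices X n\<close> consists of those with \<open>n\<close> vertices, i.e. of dimension \<open>n - 1\<close>. The list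
  \<^term>\<open>[]\<close> is the empty simplex, so that the free module on \<^term>\<open>simplices X 0\<close> is \<open>R\<close>.\<close>

definition simplices :: "'g set set \<Rightarrow> nat \<Rightarrow> 'g set list set" where
  "simplices X n = {\<sigma>. sorted_wrt (\<subset>) \<sigma> \<and> set \<sigma> \<subseteq> X \<and> length \<sigma> = n}"

definition simplex_face :: "nat \<Rightarrow> 'a list \<Rightarrow> 'a list" where
  "simplex_face i \<sigma> = take i \<sigma> @ drop (Suc i) \<sigma>"

text \<open>The suspension of the augmented simplicial chain complex of the poset \<open>\<H>\<^sub>H\<close> of members
  of \<open>\<H>\<close> strictly above \<open>H\<close>. In degree \<open>n\<close> it is the free module on the \<open>(n - 1)\<close>-simplices, with
  \<open>R\<close> in degree \<open>0\<close>. The differential from degree \<open>n + 1\<close> to \<open>n\<close> is the alternating sum of the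
  faces of \<open>n\<close>-simplices; for \<open>n = 0\<close> it sends every vertex to the empty simplex, so it is the
  augmentation.\<close>

definition suspended_augmented_chains ::
    "('r, 'k) ring_scheme \<Rightarrow> ('g, 'l) monoid_scheme \<Rightarrow> 'g set set \<Rightarrow> 'g set \<Rightarrow>
     ('r, 'g set list \<Rightarrow> 'r, 'g set) group_complex" where
  "suspended_augmented_chains R G \<H> H =
    (let S = simplices (above \<H> H) in
     \<lparr>cterm = (\<lambda>n. module.extend (free_module R (S n))
         \<lparr>gact = (\<lambda>w. free_map R (S n) (S n) (map (weyl_conjugate G w)))\<rparr>),
      cdiff = (\<lambda>n c. finsum (free_module R (S n))
         (\<lambda>i. ((\<ominus>\<^bsub>R\<^esub> \<one>\<^bsub>R\<^esub>) [^]\<^bsub>R\<^esub> i) \<odot>\<^bsub>free_module R (S n)\<^esub>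
               free_map R (S (Suc n)) (S n) (simplex_face i) c)
         {..n})\<rparr>)"


section \<open>Bredon contramodules\<close>

text \<open>A \<open>G\<close>-set is a pair of a carrier and an action. Transitive \<open>G\<close>-sets are taken on subsets of
  the type \<^typ>\<open>'g set\<close>, so that all coset spaces are among them; every transitive \<open>G\<close>-set is
  isomorphic to a coset space.\<close>

type_synonym 'g gset = "'g set set \<times> ('g \<Rightarrow> 'g set \<Rightarrow> 'g set)"

definition transitive_gsets :: "('g, 'l) monoid_scheme \<Rightarrow> 'g set set \<Rightarrow> 'g gset set" where
  "transitive_gsets G \<H> =
    {(X, \<phi>). transitive_action G X \<phi> \<and> X \<noteq> {} \<and> (\<forall>x \<in> X. stabilizer G \<phi> x \<in> \<H>)}"

definition gset_maps :: "('g, 'l) monoid_scheme \<Rightarrow> 'g gset \<Rightarrow> 'g gset \<Rightarrow> ('g set \<Rightarrow> 'g set) set" where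
  "gset_maps G X Y =
    {f \<in> fst X \<rightarrow>\<^sub>E fst Y. \<forall>g \<in> carrier G. \<forall>x \<in> fst X. f (snd X g x) = snd Y g (f x)}"

definition coset_gset :: "('g, 'l) monoid_scheme \<Rightarrow> 'g set \<Rightarrow> 'g gset" where
  "coset_gset G H = (lcosets\<^bsub>G\<^esub> H, \<lambda>g. \<lambda>C \<in> lcosets\<^bsub>G\<^esub> H. g <#\<^bsub>G\<^esub> C)"

text \<open>For \<open>f : X \<rightarrow> Y\<close>, \<open>cmap M X Y f\<close> is the induced map from the value at \<open>Y\<close> to the value
  at \<open>X\<close>.\<close>

record ('g, 'r, 'm) contramodule =
  cval :: "'g gset \<Rightarrow> ('r, 'm) module"
  cmap :: "'g gset \<Rightarrow> 'g gset \<Rightarrow> ('g set \<Rightarrow> 'g set) \<Rightarrow> 'm \<Rightarrow> 'm"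

definition is_contramodule ::
    "('r, 'k) ring_scheme \<Rightarrow> ('g, 'l) monoid_scheme \<Rightarrow> 'g set set \<Rightarrow>
     ('g, 'r, 'm) contramodule \<Rightarrow> bool" where
  "is_contramodule R G \<H> M \<longleftrightarrow>
     (\<forall>X \<in> transitive_gsets G \<H>. Module.module R (cval M X)) \<and>
     (\<forall>X \<in> transitive_gsets G \<H>. \<forall>Y \<in> transitive_gsets G \<H>. \<forall>f \<in> gset_maps G X Y.
        cmap M X Y f \<in> module_hom R (cval M Y) (cval M X)) \<and>
     (\<forall>X \<in> transitive_gsets G \<H>. \<forall>m \<in> carrier (cval M X).
        cmap M X X (\<lambda>x \<in> fst X. x) m = m) \<and>
     (\<forall>X \<in> transitive_gsets G \<H>. \<forall>Y \<in> transitive_gsets G \<H>. \<forall>Z \<in> transitive_gsets G \<H>.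
        \<forall>f \<in> gset_maps G X Y. \<forall>g \<in> gset_maps G Y Z. \<forall>m \<in> carrier (cval M Z).
        cmap M X Z (compose (fst X) g f) m = cmap M X Y f (cmap M Y Z g m))"

definition contramodule_homs ::
    "('r, 'k) ring_scheme \<Rightarrow> ('g, 'l) monoid_scheme \<Rightarrow> 'g set set \<Rightarrow>
     ('g, 'r, 'm) contramodule \<Rightarrow> ('g, 'r, 'n) contramodule \<Rightarrow> ('g gset \<Rightarrow> 'm \<Rightarrow> 'n) set" where
  "contramodule_homs R G \<H> M N =
    {\<eta>. (\<forall>X \<in> transitive_gsets G \<H>. \<eta> X \<in> module_hom R (cval M X) (cval N X)) \<and>
        (\<forall>X \<in> transitive_gsets G \<H>. \<forall>Y \<in> transitive_gsets G \<H>. \<forall>f \<in> gset_maps G X Y.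
           \<forall>m \<in> carrier (cval M Y). \<eta> X (cmap M X Y f m) = cmap N X Y f (\<eta> Y m))}"

definition contramodule_epis ::
    "('r, 'k) ring_scheme \<Rightarrow> ('g, 'l) monoid_scheme \<Rightarrow> 'g set set \<Rightarrow>
     ('g, 'r, 'm) contramodule \<Rightarrow> ('g, 'r, 'n) contramodule \<Rightarrow> ('g gset \<Rightarrow> 'm \<Rightarrow> 'n) set" where
  "contramodule_epis R G \<H> M N =
    {\<eta> \<in> contramodule_homs R G \<H> M N.
       \<forall>X \<in> transitive_gsets G \<H>. \<eta> X ` carrier (cval M X) = carrier (cval N X)}"

text \<open>Projectivity, tested on contramodules whose values have elements in the type \<open>'m\<close>.
  Since quantification over types is not available inside a definition, \<open>'m\<close> is a parameter. A
  theorem asserting this for a contramodule not depending on \<open>'m\<close>, with \<open>'m\<close> a free type variable,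
  asserts the lifting property against all epimorphisms of contramodules (two contramodules with
  elements in different types can be moved to their sum type).\<close>

definition is_projective_contramodule ::
    "'m itself \<Rightarrow> ('r, 'k) ring_scheme \<Rightarrow> ('g, 'l) monoid_scheme \<Rightarrow> 'g set set \<Rightarrow>
     ('g, 'r, 'p) contramodule \<Rightarrow> bool" where
  "is_projective_contramodule _ R G \<H> P \<longleftrightarrow>
     is_contramodule R G \<H> P \<and>
     (\<forall>(M :: ('g, 'r, 'm) contramodule) (N :: ('g, 'r, 'm) contramodule) \<epsilon> \<phi>.
        is_contramodule R G \<H> M \<longrightarrow> is_contramodule R G \<H> N \<longrightarrow>
        \<epsilon> \<in> contramodule_epis R G \<H> M N \<longrightarrow> \<phi> \<in> contramodule_homs R G \<H> P N \<longrightarrow>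
        (\<exists>\<psi> \<in> contramodule_homs R G \<H> P M.
           \<forall>X \<in> transitive_gsets G \<H>. \<forall>x \<in> carrier (cval P X). \<epsilon> X (\<psi> X x) = \<phi> X x))"

text \<open>The sequence \<open>\<dots> \<rightarrow> E 1 \<rightarrow> E 0 \<rightarrow> M \<rightarrow> 0\<close> with maps \<open>d n : E (n + 1) \<rightarrow> E n\<close> and
  \<open>\<epsilon> : E 0 \<rightarrow> M\<close> is exact, and all \<open>E n\<close> are projective.\<close>

definition is_projective_resolution ::
    "'m itself \<Rightarrow> ('r, 'k) ring_scheme \<Rightarrow> ('g, 'l) monoid_scheme \<Rightarrow> 'g set set \<Rightarrow>
     (nat \<Rightarrow> ('g, 'r, 'e) contramodule) \<Rightarrow> (nat \<Rightarrow> 'g gset \<Rightarrow> 'e \<Rightarrow> 'e) \<Rightarrow>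
     ('g gset \<Rightarrow> 'e \<Rightarrow> 'n) \<Rightarrow> ('g, 'r, 'n) contramodule \<Rightarrow> bool" where
  "is_projective_resolution T R G \<H> E d \<epsilon> M \<longleftrightarrow>
     (\<forall>n. is_projective_contramodule T R G \<H> (E n)) \<and>
     (\<forall>n. d n \<in> contramodule_homs R G \<H> (E (Suc n)) (E n)) \<and>
     \<epsilon> \<in> contramodule_epis R G \<H> (E 0) M \<and>
     (\<forall>X \<in> transitive_gsets G \<H>.
        d 0 X ` carrier (cval (E 1) X) = a_kernel (cval (E 0) X) (cval M X) (\<epsilon> X) \<and>
        (\<forall>n. d (Suc n) X ` carrier (cval (E (Suc (Suc n))) X) =
               a_kernel (cval (E (Suc n)) X) (cval (E n) X) (d n X)))"

definition constant_contramodule :: "('r, 'k) ring_scheme \<Rightarrow> ('g, 'r, 'r) contramodule" where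
  "constant_contramodule R = \<lparr>cval = (\<lambda>_. regular_module R), cmap = (\<lambda>_ _ _ r. r)\<rparr>"

definition contramodule_sum ::
    "'i set \<Rightarrow> ('i \<Rightarrow> ('g, 'r, 'm) contramodule) \<Rightarrow> ('g, 'r, 'i \<Rightarrow> 'm) contramodule" where
  "contramodule_sum I M =
    \<lparr>cval = (\<lambda>X. direct_sum I (\<lambda>i. cval (M i) X)),
     cmap = (\<lambda>X Y f m. \<lambda>i\<in>I. cmap (M i) X Y f (m i))\<rparr>"

definition free_contramodule ::
    "('r, 'k) ring_scheme \<Rightarrow> ('g, 'l) monoid_scheme \<Rightarrow> 'g set \<Rightarrow>
     ('g, 'r, ('g set \<Rightarrow> 'g set) \<Rightarrow> 'r) contramodule" where
  "free_contramodule R G H =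
    \<lparr>cval = (\<lambda>X. free_module R (gset_maps G X (coset_gset G H))),
     cmap = (\<lambda>X Y f. free_map R (gset_maps G Y (coset_gset G H)) (gset_maps G X (coset_gset G H))
               (\<lambda>h. compose (fst X) h f))\<rparr>"

text \<open>The right action of \<open>WH\<close> on the free contramodule based at \<open>H\<close>, which comes from the right
  action \<open>gH \<cdot> nH = gnH\<close> on \<open>G/H\<close>.\<close>

definition free_contramodule_ract ::
    "('r, 'k) ring_scheme \<Rightarrow> ('g, 'l) monoid_scheme \<Rightarrow> 'g set \<Rightarrow> 'g gset \<Rightarrow>
     (('g set \<Rightarrow> 'g set) \<Rightarrow> 'r) \<Rightarrow> 'g set \<Rightarrow> (('g set \<Rightarrow> 'g set) \<Rightarrow> 'r)" where
  "free_contramodule_ract R G H X a w =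
    free_map R (gset_maps G X (coset_gset G H)) (gset_maps G X (coset_gset G H))
      (\<lambda>h. \<lambda>x \<in> fst X. h x <#>\<^bsub>G\<^esub> w) a"

definition ind_tau ::
    "('r, 'k) ring_scheme \<Rightarrow> ('g, 'l) monoid_scheme \<Rightarrow> 'g set \<Rightarrow> ('r, 'm, 'g set) group_module \<Rightarrow>
     ('g, 'r, ((('g set \<Rightarrow> 'g set) \<Rightarrow> 'r) \<times> 'm \<Rightarrow> 'r) set) contramodule" where
  "ind_tau R G H U =
    \<lparr>cval = (\<lambda>X. tensor R (weyl_group G H)
               (cval (free_contramodule R G H) X) (free_contramodule_ract R G H X) U),
     cmap = (\<lambda>X Y f. tensor_map R (weyl_group G H)
               (cval (free_contramodule R G H) Y)
               (cval (free_contramodule R G H) X) (free_contramodule_ract R G H X) U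
               (cmap (free_contramodule R G H) X Y f))\<rparr>"

end

theory Submission imports Defs "HOL-Algebra.Zassenhaus" begin

text \<open>
  The chains of the posets of members of \<open>\<H>\<close> containing the stabilizer of \<open>x\<close>, for \<open>x\<close> in a transitive
  set \<open>X\<close>, form a complex \<open>F\<close> of contramodules, and \<open>F\<close> resolves \<open>R\<close>, since each of these posets has the
  stabilizer as its least element. Filter \<open>F\<close> by the \<open>\<H>\<close>-length of the least member of a chain. For a
  member \<open>K = gHg\<^sup>-\<^sup>1\<close>, the chains with least member \<open>K\<close> are the simplices of \<open>\<H>\<^sub>H\<close> with \<open>H\<close> put in
  front, so that the part of the associated graded complex belonging to \<open>K\<close> is the suspended augmented chain
  complex of \<open>\<H>\<^sub>H\<close>, which \<open>q H\<close> resolves by \<open>P H\<close>.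

  Each generator of \<open>P H\<close> therefore gets the differential of the mapping cone of \<open>q H\<close>, corrected by terms
  of strictly larger length. The corrections are found degree by degree: what has to be corrected is a
  cycle of larger length, and the cone is exact in every step of the filtration by descending induction on
  the length, because it is exact on each fibre. The result is an acyclic cone on a map from the induced
  contramodules to \<open>F\<close>, so that these form a resolution of \<open>R\<close> as well. Everything is done with
  finitely supported functions on the generators; a basis of \<open>P H\<close> identifies the value of
  the induced contramodule at \<open>X\<close> with such functions on pairs of a map \<open>X \<rightarrow> G/H\<close> and a basis element.
\<close>

section \<open>Linear algebra\<close>

text \<open>The contramodules of chains are in general not projective, because nontrivial elements
  of \<open>WH\<close> can fix a simplex of \<open>\<H>\<^sub>H\<close>; the modules of
  \<open>P H\<close> are free and cure this one conjugacy class at a time. The obstacle is that the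
  pieces do not fit together: deleting the least member of a chain changes its head, so the sum of
  the maps \<open>q H\<close> is no chain map to \<open>F\<close>, and the sum of the differentials
  of the \<open>P H\<close> has to be corrected along with it. The cone packs both corrections into
  one unknown, the image of a generator. By Yoneda this image may be prescribed freely at the
  identity of \<open>G/H\<close>, and freeness over \<open>R[WH]\<close> means that it is prescribed
  on basis elements only, with no equivariance left to respect. The bound on the lengths makes the
  descending induction stop. The suspension arises because the chain with the single member
  \<open>K\<close> corresponds to the empty simplex of \<open>\<H>\<^sub>H\<close>, so that the
  lowest term of a piece is the augmentation term \<open>R\<close>.\<close>

lemma module_homI:
  assumes "\<And>x. x \<in> carrier M \<Longrightarrow> f x \<in> carrier N"
    and "\<And>x y. x \<in> carrier M \<Longrightarrow> y \<in> carrier M \<Longrightarrow> f (x \<oplus>\<^bsub>M\<^esub> y) = f x \<oplus>\<^bsub>N\<^esub> f y"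
    and "\<And>r x. r \<in> carrier R \<Longrightarrow> x \<in> carrier M \<Longrightarrow> f (r \<odot>\<^bsub>M\<^esub> x) = r \<odot>\<^bsub>N\<^esub> f x"
  shows "f \<in> module_hom R M N"
  using assms by (auto simp: module_hom_def hom_def)

lemma module_hom_closed: "f \<in> module_hom R M N \<Longrightarrow> x \<in> carrier M \<Longrightarrow> f x \<in> carrier N"
  by (auto simp: module_hom_def hom_def)

lemma module_hom_add:
  "f \<in> module_hom R M N \<Longrightarrow> x \<in> carrier M \<Longrightarrow> y \<in> carrier M \<Longrightarrow> f (x \<oplus>\<^bsub>M\<^esub> y) = f x \<oplus>\<^bsub>N\<^esub> f y"
  by (auto simp: module_hom_def hom_def)

lemma module_hom_smult:
  "f \<in> module_hom R M N \<Longrightarrow> r \<in> carrier R \<Longrightarrow> x \<in> carrier M \<Longrightarrow> f (r \<odot>\<^bsub>M\<^esub> x) = r \<odot>\<^bsub>N\<^esub> f x"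
  by (auto simp: module_hom_def)

lemma module_hom_cong:
  assumes "f \<in> module_hom R M N" "\<And>x. x \<in> carrier M \<Longrightarrow> f x = g x" "Module.module R M"
  shows "g \<in> module_hom R M N"
proof -
  interpret Module.module R M by fact
  show ?thesis
    using assms(1) by (intro module_homI) (simp_all flip: assms(2) add: module_hom_closed module_hom_add module_hom_smult)
qed

lemma module_hom_comp:
  "f \<in> module_hom R M N \<Longrightarrow> g \<in> module_hom R N L \<Longrightarrow> (\<lambda>x. g (f x)) \<in> module_hom R M L"
  by (intro module_homI) (simp_all add: module_hom_closed module_hom_add module_hom_smult)

lemma module_hom_id: "(\<lambda>x. x) \<in> module_hom R M M"
  by (intro module_homI) auto

lemma module_hom_zero:
  assumes "Module.module R M" "Module.module R N" "f \<in> module_hom R M N"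
  shows "f \<zero>\<^bsub>M\<^esub> = \<zero>\<^bsub>N\<^esub>"
proof -
  interpret M: Module.module R M by fact
  interpret N: Module.module R N by fact
  have "f (\<zero>\<^bsub>R\<^esub> \<odot>\<^bsub>M\<^esub> \<zero>\<^bsub>M\<^esub>) = \<zero>\<^bsub>R\<^esub> \<odot>\<^bsub>N\<^esub> f \<zero>\<^bsub>M\<^esub>"
    using assms(3) by (intro module_hom_smult) auto
  moreover have "\<zero>\<^bsub>R\<^esub> \<odot>\<^bsub>N\<^esub> f \<zero>\<^bsub>M\<^esub> = \<zero>\<^bsub>N\<^esub>"
    using module_hom_closed[OF assms(3) M.zero_closed] by (rule N.smult_l_null)
  moreover have "\<zero>\<^bsub>R\<^esub> \<odot>\<^bsub>M\<^esub> \<zero>\<^bsub>M\<^esub> = \<zero>\<^bsub>M\<^esub>" by simp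
  ultimately show ?thesis by metis
qed

lemma module_hom_a_inv:
  assumes "Module.module R M" "Module.module R N" "f \<in> module_hom R M N" "x \<in> carrier M"
  shows "f (\<ominus>\<^bsub>M\<^esub> x) = \<ominus>\<^bsub>N\<^esub> f x"
proof -
  interpret M: Module.module R M by fact
  interpret N: Module.module R N by fact
  have fx: "f x \<in> carrier N" by (rule module_hom_closed[OF assms(3,4)])
  have "f (\<ominus>\<^bsub>M\<^esub> x) = f ((\<ominus>\<^bsub>R\<^esub> \<one>\<^bsub>R\<^esub>) \<odot>\<^bsub>M\<^esub> x)" using assms(4) by (simp add: M.smult_l_minus)
  also have "\<dots> = (\<ominus>\<^bsub>R\<^esub> \<one>\<^bsub>R\<^esub>) \<odot>\<^bsub>N\<^esub> f x" using assms by (intro module_hom_smult) auto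
  finally show ?thesis using fx by (simp add: N.smult_l_minus)
qed

lemma module_hom_minus:
  assumes "Module.module R M" "Module.module R N" "f \<in> module_hom R M N" "x \<in> carrier M" "y \<in> carrier M"
  shows "f (x \<ominus>\<^bsub>M\<^esub> y) = f x \<ominus>\<^bsub>N\<^esub> f y"
proof -
  interpret M: Module.module R M by fact
  show ?thesis
    using assms by (simp add: a_minus_def module_hom_add[OF assms(3)] module_hom_a_inv[OF assms(1-3)])
qed

lemma module_hom_finsum:
  assumes "Module.module R M" "Module.module R N" "f \<in> module_hom R M N"
    and "finite A" "g \<in> A \<rightarrow> carrier M"
  shows "f (finsum M g A) = finsum N (\<lambda>a. f (g a)) A"
proof -
  interpret M: Module.module R M by fact
  interpret N: Module.module R N by fact
  show ?thesis using assms(4,5)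
  proof (induction A rule: finite_induct)
    case empty
    then show ?case using module_hom_zero[OF assms(1-3)] by simp
  next
    case (insert x F)
    then have "g x \<in> carrier M" "g \<in> F \<rightarrow> carrier M" by auto
    moreover have "(\<lambda>a. f (g a)) \<in> F \<rightarrow> carrier N" "f (g x) \<in> carrier N"
      using calculation assms(3) by (auto intro: module_hom_closed)
    ultimately show ?case using insert assms(3)
      by (simp add: M.finsum_insert N.finsum_insert module_hom_add)
  qed
qed

lemma module_hom_inv:
  assumes "Module.module R M" "f \<in> module_hom R M N" "bij_betw f (carrier M) (carrier N)"
  shows "inv_into (carrier M) f \<in> module_hom R N M"
proof -
  interpret M: Module.module R M by fact
  let ?g = "inv_into (carrier M) f"
  have g: "?g y \<in> carrier M" "f (?g y) = y" if "y \<in> carrier N" for y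
    using that assms(3) by (auto simp: bij_betw_def inv_into_into f_inv_into_f)
  have inj: "x = y" if "f x = f y" "x \<in> carrier M" "y \<in> carrier M" for x y
    using that assms(3) by (auto simp: bij_betw_def inj_on_def)
  show ?thesis
  proof (rule module_homI)
    fix x y assume xy: "x \<in> carrier N" "y \<in> carrier N"
    have "f (?g x \<oplus>\<^bsub>M\<^esub> ?g y) = x \<oplus>\<^bsub>N\<^esub> y"
      using xy g assms(2) by (simp add: module_hom_add)
    moreover have "f (?g x \<oplus>\<^bsub>M\<^esub> ?g y) \<in> carrier N"
      using g xy by (intro module_hom_closed[OF assms(2)]) simp
    ultimately show "?g (x \<oplus>\<^bsub>N\<^esub> y) = ?g x \<oplus>\<^bsub>M\<^esub> ?g y"
      using xy by (intro inj) (auto simp: g)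
  next
    fix r x assume rx: "r \<in> carrier R" "x \<in> carrier N"
    have "f (r \<odot>\<^bsub>M\<^esub> ?g x) = r \<odot>\<^bsub>N\<^esub> x"
      using rx g assms(2) by (simp add: module_hom_smult)
    moreover have "f (r \<odot>\<^bsub>M\<^esub> ?g x) \<in> carrier N"
      using g rx by (intro module_hom_closed[OF assms(2)]) simp
    ultimately show "?g (r \<odot>\<^bsub>N\<^esub> x) = r \<odot>\<^bsub>M\<^esub> ?g x"
      using rx by (intro inj) (auto simp: g)
  qed (auto simp: g)
qed

lemma regular_module_simps [simp]:
  "carrier (regular_module R) = carrier R" "\<zero>\<^bsub>regular_module R\<^esub> = \<zero>\<^bsub>R\<^esub>"
  "add (regular_module R) = add R" "module.smult (regular_module R) = monoid.mult R"
  by (simp_all add: regular_module_def)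

lemma direct_sum_zero: "\<zero>\<^bsub>direct_sum I M\<^esub> = (\<lambda>i\<in>I. \<zero>\<^bsub>M i\<^esub>)"
  and direct_sum_add: "x \<oplus>\<^bsub>direct_sum I M\<^esub> y = (\<lambda>i\<in>I. x i \<oplus>\<^bsub>M i\<^esub> y i)"
  and direct_sum_smult: "r \<odot>\<^bsub>direct_sum I M\<^esub> x = (\<lambda>i\<in>I. r \<odot>\<^bsub>M i\<^esub> x i)"
  by (simp_all add: direct_sum_def)

lemma direct_sum_carrier_iff:
  "x \<in> carrier (direct_sum I M) \<longleftrightarrow>
     x \<in> extensional I \<and> (\<forall>i\<in>I. x i \<in> carrier (M i)) \<and> finite {i \<in> I. x i \<noteq> \<zero>\<^bsub>M i\<^esub>}"
  by (auto simp: direct_sum_def PiE_iff)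

lemma (in cring) abelian_group_regular_module: "abelian_group (regular_module R)"
  by (rule abelian_groupI) (auto simp: a_ac intro: bexI[where x="\<ominus> x" for x] l_neg)

lemma (in cring) module_regular_module: "Module.module R (regular_module R)"
  by (rule moduleI)
     (auto simp: is_cring abelian_group_regular_module l_distr r_distr m_assoc)

lemma (in cring) module_direct_sum:
  assumes "\<And>i. i \<in> I \<Longrightarrow> Module.module R (M i)"
  shows "Module.module R (direct_sum I M)" (is "Module.module R ?S")
proof -
  have mon: "abelian_monoid (M i)" if "i \<in> I" for i
  proof -
    interpret Module.module R "M i" using assms that .
    show ?thesis ..
  qed
  have fin1: "finite {i \<in> I. x i \<oplus>\<^bsub>M i\<^esub> y i \<noteq> \<zero>\<^bsub>M i\<^esub>}"
    if "finite {i \<in> I. x i \<noteq> \<zero>\<^bsub>M i\<^esub>}" "finite {i \<in> I. y i \<noteq> \<zero>\<^bsub>M i\<^esub>}" for x y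
  proof (rule finite_subset[OF _ finite_UnI[OF that]], rule subsetI)
    fix i assume i: "i \<in> {i \<in> I. x i \<oplus>\<^bsub>M i\<^esub> y i \<noteq> \<zero>\<^bsub>M i\<^esub>}"
    then interpret Mi: Module.module R "M i" using assms by simp
    show "i \<in> {i \<in> I. x i \<noteq> \<zero>\<^bsub>M i\<^esub>} \<union> {i \<in> I. y i \<noteq> \<zero>\<^bsub>M i\<^esub>}"
      using i by auto
  qed
  have fin2: "finite {i \<in> I. r \<odot>\<^bsub>M i\<^esub> x i \<noteq> \<zero>\<^bsub>M i\<^esub>}"
    if "finite {i \<in> I. x i \<noteq> \<zero>\<^bsub>M i\<^esub>}" "r \<in> carrier R" for r x
    by (rule finite_subset[OF _ that(1)]) (auto simp: module.smult_r_null[OF assms that(2)])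
  have closed: "x \<oplus>\<^bsub>?S\<^esub> y \<in> carrier ?S" if "x \<in> carrier ?S" "y \<in> carrier ?S" for x y
    using that fin1[of x y] mon
    by (auto simp: direct_sum_carrier_iff direct_sum_add abelian_monoid.a_closed cong: conj_cong)
  have sclosed: "r \<odot>\<^bsub>?S\<^esub> x \<in> carrier ?S" if "r \<in> carrier R" "x \<in> carrier ?S" for r x
    using that fin2[of x r] module.smult_closed[OF assms]
    by (auto simp: direct_sum_carrier_iff direct_sum_smult cong: conj_cong)
  have zero: "\<zero>\<^bsub>?S\<^esub> \<in> carrier ?S"
    using mon by (auto simp: direct_sum_carrier_iff direct_sum_zero abelian_monoid.zero_closed cong: conj_cong)
  have ext: "x = y" if "x \<in> carrier ?S" "y \<in> carrier ?S" "\<And>i. i \<in> I \<Longrightarrow> x i = y i" for x y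
    using that by (auto simp: direct_sum_carrier_iff intro: extensionalityI)
  have C: "x i \<in> carrier (M i)" if "x \<in> carrier ?S" "i \<in> I" for x i
    using that by (auto simp: direct_sum_carrier_iff)
  have ag: "abelian_group ?S"
  proof (rule abelian_groupI)
    fix x y z
    assume *: "x \<in> carrier ?S" "y \<in> carrier ?S" "z \<in> carrier ?S"
    show "x \<oplus>\<^bsub>?S\<^esub> y \<oplus>\<^bsub>?S\<^esub> z = x \<oplus>\<^bsub>?S\<^esub> (y \<oplus>\<^bsub>?S\<^esub> z)"
    proof (rule ext)
      fix i assume i: "i \<in> I"
      then interpret Mi: Module.module R "M i" using assms by simp
      show "(x \<oplus>\<^bsub>?S\<^esub> y \<oplus>\<^bsub>?S\<^esub> z) i = (x \<oplus>\<^bsub>?S\<^esub> (y \<oplus>\<^bsub>?S\<^esub> z)) i"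
        using C[OF *(1) i] C[OF *(2) i] C[OF *(3) i] i by (simp add: direct_sum_add Mi.a_assoc)
    qed (use * closed in simp_all)
  next
    fix x y assume *: "x \<in> carrier ?S" "y \<in> carrier ?S"
    show "x \<oplus>\<^bsub>?S\<^esub> y = y \<oplus>\<^bsub>?S\<^esub> x"
    proof (rule ext)
      fix i assume i: "i \<in> I"
      then interpret Mi: Module.module R "M i" using assms by simp
      show "(x \<oplus>\<^bsub>?S\<^esub> y) i = (y \<oplus>\<^bsub>?S\<^esub> x) i"
        using C[OF *(1) i] C[OF *(2) i] i by (simp add: direct_sum_add Mi.a_comm)
    qed (use * closed in simp_all)
  next
    fix x assume *: "x \<in> carrier ?S"
    show "\<zero>\<^bsub>?S\<^esub> \<oplus>\<^bsub>?S\<^esub> x = x"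
    proof (rule ext)
      fix i assume i: "i \<in> I"
      then interpret Mi: Module.module R "M i" using assms by simp
      show "(\<zero>\<^bsub>?S\<^esub> \<oplus>\<^bsub>?S\<^esub> x) i = x i"
        using C[OF * i] i by (simp add: direct_sum_add direct_sum_zero)
    qed (use * closed zero in simp_all)
    \<comment> \<open>Multiplication by -1 supplies the negative, so that its membership follows
      from \<open>sclosed\<close>.\<close>
    have m: "(\<ominus> \<one>) \<odot>\<^bsub>?S\<^esub> x \<in> carrier ?S" using * by (intro sclosed) simp_all
    show "\<exists>y\<in>carrier ?S. y \<oplus>\<^bsub>?S\<^esub> x = \<zero>\<^bsub>?S\<^esub>"
    proof (rule bexI[OF _ m], rule ext)
      fix i assume i: "i \<in> I"
      then interpret Mi: Module.module R "M i" using assms by simp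
      show "(((\<ominus> \<one>) \<odot>\<^bsub>?S\<^esub> x) \<oplus>\<^bsub>?S\<^esub> x) i = \<zero>\<^bsub>?S\<^esub> i"
        using C[OF * i] i
        by (simp add: direct_sum_add direct_sum_zero direct_sum_smult Mi.smult_l_minus Mi.l_neg)
    qed (use * closed zero m in simp_all)
  qed (use closed zero in simp_all)
  show ?thesis
  proof (rule moduleI)
    fix a b x assume *: "a \<in> carrier R" "b \<in> carrier R" "x \<in> carrier ?S"
    show "(a \<oplus> b) \<odot>\<^bsub>?S\<^esub> x = a \<odot>\<^bsub>?S\<^esub> x \<oplus>\<^bsub>?S\<^esub> b \<odot>\<^bsub>?S\<^esub> x"
      by (insert * C[OF *(3)], rule ext, simp add: closed sclosed, simp add: closed sclosed, simp add: direct_sum_add direct_sum_smult module.smult_l_distr[OF assms])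
    show "(a \<otimes> b) \<odot>\<^bsub>?S\<^esub> x = a \<odot>\<^bsub>?S\<^esub> (b \<odot>\<^bsub>?S\<^esub> x)"
      by (insert * C[OF *(3)], rule ext, simp add: closed sclosed, simp add: closed sclosed, simp add: direct_sum_smult module.smult_assoc1[OF assms])
  next
    fix a x y assume *: "a \<in> carrier R" "x \<in> carrier ?S" "y \<in> carrier ?S"
    show "a \<odot>\<^bsub>?S\<^esub> (x \<oplus>\<^bsub>?S\<^esub> y) = a \<odot>\<^bsub>?S\<^esub> x \<oplus>\<^bsub>?S\<^esub> a \<odot>\<^bsub>?S\<^esub> y"
      by (insert * C[OF *(2)] C[OF *(3)], rule ext, simp add: closed sclosed, simp add: closed sclosed, simp add: direct_sum_add direct_sum_smult module.smult_r_distr[OF assms])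
  next
    fix x assume *: "x \<in> carrier ?S"
    show "\<one> \<odot>\<^bsub>?S\<^esub> x = x"
      by (insert * C[OF *], rule ext, simp add: closed sclosed, simp add: closed sclosed, simp add: direct_sum_smult module.smult_one[OF assms])
  qed (rule is_cring, rule ag, rule sclosed, assumption+)
qed

text \<open>\<open>finsum\<close> reads only the additive structure, which \<open>R\<close> shares
  with its regular module.\<close>

lemma regular_module_finsum [simp]: "finsum (regular_module R) f A = finsum R f A"
  by (simp add: finsum_def finprod_def)

section \<open>Linear maps and free modules\<close>

context cring
begin

lemma module_hom_sum:
  assumes M: "Module.module R M" and N: "Module.module R N"
    and "f \<in> module_hom R M N" "g \<in> module_hom R M N"
  shows "(\<lambda>x. f x \<oplus>\<^bsub>N\<^esub> g x) \<in> module_hom R M N"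
proof -
  interpret N: Module.module R N by fact
  note f = module_hom_closed[OF assms(3)] module_hom_add[OF assms(3)] module_hom_smult[OF assms(3)]
  note g = module_hom_closed[OF assms(4)] module_hom_add[OF assms(4)] module_hom_smult[OF assms(4)]
  show ?thesis
    by (rule module_homI) (simp_all add: f g N.smult_r_distr N.add.m_ac)
qed

lemma module_hom_scale:
  assumes M: "Module.module R M" and N: "Module.module R N" and "f \<in> module_hom R M N" "a \<in> carrier R"
  shows "(\<lambda>x. a \<odot>\<^bsub>N\<^esub> f x) \<in> module_hom R M N"
proof -
  interpret N: Module.module R N by fact
  note f = module_hom_closed[OF assms(3)] module_hom_add[OF assms(3)] module_hom_smult[OF assms(3)]
  show ?thesis
    using assms(4)
    by (intro module_homI) (simp_all add: f N.smult_r_distr m_comm flip: N.smult_assoc1)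
qed

lemma module_hom_const_zero:
  assumes N: "Module.module R N"
  shows "(\<lambda>x. \<zero>\<^bsub>N\<^esub>) \<in> module_hom R M N"
proof -
  interpret N: Module.module R N by fact
  show ?thesis by (rule module_homI) auto
qed

lemma module_hom_finsum_fun:
  assumes M: "Module.module R M" and N: "Module.module R N" and "finite A"
    and "\<And>a. a \<in> A \<Longrightarrow> f a \<in> module_hom R M N"
  shows "(\<lambda>x. finsum N (\<lambda>a. f a x) A) \<in> module_hom R M N"
  using assms(3,4)
proof (induction A rule: finite_induct)
  interpret N: Module.module R N by fact
  case empty
  then show ?case using module_hom_const_zero[OF N] by simp
next
  interpret N: Module.module R N by fact
  case (insert a A)
  have "(\<lambda>x. f a x \<oplus>\<^bsub>N\<^esub> finsum N (\<lambda>a. f a x) A) \<in> module_hom R M N"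
    using insert by (intro module_hom_sum[OF M N]) auto
  then show ?case
  proof (rule module_hom_cong[OF _ _ M])
    fix x assume x: "x \<in> carrier M"
    have "f b x \<in> carrier N" if "b \<in> insert a A" for b
      by (rule module_hom_closed[OF insert.prems[OF that] x])
    then show "f a x \<oplus>\<^bsub>N\<^esub> finsum N (\<lambda>a. f a x) A = finsum N (\<lambda>a. f a x) (insert a A)"
      using insert.hyps by (subst N.finsum_insert) auto
  qed
qed

lemma free_module_carrier_iff:
  "c \<in> carrier (free_module R S) \<longleftrightarrow>
     c \<in> extensional S \<and> (\<forall>s\<in>S. c s \<in> carrier R) \<and> finite {s \<in> S. c s \<noteq> \<zero>}"
  by (simp add: free_module_def direct_sum_carrier_iff)

lemma module_free_module: "Module.module R (free_module R S)"
  unfolding free_module_def by (intro module_direct_sum module_regular_module)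

lemma free_module_closed [simp]: "c \<in> carrier (free_module R S) \<Longrightarrow> s \<in> S \<Longrightarrow> c s \<in> carrier R"
  and free_module_finite: "c \<in> carrier (free_module R S) \<Longrightarrow> finite {s \<in> S. c s \<noteq> \<zero>}"
  by (simp_all add: free_module_carrier_iff)

lemma free_module_apply [simp]:
  assumes "s \<in> S"
  shows "\<zero>\<^bsub>free_module R S\<^esub> s = \<zero>" "(x \<oplus>\<^bsub>free_module R S\<^esub> y) s = x s \<oplus> y s"
    "(r \<odot>\<^bsub>free_module R S\<^esub> x) s = r \<otimes> x s"
  using assms by (simp_all add: free_module_def direct_sum_zero direct_sum_add direct_sum_smult)

lemma free_module_eqI:
  assumes "x \<in> carrier (free_module R S)" "y \<in> carrier (free_module R S)"
    and "\<And>s. s \<in> S \<Longrightarrow> x s = y s"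
  shows "x = y"
  using assms by (auto simp: free_module_carrier_iff intro: extensionalityI)

lemma free_module_eval_hom:
  "s \<in> S \<Longrightarrow> (\<lambda>c. c s) \<in> module_hom R (free_module R S) (regular_module R)"
  by (rule module_homI) auto

lemma free_module_minus_apply [simp]:
  assumes "s \<in> S" "x \<in> carrier (free_module R S)" "y \<in> carrier (free_module R S)"
  shows "(x \<ominus>\<^bsub>free_module R S\<^esub> y) s = x s \<ominus> y s"
  using module_hom_minus[OF module_free_module module_regular_module free_module_eval_hom[OF assms(1)] assms(2,3)]
  by (simp add: a_minus_def a_inv_def m_inv_def)

lemma free_module_finsum_apply:
  assumes "finite A" "f \<in> A \<rightarrow> carrier (free_module R S)" "s \<in> S"
  shows "finsum (free_module R S) f A s = (\<Oplus>a\<in>A. f a s)"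
  using module_hom_finsum[OF module_free_module module_regular_module free_module_eval_hom[OF assms(3)] assms(1,2)]
  by simp

lemma free_basis_carrier [simp]: "s \<in> S \<Longrightarrow> free_basis R S s \<in> carrier (free_module R S)"
proof -
  have "{t \<in> S. free_basis R S s t \<noteq> \<zero>} \<subseteq> {s}" by (auto simp: free_basis_def)
  then show ?thesis by (auto simp: free_module_carrier_iff free_basis_def intro: finite_subset)
qed

lemma free_basis_apply: "t \<in> S \<Longrightarrow> free_basis R S s t = (if t = s then \<one> else \<zero>)"
  by (simp add: free_basis_def)

lemma free_module_expand:
  assumes c: "c \<in> carrier (free_module R S)" and A: "finite A" "A \<subseteq> S" "{s \<in> S. c s \<noteq> \<zero>} \<subseteq> A"
  shows "c = finsum (free_module R S) (\<lambda>s. c s \<odot>\<^bsub>free_module R S\<^esub> free_basis R S s) A" (is "c = ?d")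
proof -
  interpret F: Module.module R "free_module R S" by (rule module_free_module)
  have cl: "(\<lambda>s. c s \<odot>\<^bsub>free_module R S\<^esub> free_basis R S s) \<in> A \<rightarrow> carrier (free_module R S)"
    using c A by (auto intro!: F.smult_closed)
  show ?thesis
  proof (rule free_module_eqI[OF c])
    show "?d \<in> carrier (free_module R S)" using cl by simp
    fix t assume t: "t \<in> S"
    have "?d t = (\<Oplus>s\<in>A. c s \<otimes> free_basis R S s t)"
      using t A cl by (subst free_module_finsum_apply) auto
    also have "\<dots> = (\<Oplus>s\<in>A. if t = s then c s else \<zero>)"
      using c A t by (intro finsum_cong') (auto simp: free_basis_apply)
    also have "\<dots> = c t"
    proof (cases "t \<in> A")
      case True
      then show ?thesis using finsum_singleton[OF True A(1), of c] c A by (auto simp: subset_iff)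
    next
      case False
      then have "(\<Oplus>s\<in>A. if t = s then c s else \<zero>) = (\<Oplus>s\<in>A. \<zero>)" by (intro finsum_cong') auto
      then show ?thesis using False A(3) t by auto
    qed
    finally show "c t = ?d t" by simp
  qed
qed

text \<open>Induction along the expansion of \<open>c\<close> in the basis. The step may assume
  \<open>c s \<noteq> \<zero>\<close>, so that facts known only on the support of \<open>c\<close>
  can be used, as in \<open>free_hom_support\<close>.\<close>

lemma free_module_supp_induct [consumes 1, case_names zero add]:
  assumes c: "c \<in> carrier (free_module R S)"
    and zero: "Q \<zero>\<^bsub>free_module R S\<^esub>"
    and add: "\<And>r s d. r \<in> carrier R \<Longrightarrow> s \<in> S \<Longrightarrow> c s \<noteq> \<zero> \<Longrightarrow> d \<in> carrier (free_module R S) \<Longrightarrow> Q d \<Longrightarrow>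
      Q (r \<odot>\<^bsub>free_module R S\<^esub> free_basis R S s \<oplus>\<^bsub>free_module R S\<^esub> d)"
  shows "Q c"
proof -
  interpret F: Module.module R "free_module R S" by (rule module_free_module)
  let ?f = "\<lambda>s. c s \<odot>\<^bsub>free_module R S\<^esub> free_basis R S s"
  let ?A = "{s \<in> S. c s \<noteq> \<zero>}"
  have "Q (finsum (free_module R S) ?f B)" if "finite B" "B \<subseteq> ?A" for B
    using that
  proof (induction B rule: finite_induct)
    case empty then show ?case using zero by simp
  next
    case (insert x B)
    have cl: "?f \<in> insert x B \<rightarrow> carrier (free_module R S)"
      using insert.prems c by (auto intro!: F.smult_closed)
    have "Q (?f x \<oplus>\<^bsub>free_module R S\<^esub> finsum (free_module R S) ?f B)"
      using insert c cl by (intro add F.finsum_closed) auto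
    then show ?case using insert.hyps cl by (subst F.finsum_insert) auto
  qed
  from this[of ?A] show ?thesis
    using free_module_expand[OF c, of ?A] free_module_finite[OF c] by auto
qed

lemma free_hom_eqI:
  assumes M: "Module.module R M"
    and f: "f \<in> module_hom R (free_module R S) M" and g: "g \<in> module_hom R (free_module R S) M"
    and eq: "\<And>s. s \<in> S \<Longrightarrow> f (free_basis R S s) = g (free_basis R S s)"
    and c: "c \<in> carrier (free_module R S)"
  shows "f c = g c"
  using c
proof (induction rule: free_module_supp_induct)
  case zero
  then show ?case using module_hom_zero[OF module_free_module M] f g by metis
next
  case (add r s d)
  interpret F: Module.module R "free_module R S" by (rule module_free_module)
  show ?case using add eq[OF add(2)]
    by (simp add: module_hom_add[OF f] module_hom_add[OF g] module_hom_smult[OF f] module_hom_smult[OF g])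
qed

definition free_lift :: "'s set \<Rightarrow> ('a, 'm, 'c) module_scheme \<Rightarrow> ('s \<Rightarrow> 'm) \<Rightarrow> ('s \<Rightarrow> 'a) \<Rightarrow> 'm" where
  "free_lift S M f c = finsum M (\<lambda>s. c s \<odot>\<^bsub>M\<^esub> f s) {s \<in> S. c s \<noteq> \<zero>}"

text \<open>Supports change under addition and scaling; summing over any finite set that contains
  the support gives \<open>free_lift_hom\<close> a common index set.\<close>

lemma free_lift_superset:
  assumes M: "Module.module R M" and f: "f \<in> S \<rightarrow> carrier M"
    and c: "\<And>s. s \<in> S \<Longrightarrow> c s \<in> carrier R" and A: "finite A" "A \<subseteq> S" "{s \<in> S. c s \<noteq> \<zero>} \<subseteq> A"
  shows "free_lift S M f c = finsum M (\<lambda>s. c s \<odot>\<^bsub>M\<^esub> f s) A"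
proof -
  interpret M: Module.module R M by fact
  show ?thesis unfolding free_lift_def
    using f c A by (intro M.add.finprod_mono_neutral_cong_left) (auto simp: Pi_iff subset_iff)
qed

lemma free_lift_hom:
  assumes M: "Module.module R M" and f: "f \<in> S \<rightarrow> carrier M"
  shows "free_lift S M f \<in> module_hom R (free_module R S) M"
proof -
  interpret M: Module.module R M by fact
  interpret F: Module.module R "free_module R S" by (rule module_free_module)
  note sup = free_lift_superset[OF M f]
  show ?thesis
  proof (rule module_homI)
    fix x assume x: "x \<in> carrier (free_module R S)"
    then show "free_lift S M f x \<in> carrier M"
      using f unfolding free_lift_def by (intro M.finsum_closed) auto
    fix y assume y: "y \<in> carrier (free_module R S)"
    let ?A = "{s \<in> S. x s \<noteq> \<zero>} \<union> {s \<in> S. y s \<noteq> \<zero>}"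
    have fin: "finite ?A" using x y by (simp add: free_module_finite)
    have fs: "f s \<in> carrier M" if "s \<in> ?A" for s using that f by auto
    have "free_lift S M f (x \<oplus>\<^bsub>free_module R S\<^esub> y) =
        finsum M (\<lambda>s. (x \<oplus>\<^bsub>free_module R S\<^esub> y) s \<odot>\<^bsub>M\<^esub> f s) ?A"
      using x y fin by (intro sup) auto
    also have "\<dots> = finsum M (\<lambda>s. x s \<odot>\<^bsub>M\<^esub> f s \<oplus>\<^bsub>M\<^esub> y s \<odot>\<^bsub>M\<^esub> f s) ?A"
      using x y fs by (intro M.finsum_cong') (auto simp: M.smult_l_distr)
    also have "\<dots> = finsum M (\<lambda>s. x s \<odot>\<^bsub>M\<^esub> f s) ?A \<oplus>\<^bsub>M\<^esub> finsum M (\<lambda>s. y s \<odot>\<^bsub>M\<^esub> f s) ?A"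
      using x y fs by (intro M.finsum_addf) auto
    also have "\<dots> = free_lift S M f x \<oplus>\<^bsub>M\<^esub> free_lift S M f y"
      using x y fin by (subst (1 2) sup[where A="?A"]) auto
    finally show "free_lift S M f (x \<oplus>\<^bsub>free_module R S\<^esub> y) = free_lift S M f x \<oplus>\<^bsub>M\<^esub> free_lift S M f y" .
  next
    fix r x assume r: "r \<in> carrier R" and x: "x \<in> carrier (free_module R S)"
    let ?A = "{s \<in> S. x s \<noteq> \<zero>}"
    have fin: "finite ?A" using x by (simp add: free_module_finite)
    have fs: "f s \<in> carrier M" if "s \<in> ?A" for s using that f by auto
    have "free_lift S M f (r \<odot>\<^bsub>free_module R S\<^esub> x) =
        finsum M (\<lambda>s. (r \<odot>\<^bsub>free_module R S\<^esub> x) s \<odot>\<^bsub>M\<^esub> f s) ?A"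
      using x r fin by (intro sup) auto
    also have "\<dots> = finsum M (\<lambda>s. r \<odot>\<^bsub>M\<^esub> (x s \<odot>\<^bsub>M\<^esub> f s)) ?A"
      using x r fs by (intro M.finsum_cong') (auto simp: M.smult_assoc1)
    also have "\<dots> = r \<odot>\<^bsub>M\<^esub> finsum M (\<lambda>s. x s \<odot>\<^bsub>M\<^esub> f s) ?A"
      using x r fs fin by (intro M.finsum_smult_ldistr[symmetric]) auto
    finally show "free_lift S M f (r \<odot>\<^bsub>free_module R S\<^esub> x) = r \<odot>\<^bsub>M\<^esub> free_lift S M f x"
      by (simp add: free_lift_def)
  qed
qed

lemma free_lift_basis:
  assumes M: "Module.module R M" and f: "f \<in> S \<rightarrow> carrier M" and s: "s \<in> S"
  shows "free_lift S M f (free_basis R S s) = f s"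
proof -
  interpret M: Module.module R M by fact
  have "free_lift S M f (free_basis R S s) = finsum M (\<lambda>t. free_basis R S s t \<odot>\<^bsub>M\<^esub> f t) {s}"
    using s by (intro free_lift_superset[OF M f]) (auto simp: free_basis_apply split: if_splits)
  also have "\<dots> = free_basis R S s s \<odot>\<^bsub>M\<^esub> f s"
    using f s by (subst M.finsum_insert) (auto simp: free_basis_apply Pi_iff)
  finally show ?thesis using f s by (auto simp: free_basis_apply Pi_iff)
qed

text \<open>\<open>free_map\<close> is defined by sums over fibres. Recognizing it as a linear
  extension makes it a homomorphism determined by the basis, so that later identities between such
  maps need only be checked on \<open>free_basis\<close>.\<close>

lemma free_map_eq_lift:
  assumes \<phi>: "\<phi> \<in> S \<rightarrow> T" and c: "c \<in> carrier (free_module R S)"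
  shows "free_map R S T \<phi> c = free_lift S (free_module R T) (\<lambda>s. free_basis R T (\<phi> s)) c"
proof -
  interpret T: Module.module R "free_module R T" by (rule module_free_module)
  have f: "(\<lambda>s. free_basis R T (\<phi> s)) \<in> S \<rightarrow> carrier (free_module R T)" using \<phi> by (auto simp: Pi_iff)
  have cl: "free_lift S (free_module R T) (\<lambda>s. free_basis R T (\<phi> s)) c \<in> carrier (free_module R T)"
    by (rule module_hom_closed[OF free_lift_hom[OF module_free_module f] c])
  show ?thesis
  proof (rule extensionalityI)
    show "free_map R S T \<phi> c \<in> extensional T" by (simp add: free_map_def)
    show "free_lift S (free_module R T) (\<lambda>s. free_basis R T (\<phi> s)) c \<in> extensional T"
      using cl by (simp add: free_module_carrier_iff)
    fix t assume t: "t \<in> T"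
    have fs: "\<phi> s \<in> T" "c s \<in> carrier R" if "s \<in> {s \<in> S. c s \<noteq> \<zero>}" for s using that \<phi> c by auto
    have "free_lift S (free_module R T) (\<lambda>s. free_basis R T (\<phi> s)) c t =
      (\<Oplus>s\<in>{s \<in> S. c s \<noteq> \<zero>}. (c s \<odot>\<^bsub>free_module R T\<^esub> free_basis R T (\<phi> s)) t)"
      unfolding free_lift_def using c fs t by (subst free_module_finsum_apply) (auto simp: free_module_finite)
    also have "\<dots> = (\<Oplus>s\<in>{s \<in> S. \<phi> s = t \<and> c s \<noteq> \<zero>}. c s)"
      using t c fs by (intro add.finprod_mono_neutral_cong_right) (auto simp: free_module_finite free_basis_apply)
    finally show "free_map R S T \<phi> c t = free_lift S (free_module R T) (\<lambda>s. free_basis R T (\<phi> s)) c t"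
      using t by (simp add: free_map_def)
  qed
qed

lemma free_map_hom: "\<phi> \<in> S \<rightarrow> T \<Longrightarrow> free_map R S T \<phi> \<in> module_hom R (free_module R S) (free_module R T)"
  by (rule module_hom_cong[OF free_lift_hom[OF module_free_module]])
     (auto simp: free_map_eq_lift module_free_module Pi_iff)

lemma free_map_closed [simp]:
  "\<phi> \<in> S \<rightarrow> T \<Longrightarrow> c \<in> carrier (free_module R S) \<Longrightarrow> free_map R S T \<phi> c \<in> carrier (free_module R T)"
  by (rule module_hom_closed[OF free_map_hom])

lemma free_map_basis [simp]:
  "\<phi> \<in> S \<rightarrow> T \<Longrightarrow> s \<in> S \<Longrightarrow> free_map R S T \<phi> (free_basis R S s) = free_basis R T (\<phi> s)"
  by (subst free_map_eq_lift) (auto simp: free_lift_basis[OF module_free_module] Pi_iff)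

lemma free_map_cong: "(\<And>s. s \<in> S \<Longrightarrow> \<phi> s = \<psi> s) \<Longrightarrow> free_map R S T \<phi> c = free_map R S T \<psi> c"
  unfolding free_map_def by (intro restrict_ext arg_cong2[where f="finsum R"]) auto

lemma free_map_comp:
  assumes "\<phi> \<in> S \<rightarrow> T" "\<psi> \<in> T \<rightarrow> U" "c \<in> carrier (free_module R S)"
  shows "free_map R T U \<psi> (free_map R S T \<phi> c) = free_map R S U (\<lambda>s. \<psi> (\<phi> s)) c"
proof -
  have *: "(\<lambda>s. \<psi> (\<phi> s)) \<in> S \<rightarrow> U" using assms by auto
  show ?thesis
    by (rule free_hom_eqI[OF module_free_module module_hom_comp[OF free_map_hom free_map_hom] free_map_hom])
       (use assms * in \<open>auto simp: Pi_iff\<close>)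
qed

lemma free_map_id:
  assumes "c \<in> carrier (free_module R S)" "\<And>s. s \<in> S \<Longrightarrow> \<phi> s = s"
  shows "free_map R S S \<phi> c = c"
  by (rule free_hom_eqI[OF module_free_module free_map_hom module_hom_id]) (use assms in auto)

text \<open>A nonzero coefficient needs a nonempty fibre sum. Later this restricts the heads that
  can occur in the image of an embedding.\<close>

lemma free_map_support:
  assumes "free_map R S T \<phi> c t \<noteq> \<zero>" "t \<in> T"
  obtains s where "s \<in> S" "\<phi> s = t" "c s \<noteq> \<zero>"
proof -
  have eq: "free_map R S T \<phi> c t = finsum R c {s \<in> S. \<phi> s = t \<and> c s \<noteq> \<zero>}"
    using assms(2) by (simp add: free_map_def)
  have "{s \<in> S. \<phi> s = t \<and> c s \<noteq> \<zero>} \<noteq> {}"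
  proof
    assume "{s \<in> S. \<phi> s = t \<and> c s \<noteq> \<zero>} = {}"
    from eq[unfolded this] assms(1) show False by simp
  qed
  then show ?thesis using that by auto
qed

text \<open>The fibres of an injective relabelling have at most one element, so coefficients can be
  read back from the image.\<close>

lemma free_map_inj_apply:
  assumes "inj_on \<phi> S" "\<phi> \<in> S \<rightarrow> T" "c \<in> carrier (free_module R S)" "s \<in> S"
  shows "free_map R S T \<phi> c (\<phi> s) = c s"
proof -
  have eq: "free_map R S T \<phi> c (\<phi> s) = finsum R c {s' \<in> S. \<phi> s' = \<phi> s \<and> c s' \<noteq> \<zero>}"
    using assms by (auto simp: free_map_def)
  show ?thesis
  proof (cases "c s = \<zero>")
    case True
    then have "{s' \<in> S. \<phi> s' = \<phi> s \<and> c s' \<noteq> \<zero>} = {}" using assms by (auto simp: inj_on_def)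
    from eq[unfolded this] True show ?thesis by simp
  next
    case False
    then have "{s' \<in> S. \<phi> s' = \<phi> s \<and> c s' \<noteq> \<zero>} = {s}" using assms by (auto simp: inj_on_def)
    moreover have "finsum R c {s} = c s" using assms by (subst finsum_insert) auto
    ultimately show ?thesis using eq by simp
  qed
qed

end

section \<open>Quotients and tensor products\<close>

lemma (in abelian_group) minus_eq_zero_iff:
  "x \<in> carrier G \<Longrightarrow> y \<in> carrier G \<Longrightarrow> x \<ominus> y = \<zero> \<longleftrightarrow> x = y"
  using add.inv_solve_right'[of \<zero> x y] by (auto simp: a_minus_def r_neg)

context Module.module
begin

lemma submodule_generated_submodule:
  assumes "S \<subseteq> carrier M"
  shows "submodule (generated_submodule R M S) R M"
proof (rule submoduleI)
  show "generated_submodule R M S \<subseteq> carrier M"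
    using carrier_is_submodule assms by (auto simp: generated_submodule_def)
qed (auto simp: generated_submodule_def submoduleE(3-5) subgroup.one_closed
    dest: submodule.axioms(1)[THEN subgroup.one_closed])

lemma generated_submodule_incl: "s \<in> S \<Longrightarrow> s \<in> generated_submodule R M S"
  by (auto simp: generated_submodule_def)

text \<open>The preimage of \<open>L\<close> is a submodule that contains \<open>S\<close>, hence
  one of the submodules whose intersection is the generated one.\<close>

lemma generated_submodule_image:
  assumes N: "Module.module R N" and f: "f \<in> module_hom R M N" and L: "submodule L R N"
    and S: "S \<subseteq> carrier M" "\<And>s. s \<in> S \<Longrightarrow> f s \<in> L"
    and x: "x \<in> generated_submodule R M S"
  shows "f x \<in> L"
proof -
  interpret N: Module.module R N by fact
  have M: "Module.module R M" by unfold_locales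
  note L' = N.submoduleE[OF L]
  have "submodule {x \<in> carrier M. f x \<in> L} R M"
  proof (rule submoduleI)
    show "\<zero>\<^bsub>M\<^esub> \<in> {x \<in> carrier M. f x \<in> L}"
      using subgroup.one_closed[OF submodule.axioms(1)[OF L]] by (simp add: module_hom_zero[OF M N f])
  qed (auto simp: module_hom_add[OF f] module_hom_smult[OF f] module_hom_a_inv[OF M N f] L'(3-5))
  moreover have "S \<subseteq> {x \<in> carrier M. f x \<in> L}" using S by auto
  ultimately show ?thesis using x by (auto simp: generated_submodule_def)
qed

end

lemma (in Module.module) submodule_zero: "submodule {\<zero>\<^bsub>M\<^esub>} R M"
  by (rule submoduleI) (auto simp: M.add.inv_one[folded a_inv_def])

section \<open>Quotient modules\<close>

locale module_quotient = Module.module R M for R (structure) and M (structure) +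
  fixes N
  assumes sub: "submodule N R M"
begin

lemma abelian_subgroup: "abelian_subgroup N M"
  by (intro abelian_subgroupI3 additive_subgroup.intro submodule.axioms(1)[OF sub]) unfold_locales

sublocale abelian_subgroup N M by (rule abelian_subgroup)

abbreviation "Q \<equiv> quotient_module M N"

definition proj where "proj x = N +>\<^bsub>M\<^esub> x"

lemma carrier_Q: "carrier Q = proj ` carrier M"
  by (auto simp: quotient_module_def A_RCOSETS_def' proj_def a_r_coset_def')

lemma proj_closed [simp]: "x \<in> carrier M \<Longrightarrow> proj x \<in> carrier Q"
  by (simp add: carrier_Q)

lemma proj_add: "x \<in> carrier M \<Longrightarrow> y \<in> carrier M \<Longrightarrow> proj x \<oplus>\<^bsub>Q\<^esub> proj y = proj (x \<oplus>\<^bsub>M\<^esub> y)"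
  by (simp add: quotient_module_def proj_def a_rcos_sum)

lemma zero_Q: "\<zero>\<^bsub>Q\<^esub> = proj \<zero>\<^bsub>M\<^esub>"
  using a_subset by (simp add: quotient_module_def proj_def)

lemma proj_eq_iff:
  assumes "x \<in> carrier M" "y \<in> carrier M"
  shows "proj x = proj y \<longleftrightarrow> x \<ominus>\<^bsub>M\<^esub> y \<in> N"
proof
  assume "proj x = proj y"
  moreover have "x \<in> proj x" using a_rcos_self[OF assms(1)] by (simp add: proj_def)
  ultimately show "x \<ominus>\<^bsub>M\<^esub> y \<in> N" using assms a_rcos_module[of y x]
    by (simp add: proj_def a_minus_def)
next
  assume "x \<ominus>\<^bsub>M\<^esub> y \<in> N"
  then have "x \<in> N +>\<^bsub>M\<^esub> y"
    using assms a_rcos_module_rev[of y x] by (simp add: a_minus_def)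
  then show "proj x = proj y"
    using assms a_repr_independence' unfolding proj_def by metis
qed

lemma proj_cong: "x \<in> proj y \<Longrightarrow> y \<in> carrier M \<Longrightarrow> proj x = proj y \<and> x \<in> carrier M"
  unfolding proj_def using a_repr_independence'[of x y] a_elemrcos_carrier by auto

lemma proj_self: "x \<in> carrier M \<Longrightarrow> x \<in> proj x"
  by (simp add: proj_def a_rcos_self)

text \<open>The scalar multiple of a coset is defined as a union over all its representatives. These
  contribute one and the same coset, since their differences stay in \<open>N\<close> after
  scaling.\<close>

lemma proj_smult:
  assumes "r \<in> carrier R" "x \<in> carrier M"
  shows "r \<odot>\<^bsub>Q\<^esub> proj x = proj (r \<odot>\<^bsub>M\<^esub> x)"
proof -
  have "proj (r \<odot>\<^bsub>M\<^esub> y) = proj (r \<odot>\<^bsub>M\<^esub> x)" if "y \<in> proj x" for y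
  proof -
    have y: "y \<in> carrier M" "proj y = proj x" using proj_cong[OF that assms(2)] by auto
    then have "y \<ominus>\<^bsub>M\<^esub> x \<in> N" using proj_eq_iff assms(2) by simp
    then have "r \<odot>\<^bsub>M\<^esub> (y \<ominus>\<^bsub>M\<^esub> x) \<in> N" by (rule submodule.smult_closed[OF sub assms(1)])
    also have "r \<odot>\<^bsub>M\<^esub> (y \<ominus>\<^bsub>M\<^esub> x) = r \<odot>\<^bsub>M\<^esub> y \<ominus>\<^bsub>M\<^esub> r \<odot>\<^bsub>M\<^esub> x"
      using assms y by (simp add: a_minus_def smult_r_distr smult_r_minus)
    finally show ?thesis using assms y by (subst proj_eq_iff) auto
  qed
  then have "(\<Union>y\<in>proj x. proj (r \<odot>\<^bsub>M\<^esub> y)) = (\<Union>y\<in>proj x. proj (r \<odot>\<^bsub>M\<^esub> x))"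
    by (rule SUP_cong[OF refl])
  also have "\<dots> = proj (r \<odot>\<^bsub>M\<^esub> x)" using proj_self[OF assms(2)] by blast
  finally show ?thesis by (simp add: quotient_module_def proj_def)
qed

lemma Q_cases:
  assumes "X \<in> carrier Q"
  obtains x where "x \<in> carrier M" "X = proj x"
  using assms by (auto simp: carrier_Q)

lemma module_Q: "Module.module R Q"
proof -
  have ag: "abelian_group Q"
  proof (rule abelian_groupI)
    show "\<zero>\<^bsub>Q\<^esub> \<in> carrier Q" by (simp add: zero_Q)
    fix x assume "x \<in> carrier Q"
    then obtain x' where x: "x' \<in> carrier M" "x = proj x'" by (rule Q_cases)
    then show "\<zero>\<^bsub>Q\<^esub> \<oplus>\<^bsub>Q\<^esub> x = x" by (simp add: zero_Q proj_add)
    show "\<exists>y\<in>carrier Q. y \<oplus>\<^bsub>Q\<^esub> x = \<zero>\<^bsub>Q\<^esub>"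
      using x by (intro bexI[of _ "proj (\<ominus>\<^bsub>M\<^esub> x')"]) (auto simp: zero_Q proj_add M.l_neg)
    fix y assume "y \<in> carrier Q"
    then obtain y' where y: "y' \<in> carrier M" "y = proj y'" by (rule Q_cases)
    show "x \<oplus>\<^bsub>Q\<^esub> y \<in> carrier Q" using x y by (simp add: proj_add)
    show "x \<oplus>\<^bsub>Q\<^esub> y = y \<oplus>\<^bsub>Q\<^esub> x" using x y by (simp add: proj_add M.a_comm)
    fix z assume "z \<in> carrier Q"
    then obtain z' where z: "z' \<in> carrier M" "z = proj z'" by (rule Q_cases)
    show "x \<oplus>\<^bsub>Q\<^esub> y \<oplus>\<^bsub>Q\<^esub> z = x \<oplus>\<^bsub>Q\<^esub> (y \<oplus>\<^bsub>Q\<^esub> z)" using x y z by (simp add: proj_add M.a_assoc)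
  qed
  show ?thesis
  proof (rule moduleI[OF is_cring ag])
    fix x assume "x \<in> carrier Q"
    then obtain x' where x: "x' \<in> carrier M" "x = proj x'" by (rule Q_cases)
    show "\<one> \<odot>\<^bsub>Q\<^esub> x = x" using x by (simp add: proj_smult)
  next
    fix a x assume a: "a \<in> carrier R" and "x \<in> carrier Q"
    then obtain x' where x: "x' \<in> carrier M" "x = proj x'" by (elim Q_cases)
    show "a \<odot>\<^bsub>Q\<^esub> x \<in> carrier Q" using a x by (simp add: proj_smult)
    fix y assume "y \<in> carrier Q"
    then obtain y' where y: "y' \<in> carrier M" "y = proj y'" by (rule Q_cases)
    show "a \<odot>\<^bsub>Q\<^esub> (x \<oplus>\<^bsub>Q\<^esub> y) = a \<odot>\<^bsub>Q\<^esub> x \<oplus>\<^bsub>Q\<^esub> a \<odot>\<^bsub>Q\<^esub> y"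
      using a x y by (simp add: proj_add proj_smult smult_r_distr)
  next
    fix a b x assume a: "a \<in> carrier R" "b \<in> carrier R" and "x \<in> carrier Q"
    then obtain x' where x: "x' \<in> carrier M" "x = proj x'" by (elim Q_cases)
    show "(a \<oplus> b) \<odot>\<^bsub>Q\<^esub> x = a \<odot>\<^bsub>Q\<^esub> x \<oplus>\<^bsub>Q\<^esub> b \<odot>\<^bsub>Q\<^esub> x"
      using a x by (simp add: proj_add proj_smult smult_l_distr)
    show "(a \<otimes> b) \<odot>\<^bsub>Q\<^esub> x = a \<odot>\<^bsub>Q\<^esub> (b \<odot>\<^bsub>Q\<^esub> x)"
      using a x by (simp add: proj_smult smult_assoc1)
  qed
qed

lemma proj_hom: "proj \<in> module_hom R M Q"
  by (rule module_homI) (auto simp: proj_add proj_smult)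

lemma quotient_hom_eqI:
  assumes "\<And>x. x \<in> carrier M \<Longrightarrow> f (proj x) = g (proj x)" "X \<in> carrier Q"
  shows "f X = g X"
  using assms by (auto elim!: Q_cases)

text \<open>The map evaluates \<open>f\<close> at an arbitrarily chosen representative; all
  representatives give the same value because \<open>f\<close> kills their differences.\<close>

lemma quotient_hom_exists:
  assumes L: "Module.module R L" and f: "f \<in> module_hom R M L" and N: "\<And>x. x \<in> N \<Longrightarrow> f x = \<zero>\<^bsub>L\<^esub>"
  shows "\<exists>f' \<in> module_hom R Q L. \<forall>x\<in>carrier M. f' (proj x) = f x"
proof -
  interpret L: Module.module R L by fact
  have M: "Module.module R M" by unfold_locales
  define f' where "f' X = f (SOME x. x \<in> X)" for X
  have f': "f' (proj x) = f x" if x: "x \<in> carrier M" for x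
  proof -
    have "(SOME y. y \<in> proj x) \<in> proj x" using proj_self[OF x] by (rule someI)
    then obtain y where y: "y = (SOME y. y \<in> proj x)" "y \<in> carrier M" "proj y = proj x"
      using proj_cong x by blast
    then have "f (y \<ominus>\<^bsub>M\<^esub> x) = \<zero>\<^bsub>L\<^esub>" using x N by (simp add: proj_eq_iff)
    then have "f y \<ominus>\<^bsub>L\<^esub> f x = \<zero>\<^bsub>L\<^esub>" using x y by (simp add: module_hom_minus[OF M L f])
    then have "f y = f x"
      using x y by (subst (asm) L.minus_eq_zero_iff) (auto intro: module_hom_closed[OF f])
    then show ?thesis using y(1) by (simp add: f'_def)
  qed
  have "f' \<in> module_hom R Q L"
  proof (rule module_homI)
    fix x assume "x \<in> carrier Q"
    then obtain x' where x: "x' \<in> carrier M" "x = proj x'" by (rule Q_cases)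
    then show "f' x \<in> carrier L" by (simp add: f' module_hom_closed[OF f])
    fix y assume "y \<in> carrier Q"
    then obtain y' where y: "y' \<in> carrier M" "y = proj y'" by (rule Q_cases)
    show "f' (x \<oplus>\<^bsub>Q\<^esub> y) = f' x \<oplus>\<^bsub>L\<^esub> f' y"
      using x y by (simp add: f' proj_add module_hom_add[OF f])
  next
    fix r x assume r: "r \<in> carrier R" and "x \<in> carrier Q"
    then obtain x' where x: "x' \<in> carrier M" "x = proj x'" by (elim Q_cases)
    then show "f' (r \<odot>\<^bsub>Q\<^esub> x) = r \<odot>\<^bsub>L\<^esub> f' x"
      using r by (simp add: f' proj_smult module_hom_smult[OF f])
  qed
  then show ?thesis using f' by blast
qed

end

section \<open>The tensor product and its universal property\<close>

locale tensor_product = cring R + A: Module.module R A + U: Module.module R U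
  for R :: "('r, 'k) ring_scheme" (structure) and W :: "('w, 'l) monoid_scheme"
    and A :: "('r, 'a) module" and ract :: "'a \<Rightarrow> 'w \<Rightarrow> 'a" and U :: "('r, 'b, 'w) group_module" +
  assumes ract_closed: "a \<in> carrier A \<Longrightarrow> w \<in> carrier W \<Longrightarrow> ract a w \<in> carrier A"
    and gact_closed: "u \<in> carrier U \<Longrightarrow> w \<in> carrier W \<Longrightarrow> gact U w u \<in> carrier U"
begin

abbreviation "F \<equiv> tensor_free R A U"
abbreviation "e a u \<equiv> free_basis R (carrier A \<times> carrier U) (a, u)"
abbreviation "rel \<equiv> tensor_relations R W A ract U"
abbreviation "T \<equiv> tensor R W A ract U"

text \<open>The generating set inside \<open>tensor_relations\<close>, named so that its five kinds
  can be treated by cases.\<close>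

definition generators where
  "generators =
       {e (a \<oplus>\<^bsub>A\<^esub> a') b \<ominus>\<^bsub>F\<^esub> (e a b \<oplus>\<^bsub>F\<^esub> e a' b) | a a' b.
           a \<in> carrier A \<and> a' \<in> carrier A \<and> b \<in> carrier U} \<union>
        {e a (b \<oplus>\<^bsub>U\<^esub> b') \<ominus>\<^bsub>F\<^esub> (e a b \<oplus>\<^bsub>F\<^esub> e a b') | a b b'.
           a \<in> carrier A \<and> b \<in> carrier U \<and> b' \<in> carrier U} \<union>
        {e (r \<odot>\<^bsub>A\<^esub> a) b \<ominus>\<^bsub>F\<^esub> (r \<odot>\<^bsub>F\<^esub> e a b) | r a b.
           r \<in> carrier R \<and> a \<in> carrier A \<and> b \<in> carrier U} \<union>
        {e a (r \<odot>\<^bsub>U\<^esub> b) \<ominus>\<^bsub>F\<^esub> (r \<odot>\<^bsub>F\<^esub> e a b) | r a b.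
           r \<in> carrier R \<and> a \<in> carrier A \<and> b \<in> carrier U} \<union>
        {e (ract a w) b \<ominus>\<^bsub>F\<^esub> e a (gact U w b) | w a b.
           w \<in> carrier W \<and> a \<in> carrier A \<and> b \<in> carrier U}"

lemma rel_eq: "rel = generated_submodule R F generators"
  by (simp add: tensor_relations_def generators_def Let_def)

lemma module_F: "Module.module R F"
  by (simp add: tensor_free_def module_free_module)

sublocale F: Module.module R F by (rule module_F)

lemma e_closed [simp]: "a \<in> carrier A \<Longrightarrow> u \<in> carrier U \<Longrightarrow> e a u \<in> carrier F"
  by (simp add: tensor_free_def)

lemma generators_cases:
  assumes "g \<in> generators"
  obtains (addl) a a' b where "g = e (a \<oplus>\<^bsub>A\<^esub> a') b \<ominus>\<^bsub>F\<^esub> (e a b \<oplus>\<^bsub>F\<^esub> e a' b)" "a \<in> carrier A" "a' \<in> carrier A" "b \<in> carrier U"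
  | (addr) a b b' where "g = e a (b \<oplus>\<^bsub>U\<^esub> b') \<ominus>\<^bsub>F\<^esub> (e a b \<oplus>\<^bsub>F\<^esub> e a b')" "a \<in> carrier A" "b \<in> carrier U" "b' \<in> carrier U"
  | (smultl) r a b where "g = e (r \<odot>\<^bsub>A\<^esub> a) b \<ominus>\<^bsub>F\<^esub> (r \<odot>\<^bsub>F\<^esub> e a b)" "r \<in> carrier R" "a \<in> carrier A" "b \<in> carrier U"
  | (smultr) r a b where "g = e a (r \<odot>\<^bsub>U\<^esub> b) \<ominus>\<^bsub>F\<^esub> (r \<odot>\<^bsub>F\<^esub> e a b)" "r \<in> carrier R" "a \<in> carrier A" "b \<in> carrier U"
  | (balance) w a b where "g = e (ract a w) b \<ominus>\<^bsub>F\<^esub> e a (gact U w b)" "w \<in> carrier W" "a \<in> carrier A" "b \<in> carrier U"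
proof -
  from assms consider
    "\<exists>a a' b. g = e (a \<oplus>\<^bsub>A\<^esub> a') b \<ominus>\<^bsub>F\<^esub> (e a b \<oplus>\<^bsub>F\<^esub> e a' b) \<and>
       a \<in> carrier A \<and> a' \<in> carrier A \<and> b \<in> carrier U"
  | "\<exists>a b b'. g = e a (b \<oplus>\<^bsub>U\<^esub> b') \<ominus>\<^bsub>F\<^esub> (e a b \<oplus>\<^bsub>F\<^esub> e a b') \<and>
       a \<in> carrier A \<and> b \<in> carrier U \<and> b' \<in> carrier U"
  | "\<exists>r a b. g = e (r \<odot>\<^bsub>A\<^esub> a) b \<ominus>\<^bsub>F\<^esub> (r \<odot>\<^bsub>F\<^esub> e a b) \<and>
       r \<in> carrier R \<and> a \<in> carrier A \<and> b \<in> carrier U"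
  | "\<exists>r a b. g = e a (r \<odot>\<^bsub>U\<^esub> b) \<ominus>\<^bsub>F\<^esub> (r \<odot>\<^bsub>F\<^esub> e a b) \<and>
       r \<in> carrier R \<and> a \<in> carrier A \<and> b \<in> carrier U"
  | "\<exists>w a b. g = e (ract a w) b \<ominus>\<^bsub>F\<^esub> e a (gact U w b) \<and>
       w \<in> carrier W \<and> a \<in> carrier A \<and> b \<in> carrier U"
    unfolding generators_def Un_iff mem_Collect_eq by (elim disjE) assumption+
  then show thesis
    by cases (elim exE conjE, rule that, assumption+)+
qed

lemma generators_addl:
    "a \<in> carrier A \<Longrightarrow> a' \<in> carrier A \<Longrightarrow> u \<in> carrier U \<Longrightarrow>
      e (a \<oplus>\<^bsub>A\<^esub> a') u \<ominus>\<^bsub>F\<^esub> (e a u \<oplus>\<^bsub>F\<^esub> e a' u) \<in> generators"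
  and generators_addr:
    "a \<in> carrier A \<Longrightarrow> u \<in> carrier U \<Longrightarrow> u' \<in> carrier U \<Longrightarrow>
      e a (u \<oplus>\<^bsub>U\<^esub> u') \<ominus>\<^bsub>F\<^esub> (e a u \<oplus>\<^bsub>F\<^esub> e a u') \<in> generators"
  and generators_smultl:
    "r \<in> carrier R \<Longrightarrow> a \<in> carrier A \<Longrightarrow> u \<in> carrier U \<Longrightarrow>
      e (r \<odot>\<^bsub>A\<^esub> a) u \<ominus>\<^bsub>F\<^esub> (r \<odot>\<^bsub>F\<^esub> e a u) \<in> generators"
  and generators_smultr:
    "r \<in> carrier R \<Longrightarrow> a \<in> carrier A \<Longrightarrow> u \<in> carrier U \<Longrightarrow>
      e a (r \<odot>\<^bsub>U\<^esub> u) \<ominus>\<^bsub>F\<^esub> (r \<odot>\<^bsub>F\<^esub> e a u) \<in> generators"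
  and generators_balance:
    "w \<in> carrier W \<Longrightarrow> a \<in> carrier A \<Longrightarrow> u \<in> carrier U \<Longrightarrow>
      e (ract a w) u \<ominus>\<^bsub>F\<^esub> e a (gact U w u) \<in> generators"
  unfolding generators_def
  by (rule UnI1, rule UnI1, rule UnI1, rule UnI1, rule CollectI, (intro exI conjI, rule refl, assumption+)[1],
      rule UnI1, rule UnI1, rule UnI1, rule UnI2, rule CollectI, (intro exI conjI, rule refl, assumption+)[1],
      rule UnI1, rule UnI1, rule UnI2, rule CollectI, (intro exI conjI, rule refl, assumption+)[1],
      rule UnI1, rule UnI2, rule CollectI, (intro exI conjI, rule refl, assumption+)[1],
      rule UnI2, rule CollectI, (intro exI conjI, rule refl, assumption+)[1])

lemma generators_carrier: "generators \<subseteq> carrier F"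
proof
  fix g assume "g \<in> generators"
  then show "g \<in> carrier F"
    by (cases rule: generators_cases) (simp_all add: ract_closed gact_closed)
qed

lemma submodule_rel: "submodule rel R F"
  unfolding rel_eq by (rule F.submodule_generated_submodule[OF generators_carrier])

sublocale quot: module_quotient R F rel
  by (intro module_quotient.intro module_quotient_axioms.intro module_F submodule_rel)

lemma T_eq: "T = quotient_module F rel"
  by (simp add: tensor_def)

lemma module_T: "Module.module R T"
  unfolding T_eq by (rule quot.module_Q)

definition t where "t a u = quot.proj (e a u)"

lemma t_closed [simp]: "a \<in> carrier A \<Longrightarrow> u \<in> carrier U \<Longrightarrow> t a u \<in> carrier T"
  by (simp add: t_def T_eq)

lemma relI: "g \<in> generators \<Longrightarrow> g \<in> rel"
  unfolding rel_eq by (rule F.generated_submodule_incl)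

lemma t_addl:
  assumes "a \<in> carrier A" "a' \<in> carrier A" "u \<in> carrier U"
  shows "t (a \<oplus>\<^bsub>A\<^esub> a') u = t a u \<oplus>\<^bsub>T\<^esub> t a' u"
proof -
  have "e (a \<oplus>\<^bsub>A\<^esub> a') u \<ominus>\<^bsub>F\<^esub> (e a u \<oplus>\<^bsub>F\<^esub> e a' u) \<in> rel"
    by (rule relI, rule generators_addl) (use assms in auto)
  then have "quot.proj (e (a \<oplus>\<^bsub>A\<^esub> a') u) = quot.proj (e a u \<oplus>\<^bsub>F\<^esub> e a' u)"
    using assms by (subst quot.proj_eq_iff) auto
  then show ?thesis using assms by (simp add: t_def T_eq quot.proj_add)
qed

lemma t_addr:
  assumes "a \<in> carrier A" "u \<in> carrier U" "u' \<in> carrier U"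
  shows "t a (u \<oplus>\<^bsub>U\<^esub> u') = t a u \<oplus>\<^bsub>T\<^esub> t a u'"
proof -
  have "e a (u \<oplus>\<^bsub>U\<^esub> u') \<ominus>\<^bsub>F\<^esub> (e a u \<oplus>\<^bsub>F\<^esub> e a u') \<in> rel"
    by (rule relI, rule generators_addr) (use assms in auto)
  then have "quot.proj (e a (u \<oplus>\<^bsub>U\<^esub> u')) = quot.proj (e a u \<oplus>\<^bsub>F\<^esub> e a u')"
    using assms by (subst quot.proj_eq_iff) auto
  then show ?thesis using assms by (simp add: t_def T_eq quot.proj_add)
qed

lemma t_smultl:
  assumes "r \<in> carrier R" "a \<in> carrier A" "u \<in> carrier U"
  shows "t (r \<odot>\<^bsub>A\<^esub> a) u = r \<odot>\<^bsub>T\<^esub> t a u"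
proof -
  have "e (r \<odot>\<^bsub>A\<^esub> a) u \<ominus>\<^bsub>F\<^esub> (r \<odot>\<^bsub>F\<^esub> e a u) \<in> rel"
    by (rule relI, rule generators_smultl) (use assms in auto)
  then have "quot.proj (e (r \<odot>\<^bsub>A\<^esub> a) u) = quot.proj (r \<odot>\<^bsub>F\<^esub> e a u)"
    using assms by (subst quot.proj_eq_iff) auto
  then show ?thesis using assms by (simp add: t_def T_eq quot.proj_smult)
qed

lemma t_smultr:
  assumes "r \<in> carrier R" "a \<in> carrier A" "u \<in> carrier U"
  shows "t a (r \<odot>\<^bsub>U\<^esub> u) = r \<odot>\<^bsub>T\<^esub> t a u"
proof -
  have "e a (r \<odot>\<^bsub>U\<^esub> u) \<ominus>\<^bsub>F\<^esub> (r \<odot>\<^bsub>F\<^esub> e a u) \<in> rel"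
    by (rule relI, rule generators_smultr) (use assms in auto)
  then have "quot.proj (e a (r \<odot>\<^bsub>U\<^esub> u)) = quot.proj (r \<odot>\<^bsub>F\<^esub> e a u)"
    using assms by (subst quot.proj_eq_iff) auto
  then show ?thesis using assms by (simp add: t_def T_eq quot.proj_smult)
qed

lemma t_balance:
  assumes "w \<in> carrier W" "a \<in> carrier A" "u \<in> carrier U"
  shows "t (ract a w) u = t a (gact U w u)"
proof -
  have "e (ract a w) u \<ominus>\<^bsub>F\<^esub> e a (gact U w u) \<in> rel"
    by (rule relI, rule generators_balance) (use assms in auto)
  then show ?thesis unfolding t_def
    using assms by (subst quot.proj_eq_iff) (auto simp: ract_closed gact_closed)
qed

lemma t_hom_left: "u \<in> carrier U \<Longrightarrow> (\<lambda>a. t a u) \<in> module_hom R A T"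
  by (rule module_homI) (auto simp: t_addl t_smultl)

lemma t_hom_right: "a \<in> carrier A \<Longrightarrow> t a \<in> module_hom R U T"
  by (rule module_homI) (auto simp: t_addr t_smultr)

lemma proj_hom_T: "quot.proj \<in> module_hom R F T"
  unfolding T_eq by (rule quot.proj_hom)

lemma F_hom_eqI:
  assumes "Module.module R L" "f \<in> module_hom R F L" "g \<in> module_hom R F L"
    and "\<And>a u. a \<in> carrier A \<Longrightarrow> u \<in> carrier U \<Longrightarrow> f (e a u) = g (e a u)" and "c \<in> carrier F"
  shows "f c = g c"
  by (rule free_hom_eqI[OF assms(1) assms(2,3)[unfolded tensor_free_def] _ assms(5)[unfolded tensor_free_def]])
     (use assms(4) in auto)

lemma tensor_hom_eqI:
  assumes L: "Module.module R L" and f: "f \<in> module_hom R T L" and g: "g \<in> module_hom R T L"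
    and eq: "\<And>a u. a \<in> carrier A \<Longrightarrow> u \<in> carrier U \<Longrightarrow> f (t a u) = g (t a u)"
    and x: "x \<in> carrier T"
  shows "f x = g x"
proof (rule quot.quotient_hom_eqI[OF _ x[unfolded T_eq]])
  fix c assume c: "c \<in> carrier F"
  show "f (quot.proj c) = g (quot.proj c)"
    by (rule F_hom_eqI[where f="\<lambda>c. f (quot.proj c)" and g="\<lambda>c. g (quot.proj c)",
          OF L module_hom_comp[OF proj_hom_T f] module_hom_comp[OF proj_hom_T g] _ c])
       (use eq in \<open>auto simp: t_def\<close>)
qed

text \<open>The universal property. The linear extension of \<open>\<beta>\<close> to pairs kills
  all five kinds of generators: four by bilinearity, the last by balance.\<close>

lemma tensor_hom_exists:
  assumes L: "Module.module R L"
    and closed: "\<And>a u. a \<in> carrier A \<Longrightarrow> u \<in> carrier U \<Longrightarrow> \<beta> a u \<in> carrier L"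
    and left: "\<And>u. u \<in> carrier U \<Longrightarrow> (\<lambda>a. \<beta> a u) \<in> module_hom R A L"
    and right: "\<And>a. a \<in> carrier A \<Longrightarrow> \<beta> a \<in> module_hom R U L"
    and bal: "\<And>w a u. w \<in> carrier W \<Longrightarrow> a \<in> carrier A \<Longrightarrow> u \<in> carrier U \<Longrightarrow>
      \<beta> (ract a w) u = \<beta> a (gact U w u)"
  shows "\<exists>f\<in>module_hom R T L. \<forall>a\<in>carrier A. \<forall>u\<in>carrier U. f (t a u) = \<beta> a u"
proof -
  interpret L: Module.module R L by fact
  define b where "b = free_lift (carrier A \<times> carrier U) L (\<lambda>(a, u). \<beta> a u)"
  have cl: "(\<lambda>(a, u). \<beta> a u) \<in> carrier A \<times> carrier U \<rightarrow> carrier L" using closed by auto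
  have b: "b \<in> module_hom R F L" unfolding b_def tensor_free_def by (rule free_lift_hom[OF L cl])
  have be: "b (e a u) = \<beta> a u" if "a \<in> carrier A" "u \<in> carrier U" for a u
    unfolding b_def using that by (subst free_lift_basis[OF L cl]) auto
  note b_simps = module_hom_minus[OF module_F L b] module_hom_add[OF b] module_hom_smult[OF b]
    L.minus_eq_zero_iff be closed ract_closed gact_closed
  have "b x \<in> {\<zero>\<^bsub>L\<^esub>}" if "x \<in> rel" for x
  proof (rule F.generated_submodule_image[OF L b L.submodule_zero generators_carrier])
    fix g assume "g \<in> generators"
    then show "b g \<in> {\<zero>\<^bsub>L\<^esub>}"
    proof (cases rule: generators_cases)
      case (addl a a' u)
      then show ?thesis by (simp add: b_simps module_hom_add[OF left])
    next
      case (addr a u u')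
      then show ?thesis by (simp add: b_simps module_hom_add[OF right])
    next
      case (smultl r a u)
      then show ?thesis by (simp add: b_simps module_hom_smult[OF left])
    next
      case (smultr r a u)
      then show ?thesis by (simp add: b_simps module_hom_smult[OF right])
    next
      case (balance w a u)
      then show ?thesis by (simp add: b_simps bal)
    qed
  qed (use that rel_eq in simp)
  then obtain f' where f': "f' \<in> module_hom R quot.Q L" "\<And>x. x \<in> carrier F \<Longrightarrow> f' (quot.proj x) = b x"
    using quot.quotient_hom_exists[OF L b] by auto
  have "f' (t a u) = \<beta> a u" if "a \<in> carrier A" "u \<in> carrier U" for a u
    using that by (simp add: t_def f'(2) be)
  with f'(1) show ?thesis unfolding T_eq by blast
qed

end

text \<open>The map on pairs sends each generating relation to one of the same kind,
  \<open>equiv\<close> being used for the balancing relations, and so descends to the quotients.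
  \<open>tensor_map\<close> is a union over representatives, but all of them contribute the same
  coset.\<close>

lemma (in cring) tensor_map_hom:
  assumes "tensor_product R W A ract U" and "tensor_product R W A' ract' U"
    and f: "f \<in> module_hom R A A'"
    and equiv: "\<And>a w. a \<in> carrier A \<Longrightarrow> w \<in> carrier W \<Longrightarrow> f (ract a w) = ract' (f a) w"
  shows "tensor_map R W A A' ract' U f \<in> module_hom R (tensor R W A ract U) (tensor R W A' ract' U)"
    and "a \<in> carrier A \<Longrightarrow> u \<in> carrier U \<Longrightarrow> tensor_map R W A A' ract' U f
      (tensor_product.t R W A ract U a u) = tensor_product.t R W A' ract' U (f a) u"
proof -
  interpret T: tensor_product R W A ract U by fact
  interpret T': tensor_product R W A' ract' U by fact
  let ?F = "free_map R (carrier A \<times> carrier U) (carrier A' \<times> carrier U) (\<lambda>(a, b). (f a, b))"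
  have map: "(\<lambda>(a, b). (f a, b)) \<in> carrier A \<times> carrier U \<rightarrow> carrier A' \<times> carrier U"
    by (auto intro: module_hom_closed[OF f])
  have F: "?F \<in> module_hom R T.F T'.F"
    unfolding tensor_free_def by (rule free_map_hom[OF map])
  have Fe: "?F (T.e a u) = T'.e (f a) u" if "a \<in> carrier A" "u \<in> carrier U" for a u
    using that by (subst free_map_basis[OF map]) auto
  note F_simps = module_hom_minus[OF T.module_F T'.module_F F] module_hom_add[OF F] module_hom_smult[OF F]
    Fe module_hom_closed[OF f] T.ract_closed T.gact_closed equiv module_hom_add[OF f] module_hom_smult[OF f]
  have rel: "?F x \<in> T'.rel" if "x \<in> T.rel" for x
  proof (rule T.F.generated_submodule_image[OF T'.module_F F T'.quot.sub T.generators_carrier])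
    fix g assume "g \<in> T.generators"
    then show "?F g \<in> T'.rel"
    proof (cases rule: T.generators_cases)
      case (addl a a' u)
      then have "?F g = T'.e (f a \<oplus>\<^bsub>A'\<^esub> f a') u \<ominus>\<^bsub>T'.F\<^esub> (T'.e (f a) u \<oplus>\<^bsub>T'.F\<^esub> T'.e (f a') u)"
        by (simp add: F_simps)
      moreover have "\<dots> \<in> T'.generators"
        using addl module_hom_closed[OF f] by (intro T'.generators_addl)
      ultimately show ?thesis by (simp add: T'.relI)
    next
      case (addr a u u')
      then have "?F g = T'.e (f a) (u \<oplus>\<^bsub>U\<^esub> u') \<ominus>\<^bsub>T'.F\<^esub> (T'.e (f a) u \<oplus>\<^bsub>T'.F\<^esub> T'.e (f a) u')"
        by (simp add: F_simps)
      moreover have "\<dots> \<in> T'.generators"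
        using addr module_hom_closed[OF f] by (intro T'.generators_addr)
      ultimately show ?thesis by (simp add: T'.relI)
    next
      case (smultl r a u)
      then have "?F g = T'.e (r \<odot>\<^bsub>A'\<^esub> f a) u \<ominus>\<^bsub>T'.F\<^esub> (r \<odot>\<^bsub>T'.F\<^esub> T'.e (f a) u)"
        by (simp add: F_simps)
      moreover have "\<dots> \<in> T'.generators"
        using smultl module_hom_closed[OF f] by (intro T'.generators_smultl)
      ultimately show ?thesis by (simp add: T'.relI)
    next
      case (smultr r a u)
      then have "?F g = T'.e (f a) (r \<odot>\<^bsub>U\<^esub> u) \<ominus>\<^bsub>T'.F\<^esub> (r \<odot>\<^bsub>T'.F\<^esub> T'.e (f a) u)"
        by (simp add: F_simps)
      moreover have "\<dots> \<in> T'.generators"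
        using smultr module_hom_closed[OF f] by (intro T'.generators_smultr)
      ultimately show ?thesis by (simp add: T'.relI)
    next
      case (balance w a u)
      then have "?F g = T'.e (ract' (f a) w) u \<ominus>\<^bsub>T'.F\<^esub> T'.e (f a) (gact U w u)"
        by (simp add: F_simps)
      moreover have "\<dots> \<in> T'.generators"
        using balance module_hom_closed[OF f] by (intro T'.generators_balance)
      ultimately show ?thesis by (simp add: T'.relI)
    qed
  qed (use that T.rel_eq in simp)
  have proj: "tensor_map R W A A' ract' U f (T.quot.proj c) = T'.quot.proj (?F c)"
    if c: "c \<in> carrier T.F" for c
  proof -
    have "T'.quot.proj (?F c') = T'.quot.proj (?F c)" if "c' \<in> T.quot.proj c" for c'
    proof -
      have c': "c' \<in> carrier T.F" "c' \<ominus>\<^bsub>T.F\<^esub> c \<in> T.rel"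
        using T.quot.proj_cong[OF that c] c T.quot.proj_eq_iff[of c' c] by auto
      then have "?F c' \<ominus>\<^bsub>T'.F\<^esub> ?F c \<in> T'.rel" using rel[OF c'(2)] c by (simp add: F_simps)
      then show ?thesis
        using c' c by (subst T'.quot.proj_eq_iff) (auto intro: module_hom_closed[OF F])
    qed
    then have "(\<Union>c'\<in>T.quot.proj c. T'.quot.proj (?F c')) = (\<Union>c'\<in>T.quot.proj c. T'.quot.proj (?F c))"
      by (rule SUP_cong[OF refl])
    also have "\<dots> = T'.quot.proj (?F c)" using T.quot.proj_self[OF c] by blast
    finally show ?thesis by (simp add: tensor_map_def T'.quot.proj_def)
  qed
  show "tensor_map R W A A' ract' U f \<in> module_hom R T.T T'.T"
    unfolding T.T_eq T'.T_eq
  proof (rule module_homI)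
    fix x assume "x \<in> carrier T.quot.Q"
    then obtain x' where x: "x' \<in> carrier T.F" "x = T.quot.proj x'" by (rule T.quot.Q_cases)
    then show "tensor_map R W A A' ract' U f x \<in> carrier T'.quot.Q"
      by (simp add: proj module_hom_closed[OF F])
    fix y assume "y \<in> carrier T.quot.Q"
    then obtain y' where y: "y' \<in> carrier T.F" "y = T.quot.proj y'" by (rule T.quot.Q_cases)
    show "tensor_map R W A A' ract' U f (x \<oplus>\<^bsub>T.quot.Q\<^esub> y) =
        tensor_map R W A A' ract' U f x \<oplus>\<^bsub>T'.quot.Q\<^esub> tensor_map R W A A' ract' U f y"
      using x y by (simp add: proj T.quot.proj_add T'.quot.proj_add module_hom_add[OF F] module_hom_closed[OF F])
  next
    fix r x assume r: "r \<in> carrier R" and "x \<in> carrier T.quot.Q"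
    then obtain x' where x: "x' \<in> carrier T.F" "x = T.quot.proj x'" by (elim T.quot.Q_cases)
    then show "tensor_map R W A A' ract' U f (r \<odot>\<^bsub>T.quot.Q\<^esub> x) =
        r \<odot>\<^bsub>T'.quot.Q\<^esub> tensor_map R W A A' ract' U f x"
      using r by (simp add: proj T.quot.proj_smult T'.quot.proj_smult module_hom_smult[OF F] module_hom_closed[OF F])
  qed
  show "tensor_map R W A A' ract' U f (T.t a u) = T'.t (f a) u" if "a \<in> carrier A" "u \<in> carrier U"
    using that by (simp add: T.t_def T'.t_def proj Fe)
qed

section \<open>Free modules over a group ring and their coordinates\<close>

locale group_ring_module = cring R + W: group W
  for R :: "('r, 'k) ring_scheme" (structure) and W :: "('w, 'l) monoid_scheme" +
  fixes U :: "('r, 'm, 'w) group_module"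
  assumes group_module: "is_group_module R W U"
begin

lemma module_U: "Module.module R U"
  using group_module by (simp add: is_group_module_def)

sublocale U: Module.module R U by (rule module_U)

lemma gact_hom: "w \<in> carrier W \<Longrightarrow> gact U w \<in> module_hom R U U"
  and gact_one [simp]: "u \<in> carrier U \<Longrightarrow> gact U \<one>\<^bsub>W\<^esub> u = u"
  and gact_mult: "v \<in> carrier W \<Longrightarrow> w \<in> carrier W \<Longrightarrow> u \<in> carrier U \<Longrightarrow>
    gact U (v \<otimes>\<^bsub>W\<^esub> w) u = gact U v (gact U w u)"
  using group_module by (simp_all add: is_group_module_def)

lemma gact_closed [simp]: "w \<in> carrier W \<Longrightarrow> u \<in> carrier U \<Longrightarrow> gact U w u \<in> carrier U"
  by (rule module_hom_closed[OF gact_hom])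

text \<open>A basis in the sense of \<open>is_free_group_module\<close> is a set for which this map
  is bijective; the \<open>R[W]\<close>-basis \<open>B\<close> becomes the \<open>R\<close>-basis of
  all \<open>w b\<close>.\<close>

definition synthesis where
  "synthesis B = free_lift (carrier W \<times> B) U (\<lambda>p. gact U (fst p) (snd p))"

lemma synthesis_closed_gens: "B \<subseteq> carrier U \<Longrightarrow>
  (\<lambda>p. gact U (fst p) (snd p)) \<in> carrier W \<times> B \<rightarrow> carrier U"
  by auto

lemma synthesis_hom:
  "B \<subseteq> carrier U \<Longrightarrow> synthesis B \<in> module_hom R (free_module R (carrier W \<times> B)) U"
  unfolding synthesis_def by (rule free_lift_hom[OF module_U synthesis_closed_gens])

lemma synthesis_basis:
  "B \<subseteq> carrier U \<Longrightarrow> w \<in> carrier W \<Longrightarrow> b \<in> B \<Longrightarrow>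
    synthesis B (free_basis R (carrier W \<times> B) (w, b)) = gact U w b"
  unfolding synthesis_def by (subst free_lift_basis[OF module_U synthesis_closed_gens]) auto

lemma free_group_module_basis:
  assumes "is_free_group_module R W U"
  obtains B where "B \<subseteq> carrier U"
    "bij_betw (synthesis B) (carrier (free_module R (carrier W \<times> B))) (carrier U)"
proof -
  from assms obtain B where B: "B \<subseteq> carrier U"
    and ex1: "\<And>x. x \<in> carrier U \<Longrightarrow> \<exists>!c. c \<in> carrier (free_module R (carrier W \<times> B)) \<and> x = synthesis B c"
    by (auto simp: is_free_group_module_def synthesis_def free_lift_def)
  have "bij_betw (synthesis B) (carrier (free_module R (carrier W \<times> B))) (carrier U)"
  proof (rule bij_betwI')
    fix c assume c: "c \<in> carrier (free_module R (carrier W \<times> B))"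
    show "synthesis B c \<in> carrier U" by (rule module_hom_closed[OF synthesis_hom[OF B] c])
    fix c' assume c': "c' \<in> carrier (free_module R (carrier W \<times> B))"
    show "(synthesis B c = synthesis B c') = (c = c')"
      using ex1[OF \<open>synthesis B c \<in> carrier U\<close>] c c' by auto
  next
    fix x assume "x \<in> carrier U"
    then show "\<exists>c\<in>carrier (free_module R (carrier W \<times> B)). x = synthesis B c" using ex1 by blast
  qed
  with B show ?thesis by (rule that)
qed

end

locale based_group_ring_module = group_ring_module +
  fixes B
  assumes B: "B \<subseteq> carrier U"
    and bij: "bij_betw (synthesis B) (carrier (free_module R (carrier W \<times> B))) (carrier U)"
begin

abbreviation "WB \<equiv> carrier W \<times> B"

definition "coord = inv_into (carrier (free_module R WB)) (synthesis B)"

lemma coord_hom: "coord \<in> module_hom R U (free_module R WB)"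
  unfolding coord_def by (rule module_hom_inv[OF module_free_module synthesis_hom[OF B] bij])

lemma coord_closed [simp]: "u \<in> carrier U \<Longrightarrow> coord u \<in> carrier (free_module R WB)"
  by (rule module_hom_closed[OF coord_hom])

lemma synthesis_coord: "u \<in> carrier U \<Longrightarrow> synthesis B (coord u) = u"
  using bij by (simp add: coord_def bij_betw_def f_inv_into_f)

lemma coord_synthesis: "c \<in> carrier (free_module R WB) \<Longrightarrow> coord (synthesis B c) = c"
  using bij by (simp add: coord_def bij_betw_def inv_into_f_f)

lemma coord_gact_basis: "w \<in> carrier W \<Longrightarrow> b \<in> B \<Longrightarrow> coord (gact U w b) = free_basis R WB (w, b)"
  using coord_synthesis[of "free_basis R WB (w, b)"] synthesis_basis[OF B] by simp

lemma coord_basis: "b \<in> B \<Longrightarrow> coord b = free_basis R WB (\<one>\<^bsub>W\<^esub>, b)"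
  using coord_gact_basis[of "\<one>\<^bsub>W\<^esub>" b] B by auto

text \<open>Comparing both sides after \<open>synthesis\<close> reduces this to
  \<open>w (v b) = (w v) b\<close> on basis elements.\<close>

lemma coord_gact:
  assumes w: "w \<in> carrier W" and u: "u \<in> carrier U"
  shows "coord (gact U w u) = free_map R WB WB (\<lambda>(v, b). (w \<otimes>\<^bsub>W\<^esub> v, b)) (coord u)"
proof -
  have m: "(\<lambda>(v, b). (w \<otimes>\<^bsub>W\<^esub> v, b)) \<in> WB \<rightarrow> WB" using w by auto
  have eq: "gact U w (synthesis B c) = synthesis B (free_map R WB WB (\<lambda>(v, b). (w \<otimes>\<^bsub>W\<^esub> v, b)) c)"
    if "c \<in> carrier (free_module R WB)" for c
    by (rule free_hom_eqI[where f="\<lambda>c. gact U w (synthesis B c)" and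
          g="\<lambda>c. synthesis B (free_map R WB WB (\<lambda>(v, b). (w \<otimes>\<^bsub>W\<^esub> v, b)) c)",
          OF module_U module_hom_comp[OF synthesis_hom[OF B] gact_hom[OF w]]
             module_hom_comp[OF free_map_hom[OF m] synthesis_hom[OF B]] _ that])
       (use w m B in \<open>auto simp: synthesis_basis gact_mult subset_iff\<close>)
  show ?thesis
    using eq[of "coord u"] u m by (simp add: synthesis_coord coord_synthesis)
qed

end

text \<open>The permutation module of a right \<open>W\<close>-set \<open>Y\<close>, to be tensored
  with a module that is free on \<open>B\<close>. Since
  \<open>h \<otimes> w b = h w \<otimes> b\<close>, the result should be free over \<open>R\<close>
  on \<open>Y \<times> B\<close>. Later \<open>Y\<close> is \<open>cmaps X H\<close>.\<close>

locale free_tensor = based_group_ring_module +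
  fixes Y and \<rho>
  assumes \<rho>_closed: "h \<in> Y \<Longrightarrow> w \<in> carrier W \<Longrightarrow> \<rho> h w \<in> Y"
    and \<rho>_one: "h \<in> Y \<Longrightarrow> \<rho> h \<one>\<^bsub>W\<^esub> = h"
    and \<rho>_mult: "h \<in> Y \<Longrightarrow> v \<in> carrier W \<Longrightarrow> w \<in> carrier W \<Longrightarrow> \<rho> h (v \<otimes>\<^bsub>W\<^esub> w) = \<rho> (\<rho> h v) w"
begin

sublocale tensor_product R W "free_module R Y" "\<lambda>a w. free_map R Y Y (\<lambda>h. \<rho> h w) a" U
  by (intro tensor_product.intro tensor_product_axioms.intro module_free_module module_U is_cring
        free_map_closed gact_closed) (auto simp: \<rho>_closed)

definition \<Theta> where "\<Theta> = free_lift (Y \<times> B) T (\<lambda>(h, b). t (free_basis R Y h) b)"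

lemma gens: "(\<lambda>(h, b). t (free_basis R Y h) b) \<in> Y \<times> B \<rightarrow> carrier T"
  using B by auto

lemma \<Theta>_hom: "\<Theta> \<in> module_hom R (free_module R (Y \<times> B)) T"
  unfolding \<Theta>_def by (rule free_lift_hom[OF module_T gens])

lemma \<Theta>_basis: "h \<in> Y \<Longrightarrow> b \<in> B \<Longrightarrow> \<Theta> (free_basis R (Y \<times> B) (h, b)) = t (free_basis R Y h) b"
  unfolding \<Theta>_def by (subst free_lift_basis[OF module_T gens]) auto

text \<open>The coordinates of \<open>h \<otimes> u\<close>: a term \<open>w b\<close> of
  \<open>u\<close> contributes at \<open>(h w, b)\<close>.\<close>

definition push where "push h = free_map R WB (Y \<times> B) (\<lambda>(w, b). (\<rho> h w, b))"

lemma push_map: "h \<in> Y \<Longrightarrow> (\<lambda>(w, b). (\<rho> h w, b)) \<in> WB \<rightarrow> Y \<times> B"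
  by (auto simp: \<rho>_closed)

lemma push_hom: "h \<in> Y \<Longrightarrow> push h \<in> module_hom R (free_module R WB) (free_module R (Y \<times> B))"
  unfolding push_def by (rule free_map_hom[OF push_map])

lemma push_closed [simp]: "h \<in> Y \<Longrightarrow> c \<in> carrier (free_module R WB) \<Longrightarrow> push h c \<in> carrier (free_module R (Y \<times> B))"
  by (rule module_hom_closed[OF push_hom])

lemma push_basis: "h \<in> Y \<Longrightarrow> w \<in> carrier W \<Longrightarrow> b \<in> B \<Longrightarrow>
  push h (free_basis R WB (w, b)) = free_basis R (Y \<times> B) (\<rho> h w, b)"
  unfolding push_def by (subst free_map_basis[OF push_map]) auto

definition \<beta> where "\<beta> a u = free_lift Y (free_module R (Y \<times> B)) (\<lambda>h. push h (coord u)) a"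

lemma push_gens: "u \<in> carrier U \<Longrightarrow> (\<lambda>h. push h (coord u)) \<in> Y \<rightarrow> carrier (free_module R (Y \<times> B))"
  by auto

lemma \<beta>_left: "u \<in> carrier U \<Longrightarrow> (\<lambda>a. \<beta> a u) \<in> module_hom R (free_module R Y) (free_module R (Y \<times> B))"
  unfolding \<beta>_def by (rule free_lift_hom[OF module_free_module push_gens])

lemma \<beta>_basis: "u \<in> carrier U \<Longrightarrow> h \<in> Y \<Longrightarrow> \<beta> (free_basis R Y h) u = push h (coord u)"
  unfolding \<beta>_def by (rule free_lift_basis[OF module_free_module push_gens])

text \<open>\<open>\<beta>\<close> is linear in its first argument by construction. For the second,
  both sides are compared as linear maps in \<open>a\<close>, that is, on basis elements
  \<open>h\<close>.\<close>

lemma \<beta>_right: "a \<in> carrier (free_module R Y) \<Longrightarrow> \<beta> a \<in> module_hom R U (free_module R (Y \<times> B))"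
proof (rule module_homI)
  interpret FY: Module.module R "free_module R (Y \<times> B)" by (rule module_free_module)
  assume a: "a \<in> carrier (free_module R Y)"
  fix u assume u: "u \<in> carrier U"
  show "\<beta> a u \<in> carrier (free_module R (Y \<times> B))" by (rule module_hom_closed[OF \<beta>_left[OF u] a])
  fix u' assume u': "u' \<in> carrier U"
  show "\<beta> a (u \<oplus>\<^bsub>U\<^esub> u') = \<beta> a u \<oplus>\<^bsub>free_module R (Y \<times> B)\<^esub> \<beta> a u'"
    by (rule free_hom_eqI[where f="\<lambda>a. \<beta> a (u \<oplus>\<^bsub>U\<^esub> u')" and
          g="\<lambda>a. \<beta> a u \<oplus>\<^bsub>free_module R (Y \<times> B)\<^esub> \<beta> a u'",
          OF module_free_module \<beta>_left module_hom_sum[OF module_free_module module_free_module \<beta>_left \<beta>_left] _ a])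
       (use u u' in \<open>simp_all add: \<beta>_basis module_hom_add[OF coord_hom] module_hom_add[OF push_hom]\<close>)
next
  assume a: "a \<in> carrier (free_module R Y)"
  fix r u assume r: "r \<in> carrier R" and u: "u \<in> carrier U"
  show "\<beta> a (r \<odot>\<^bsub>U\<^esub> u) = r \<odot>\<^bsub>free_module R (Y \<times> B)\<^esub> \<beta> a u"
    by (rule free_hom_eqI[where f="\<lambda>a. \<beta> a (r \<odot>\<^bsub>U\<^esub> u)" and g="\<lambda>a. r \<odot>\<^bsub>free_module R (Y \<times> B)\<^esub> \<beta> a u",
          OF module_free_module \<beta>_left module_hom_scale[OF module_free_module module_free_module \<beta>_left] _ a])
       (use r u in \<open>simp_all add: \<beta>_basis module_hom_smult[OF coord_hom] module_hom_smult[OF push_hom]\<close>)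
qed

text \<open>Balance on basis elements: both sides move a coordinate \<open>(v, b)\<close> to
  \<open>(h w v, b)\<close>.\<close>

lemma push_\<rho>:
  assumes h: "h \<in> Y" and w: "w \<in> carrier W" and u: "u \<in> carrier U"
  shows "push (\<rho> h w) (coord u) = push h (coord (gact U w u))"
proof -
  have m: "(\<lambda>(v, b). (w \<otimes>\<^bsub>W\<^esub> v, b)) \<in> WB \<rightarrow> WB" using w by auto
  have "push h (coord (gact U w u)) = free_map R WB (Y \<times> B) (\<lambda>s. (\<lambda>(w, b). (\<rho> h w, b)) ((\<lambda>(v, b). (w \<otimes>\<^bsub>W\<^esub> v, b)) s)) (coord u)"
    unfolding coord_gact[OF w u] push_def
    by (rule free_map_comp[OF m push_map[OF h] coord_closed[OF u]])
  also have "\<dots> = push (\<rho> h w) (coord u)"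
    unfolding push_def by (rule free_map_cong) (use h w in \<open>auto simp: \<rho>_mult\<close>)
  finally show ?thesis ..
qed

lemma \<beta>_balance:
  assumes w: "w \<in> carrier W" and a: "a \<in> carrier (free_module R Y)" and u: "u \<in> carrier U"
  shows "\<beta> (free_map R Y Y (\<lambda>h. \<rho> h w) a) u = \<beta> a (gact U w u)"
proof -
  have m: "(\<lambda>h. \<rho> h w) \<in> Y \<rightarrow> Y" using w by (auto simp: \<rho>_closed)
  show ?thesis
    by (rule free_hom_eqI[where f="\<lambda>a. \<beta> (free_map R Y Y (\<lambda>h. \<rho> h w) a) u" and g="\<lambda>a. \<beta> a (gact U w u)",
          OF module_free_module module_hom_comp[OF free_map_hom[OF m] \<beta>_left[OF u]] \<beta>_left _ a])
       (use w u m in \<open>simp_all add: \<beta>_basis push_\<rho> \<rho>_closed\<close>)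
qed

lemma \<Theta>_push:
  assumes h: "h \<in> Y" and u: "u \<in> carrier U"
  shows "\<Theta> (push h (coord u)) = t (free_basis R Y h) u"
proof -
  have "\<Theta> (push h (coord u)) = t (free_basis R Y h) (synthesis B (coord u))"
    by (rule free_hom_eqI[where f="\<lambda>c. \<Theta> (push h c)" and g="\<lambda>c. t (free_basis R Y h) (synthesis B c)",
          OF module_T module_hom_comp[OF push_hom[OF h] \<Theta>_hom]
             module_hom_comp[OF synthesis_hom[OF B] t_hom_right] _ coord_closed[OF u]])
       (use h B in \<open>auto simp: push_basis synthesis_basis \<Theta>_basis \<rho>_closed subset_iff simp flip: t_balance\<close>)
  then show ?thesis using u by (simp add: synthesis_coord)
qed

text \<open>The inverse is the map induced by \<open>\<beta>\<close>. One composite is the identity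
  because \<open>b\<close> has the coordinate \<open>(\<one>, b)\<close> and
  \<open>h \<one> = h\<close>, the other because \<open>\<Theta>\<close> reassembles
  \<open>h \<otimes> u\<close> from its coordinates (\<open>\<Theta>_push\<close>).\<close>

theorem \<Theta>_bij: "bij_betw \<Theta> (carrier (free_module R (Y \<times> B))) (carrier T)"
proof -
  obtain \<Xi> where \<Xi>: "\<Xi> \<in> module_hom R T (free_module R (Y \<times> B))"
    and \<Xi>_t: "\<And>a u. a \<in> carrier (free_module R Y) \<Longrightarrow> u \<in> carrier U \<Longrightarrow> \<Xi> (t a u) = \<beta> a u"
    using tensor_hom_exists[OF module_free_module module_hom_closed[OF \<beta>_left] \<beta>_left \<beta>_right \<beta>_balance]
    by blast
  have "\<Xi> (\<Theta> c) = c" if "c \<in> carrier (free_module R (Y \<times> B))" for c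
    by (rule free_hom_eqI[where f="\<lambda>c. \<Xi> (\<Theta> c)" and g="\<lambda>c. c",
          OF module_free_module module_hom_comp[OF \<Theta>_hom \<Xi>] module_hom_id _ that])
       (use B in \<open>auto simp: \<Theta>_basis \<Xi>_t \<beta>_basis coord_basis push_basis \<rho>_one subset_iff\<close>)
  moreover have "\<Theta> (\<Xi> x) = x" if "x \<in> carrier T" for x
  proof (rule tensor_hom_eqI[where f="\<lambda>x. \<Theta> (\<Xi> x)" and g="\<lambda>x. x",
        OF module_T module_hom_comp[OF \<Xi> \<Theta>_hom] module_hom_id _ that])
    fix a u assume a: "a \<in> carrier (free_module R Y)" and u: "u \<in> carrier U"
    have "\<Theta> (\<beta> a u) = t a u"
      by (rule free_hom_eqI[where f="\<lambda>a. \<Theta> (\<beta> a u)" and g="\<lambda>a. t a u",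
            OF module_T module_hom_comp[OF \<beta>_left[OF u] \<Theta>_hom] t_hom_left[OF u] _ a])
         (use u in \<open>simp_all add: \<beta>_basis \<Theta>_push\<close>)
    then show "\<Theta> (\<Xi> (t a u)) = t a u" using a u by (simp add: \<Xi>_t)
  qed
  ultimately show ?thesis
    by (intro bij_betw_byWitness[where f'=\<Xi>])
       (auto intro: module_hom_closed[OF \<Theta>_hom] module_hom_closed[OF \<Xi>])
qed

end

section \<open>Conjugation and cosets\<close>

context group
begin

lemma conjugate_eq_image: "conjugate G g K = (\<lambda>k. g \<otimes> k \<otimes> inv g) ` K"
  by (auto simp: conjugate_def l_coset_def r_coset_def)

lemma conjugate_carrier: "g \<in> carrier G \<Longrightarrow> K \<subseteq> carrier G \<Longrightarrow> conjugate G g K \<subseteq> carrier G"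
  by (auto simp: conjugate_eq_image)

lemma conjugate_one: "K \<subseteq> carrier G \<Longrightarrow> conjugate G \<one> K = K"
  unfolding conjugate_eq_image by (subst image_cong[where g="\<lambda>k. k"]) auto

lemma conjugate_mult:
  assumes "g \<in> carrier G" "h \<in> carrier G" "K \<subseteq> carrier G"
  shows "conjugate G (g \<otimes> h) K = conjugate G g (conjugate G h K)"
  unfolding conjugate_eq_image image_image
  by (rule image_cong) (use assms in \<open>auto simp: inv_mult_group m_assoc subset_iff\<close>)

lemma conjugate_inv:
  assumes "g \<in> carrier G" "K \<subseteq> carrier G"
  shows "conjugate G (inv g) (conjugate G g K) = K" "conjugate G g (conjugate G (inv g) K) = K"
  using conjugate_mult[of "inv g" g K] conjugate_mult[of g "inv g" K] assms by (simp_all add: conjugate_one)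

lemma conjugate_mono: "K \<subseteq> L \<Longrightarrow> conjugate G g K \<subseteq> conjugate G g L"
  by (auto simp: conjugate_eq_image)

lemma conjugate_subset_iff:
  assumes "g \<in> carrier G" "K \<subseteq> carrier G" "L \<subseteq> carrier G"
  shows "conjugate G g K \<subseteq> conjugate G g L \<longleftrightarrow> K \<subseteq> L"
  using conjugate_mono[of K L g] conjugate_mono[of "conjugate G g K" "conjugate G g L" "inv g"]
  by (auto simp: conjugate_inv assms)

lemma conjugate_psubset_iff:
  assumes "g \<in> carrier G" "K \<subseteq> carrier G" "L \<subseteq> carrier G"
  shows "conjugate G g K \<subset> conjugate G g L \<longleftrightarrow> K \<subset> L"
  by (simp add: less_le_not_le conjugate_subset_iff assms)

lemma conjugate_mem_iff:
  assumes "g \<in> carrier G" "K \<subseteq> carrier G" "x \<in> carrier G"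
  shows "x \<in> conjugate G g K \<longleftrightarrow> inv g \<otimes> x \<otimes> g \<in> K"
proof
  assume "x \<in> conjugate G g K"
  then obtain k where k: "k \<in> K" "x = g \<otimes> k \<otimes> inv g" by (auto simp: conjugate_eq_image)
  then have "inv g \<otimes> x \<otimes> g = k" using assms by (auto simp: m_assoc subset_iff inv_solve_left')
  then show "inv g \<otimes> x \<otimes> g \<in> K" using k by simp
next
  assume k: "inv g \<otimes> x \<otimes> g \<in> K"
  have "x = g \<otimes> (inv g \<otimes> x \<otimes> g) \<otimes> inv g"
    using assms by (simp add: m_assoc) (simp flip: m_assoc)
  then show "x \<in> conjugate G g K" using k unfolding conjugate_eq_image by blast
qed

lemma conjugate_self:
  assumes K: "subgroup K G" and g: "g \<in> K"
  shows "conjugate G g K = K"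
proof -
  note Kc = subgroup.mem_carrier[OF K]
  have "x \<in> conjugate G g K \<longleftrightarrow> x \<in> K" if x: "x \<in> carrier G" for x
  proof -
    have "x \<in> K" if "inv g \<otimes> x \<otimes> g \<in> K"
    proof -
      have "x = g \<otimes> (inv g \<otimes> x \<otimes> g) \<otimes> inv g"
        using Kc[OF g] x by (simp add: m_assoc) (simp flip: m_assoc)
      also have "\<dots> \<in> K" using that g K by (simp add: subgroup.m_closed subgroup.m_inv_closed)
      finally show ?thesis .
    qed
    moreover have "inv g \<otimes> x \<otimes> g \<in> K" if "x \<in> K"
      using that g K by (simp add: subgroup.m_closed subgroup.m_inv_closed)
    ultimately show ?thesis using conjugate_mem_iff Kc[OF g] subgroup.subset[OF K] x by auto
  qed
  moreover have "conjugate G g K \<subseteq> carrier G"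
    using Kc[OF g] subgroup.subset[OF K] by (rule conjugate_carrier)
  ultimately show ?thesis using Kc by blast
qed

lemma lcoset_eq_iff:
  assumes "subgroup H G" "g \<in> carrier G" "g' \<in> carrier G"
  shows "g <# H = g' <# H \<longleftrightarrow> inv g \<otimes> g' \<in> H"
proof
  assume "g <# H = g' <# H"
  then have "g' \<in> g <# H" using lcos_self assms by blast
  then show "inv g \<otimes> g' \<in> H" using subgroup.lcos_module_imp[OF assms(1) is_group assms(2)] by simp
next
  assume "inv g \<otimes> g' \<in> H"
  then have "g' \<in> g <# H" using subgroup.lcos_module_rev[OF assms(1) is_group assms(2,3)] by simp
  then show "g <# H = g' <# H" using l_repr_independence assms by blast
qed

lemma lcosetsE:
  assumes "C \<in> lcosets H"
  obtains g where "g \<in> carrier G" "C = g <# H"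
  using assms by (auto simp: LCOSETS_def)

lemma lcosetsI: "g \<in> carrier G \<Longrightarrow> g <# H \<in> lcosets H"
  by (auto simp: LCOSETS_def)

lemma lcoset_lcosets: "H \<subseteq> carrier G \<Longrightarrow> g \<in> carrier G \<Longrightarrow> C \<in> lcosets H \<Longrightarrow> g <# C \<in> lcosets H"
  by (elim lcosetsE) (simp add: lcos_m_assoc lcosetsI)

text \<open>The factors from \<open>H\<close> on both sides of \<open>K\<close> are absorbed by
  \<open>K\<close>, so the conjugate does not depend on the representative \<open>g\<close>.\<close>

lemma weyl_conjugate_lcoset:
  assumes H: "subgroup H G" and K: "subgroup K G" and HK: "H \<subseteq> K" and g: "g \<in> carrier G"
  shows "weyl_conjugate G (g <# H) K = conjugate G g K"
proof
  note Kc = subgroup.mem_carrier[OF K] and Hc = subgroup.mem_carrier[OF H]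
  show "weyl_conjugate G (g <# H) K \<subseteq> conjugate G g K"
  proof
    fix x assume "x \<in> weyl_conjugate G (g <# H) K"
    then obtain h k h' where hk: "h \<in> H" "k \<in> K" "h' \<in> H"
      and x: "x = g \<otimes> h \<otimes> k \<otimes> inv (g \<otimes> h')"
      by (auto simp: weyl_conjugate_def set_mult_def SET_INV_def l_coset_def)
    have "x = g \<otimes> (h \<otimes> k \<otimes> inv h') \<otimes> inv g"
      using g hk Kc Hc x by (simp add: m_assoc inv_mult_group)
    moreover have "h \<otimes> k \<otimes> inv h' \<in> K"
      using hk HK K by (auto intro!: subgroup.m_closed subgroup.m_inv_closed)
    ultimately show "x \<in> conjugate G g K" by (auto simp: conjugate_eq_image)
  qed
  show "conjugate G g K \<subseteq> weyl_conjugate G (g <# H) K"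
  proof
    fix x assume "x \<in> conjugate G g K"
    then obtain k where k: "k \<in> K" "x = g \<otimes> k \<otimes> inv g" by (auto simp: conjugate_eq_image)
    have "g \<in> g <# H" using lcos_self[OF g H] .
    then show "x \<in> weyl_conjugate G (g <# H) K"
      using k unfolding weyl_conjugate_def set_mult_def SET_INV_def by blast
  qed
qed

lemma normalizer_iff:
  assumes "H \<subseteq> carrier G"
  shows "n \<in> normalizer G H \<longleftrightarrow> n \<in> carrier G \<and> conjugate G n H = H"
  using assms by (simp add: normalizer_def stabilizer_def conjugate_def)

lemma group_weyl_group: "subgroup H G \<Longrightarrow> group (weyl_group G H)"
  unfolding weyl_group_def by (rule normal.factorgroup_is_group[OF subgroup_in_normalizer])

text \<open>The elements of \<open>weyl_group\<close> arise as right cosets, the points of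
  \<open>G/H\<close> are left cosets. On the normalizer the two agree, which allows
  \<open>w = n H\<close> for elements of \<open>WH\<close>.\<close>

lemma rcoset_eq_lcoset:
  assumes H: "H \<subseteq> carrier G" and n: "n \<in> carrier G" "conjugate G n H = H"
  shows "H #> n = n <# H"
proof -
  have "H #> n = (n <# H #> inv n) #> n" using n by (simp add: conjugate_def)
  also have "\<dots> = n <# H" using n H by (simp add: coset_mult_assoc l_coset_subset_G)
  finally show ?thesis .
qed

lemma weyl_group_carrierE:
  assumes H: "subgroup H G" and w: "w \<in> carrier (weyl_group G H)"
  obtains n where "n \<in> carrier G" "conjugate G n H = H" "w = n <# H"
proof -
  from w obtain n where n: "n \<in> normalizer G H" "w = H #> n"
    by (auto simp: weyl_group_def carrier_FactGroup)
  then show ?thesis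
    using that[of n] rcoset_eq_lcoset[of H n] subgroup.subset[OF H] by (simp add: normalizer_iff)
qed

lemma weyl_group_carrierI:
  assumes H: "subgroup H G" and "n \<in> carrier G" "conjugate G n H = H"
  shows "n <# H \<in> carrier (weyl_group G H)"
proof -
  have "n \<in> normalizer G H" "n <# H = H #> n"
    using assms subgroup.subset[OF H] by (simp_all add: normalizer_iff rcoset_eq_lcoset)
  then show ?thesis by (auto simp: weyl_group_def carrier_FactGroup)
qed

lemma weyl_group_one: "\<one>\<^bsub>weyl_group G H\<^esub> = H"
  and weyl_group_mult: "v \<otimes>\<^bsub>weyl_group G H\<^esub> w = v <#> w"
  by (simp_all add: weyl_group_def)

text \<open>Moving \<open>n\<close> past \<open>H\<close> leaves \<open>g n H H = g n H\<close>.
  This is the right action of \<open>WH\<close> on \<open>G/H\<close>.\<close>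

lemma lcoset_mult_weyl:
  assumes H: "subgroup H G" and n: "n \<in> carrier G" "conjugate G n H = H" and g: "g \<in> carrier G"
  shows "(g <# H) <#> (n <# H) = (g \<otimes> n) <# H"
proof -
  note Hs = subgroup.subset[OF H]
  have "(g <# H) <#> (n <# H) = {g} <#> (H <#> ({n} <#> H))"
    using g n Hs by (simp add: l_coset_eq_set_mult set_mult_assoc set_mult_closed)
  also have "H <#> ({n} <#> H) = (H #> n) <#> H"
    using n Hs by (simp add: r_coset_eq_set_mult set_mult_assoc)
  also have "\<dots> = n <# (H <#> H)"
    using n Hs by (simp add: rcoset_eq_lcoset l_coset_eq_set_mult set_mult_assoc)
  also have "\<dots> = n <# H" using subgroup_mult_id[OF H] by simp
  also have "{g} <#> (n <# H) = (g \<otimes> n) <# H"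
    using g n Hs by (simp add: lcos_m_assoc flip: l_coset_eq_set_mult)
  finally show ?thesis .
qed

lemma lcoset_set_mult_left:
  assumes "g \<in> carrier G" "C \<subseteq> carrier G" "w \<subseteq> carrier G"
  shows "(g <# C) <#> w = g <# (C <#> w)"
  using assms by (simp add: l_coset_eq_set_mult set_mult_assoc)

end

section \<open>Transitive sets and equivariant chains\<close>

lemma simplices_mono: "X \<subseteq> Y \<Longrightarrow> simplices X n \<subseteq> simplices Y n"
  by (auto simp: simplices_def)

lemma simplices_face: "\<sigma> \<in> simplices X (Suc n) \<Longrightarrow> i \<le> n \<Longrightarrow> simplex_face i \<sigma> \<in> simplices X n"
proof -
  assume s: "\<sigma> \<in> simplices X (Suc n)" and i: "i \<le> n"
  have "sorted_wrt (\<subset>) (take i \<sigma> @ drop (Suc i) \<sigma>)"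
  proof -
    have "sorted_wrt (\<subset>) (take i \<sigma> @ drop i \<sigma>)" using s by (simp add: simplices_def)
    moreover have "drop (Suc i) \<sigma> = drop 1 (drop i \<sigma>)" by simp
    ultimately show ?thesis
      unfolding sorted_wrt_append by (metis sorted_wrt_drop set_drop_subset subsetD)
  qed
  moreover have "set (take i \<sigma> @ drop (Suc i) \<sigma>) \<subseteq> set \<sigma>"
    using set_take_subset[of i \<sigma>] set_drop_subset[of "Suc i" \<sigma>] by auto
  ultimately show ?thesis using s i by (auto simp: simplices_def simplex_face_def)
qed

lemma simplex_face_map: "simplex_face i (map f \<sigma>) = map f (simplex_face i \<sigma>)"
  by (simp add: simplex_face_def take_map drop_map)

lemma simplices_Cons:
  "K # \<tau> \<in> simplices X (Suc n) \<longleftrightarrow> K \<in> X \<and> \<tau> \<in> simplices {L \<in> X. K \<subset> L} n"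
  by (auto simp: simplices_def)

locale subgroup_family = group G for G (structure) +
  fixes \<H> :: "'a set set"
  assumes family_subgroup: "H \<in> \<H> \<Longrightarrow> subgroup H G"
    and family_conjugate: "H \<in> \<H> \<Longrightarrow> g \<in> carrier G \<Longrightarrow> conjugate G g H \<in> \<H>"
begin

abbreviation "TG \<equiv> transitive_gsets G \<H>"
abbreviation "stab X x \<equiv> stabilizer G (snd X) x"

lemma family_carrier: "H \<in> \<H> \<Longrightarrow> H \<subseteq> carrier G"
  by (rule subgroup.subset[OF family_subgroup])

lemma gset_action: "X \<in> TG \<Longrightarrow> transitive_action G (fst X) (snd X)"
  by (auto simp: transitive_gsets_def)

lemma gset_group_action: "X \<in> TG \<Longrightarrow> group_action G (fst X) (snd X)"
  by (rule transitive_action.axioms(1)[OF gset_action])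

lemma gset_nonempty: "X \<in> TG \<Longrightarrow> fst X \<noteq> {}"
  and stab_family: "X \<in> TG \<Longrightarrow> x \<in> fst X \<Longrightarrow> stab X x \<in> \<H>"
  by (auto simp: transitive_gsets_def)

lemma act_closed: "X \<in> TG \<Longrightarrow> g \<in> carrier G \<Longrightarrow> x \<in> fst X \<Longrightarrow> snd X g x \<in> fst X"
  using group_action.element_image[OF gset_group_action] by blast

lemma act_mult: "X \<in> TG \<Longrightarrow> g \<in> carrier G \<Longrightarrow> h \<in> carrier G \<Longrightarrow> x \<in> fst X \<Longrightarrow>
    snd X (g \<otimes> h) x = snd X g (snd X h x)"
  using group_action.composition_rule[OF gset_group_action] by blast

lemma act_one: "X \<in> TG \<Longrightarrow> x \<in> fst X \<Longrightarrow> snd X \<one> x = x"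
  using group_action.id_eq_one[OF gset_group_action] by (metis restrict_apply')

lemma act_transitive:
  assumes "X \<in> TG" "x \<in> fst X" "y \<in> fst X"
  obtains g where "g \<in> carrier G" "snd X g x = y"
  using transitive_action.unique_orbit[OF gset_action] assms by blast

lemma stab_iff: "g \<in> stab X x \<longleftrightarrow> g \<in> carrier G \<and> snd X g x = x"
  by (simp add: stabilizer_def)

lemma carrier_set_eqI:
  "A \<subseteq> carrier G \<Longrightarrow> B \<subseteq> carrier G \<Longrightarrow> (\<And>k. k \<in> carrier G \<Longrightarrow> k \<in> A \<longleftrightarrow> k \<in> B) \<Longrightarrow> A = B"
  by (intro equalityI subsetI) (meson subsetD)+

lemma stab_carrier: "stab X x \<subseteq> carrier G"
  by (auto simp: stab_iff)

lemma act_inv: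
  assumes "X \<in> TG" "g \<in> carrier G" "x \<in> fst X"
  shows "snd X (inv g) (snd X g x) = x"
  using act_mult[of X "inv g" g x] assms by (simp add: act_one)

lemma stab_act:
  assumes X: "X \<in> TG" and g: "g \<in> carrier G" and x: "x \<in> fst X"
  shows "stab X (snd X g x) = conjugate G g (stab X x)"
proof -
  have sub: "stab X x \<subseteq> carrier G" by (rule stab_carrier)
  have "k \<in> stab X (snd X g x) \<longleftrightarrow> k \<in> conjugate G g (stab X x)" if k: "k \<in> carrier G" for k
  proof -
    have "k \<in> conjugate G g (stab X x) \<longleftrightarrow> snd X (inv g \<otimes> k \<otimes> g) x = x"
      using k g by (simp add: conjugate_mem_iff[OF g sub] stab_iff)
    also have "snd X (inv g \<otimes> k \<otimes> g) x = snd X (inv g) (snd X k (snd X g x))"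
      using k g x X by (simp add: act_mult act_closed)
    also have "\<dots> = x \<longleftrightarrow> snd X k (snd X g x) = snd X g x"
    proof
      assume "snd X (inv g) (snd X k (snd X g x)) = x"
      then have "snd X g (snd X (inv g) (snd X k (snd X g x))) = snd X g x" by simp
      then show "snd X k (snd X g x) = snd X g x"
        using act_inv[of X "inv g" "snd X k (snd X g x)"] k g x X by (simp add: act_closed)
    qed (use act_inv X g x in simp)
    finally show ?thesis using k by (simp add: stab_iff)
  qed
  then show ?thesis
    by (rule carrier_set_eqI[OF stab_carrier conjugate_carrier[OF g sub]])
qed

text \<open>The map sends \<open>g x0\<close> to \<open>g v0\<close>, which is well defined because
  the stabilizer of \<open>x0\<close> fixes \<open>v0\<close>. The target \<open>V\<close> is kept
  abstract; it is used both for cosets and for lists of subgroups.\<close>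

lemma equivariant_extension:
  assumes X: "X \<in> TG" and x0: "x0 \<in> fst X" and v0: "v0 \<in> V"
    and closed: "\<And>g v. g \<in> carrier G \<Longrightarrow> v \<in> V \<Longrightarrow> a g v \<in> V"
    and mult: "\<And>g h v. g \<in> carrier G \<Longrightarrow> h \<in> carrier G \<Longrightarrow> v \<in> V \<Longrightarrow> a (g \<otimes> h) v = a g (a h v)"
    and one: "\<And>v. v \<in> V \<Longrightarrow> a \<one> v = v"
    and stab: "\<And>g. g \<in> stab X x0 \<Longrightarrow> a g v0 = v0"
  obtains f where "f \<in> fst X \<rightarrow>\<^sub>E V" "f x0 = v0"
    "\<And>g x. g \<in> carrier G \<Longrightarrow> x \<in> fst X \<Longrightarrow> f (snd X g x) = a g (f x)"
proof -
  define c where "c x = (SOME g. g \<in> carrier G \<and> snd X g x0 = x)" for x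
  have c: "c x \<in> carrier G" "snd X (c x) x0 = x" if "x \<in> fst X" for x
    using someI_ex[of "\<lambda>g. g \<in> carrier G \<and> snd X g x0 = x"] act_transitive[OF X x0 that]
    unfolding c_def by blast+
  have wd: "a g v0 = a h v0" if gh: "g \<in> carrier G" "h \<in> carrier G" "snd X g x0 = snd X h x0" for g h
  proof -
    have "inv g \<otimes> h \<in> stab X x0"
      using gh act_inv[OF X gh(1) x0] X x0 by (simp add: stab_iff act_mult)
    then have "a g (a (inv g \<otimes> h) v0) = a g v0" by (simp add: stab)
    moreover have "a g (a (inv g \<otimes> h) v0) = a h v0"
      using gh v0 by (simp flip: mult add: m_assoc[symmetric])
    ultimately show ?thesis by simp
  qed
  let ?f = "\<lambda>x\<in>fst X. a (c x) v0"
  show ?thesis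
  proof (rule that)
    show "?f \<in> fst X \<rightarrow>\<^sub>E V" using c closed v0 by auto
    show "?f x0 = v0"
      using wd[OF c(1)[OF x0] one_closed] c(2)[OF x0] x0 v0 X by (simp add: one act_one)
    fix g x assume g: "g \<in> carrier G" and x: "x \<in> fst X"
    have "a (c (snd X g x)) v0 = a (g \<otimes> c x) v0"
      using g x X x0 c by (intro wd) (simp_all add: act_closed act_mult)
    then show "?f (snd X g x) = a g (?f x)"
      using g x X c v0 by (simp add: act_closed mult)
  qed
qed

lemma gset_maps_closed: "f \<in> gset_maps G X Y \<Longrightarrow> x \<in> fst X \<Longrightarrow> f x \<in> fst Y"
  and gset_maps_equiv: "f \<in> gset_maps G X Y \<Longrightarrow> g \<in> carrier G \<Longrightarrow> x \<in> fst X \<Longrightarrow> f (snd X g x) = snd Y g (f x)"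
  and gset_maps_ext: "f \<in> gset_maps G X Y \<Longrightarrow> f \<in> extensional (fst X)"
  by (auto simp: gset_maps_def PiE_iff)

lemma equivariant_eqI:
  assumes X: "X \<in> TG" and x0: "x0 \<in> fst X"
    and f: "f \<in> extensional (fst X)" "\<And>g x. g \<in> carrier G \<Longrightarrow> x \<in> fst X \<Longrightarrow> f (snd X g x) = a g (f x)"
    and f': "f' \<in> extensional (fst X)" "\<And>g x. g \<in> carrier G \<Longrightarrow> x \<in> fst X \<Longrightarrow> f' (snd X g x) = a g (f' x)"
    and eq: "f x0 = f' x0"
  shows "f = f'"
proof (rule extensionalityI[OF f(1) f'(1)])
  fix x assume "x \<in> fst X"
  then obtain g where "g \<in> carrier G" "snd X g x0 = x" by (rule act_transitive[OF X x0])
  then show "f x = f' x" using f(2)[of g x0] f'(2)[of g x0] x0 eq by metis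
qed

lemma gset_maps_eqI:
  assumes "X \<in> TG" "x0 \<in> fst X" "f \<in> gset_maps G X Y" "f' \<in> gset_maps G X Y" "f x0 = f' x0"
  shows "f = f'"
  by (rule equivariant_eqI[OF assms(1,2) gset_maps_ext[OF assms(3)] gset_maps_equiv[OF assms(3)]
        gset_maps_ext[OF assms(4)] gset_maps_equiv[OF assms(4)] assms(5)])

lemma gset_maps_compose:
  assumes "X \<in> TG" "f \<in> gset_maps G X Y" "h \<in> gset_maps G Y Z"
  shows "compose (fst X) h f \<in> gset_maps G X Z"
  using assms act_closed[OF assms(1)] unfolding gset_maps_def
  by (auto simp: compose_def PiE_iff)

lemma gset_maps_id: "X \<in> TG \<Longrightarrow> (\<lambda>x\<in>fst X. x) \<in> gset_maps G X X"
  by (auto simp: gset_maps_def act_closed)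

lemma stab_gset_map: "f \<in> gset_maps G X Y \<Longrightarrow> x \<in> fst X \<Longrightarrow> stab X x \<subseteq> stab Y (f x)"
  by (auto simp: stab_iff gset_maps_equiv[symmetric])

lemma coset_gset_simps:
  "fst (coset_gset G H) = lcosets H"
  "C \<in> lcosets H \<Longrightarrow> snd (coset_gset G H) g C = g <# C"
  by (simp_all add: coset_gset_def)

lemma lcosets_subset_carrier: "H \<subseteq> carrier G \<Longrightarrow> C \<in> lcosets H \<Longrightarrow> C \<subseteq> carrier G"
  by (elim lcosetsE) (simp add: l_coset_subset_G)

lemma stab_coset:
  assumes H: "H \<in> \<H>" and g: "g \<in> carrier G"
  shows "stab (coset_gset G H) (g <# H) = conjugate G g H"
proof -
  note Hs = family_subgroup[OF H] and Hc = family_carrier[OF H]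
  have "k \<in> stab (coset_gset G H) (g <# H) \<longleftrightarrow> k \<in> conjugate G g H" if k: "k \<in> carrier G" for k
  proof -
    have "k \<in> stab (coset_gset G H) (g <# H) \<longleftrightarrow> k <# (g <# H) = g <# H"
      using k lcosetsI[OF g] by (simp add: stab_iff coset_gset_simps)
    also have "\<dots> \<longleftrightarrow> g <# H = (k \<otimes> g) <# H" using k g Hc by (auto simp: lcos_m_assoc)
    also have "\<dots> \<longleftrightarrow> inv g \<otimes> (k \<otimes> g) \<in> H" using lcoset_eq_iff[OF Hs g] k g by simp
    also have "\<dots> \<longleftrightarrow> k \<in> conjugate G g H" using k g Hc by (simp add: conjugate_mem_iff m_assoc)
    finally show ?thesis .
  qed
  then show ?thesis
    by (rule carrier_set_eqI[OF stab_carrier conjugate_carrier[OF g Hc]])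
qed

lemma coset_gset_transitive:
  assumes H: "H \<in> \<H>"
  shows "coset_gset G H \<in> TG"
proof -
  note Hs = family_subgroup[OF H] and Hc = family_carrier[OF H]
  let ?a = "\<lambda>g. \<lambda>C\<in>lcosets H. g <# C"
  have cl: "g <# C \<in> lcosets H" if "g \<in> carrier G" "C \<in> lcosets H" for g C
    using lcoset_lcosets[OF Hc that] .
  have inv: "inv g <# (g <# C) = C" "g <# (inv g <# C) = C" if "g \<in> carrier G" "C \<in> lcosets H" for g C
    using that lcosets_subset_carrier[OF Hc that(2)] by (simp_all add: lcos_m_assoc lcos_mult_one)
  have bij: "?a g \<in> Bij (lcosets H)" if g: "g \<in> carrier G" for g
  proof -
    have "bij_betw (?a g) (lcosets H) (lcosets H)"
      by (rule bij_betw_byWitness[where f'="\<lambda>C. inv g <# C"]) (use g cl inv in auto)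
    then show ?thesis by (simp add: Bij_def)
  qed
  have act: "group_action G (lcosets H) ?a"
    unfolding group_action_def
  proof (intro group_hom.intro group_hom_axioms.intro homI)
    show "?a g \<in> carrier (BijGroup (lcosets H))" if "g \<in> carrier G" for g
      using bij[OF that] by (simp add: BijGroup_def)
    fix g h assume gh: "g \<in> carrier G" "h \<in> carrier G"
    show "?a (g \<otimes> h) = ?a g \<otimes>\<^bsub>BijGroup (lcosets H)\<^esub> ?a h"
      using gh bij cl lcosets_subset_carrier[OF Hc]
      by (auto simp: BijGroup_def compose_def lcos_m_assoc fun_eq_iff)
  qed (simp_all add: group_BijGroup is_group)
  have trans: "\<exists>g\<in>carrier G. ?a g C = D" if CD: "C \<in> lcosets H" "D \<in> lcosets H" for C D
  proof -
    from CD obtain c d where c: "c \<in> carrier G" "C = c <# H" and d: "d \<in> carrier G" "D = d <# H"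
      by (elim lcosetsE)
    have "?a (d \<otimes> inv c) C = D"
      using c d CD Hc by (simp add: lcos_m_assoc m_assoc)
    then show ?thesis using c d by blast
  qed
  have "stabilizer G ?a C \<in> \<H>" if "C \<in> lcosets H" for C
  proof -
    from that obtain c where c: "c \<in> carrier G" "C = c <# H" by (rule lcosetsE)
    then show ?thesis
      using stab_coset[OF H c(1)] family_conjugate[OF H c(1)] by (simp add: coset_gset_def)
  qed
  moreover have "lcosets H \<noteq> {}" using lcosetsI[OF one_closed] by blast
  moreover have "transitive_action G (lcosets H) ?a"
    by (intro transitive_action.intro transitive_action_axioms.intro act trans)
  ultimately show ?thesis by (simp add: transitive_gsets_def coset_gset_def)
qed

abbreviation "cmaps X H \<equiv> gset_maps G X (coset_gset G H)"

lemma cmaps_lcosets: "h \<in> cmaps X H \<Longrightarrow> x \<in> fst X \<Longrightarrow> h x \<in> lcosets H"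
  using gset_maps_closed coset_gset_simps(1) by blast

lemma cmaps_equiv: "h \<in> cmaps X H \<Longrightarrow> g \<in> carrier G \<Longrightarrow> x \<in> fst X \<Longrightarrow> h (snd X g x) = g <# h x"
  by (simp add: gset_maps_equiv coset_gset_simps cmaps_lcosets)

text \<open>An equivariant map may send \<open>x0\<close> to \<open>gH\<close> as soon as the
  stabilizer of \<open>x0\<close> fixes \<open>gH\<close>, and the stabilizer of \<open>gH\<close>
  is \<open>gHg\<^sup>-\<^sup>1\<close>.\<close>

lemma cmaps_exists:
  assumes H: "H \<in> \<H>" and X: "X \<in> TG" and x0: "x0 \<in> fst X" and g: "g \<in> carrier G"
    and sub: "stab X x0 \<subseteq> conjugate G g H"
  obtains h where "h \<in> cmaps X H" "h x0 = g <# H"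
proof -
  note Hs = family_subgroup[OF H] and Hc = family_carrier[OF H]
  obtain f where f: "f \<in> fst X \<rightarrow>\<^sub>E lcosets H" "f x0 = g <# H"
    "\<And>g x. g \<in> carrier G \<Longrightarrow> x \<in> fst X \<Longrightarrow> f (snd X g x) = g <# f x"
  proof (rule equivariant_extension[OF X x0 lcosetsI[OF g], where a="\<lambda>g C. g <# C"])
    fix k assume "k \<in> stab X x0"
    then have "k \<in> stab (coset_gset G H) (g <# H)" using sub stab_coset[OF H g] by blast
    then show "k <# (g <# H) = g <# H" using lcosetsI[OF g] by (simp add: stab_iff coset_gset_simps)
  qed (use Hc lcosets_subset_carrier[OF Hc] in \<open>auto simp: lcoset_lcosets lcos_m_assoc lcos_mult_one\<close>)
  have "f \<in> cmaps X H"
    using f by (auto simp: gset_maps_def coset_gset_simps PiE_iff)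
  then show ?thesis using f(2) by (rule that)
qed

text \<open>Right multiplication by \<open>w = nH\<close> takes \<open>gH\<close> to
  \<open>gnH\<close> and commutes with the left action.\<close>

lemma cmaps_ract:
  assumes H: "H \<in> \<H>" and X: "X \<in> TG" and h: "h \<in> cmaps X H" and w: "w \<in> carrier (weyl_group G H)"
  shows "(\<lambda>x\<in>fst X. h x <#> w) \<in> cmaps X H"
proof -
  note Hs = family_subgroup[OF H] and Hc = family_carrier[OF H]
  obtain n where n: "n \<in> carrier G" "conjugate G n H = H" "w = n <# H"
    using weyl_group_carrierE[OF Hs w] .
  have wc: "w \<subseteq> carrier G" using n Hc by (simp add: l_coset_subset_G)
  have "C <#> w \<in> lcosets H" if "C \<in> lcosets H" for C
    using that n by (elim lcosetsE) (simp add: lcoset_mult_weyl[OF Hs n(1,2)] lcosetsI)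
  then show ?thesis
    using X h cmaps_lcosets[OF h] lcosets_subset_carrier[OF Hc] wc
    by (auto simp: gset_maps_def coset_gset_simps cmaps_equiv[OF h] act_closed lcoset_set_mult_left)
qed

lemma cmaps_ract_one:
  assumes H: "H \<in> \<H>" and X: "X \<in> TG" and h: "h \<in> cmaps X H"
  shows "(\<lambda>x\<in>fst X. h x <#> \<one>\<^bsub>weyl_group G H\<^esub>) = h"
proof (rule extensionalityI)
  note Hs = family_subgroup[OF H] and Hc = family_carrier[OF H]
  fix x assume x: "x \<in> fst X"
  then obtain g where "g \<in> carrier G" "h x = g <# H" using cmaps_lcosets[OF h] lcosetsE by metis
  then show "(\<lambda>x\<in>fst X. h x <#> \<one>\<^bsub>weyl_group G H\<^esub>) x = h x"
    using x lcoset_mult_weyl[OF Hs one_closed conjugate_one[OF Hc]] Hc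
    by (simp add: weyl_group_one lcos_mult_one)
qed (use gset_maps_ext[OF h] in auto)

lemma cmaps_ract_mult:
  assumes H: "H \<in> \<H>" and X: "X \<in> TG" and h: "h \<in> cmaps X H"
    and v: "v \<in> carrier (weyl_group G H)" and w: "w \<in> carrier (weyl_group G H)"
  shows "(\<lambda>x\<in>fst X. h x <#> (v \<otimes>\<^bsub>weyl_group G H\<^esub> w)) = (\<lambda>x\<in>fst X. (\<lambda>x\<in>fst X. h x <#> v) x <#> w)"
proof -
  note Hs = family_subgroup[OF H] and Hc = family_carrier[OF H]
  have c: "u \<subseteq> carrier G" if "u \<in> carrier (weyl_group G H)" for u
    using weyl_group_carrierE[OF Hs that] Hc l_coset_subset_G by metis
  show ?thesis
    using c[OF v] c[OF w] cmaps_lcosets[OF h] lcosets_subset_carrier[OF Hc]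
    by (intro restrict_ext) (simp add: weyl_group_mult set_mult_assoc)
qed

end

section \<open>Equivariant chains of subgroups and the level of a subgroup\<close>

context subgroup_family
begin

abbreviation "over X x \<equiv> {K \<in> \<H>. stab X x \<subseteq> K}"
abbreviation "upper H \<equiv> {K \<in> \<H>. H \<subseteq> K}"

text \<open>The basis of the value of \<open>F\<close> at \<open>X\<close>, made independent of a
  base point: a chain is given at every point, and equivariance determines it from any one of them.
  The index counts members, one more than the dimension, so that \<open>chains 0\<close> contains
  just the empty family and carries the augmentation.\<close>

definition chains :: "nat \<Rightarrow> 'a gset \<Rightarrow> ('a set \<Rightarrow> 'a set list) set" where
  "chains n X = {\<sigma> \<in> extensional (fst X). (\<forall>x\<in>fst X. \<sigma> x \<in> simplices (over X x) n) \<and>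
     (\<forall>g\<in>carrier G. \<forall>x\<in>fst X. \<sigma> (snd X g x) = map (conjugate G g) (\<sigma> x))}"

lemma chains_simplices: "\<sigma> \<in> chains n X \<Longrightarrow> x \<in> fst X \<Longrightarrow> \<sigma> x \<in> simplices (over X x) n"
  and chains_equiv: "\<sigma> \<in> chains n X \<Longrightarrow> g \<in> carrier G \<Longrightarrow> x \<in> fst X \<Longrightarrow> \<sigma> (snd X g x) = map (conjugate G g) (\<sigma> x)"
  and chains_ext: "\<sigma> \<in> chains n X \<Longrightarrow> \<sigma> \<in> extensional (fst X)"
  by (auto simp: chains_def)

lemma simplices_conjugate:
  assumes \<tau>: "\<tau> \<in> simplices Z n" and Z: "Z \<subseteq> \<H>" and g: "g \<in> carrier G"
    and Z': "\<And>K. K \<in> Z \<Longrightarrow> conjugate G g K \<in> Z'"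
  shows "map (conjugate G g) \<tau> \<in> simplices Z' n"
proof -
  have c: "K \<subseteq> carrier G" if "K \<in> set \<tau>" for K
    using \<tau> Z that by (intro family_carrier) (auto simp: simplices_def)
  have "sorted_wrt (\<subset>) \<tau>" using \<tau> by (simp add: simplices_def)
  then have "sorted_wrt (\<lambda>x y. conjugate G g x \<subset> conjugate G g y) \<tau>"
    by (rule sorted_wrt_mono_rel[rotated]) (simp add: conjugate_psubset_iff[OF g] c)
  then show ?thesis using \<tau> Z' by (auto simp: simplices_def sorted_wrt_map)
qed

lemma map_conjugate_mult:
  assumes "set \<tau> \<subseteq> \<H>" "g \<in> carrier G" "h \<in> carrier G"
  shows "map (conjugate G (g \<otimes> h)) \<tau> = map (conjugate G g) (map (conjugate G h) \<tau>)"
  using assms by (auto simp: conjugate_mult family_carrier)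

lemma map_conjugate_one: "set \<tau> \<subseteq> \<H> \<Longrightarrow> map (conjugate G \<one>) \<tau> = \<tau>"
  by (auto simp: conjugate_one family_carrier intro!: map_idI)

lemma map_conjugate_inv:
  assumes "set \<tau> \<subseteq> \<H>" "g \<in> carrier G"
  shows "map (conjugate G (inv g)) (map (conjugate G g) \<tau>) = \<tau>"
    and "map (conjugate G g) (map (conjugate G (inv g)) \<tau>) = \<tau>"
  using map_conjugate_mult[OF assms(1), of "inv g" g] map_conjugate_mult[OF assms(1), of g "inv g"]
    map_conjugate_one[OF assms(1)] assms(2) by auto

lemma map_conjugate_self:
  assumes "\<And>K. K \<in> set \<tau> \<Longrightarrow> K \<in> \<H> \<and> g \<in> K"
  shows "map (conjugate G g) \<tau> = \<tau>"
  using assms by (auto simp: conjugate_self family_subgroup intro!: map_idI)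

text \<open>Equivariance gives injectivity. For surjectivity, a stabilizing element lies in every
  member of \<open>\<tau>\<close> and thus conjugates it to itself, so \<open>\<tau>\<close> extends
  along the orbit.\<close>

lemma chains_eval_bij:
  assumes X: "X \<in> TG" and x0: "x0 \<in> fst X"
  shows "bij_betw (\<lambda>\<sigma>. \<sigma> x0) (chains n X) (simplices (over X x0) n)"
proof (rule bij_betwI')
  fix \<sigma> \<sigma>' assume s: "\<sigma> \<in> chains n X" "\<sigma>' \<in> chains n X"
  show "(\<sigma> x0 = \<sigma>' x0) = (\<sigma> = \<sigma>')"
    using equivariant_eqI[where a="\<lambda>g. map (conjugate G g)", OF X x0 chains_ext[OF s(1)]
        chains_equiv[OF s(1)] chains_ext[OF s(2)] chains_equiv[OF s(2)]] by auto
next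
  fix \<tau> assume \<tau>: "\<tau> \<in> simplices (over X x0) n"
  let ?V = "{\<tau>. set \<tau> \<subseteq> \<H>}"
  obtain f where f: "f \<in> fst X \<rightarrow>\<^sub>E ?V" "f x0 = \<tau>"
    "\<And>g x. g \<in> carrier G \<Longrightarrow> x \<in> fst X \<Longrightarrow> f (snd X g x) = map (conjugate G g) (f x)"
  proof (rule equivariant_extension[OF X x0, where V="?V" and ?v0.0=\<tau> and a="\<lambda>g. map (conjugate G g)"])
    show "\<tau> \<in> ?V" using \<tau> by (auto simp: simplices_def)
    fix k assume "k \<in> stab X x0"
    then show "map (conjugate G k) \<tau> = \<tau>"
      using \<tau> by (intro map_conjugate_self) (auto simp: simplices_def)
  qed (auto simp: family_conjugate map_conjugate_one simp del: map_map dest: map_conjugate_mult)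
  have "f x \<in> simplices (over X x) n" if x: "x \<in> fst X" for x
  proof -
    obtain g where g: "g \<in> carrier G" "snd X g x0 = x" using act_transitive[OF X x0 x] .
    have "map (conjugate G g) \<tau> \<in> simplices (over X (snd X g x0)) n"
      by (rule simplices_conjugate[OF \<tau> _ g(1)])
         (auto simp: family_conjugate g(1) stab_act[OF X g(1) x0] conjugate_mono)
    then show ?thesis using f(3)[OF g(1) x0] f(2) g(2) by simp
  qed
  then show "\<exists>\<sigma>\<in>chains n X. \<tau> = \<sigma> x0" using f by (intro bexI[of _ f]) (auto simp: chains_def PiE_iff)
qed (rule chains_simplices[OF _ x0])

text \<open>Stabilizers grow along \<open>f\<close>, so whatever contains the stabilizer of
  \<open>f x\<close> contains that of \<open>x\<close>.\<close>

lemma chains_pull: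
  assumes X: "X \<in> TG" and f: "f \<in> gset_maps G X Y" and \<sigma>: "\<sigma> \<in> chains n Y"
  shows "compose (fst X) \<sigma> f \<in> chains n X"
proof -
  have "\<sigma> (f x) \<in> simplices (over X x) n" if x: "x \<in> fst X" for x
  proof -
    have "over Y (f x) \<subseteq> over X x" using stab_gset_map[OF f x] by blast
    then show ?thesis
      using chains_simplices[OF \<sigma> gset_maps_closed[OF f x]] simplices_mono by blast
  qed
  then show ?thesis
    using act_closed[OF X] f \<sigma>
    by (simp add: chains_def[of n X] compose_def gset_maps_equiv[OF f] chains_equiv[OF \<sigma>] gset_maps_closed[OF f])
qed

lemma chains_face:
  assumes X: "X \<in> TG" and "i \<le> n" and \<sigma>: "\<sigma> \<in> chains (Suc n) X"
  shows "(\<lambda>x\<in>fst X. simplex_face i (\<sigma> x)) \<in> chains n X"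
  using act_closed[OF X] chains_simplices[OF \<sigma>] chains_equiv[OF \<sigma>] assms(2)
  by (simp add: chains_def[of n X] simplices_face simplex_face_map)

text \<open>A chain \<open>\<tau>\<close> above \<open>H\<close> transported along
  \<open>h : X -> G/H\<close>: where \<open>h x = gH\<close> it is the conjugate of
  \<open>\<tau>\<close> by \<open>g\<close>. The use of \<open>weyl_conjugate\<close> avoids a
  choice of \<open>g\<close>.\<close>

definition orbit_chain :: "'a gset \<Rightarrow> ('a set \<Rightarrow> 'a set) \<Rightarrow> 'a set list \<Rightarrow> 'a set \<Rightarrow> 'a set list" where
  "orbit_chain X h \<tau> = (\<lambda>x\<in>fst X. map (weyl_conjugate G (h x)) \<tau>)"

lemma weyl_conjugate_upper:
  "H \<in> \<H> \<Longrightarrow> g \<in> carrier G \<Longrightarrow> K \<in> upper H \<Longrightarrow> weyl_conjugate G (g <# H) K = conjugate G g K"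
  by (simp add: weyl_conjugate_lcoset family_subgroup)

lemma map_weyl_conjugate_upper:
  assumes "H \<in> \<H>" "g \<in> carrier G" "\<tau> \<in> simplices (upper H) n"
  shows "map (weyl_conjugate G (g <# H)) \<tau> = map (conjugate G g) \<tau>"
  using assms by (intro map_cong) (auto simp: simplices_def weyl_conjugate_upper)

lemma stab_cmap:
  assumes H: "H \<in> \<H>" and h: "h \<in> cmaps X H" and x: "x \<in> fst X" and g: "g \<in> carrier G" "h x = g <# H"
  shows "stab X x \<subseteq> conjugate G g H"
  using stab_gset_map[OF h x] stab_coset[OF H g(1)] g(2) by simp

lemma orbit_chain_eval:
  assumes "H \<in> \<H>" "x \<in> fst X" "g \<in> carrier G" "h x = g <# H" "\<tau> \<in> simplices (upper H) n"
  shows "orbit_chain X h \<tau> x = map (conjugate G g) \<tau>"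
  using assms map_weyl_conjugate_upper[OF assms(1,3,5)] by (simp add: orbit_chain_def)

lemma orbit_chain_chains:
  assumes H: "H \<in> \<H>" and X: "X \<in> TG" and h: "h \<in> cmaps X H" and \<tau>: "\<tau> \<in> simplices (upper H) n"
  shows "orbit_chain X h \<tau> \<in> chains n X"
proof -
  have "orbit_chain X h \<tau> x \<in> simplices (over X x) n \<and>
      (\<forall>k\<in>carrier G. orbit_chain X h \<tau> (snd X k x) = map (conjugate G k) (orbit_chain X h \<tau> x))"
    if x: "x \<in> fst X" for x
  proof -
    obtain g where g: "g \<in> carrier G" "h x = g <# H" using cmaps_lcosets[OF h x] lcosetsE by metis
    have "map (conjugate G g) \<tau> \<in> simplices (over X x) n"
      using stab_cmap[OF H h x g] conjugate_mono[of H _ g]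
      by (intro simplices_conjugate[OF \<tau> _ g(1)]) (auto simp: family_conjugate g(1))
    moreover have "orbit_chain X h \<tau> (snd X k x) = map (conjugate G k) (map (conjugate G g) \<tau>)"
      if k: "k \<in> carrier G" for k
    proof -
      have "h (snd X k x) = (k \<otimes> g) <# H"
        using g k x family_carrier[OF H] by (simp add: cmaps_equiv[OF h] lcos_m_assoc)
      then have "orbit_chain X h \<tau> (snd X k x) = map (conjugate G (k \<otimes> g)) \<tau>"
        using g k x X \<tau> by (intro orbit_chain_eval[OF H]) (auto simp: act_closed)
      then show ?thesis using map_conjugate_mult[OF _ k g(1), of \<tau>] \<tau> by (auto simp: simplices_def)
    qed
    ultimately show ?thesis using orbit_chain_eval[where h=h, OF H x g \<tau>] by simp
  qed
  then show ?thesis by (simp add: chains_def) (simp add: orbit_chain_def)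
qed

lemma orbit_chain_pull:
  assumes f: "f \<in> gset_maps G X Y"
  shows "compose (fst X) (orbit_chain Y h \<tau>) f = orbit_chain X (compose (fst X) h f) \<tau>"
  using gset_maps_closed[OF f] by (auto simp: orbit_chain_def compose_def)

lemma orbit_chain_face:
  "(\<lambda>x\<in>fst X. simplex_face i (orbit_chain X h \<tau> x)) = orbit_chain X h (simplex_face i \<tau>)"
  by (auto simp: orbit_chain_def simplex_face_map intro!: restrict_ext)

lemma weyl_self:
  assumes H: "H \<in> \<H>" and w: "w \<in> carrier (weyl_group G H)"
  shows "weyl_conjugate G w H = H"
proof -
  obtain n where "n \<in> carrier G" "conjugate G n H = H" "w = n <# H"
    using weyl_group_carrierE[OF family_subgroup[OF H] w] .
  then show ?thesis by (simp add: weyl_conjugate_upper[OF H] H)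
qed

lemma weyl_simplices_upper:
  assumes H: "H \<in> \<H>" and w: "w \<in> carrier (weyl_group G H)" and \<tau>: "\<tau> \<in> simplices (upper H) n"
  shows "map (weyl_conjugate G w) \<tau> \<in> simplices (upper H) n"
proof -
  obtain k where k: "k \<in> carrier G" "conjugate G k H = H" "w = k <# H"
    using weyl_group_carrierE[OF family_subgroup[OF H] w] .
  have "map (conjugate G k) \<tau> \<in> simplices (upper H) n"
    using k conjugate_mono[of H _ k] by (intro simplices_conjugate[OF \<tau> _ k(1)]) (auto simp: family_conjugate)
  then show ?thesis unfolding k(3) map_weyl_conjugate_upper[OF H k(1) \<tau>] .
qed

lemma weyl_simplices_above:
  assumes H: "H \<in> \<H>" and w: "w \<in> carrier (weyl_group G H)" and \<tau>: "\<tau> \<in> simplices (above \<H> H) n"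
  shows "map (weyl_conjugate G w) \<tau> \<in> simplices (above \<H> H) n"
proof -
  obtain k where k: "k \<in> carrier G" "conjugate G k H = H" "w = k <# H"
    using weyl_group_carrierE[OF family_subgroup[OF H] w] .
  have \<tau>': "\<tau> \<in> simplices (upper H) n"
    using \<tau> by (rule subsetD[OF simplices_mono, rotated]) (auto simp: above_def)
  have "map (conjugate G k) \<tau> \<in> simplices (above \<H> H) n"
    using k conjugate_psubset_iff[OF k(1) family_carrier[OF H]]
    by (intro simplices_conjugate[OF \<tau> _ k(1)]) (auto simp: family_conjugate above_def family_carrier)
  then show ?thesis unfolding k(3) map_weyl_conjugate_upper[OF H k(1) \<tau>'] .
qed

text \<open>If \<open>h x = gH\<close> and \<open>w = kH\<close>, then at \<open>x\<close> both
  sides are the conjugate of \<open>\<tau>\<close> by \<open>gk\<close>. This makes the passage from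
  chains above \<open>H\<close> to chains on \<open>X\<close> balanced over
  \<open>WH\<close>.\<close>

lemma orbit_chain_ract:
  assumes H: "H \<in> \<H>" and h: "h \<in> cmaps X H" and w: "w \<in> carrier (weyl_group G H)"
    and \<tau>: "\<tau> \<in> simplices (upper H) n"
  shows "orbit_chain X (\<lambda>x\<in>fst X. h x <#> w) \<tau> = orbit_chain X h (map (weyl_conjugate G w) \<tau>)"
proof (rule extensionalityI[of _ "fst X"])
  fix x assume x: "x \<in> fst X"
  obtain k where k: "k \<in> carrier G" "conjugate G k H = H" "w = k <# H"
    using weyl_group_carrierE[OF family_subgroup[OF H] w] .
  obtain g where g: "g \<in> carrier G" "h x = g <# H" using cmaps_lcosets[OF h x] lcosetsE by metis
  have "(\<lambda>x\<in>fst X. h x <#> w) x = (g \<otimes> k) <# H"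
    using x k g lcoset_mult_weyl[OF family_subgroup[OF H] k(1,2) g(1)] by simp
  then have "orbit_chain X (\<lambda>x\<in>fst X. h x <#> w) \<tau> x = map (conjugate G (g \<otimes> k)) \<tau>"
    using x g k \<tau> by (intro orbit_chain_eval[OF H]) auto
  also have "\<dots> = map (conjugate G g) (map (weyl_conjugate G w) \<tau>)"
    using map_conjugate_mult[OF _ g(1) k(1), of \<tau>] map_weyl_conjugate_upper[OF H k(1) \<tau>] \<tau> k(3)
    by (auto simp: simplices_def)
  also have "\<dots> = orbit_chain X h (map (weyl_conjugate G w) \<tau>) x"
    using orbit_chain_eval[where h=h and \<tau>="map (weyl_conjugate G w) \<tau>", OF H x g weyl_simplices_upper[OF H w \<tau>]] by simp
  finally show "orbit_chain X (\<lambda>x\<in>fst X. h x <#> w) \<tau> x = orbit_chain X h (map (weyl_conjugate G w) \<tau>) x" .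
qed (auto simp: orbit_chain_def)

lemma Cons_above_upper: "H \<in> \<H> \<Longrightarrow> \<tau> \<in> simplices (above \<H> H) n \<Longrightarrow> H # \<tau> \<in> simplices (upper H) (Suc n)"
  by (auto simp: simplices_def above_def)

lemma orbit_chain_hd:
  assumes "H \<in> \<H>" "x \<in> fst X" "g \<in> carrier G" "h x = g <# H" "\<tau> \<in> simplices (above \<H> H) n"
  shows "hd (orbit_chain X h (H # \<tau>) x) = conjugate G g H"
  using orbit_chain_eval[where h=h, OF assms(1-4) Cons_above_upper[OF assms(1,5)]] by simp

text \<open>The fibre of the head map over \<open>gHg\<^sup>-\<^sup>1\<close> is a copy of the
  simplices above \<open>H\<close>: a chain in the fibre comes from its tail, conjugated back by
  \<open>inv g\<close>. Equality of equivariant chains is decided at \<open>x0\<close>.\<close>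

lemma orbit_chain_bij:
  assumes H: "H \<in> \<H>" and X: "X \<in> TG" and x0: "x0 \<in> fst X" and h: "h \<in> cmaps X H"
    and g: "g \<in> carrier G" "h x0 = g <# H"
  shows "bij_betw (\<lambda>\<tau>. orbit_chain X h (H # \<tau>)) (simplices (above \<H> H) n)
    {\<sigma> \<in> chains (Suc n) X. hd (\<sigma> x0) = conjugate G g H}"
proof -
  have eval: "orbit_chain X h (H # \<rho>) x0 = map (conjugate G g) (H # \<rho>)" if "\<rho> \<in> simplices (above \<H> H) n" for \<rho>
    by (rule orbit_chain_eval[where h=h, OF H x0 g Cons_above_upper[OF H that]])
  show ?thesis
  proof (rule bij_betwI')
  fix \<tau> \<tau>' assume \<tau>: "\<tau> \<in> simplices (above \<H> H) n" "\<tau>' \<in> simplices (above \<H> H) n"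
  have "\<tau> = \<tau>'" if "orbit_chain X h (H # \<tau>) = orbit_chain X h (H # \<tau>')"
  proof -
    have "map (conjugate G g) \<tau> = map (conjugate G g) \<tau>'"
      using fun_cong[OF that, of x0] eval \<tau> by simp
    then have "map (conjugate G (inv g)) (map (conjugate G g) \<tau>) = map (conjugate G (inv g)) (map (conjugate G g) \<tau>')"
      by simp
    moreover have "map (conjugate G (inv g)) (map (conjugate G g) \<rho>) = \<rho>" if "\<rho> \<in> simplices (above \<H> H) n" for \<rho>
      using that g(1) by (intro map_conjugate_inv) (auto simp: simplices_def above_def)
    ultimately show ?thesis using \<tau> by metis
  qed
  then show "(orbit_chain X h (H # \<tau>) = orbit_chain X h (H # \<tau>')) = (\<tau> = \<tau>')" by blast
next
  fix \<tau> assume \<tau>: "\<tau> \<in> simplices (above \<H> H) n"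
  show "orbit_chain X h (H # \<tau>) \<in> {\<sigma> \<in> chains (Suc n) X. hd (\<sigma> x0) = conjugate G g H}"
    using orbit_chain_chains[OF H X h Cons_above_upper[OF H \<tau>]] orbit_chain_hd[where h=h, OF H x0 g \<tau>] by simp
next
  fix \<sigma> assume "\<sigma> \<in> {\<sigma> \<in> chains (Suc n) X. hd (\<sigma> x0) = conjugate G g H}"
  then have \<sigma>: "\<sigma> \<in> chains (Suc n) X" and hd: "hd (\<sigma> x0) = conjugate G g H" by auto
  have s: "\<sigma> x0 \<in> simplices (over X x0) (Suc n)" by (rule chains_simplices[OF \<sigma> x0])
  then obtain \<rho> where \<rho>: "\<sigma> x0 = conjugate G g H # \<rho>"
    using hd by (cases "\<sigma> x0") (auto simp: simplices_def)
  have gi: "inv g \<in> carrier G" using g by simp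
  have \<rho>s: "\<rho> \<in> simplices {L \<in> over X x0. conjugate G g H \<subset> L} n"
    using s unfolding \<rho> simplices_Cons by blast
  let ?\<tau> = "map (conjugate G (inv g)) \<rho>"
  have \<tau>: "?\<tau> \<in> simplices (above \<H> H) n"
  proof (rule simplices_conjugate[OF \<rho>s _ gi])
    fix K assume K: "K \<in> {L \<in> over X x0. conjugate G g H \<subset> L}"
    then have "conjugate G (inv g) (conjugate G g H) \<subset> conjugate G (inv g) K"
      using conjugate_psubset_iff[OF gi conjugate_carrier[OF g(1) family_carrier[OF H]], of K]
      by (simp add: family_carrier)
    then show "conjugate G (inv g) K \<in> above \<H> H"
      using K gi g H by (simp add: above_def conjugate_inv family_carrier family_conjugate)
  qed auto
  have "map (conjugate G g) ?\<tau> = \<rho>"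
    using \<rho>s g(1) by (intro map_conjugate_inv) (auto simp: simplices_def)
  then have "orbit_chain X h (H # ?\<tau>) x0 = \<sigma> x0"
    using eval \<tau> \<rho> by simp
  then have "orbit_chain X h (H # ?\<tau>) = \<sigma>"
    using bij_betw_imp_inj_on[OF chains_eval_bij[OF X x0, of "Suc n"]]
      orbit_chain_chains[OF H X h Cons_above_upper[OF H \<tau>]] \<sigma>
    by (auto dest: inj_onD)
  then show "\<exists>\<tau>\<in>simplices (above \<H> H) n. \<sigma> = orbit_chain X h (H # \<tau>)" using \<tau> by blast
qed
qed

text \<open>Under the length bound the supremum is finite on \<H>, and \<open>the_enat\<close>
  returns the length itself. A natural number is convenient for the descending induction.\<close>

definition level :: "'a set \<Rightarrow> nat" where "level H = the_enat (subgroup_length \<H> H)"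

lemma subgroup_length_conjugate_le:
  assumes g: "g \<in> carrier G"
  shows "H \<subseteq> carrier G \<Longrightarrow> subgroup_length \<H> H \<le> subgroup_length \<H> (conjugate G g H)"
  unfolding subgroup_length_def
proof (rule Sup_mono, clarsimp)
  fix s c assume H: "H \<subseteq> carrier G" and c: "\<forall>i\<le>s. c i \<in> \<H>" "\<forall>i<s. c i \<subset> c (Suc i)" "c s \<subseteq> H"
  let ?c = "\<lambda>i. conjugate G g (c i)"
  have "(\<forall>i\<le>s. ?c i \<in> \<H>) \<and> (\<forall>i<s. ?c i \<subset> ?c (Suc i)) \<and> ?c s \<subseteq> conjugate G g H"
    using c g by (simp add: family_conjugate conjugate_psubset_iff family_carrier conjugate_mono)
  then show "\<exists>a. (\<exists>s. a = enat s \<and> (\<exists>c. (\<forall>i\<le>s. c i \<in> \<H>) \<and> (\<forall>i<s. c i \<subset> c (Suc i)) \<and>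
      c s \<subseteq> conjugate G g H)) \<and> enat s \<le> a"
    by (intro exI[of _ "enat s"]) auto
qed

text \<open>Conjugation by \<open>g\<close> and by \<open>inv g\<close> give the two
  inequalities.\<close>

lemma level_conjugate:
  assumes g: "g \<in> carrier G" and H: "H \<subseteq> carrier G"
  shows "level (conjugate G g H) = level H"
proof -
  have "subgroup_length \<H> (conjugate G g H) \<le> subgroup_length \<H> (conjugate G (inv g) (conjugate G g H))"
    using g H by (intro subgroup_length_conjugate_le) (auto simp: conjugate_carrier)
  then show ?thesis
    using subgroup_length_conjugate_le[OF g H] g H by (simp add: level_def conjugate_inv)
qed

text \<open>A chain inside \<open>H\<close> can be prolonged by \<open>K\<close>, so every length
  realized in \<open>H\<close> is exceeded by one in \<open>K\<close>. With infinite lengths this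
  would not force a strict inequality; hence the bound.\<close>

lemma level_strict:
  assumes bound: "\<And>H. H \<in> \<H> \<Longrightarrow> subgroup_length \<H> H \<le> enat N" and H: "H \<in> \<H>" and K: "K \<in> \<H>" and HK: "H \<subset> K"
  shows "level H < level K"
proof -
  obtain m where m: "subgroup_length \<H> K = enat m"
    using bound[OF K] by (cases "subgroup_length \<H> K") auto
  have ext: "enat (Suc s) \<le> subgroup_length \<H> K"
    if c: "\<forall>i\<le>s. c i \<in> \<H>" "\<forall>i<s. c i \<subset> c (Suc i)" "c s \<subseteq> H" for s c
  proof -
    let ?c = "c(Suc s := K)"
    have "(\<forall>i\<le>Suc s. ?c i \<in> \<H>) \<and> (\<forall>i<Suc s. ?c i \<subset> ?c (Suc i)) \<and> ?c (Suc s) \<subseteq> K"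
      using c K HK by (auto simp: less_Suc_eq le_Suc_eq)
    then show ?thesis
      unfolding subgroup_length_def by (intro Sup_upper) blast
  qed
  have "enat (Suc 0) \<le> subgroup_length \<H> K"
    by (rule ext[of 0 "\<lambda>i. H"]) (use H in auto)
  \<comment> \<open>The chain \<open>H < K\<close> makes \<open>m\<close> positive, so the truncated
    \<open>m - 1\<close> is a genuine predecessor.\<close>
  then have pos: "0 < m" by (simp add: m)
  have "subgroup_length \<H> H \<le> enat (m - 1)"
    unfolding subgroup_length_def[of \<H> H]
  proof (rule Sup_least)
    fix e assume "e \<in> {enat s | s. \<exists>c :: nat \<Rightarrow> 'a set. (\<forall>i\<le>s. c i \<in> \<H>) \<and> (\<forall>i<s. c i \<subset> c (Suc i)) \<and> c s \<subseteq> H}"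
    then obtain s c where "e = enat s" "\<forall>i\<le>s. c i \<in> \<H>" "\<forall>i<s. c i \<subset> c (Suc i)" "c s \<subseteq> H" by blast
    then show "e \<le> enat (m - 1)" using ext[of s c] pos by (simp add: m)
  qed
  then show ?thesis using m pos by (cases "subgroup_length \<H> H") (auto simp: level_def)
qed

lemma level_le: "subgroup_length \<H> H \<le> enat N \<Longrightarrow> level H \<le> N"
  by (cases "subgroup_length \<H> H") (auto simp: level_def)

end

section \<open>The simplicial boundary\<close>

context cring
begin

lemma free_map_bij:
  assumes "bij_betw \<phi> S T"
  shows "bij_betw (free_map R S T \<phi>) (carrier (free_module R S)) (carrier (free_module R T))"
proof -
  let ?\<psi> = "inv_into S \<phi>"
  have \<phi>: "\<phi> \<in> S \<rightarrow> T" using assms by (auto simp: bij_betw_def)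
  have \<psi>: "?\<psi> \<in> T \<rightarrow> S" using bij_betw_inv_into[OF assms] by (auto simp: bij_betw_def)
  show ?thesis
  proof (rule bij_betw_byWitness[where f'="free_map R T S ?\<psi>"])
    show "\<forall>c\<in>carrier (free_module R S). free_map R T S ?\<psi> (free_map R S T \<phi> c) = c"
      using assms by (auto simp: free_map_comp[OF \<phi> \<psi>] bij_betw_def intro!: free_map_id)
    show "\<forall>c\<in>carrier (free_module R T). free_map R S T \<phi> (free_map R T S ?\<psi> c) = c"
      using assms by (auto simp: free_map_comp[OF \<psi> \<phi>] bij_betw_def f_inv_into_f intro!: free_map_id)
  qed (use \<phi> \<psi> in auto)
qed

text \<open>Kept general in the face maps \<open>F\<close>, because it serves both for the simplices
  of a poset and, pointwise, for equivariant chains. Evaluation at a point then commutes with it by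
  \<open>boundary_natural\<close>.\<close>

definition boundary :: "'s set \<Rightarrow> 't set \<Rightarrow> (nat \<Rightarrow> 's \<Rightarrow> 't) \<Rightarrow> nat \<Rightarrow> ('s \<Rightarrow> 'a) \<Rightarrow> 't \<Rightarrow> 'a" where
  "boundary S S' F n c = finsum (free_module R S')
     (\<lambda>i. ((\<ominus> \<one>) [^] i) \<odot>\<^bsub>free_module R S'\<^esub> free_map R S S' (F i) c) {..n}"

lemma sign_closed [simp]: "(\<ominus> \<one>) [^] (i::nat) \<in> carrier R"
  by simp

lemma boundary_hom:
  assumes "\<And>i. i \<le> n \<Longrightarrow> F i \<in> S \<rightarrow> S'"
  shows "boundary S S' F n \<in> module_hom R (free_module R S) (free_module R S')"
  unfolding boundary_def
  by (intro module_hom_finsum_fun module_hom_scale free_map_hom assms module_free_module) auto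

lemma boundary_basis:
  assumes "\<And>i. i \<le> n \<Longrightarrow> F i \<in> S \<rightarrow> S'" "s \<in> S"
  shows "boundary S S' F n (free_basis R S s) = finsum (free_module R S')
     (\<lambda>i. ((\<ominus> \<one>) [^] i) \<odot>\<^bsub>free_module R S'\<^esub> free_basis R S' (F i s)) {..n}"
proof -
  interpret F: Module.module R "free_module R S'" by (rule module_free_module)
  have "F i s \<in> S'" if "i \<le> n" for i using assms that by blast
  then show ?thesis
    unfolding boundary_def using assms by (intro F.finsum_cong') (auto intro!: F.smult_closed)
qed

lemma boundary_natural:
  assumes F: "\<And>i. i \<le> n \<Longrightarrow> F i \<in> S \<rightarrow> S'" and F': "\<And>i. i \<le> n \<Longrightarrow> F' i \<in> T \<rightarrow> T'"
    and \<phi>: "\<phi> \<in> S \<rightarrow> T" and \<phi>': "\<phi>' \<in> S' \<rightarrow> T'"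
    and comm: "\<And>i s. i \<le> n \<Longrightarrow> s \<in> S \<Longrightarrow> \<phi>' (F i s) = F' i (\<phi> s)"
    and c: "c \<in> carrier (free_module R S)"
  shows "free_map R S' T' \<phi>' (boundary S S' F n c) = boundary T T' F' n (free_map R S T \<phi> c)"
proof -
  interpret S': Module.module R "free_module R S'" by (rule module_free_module)
  interpret T': Module.module R "free_module R T'" by (rule module_free_module)
  have cl: "(\<lambda>i. ((\<ominus> \<one>) [^] i) \<odot>\<^bsub>free_module R S'\<^esub> free_map R S S' (F i) c) \<in> {..n} \<rightarrow> carrier (free_module R S')"
    using F c by (auto intro!: S'.smult_closed)
  have eq: "free_map R S' T' \<phi>' (((\<ominus> \<one>) [^] i) \<odot>\<^bsub>free_module R S'\<^esub> free_map R S S' (F i) c) =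
    ((\<ominus> \<one>) [^] i) \<odot>\<^bsub>free_module R T'\<^esub> free_map R T T' (F' i) (free_map R S T \<phi> c)" if i: "i \<le> n" for i
  proof -
    have "free_map R S' T' \<phi>' (free_map R S S' (F i) c) = free_map R S T' (\<lambda>s. \<phi>' (F i s)) c"
      by (rule free_map_comp[OF F[OF i] \<phi>' c])
    also have "\<dots> = free_map R S T' (\<lambda>s. F' i (\<phi> s)) c" using comm[OF i] by (rule free_map_cong)
    also have "\<dots> = free_map R T T' (F' i) (free_map R S T \<phi> c)"
      by (rule free_map_comp[OF \<phi> F'[OF i] c, symmetric])
    finally show ?thesis
      using F[OF i] c by (simp add: module_hom_smult[OF free_map_hom[OF \<phi>']])
  qed
  show ?thesis unfolding boundary_def
    using module_hom_finsum[OF module_free_module module_free_module free_map_hom[OF \<phi>'] _ cl]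
      F' \<phi> c by (simp add: eq cong: T'.finsum_cong)
qed

abbreviation simplex_boundary :: "'g set set \<Rightarrow> nat \<Rightarrow> ('g set list \<Rightarrow> 'a) \<Rightarrow> 'g set list \<Rightarrow> 'a" where
  "simplex_boundary Z n \<equiv> boundary (simplices Z (Suc n)) (simplices Z n) simplex_face n"

abbreviation "chain_module Z n \<equiv> free_module R (simplices Z n)"

text \<open>The simplicial cone with apex \<open>K\<close>, not the mapping cone.\<close>

definition cone :: "'g set \<Rightarrow> 'g set set \<Rightarrow> 'g set set \<Rightarrow> nat \<Rightarrow> ('g set list \<Rightarrow> 'a) \<Rightarrow> 'g set list \<Rightarrow> 'a" where
  "cone K Z Z' n = free_map R (simplices Z n) (simplices Z' (Suc n)) (\<lambda>\<tau>. K # \<tau>)"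

text \<open>The inclusion of chains. Coefficient functions are extensional on the simplices of their
  own poset, so the inclusion has to be an explicit map.\<close>

definition enlarge :: "'g set set \<Rightarrow> 'g set set \<Rightarrow> nat \<Rightarrow> ('g set list \<Rightarrow> 'a) \<Rightarrow> 'g set list \<Rightarrow> 'a" where
  "enlarge Z Z' n = free_map R (simplices Z n) (simplices Z' n) (\<lambda>\<tau>. \<tau>)"

lemma simplex_face_map_to: "i \<le> n \<Longrightarrow> simplex_face i \<in> simplices Z (Suc n) \<rightarrow> simplices Z n"
  by (auto intro: simplices_face)

lemma simplex_boundary_hom: "simplex_boundary Z n \<in> module_hom R (chain_module Z (Suc n)) (chain_module Z n)"
  by (intro boundary_hom simplex_face_map_to)

lemma simplex_boundary_closed [simp]:
  "c \<in> carrier (chain_module Z (Suc n)) \<Longrightarrow> simplex_boundary Z n c \<in> carrier (chain_module Z n)"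
  by (rule module_hom_closed[OF simplex_boundary_hom])

lemma enlarge_map: "Z \<subseteq> Z' \<Longrightarrow> (\<lambda>\<tau>. \<tau>) \<in> simplices Z n \<rightarrow> simplices Z' n"
  using simplices_mono by blast

lemma enlarge_hom: "Z \<subseteq> Z' \<Longrightarrow> enlarge Z Z' n \<in> module_hom R (chain_module Z n) (chain_module Z' n)"
  unfolding enlarge_def by (intro free_map_hom enlarge_map)

lemma enlarge_basis: "Z \<subseteq> Z' \<Longrightarrow> \<tau> \<in> simplices Z n \<Longrightarrow>
  enlarge Z Z' n (free_basis R (simplices Z n) \<tau>) = free_basis R (simplices Z' n) \<tau>"
  unfolding enlarge_def by (intro free_map_basis enlarge_map)

lemma simplex_boundary_enlarge:
  "Z \<subseteq> Z' \<Longrightarrow> c \<in> carrier (chain_module Z (Suc n)) \<Longrightarrow>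
    simplex_boundary Z' n (enlarge Z Z' (Suc n) c) = enlarge Z Z' n (simplex_boundary Z n c)"
  unfolding enlarge_def
  by (rule boundary_natural[symmetric]) (auto simp: simplex_face_map_to enlarge_map intro: simplices_face simplices_mono[THEN subsetD])

context
  fixes K :: "'g set" and Z Z' :: "'g set set"
  assumes below: "\<forall>L\<in>Z. K \<subset> L" and KZ': "K \<in> Z'" and ZZ': "Z \<subseteq> Z'"
begin

lemma cone_map: "(\<lambda>\<tau>. K # \<tau>) \<in> simplices Z n \<rightarrow> simplices Z' (Suc n)"
proof (rule funcsetI)
  fix \<tau> assume "\<tau> \<in> simplices Z n"
  then have "sorted_wrt (\<subset>) \<tau>" "set \<tau> \<subseteq> Z" "length \<tau> = n" by (simp_all add: simplices_def)
  moreover have "\<forall>L\<in>set \<tau>. K \<subset> L" using calculation below by blast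
  ultimately show "K # \<tau> \<in> simplices Z' (Suc n)"
    using KZ' ZZ' by (auto simp: simplices_def)
qed

lemma cone_hom: "cone K Z Z' n \<in> module_hom R (chain_module Z n) (chain_module Z' (Suc n))"
  unfolding cone_def by (rule free_map_hom[OF cone_map])

lemma cone_basis: "\<tau> \<in> simplices Z n \<Longrightarrow>
  cone K Z Z' n (free_basis R (simplices Z n) \<tau>) = free_basis R (simplices Z' (Suc n)) (K # \<tau>)"
  unfolding cone_def by (rule free_map_basis[OF cone_map])

lemma boundary_cone_0:
  assumes c: "c \<in> carrier (chain_module Z 0)"
  shows "simplex_boundary Z' 0 (cone K Z Z' 0 c) = enlarge Z Z' 0 c"
proof -
  interpret F: Module.module R "chain_module Z' 0" by (rule module_free_module)
  show ?thesis
  proof (rule free_hom_eqI[where f="\<lambda>c. simplex_boundary Z' 0 (cone K Z Z' 0 c)",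
        OF module_free_module module_hom_comp[OF cone_hom simplex_boundary_hom] enlarge_hom[OF ZZ'] _ c])
    fix \<tau> assume \<tau>: "\<tau> \<in> simplices Z 0"
    then have "\<tau> = []" "\<tau> \<in> simplices Z' 0" "K # \<tau> \<in> simplices Z' (Suc 0)"
      using cone_map[of 0] by (auto simp: simplices_def)
    then show "simplex_boundary Z' 0 (cone K Z Z' 0 (free_basis R (simplices Z 0) \<tau>)) =
        enlarge Z Z' 0 (free_basis R (simplices Z 0) \<tau>)"
      using \<tau> by (simp add: cone_basis enlarge_basis[OF ZZ'] boundary_basis simplex_face_map_to simplex_face_def F.finsum_insert)
  qed
qed

text \<open>Face 0 of \<open>K # \<tau>\<close> removes the apex. Face \<open>Suc i\<close> is the
  cone on face \<open>i\<close> of \<open>\<tau>\<close>, and the shift of the index turns the sign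
  around.\<close>

lemma boundary_cone_Suc:
  assumes c: "c \<in> carrier (chain_module Z (Suc n))"
  shows "simplex_boundary Z' (Suc n) (cone K Z Z' (Suc n) c) =
    enlarge Z Z' (Suc n) c \<ominus>\<^bsub>chain_module Z' (Suc n)\<^esub> cone K Z Z' n (simplex_boundary Z n c)"
proof -
  interpret F: Module.module R "chain_module Z' (Suc n)" by (rule module_free_module)
  interpret F0: Module.module R "chain_module Z n" by (rule module_free_module)
  let ?M = "chain_module Z' (Suc n)"
  have m1: "\<ominus> \<one> \<in> carrier R" by simp
  \<comment> \<open>The difference is rewritten as a sum with a (-1)-multiple, to which the closure
    rules for linear maps apply, so that both sides can be compared on basis elements.\<close>
  have "simplex_boundary Z' (Suc n) (cone K Z Z' (Suc n) c) =
    enlarge Z Z' (Suc n) c \<oplus>\<^bsub>?M\<^esub> ((\<ominus> \<one>) \<odot>\<^bsub>?M\<^esub> cone K Z Z' n (simplex_boundary Z n c))"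
  proof (rule free_hom_eqI[where f="\<lambda>c. simplex_boundary Z' (Suc n) (cone K Z Z' (Suc n) c)" and
        g="\<lambda>c. enlarge Z Z' (Suc n) c \<oplus>\<^bsub>?M\<^esub> ((\<ominus> \<one>) \<odot>\<^bsub>?M\<^esub> cone K Z Z' n (simplex_boundary Z n c))",
        OF module_free_module module_hom_comp[OF cone_hom simplex_boundary_hom]
          module_hom_sum[OF module_free_module module_free_module enlarge_hom[OF ZZ']
            module_hom_scale[OF module_free_module module_free_module module_hom_comp[OF simplex_boundary_hom cone_hom] m1]] _ c])
    fix \<tau> assume \<tau>: "\<tau> \<in> simplices Z (Suc n)"
    have \<tau>': "\<tau> \<in> simplices Z' (Suc n)" "K # \<tau> \<in> simplices Z' (Suc (Suc n))"
      using \<tau> cone_map simplices_mono[OF ZZ'] by blast+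
    have face: "simplex_face i \<tau> \<in> simplices Z n" if "i \<le> n" for i using simplices_face[OF \<tau> that] .
    then have Kface: "K # simplex_face i \<tau> \<in> simplices Z' (Suc n)" if "i \<le> n" for i
      using cone_map that by blast
    have f0: "simplex_face 0 (K # \<tau>) = \<tau>" "\<And>i. simplex_face (Suc i) (K # \<tau>) = K # simplex_face i \<tau>"
      by (auto simp: simplex_face_def)
    let ?e = "free_basis R (simplices Z' (Suc n))"
    let ?s = "\<lambda>i::nat. (\<ominus> \<one>) [^] i"
    have "simplex_boundary Z' (Suc n) (cone K Z Z' (Suc n) (free_basis R (simplices Z (Suc n)) \<tau>)) =
      finsum ?M (\<lambda>i. ?s i \<odot>\<^bsub>?M\<^esub> ?e (simplex_face i (K # \<tau>))) {..Suc n}"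
      using \<tau> \<tau>' by (simp add: cone_basis boundary_basis simplex_face_map_to)
    also have "\<dots> = finsum ?M (\<lambda>i. ?s (Suc i) \<odot>\<^bsub>?M\<^esub> ?e (K # simplex_face i \<tau>)) {..n} \<oplus>\<^bsub>?M\<^esub> ?e \<tau>"
      using \<tau>' by (subst F.finsum_Suc2)
        (auto simp: f0 simp del: nat_pow_Suc intro!: F.smult_closed free_basis_carrier simplices_face)
    also have "finsum ?M (\<lambda>i. ?s (Suc i) \<odot>\<^bsub>?M\<^esub> ?e (K # simplex_face i \<tau>)) {..n} =
        finsum ?M (\<lambda>i. (\<ominus> \<one>) \<odot>\<^bsub>?M\<^esub> (?s i \<odot>\<^bsub>?M\<^esub> ?e (K # simplex_face i \<tau>))) {..n}"
      using Kface by (intro F.finsum_cong') (auto simp: m_comm simp flip: F.smult_assoc1 intro!: F.smult_closed)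
    also have "\<dots> = (\<ominus> \<one>) \<odot>\<^bsub>?M\<^esub> finsum ?M (\<lambda>i. ?s i \<odot>\<^bsub>?M\<^esub> ?e (K # simplex_face i \<tau>)) {..n}"
      using Kface by (intro F.finsum_smult_ldistr[symmetric]) (auto intro!: F.smult_closed)
    also have "finsum ?M (\<lambda>i. ?s i \<odot>\<^bsub>?M\<^esub> ?e (K # simplex_face i \<tau>)) {..n} =
        cone K Z Z' n (simplex_boundary Z n (free_basis R (simplices Z (Suc n)) \<tau>))"
    proof -
      have "cone K Z Z' n (simplex_boundary Z n (free_basis R (simplices Z (Suc n)) \<tau>)) =
        finsum ?M (\<lambda>i. cone K Z Z' n (?s i \<odot>\<^bsub>chain_module Z n\<^esub> free_basis R (simplices Z n) (simplex_face i \<tau>))) {..n}"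
        using face by (subst boundary_basis[OF simplex_face_map_to \<tau>], simp)
          (rule module_hom_finsum[OF module_free_module module_free_module cone_hom], auto intro!: F0.smult_closed)
      also have "\<dots> = finsum ?M (\<lambda>i. ?s i \<odot>\<^bsub>?M\<^esub> ?e (K # simplex_face i \<tau>)) {..n}"
        using face Kface by (intro F.finsum_cong') (auto simp: module_hom_smult[OF cone_hom] cone_basis intro!: F.smult_closed)
      finally show ?thesis ..
    qed
    finally show "simplex_boundary Z' (Suc n) (cone K Z Z' (Suc n) (free_basis R (simplices Z (Suc n)) \<tau>)) =
        enlarge Z Z' (Suc n) (free_basis R (simplices Z (Suc n)) \<tau>) \<oplus>\<^bsub>?M\<^esub>
        (\<ominus> \<one>) \<odot>\<^bsub>?M\<^esub> cone K Z Z' n (simplex_boundary Z n (free_basis R (simplices Z (Suc n)) \<tau>))"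
      using \<tau> \<tau>'
      by (simp add: enlarge_basis[OF ZZ'])
        (rule F.a_comm, auto intro!: F.smult_closed module_hom_closed[OF cone_hom])
  qed
  then show ?thesis
    using c by (simp add: a_minus_def F.smult_l_minus module_hom_closed[OF cone_hom])
qed

end

text \<open>Every nonempty simplex is a cone over its tail, taken in the part of \<open>Z\<close>
  above the least vertex \<open>K\<close>. Writing \<open>d\<close> for the boundary,
  \<open>d (K t) = t - K (d t)\<close>; applying \<open>d\<close> again leaves
  \<open>K (d (d t))\<close>, which vanishes by induction on the dimension.\<close>

lemma simplex_boundary_boundary:
  "c \<in> carrier (chain_module Z (Suc (Suc n))) \<Longrightarrow>
    simplex_boundary Z n (simplex_boundary Z (Suc n) c) = \<zero>\<^bsub>chain_module Z n\<^esub>"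
proof (induction n arbitrary: Z c rule: less_induct)
  case (less n)
  note IH = less.IH and c = less.prems
  interpret F: Module.module R "chain_module Z n" by (rule module_free_module)
  interpret F1: Module.module R "chain_module Z (Suc n)" by (rule module_free_module)
  show ?case
  proof (rule free_hom_eqI[where f="\<lambda>c. simplex_boundary Z n (simplex_boundary Z (Suc n) c)" and g="\<lambda>c. \<zero>\<^bsub>chain_module Z n\<^esub>",
        OF module_free_module module_hom_comp[OF simplex_boundary_hom simplex_boundary_hom]
          module_hom_const_zero[OF module_free_module] _ c])
    fix \<sigma> assume \<sigma>: "\<sigma> \<in> simplices Z (Suc (Suc n))"
    then obtain K \<tau> where K: "\<sigma> = K # \<tau>" by (cases \<sigma>) (auto simp: simplices_def)
    define Y where "Y = {L \<in> Z. K \<subset> L}"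
    have \<tau>: "\<tau> \<in> simplices Y (Suc n)" and KZ: "K \<in> Z"
      using \<sigma> unfolding K simplices_Cons Y_def by auto
    have YZ: "Y \<subseteq> Z" and KY: "\<forall>L\<in>Y. K \<subset> L" by (auto simp: Y_def)
    note cone = cone_hom[of Y K Z, OF KY KZ YZ] cone_basis[of Y K Z, OF KY KZ YZ]
      boundary_cone_0[of Y K Z, OF KY KZ YZ] boundary_cone_Suc[of Y K Z, OF KY KZ YZ]
    let ?t = "free_basis R (simplices Y (Suc n)) \<tau>"
    let ?y = "simplex_boundary Y n ?t"
    have t: "?t \<in> carrier (chain_module Y (Suc n))" using \<tau> by simp
    have y: "?y \<in> carrier (chain_module Y n)" using t by simp
    have cl: "enlarge Y Z n ?y \<in> carrier (chain_module Z n)"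
      "cone K Y Z n ?y \<in> carrier (chain_module Z (Suc n))"
      "enlarge Y Z (Suc n) ?t \<in> carrier (chain_module Z (Suc n))"
      using module_hom_closed[OF enlarge_hom[OF YZ] y] module_hom_closed[OF cone(1) y]
        module_hom_closed[OF enlarge_hom[OF YZ] t] by auto
    have "simplex_boundary Z n (simplex_boundary Z (Suc n) (free_basis R (simplices Z (Suc (Suc n))) \<sigma>)) =
      simplex_boundary Z n (enlarge Y Z (Suc n) ?t \<ominus>\<^bsub>chain_module Z (Suc n)\<^esub> cone K Y Z n ?y)"
      unfolding K using cone(2)[OF \<tau>] cone(4)[OF t] by simp
    also have "\<dots> = simplex_boundary Z n (enlarge Y Z (Suc n) ?t) \<ominus>\<^bsub>chain_module Z n\<^esub> simplex_boundary Z n (cone K Y Z n ?y)"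
      using cl by (intro module_hom_minus[OF module_free_module module_free_module simplex_boundary_hom]) auto
    also have "simplex_boundary Z n (enlarge Y Z (Suc n) ?t) = enlarge Y Z n ?y"
      by (rule simplex_boundary_enlarge[OF YZ t])
    also have "simplex_boundary Z n (cone K Y Z n ?y) = enlarge Y Z n ?y"
    proof (cases n)
      case 0
      then show ?thesis using cone(3) y by simp
    next
      case (Suc m)
      have "simplex_boundary Y m ?y = \<zero>\<^bsub>chain_module Y m\<^esub>"
        using IH[of m ?t Y] t Suc by simp
      moreover have "cone K Y Z m \<zero>\<^bsub>chain_module Y m\<^esub> = \<zero>\<^bsub>chain_module Z (Suc m)\<^esub>"
        by (rule module_hom_zero[OF module_free_module module_free_module cone(1)])
      ultimately have "simplex_boundary Z n (cone K Y Z n ?y) = enlarge Y Z n ?y \<ominus>\<^bsub>chain_module Z n\<^esub> \<zero>\<^bsub>chain_module Z n\<^esub>"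
        using cone(4)[of ?y m] y Suc by simp
      then show ?thesis using cl(1) F.minus_eq_zero_iff by (simp add: a_minus_def F.add.inv_one[folded a_inv_def])
    qed
    finally show "simplex_boundary Z n (simplex_boundary Z (Suc n) (free_basis R (simplices Z (Suc (Suc n))) \<sigma>)) =
        \<zero>\<^bsub>chain_module Z n\<^esub>"
      using cl(1) by (simp add: F.minus_eq_zero_iff)
  qed
qed

section \<open>Contraction of the chains of a poset with a least element\<close>

context
  fixes T :: "'g set" and Z :: "'g set set"
  assumes TZ: "T \<in> Z" and least: "\<forall>L\<in>Z. T \<subseteq> L"
begin

abbreviation "strictly_above \<equiv> {L \<in> Z. T \<subset> L}"

text \<open>The contraction onto the least element: put \<open>T\<close> in front unless it is there
  already. The test \<open>\<sigma> \<noteq> []\<close> guards against the unspecified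
  \<open>hd []\<close>.\<close>

definition contraction :: "nat \<Rightarrow> ('g set list \<Rightarrow> 'a) \<Rightarrow> 'g set list \<Rightarrow> 'a" where
  "contraction n = free_lift (simplices Z n) (chain_module Z (Suc n))
    (\<lambda>\<sigma>. if \<sigma> \<noteq> [] \<and> hd \<sigma> = T then \<zero>\<^bsub>chain_module Z (Suc n)\<^esub> else free_basis R (simplices Z (Suc n)) (T # \<sigma>))"

lemma YT: "\<forall>L\<in>strictly_above. T \<subset> L" and YZ: "strictly_above \<subseteq> Z"
  by auto

lemmas conT = cone_map[OF YT TZ YZ] cone_hom[OF YT TZ YZ] cone_basis[OF YT TZ YZ]
lemmas bconT = boundary_cone_0[OF YT TZ YZ] boundary_cone_Suc[OF YT TZ YZ]

text \<open>The head is the least vertex, so if it differs from \<open>T\<close>, all vertices lie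
  strictly above \<open>T\<close>.\<close>

lemma simplices_strictly_above:
  assumes "\<sigma> \<in> simplices Z n" "\<not> (\<sigma> \<noteq> [] \<and> hd \<sigma> = T)"
  shows "\<sigma> \<in> simplices strictly_above n"
proof (cases \<sigma>)
  case (Cons K \<tau>)
  then have "T \<subset> K" using assms least by (auto simp: simplices_def)
  then have "\<forall>L\<in>set \<sigma>. T \<subset> L" using assms(1) Cons by (auto simp: simplices_def)
  then show ?thesis using assms(1) by (auto simp: simplices_def)
qed (use assms in \<open>auto simp: simplices_def\<close>)

lemma contraction_gens:
  "(\<lambda>\<sigma>. if \<sigma> \<noteq> [] \<and> hd \<sigma> = T then \<zero>\<^bsub>chain_module Z (Suc n)\<^esub> else free_basis R (simplices Z (Suc n)) (T # \<sigma>))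
    \<in> simplices Z n \<rightarrow> carrier (chain_module Z (Suc n))"
proof -
  interpret F: Module.module R "chain_module Z (Suc n)" by (rule module_free_module)
  have "T # \<sigma> \<in> simplices Z (Suc n)" if "\<sigma> \<in> simplices Z n" "\<not> (\<sigma> \<noteq> [] \<and> hd \<sigma> = T)" for \<sigma>
    using conT(1) simplices_strictly_above[OF that] by blast
  then show ?thesis by (intro funcsetI) (simp split: if_split)
qed

lemma contraction_hom: "contraction n \<in> module_hom R (chain_module Z n) (chain_module Z (Suc n))"
  unfolding contraction_def by (rule free_lift_hom[OF module_free_module contraction_gens])

lemma contraction_basis:
  assumes "\<sigma> \<in> simplices Z n"
  shows "contraction n (free_basis R (simplices Z n) \<sigma>) =
    (if \<sigma> \<noteq> [] \<and> hd \<sigma> = T then \<zero>\<^bsub>chain_module Z (Suc n)\<^esub> else free_basis R (simplices Z (Suc n)) (T # \<sigma>))"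
  unfolding contraction_def by (rule free_lift_basis[OF module_free_module contraction_gens assms])

text \<open>With \<open>contraction_cone\<close> this turns the case distinction into two linear
  statements: the contraction is the cone on chains that avoid \<open>T\<close> and zero on
  cones.\<close>

lemma contraction_enlarge:
  assumes c: "c \<in> carrier (chain_module strictly_above n)"
  shows "contraction n (enlarge strictly_above Z n c) = cone T strictly_above Z n c"
proof (rule free_hom_eqI[where f="\<lambda>c. contraction n (enlarge strictly_above Z n c)",
      OF module_free_module module_hom_comp[OF enlarge_hom[OF YZ] contraction_hom] conT(2) _ c])
  fix \<tau> assume \<tau>: "\<tau> \<in> simplices strictly_above n"
  then have "\<not> (\<tau> \<noteq> [] \<and> hd \<tau> = T)" by (cases \<tau>) (auto simp: simplices_def)
  moreover have "\<tau> \<in> simplices Z n" using \<tau> simplices_mono[OF YZ] by blast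
  ultimately show "contraction n (enlarge strictly_above Z n (free_basis R (simplices strictly_above n) \<tau>)) =
    cone T strictly_above Z n (free_basis R (simplices strictly_above n) \<tau>)"
    using \<tau> by (auto simp: enlarge_basis[OF YZ] contraction_basis conT(3))
qed

lemma contraction_cone:
  assumes c: "c \<in> carrier (chain_module strictly_above n)"
  shows "contraction (Suc n) (cone T strictly_above Z n c) = \<zero>\<^bsub>chain_module Z (Suc (Suc n))\<^esub>"
proof (rule free_hom_eqI[where f="\<lambda>c. contraction (Suc n) (cone T strictly_above Z n c)" and g="\<lambda>c. \<zero>\<^bsub>chain_module Z (Suc (Suc n))\<^esub>",
      OF module_free_module module_hom_comp[OF conT(2) contraction_hom] module_hom_const_zero[OF module_free_module] _ c])
  fix \<tau> assume \<tau>: "\<tau> \<in> simplices strictly_above n"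
  have "T # \<tau> \<in> simplices Z (Suc n)" using conT(1) \<tau> by blast
  then show "contraction (Suc n) (cone T strictly_above Z n (free_basis R (simplices strictly_above n) \<tau>)) =
    \<zero>\<^bsub>chain_module Z (Suc (Suc n))\<^esub>"
    using \<tau> by (simp add: conT(3) contraction_basis)
qed

lemma boundary_contraction_0:
  assumes c: "c \<in> carrier (chain_module Z 0)"
  shows "simplex_boundary Z 0 (contraction 0 c) = c"
proof (rule free_hom_eqI[where f="\<lambda>c. simplex_boundary Z 0 (contraction 0 c)" and g="\<lambda>c. c",
      OF module_free_module module_hom_comp[OF contraction_hom simplex_boundary_hom] module_hom_id _ c])
  fix \<tau> assume \<tau>: "\<tau> \<in> simplices Z 0"
  then have \<tau>': "\<tau> \<in> simplices strictly_above 0" by (intro simplices_strictly_above) (auto simp: simplices_def)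
  let ?t = "free_basis R (simplices strictly_above 0) \<tau>"
  have e: "enlarge strictly_above Z 0 ?t = free_basis R (simplices Z 0) \<tau>" by (rule enlarge_basis[OF YZ \<tau>'])
  show "simplex_boundary Z 0 (contraction 0 (free_basis R (simplices Z 0) \<tau>)) = free_basis R (simplices Z 0) \<tau>"
    using bconT(1)[of ?t] contraction_enlarge[of ?t 0] \<tau>' by (simp add: e)
qed

text \<open>The homotopy formula. If the head is not \<open>T\<close>, the contraction is the cone
  and \<open>boundary_cone_Suc\<close> applies. If \<open>\<sigma> = T # \<tau>\<close>, the first
  summand vanishes, and of the boundary \<open>\<tau> - T (d \<tau>)\<close> only
  \<open>\<tau>\<close> survives the contraction, which sends it back to
  \<open>\<sigma>\<close>.\<close>

lemma boundary_contraction_Suc: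
  assumes c: "c \<in> carrier (chain_module Z (Suc n))"
  shows "simplex_boundary Z (Suc n) (contraction (Suc n) c) \<oplus>\<^bsub>chain_module Z (Suc n)\<^esub>
    contraction n (simplex_boundary Z n c) = c"
proof -
  interpret F: Module.module R "chain_module Z (Suc n)" by (rule module_free_module)
  interpret F2: Module.module R "chain_module Z (Suc (Suc n))" by (rule module_free_module)
  let ?M = "chain_module Z (Suc n)"
  show ?thesis
  proof (rule free_hom_eqI[where f="\<lambda>c. simplex_boundary Z (Suc n) (contraction (Suc n) c) \<oplus>\<^bsub>?M\<^esub> contraction n (simplex_boundary Z n c)" and g="\<lambda>c. c",
      OF module_free_module module_hom_sum[OF module_free_module module_free_module
          module_hom_comp[OF contraction_hom simplex_boundary_hom] module_hom_comp[OF simplex_boundary_hom contraction_hom]] module_hom_id _ c])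
    fix \<sigma> assume \<sigma>: "\<sigma> \<in> simplices Z (Suc n)"
    let ?s = "free_basis R (simplices Z (Suc n)) \<sigma>"
    show "simplex_boundary Z (Suc n) (contraction (Suc n) ?s) \<oplus>\<^bsub>?M\<^esub> contraction n (simplex_boundary Z n ?s) = ?s"
    proof (cases "\<sigma> \<noteq> [] \<and> hd \<sigma> = T")
      case False
      let ?t = "free_basis R (simplices strictly_above (Suc n)) \<sigma>"
      have \<sigma>': "\<sigma> \<in> simplices strictly_above (Suc n)" by (rule simplices_strictly_above[OF \<sigma> False])
      then have t: "?t \<in> carrier (chain_module strictly_above (Suc n))" by simp
      have e: "enlarge strictly_above Z (Suc n) ?t = ?s" by (rule enlarge_basis[OF YZ \<sigma>'])
      let ?x = "cone T strictly_above Z n (simplex_boundary strictly_above n ?t)"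
      have x: "?x \<in> carrier ?M" using t by (intro module_hom_closed[OF conT(2)]) simp
      have "simplex_boundary Z (Suc n) (contraction (Suc n) ?s) = ?s \<ominus>\<^bsub>?M\<^esub> ?x"
        using contraction_enlarge[OF t] bconT(2)[OF t] by (simp add: e)
      moreover have "contraction n (simplex_boundary Z n ?s) = ?x"
        using simplex_boundary_enlarge[OF YZ t] contraction_enlarge[of "simplex_boundary strictly_above n ?t" n] t by (simp add: e)
      ultimately show ?thesis using x \<sigma> by (simp add: a_minus_def F.a_assoc F.l_neg)
    next
      case True
      then obtain \<tau> where \<tau>: "\<sigma> = T # \<tau>" by (cases \<sigma>) auto
      then have \<tau>': "\<tau> \<in> simplices strictly_above n" using \<sigma> by (simp add: simplices_Cons)
      let ?t = "free_basis R (simplices strictly_above n) \<tau>"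
      have t: "?t \<in> carrier (chain_module strictly_above n)" using \<tau>' by simp
      have s: "?s = cone T strictly_above Z n ?t" using conT(3)[OF \<tau>'] \<tau> by simp
      have 0: "simplex_boundary Z (Suc n) (contraction (Suc n) ?s) = \<zero>\<^bsub>?M\<^esub>"
        using contraction_cone[OF t] module_hom_zero[OF module_free_module module_free_module simplex_boundary_hom, of Z "Suc n"]
        unfolding s by simp
      have "contraction n (simplex_boundary Z n ?s) = ?s"
      proof (cases n)
        case 0
        then show ?thesis using bconT(1)[of ?t] contraction_enlarge[of ?t 0] t s by simp
      next
        case (Suc m)
        let ?y = "simplex_boundary strictly_above m ?t"
        have y: "?y \<in> carrier (chain_module strictly_above m)" using t Suc by simp
        have "contraction n (simplex_boundary Z n ?s) =
          contraction n (enlarge strictly_above Z n ?t \<ominus>\<^bsub>chain_module Z n\<^esub> cone T strictly_above Z m ?y)"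
          unfolding s using bconT(2)[of ?t m] t Suc by simp
        also have "\<dots> = contraction n (enlarge strictly_above Z n ?t) \<ominus>\<^bsub>?M\<^esub> contraction n (cone T strictly_above Z m ?y)"
          using module_hom_closed[OF enlarge_hom[OF YZ] t] module_hom_closed[OF conT(2) y] Suc
          by (intro module_hom_minus[OF module_free_module module_free_module contraction_hom]) auto
        also have "\<dots> = ?s \<ominus>\<^bsub>?M\<^esub> \<zero>\<^bsub>?M\<^esub>"
          using contraction_enlarge[OF t] contraction_cone[OF y] Suc s by simp
        also have "\<dots> = ?s" using \<sigma> by (simp add: a_minus_def F.add.inv_one[folded a_inv_def])
        finally show ?thesis .
      qed
      then show ?thesis using 0 \<sigma> by simp
    qed
  qed
qed

lemma simplex_boundary_exact:
  assumes c: "c \<in> carrier (chain_module Z (Suc n))" and "simplex_boundary Z n c = \<zero>\<^bsub>chain_module Z n\<^esub>"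
  shows "\<exists>b\<in>carrier (chain_module Z (Suc (Suc n))). simplex_boundary Z (Suc n) b = c"
proof -
  interpret F: Module.module R "chain_module Z (Suc n)" by (rule module_free_module)
  have b: "contraction (Suc n) c \<in> carrier (chain_module Z (Suc (Suc n)))" by (rule module_hom_closed[OF contraction_hom c])
  have "contraction n (simplex_boundary Z n c) = \<zero>\<^bsub>chain_module Z (Suc n)\<^esub>"
    unfolding assms(2) by (rule module_hom_zero[OF module_free_module module_free_module contraction_hom])
  then have "simplex_boundary Z (Suc n) (contraction (Suc n) c) = c"
    using boundary_contraction_Suc[OF c] b by simp
  then show ?thesis using b by blast
qed

end

end

section \<open>Exactness from fibrewise exactness\<close>

context cring
begin

text \<open>The filtration argument in abstract form. By \<open>tri\<close> the map \<open>D\<close>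
  never lowers the level, and at equal level it keeps the head; \<open>fib\<close> solves
  \<open>D y = z\<close> on one fibre of lowest level. Subtracting such a solution empties that
  fibre and otherwise disturbs only larger levels, so the number of heads of level \<open>l\<close>
  drops; once none is left, \<open>l\<close> can be increased. The set \<open>Z\<close> of
  right-hand sides will be everything in degree 0 and the cycles in positive degree.\<close>

lemma exact_of_fibres:
  fixes hd1 :: "'s \<Rightarrow> 'h" and hd0 :: "'t \<Rightarrow> 'h" and lev :: "'h \<Rightarrow> nat"
  assumes D: "D \<in> module_hom R (free_module R S1) (free_module R S0)"
    and levN: "\<And>t. t \<in> S0 \<Longrightarrow> lev (hd0 t) \<le> N"
    and ZC: "Z \<subseteq> carrier (free_module R S0)"
    and Zim: "\<And>y. y \<in> carrier (free_module R S1) \<Longrightarrow> D y \<in> Z"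
    and Zminus: "\<And>z z'. z \<in> Z \<Longrightarrow> z' \<in> Z \<Longrightarrow> z \<ominus>\<^bsub>free_module R S0\<^esub> z' \<in> Z"
    and tri: "\<And>y k t. y \<in> carrier (free_module R S1) \<Longrightarrow> (\<And>s. s \<in> S1 \<Longrightarrow> y s \<noteq> \<zero> \<Longrightarrow> hd1 s = k) \<Longrightarrow>
      t \<in> S0 \<Longrightarrow> D y t \<noteq> \<zero> \<Longrightarrow> hd0 t = k \<or> lev k < lev (hd0 t)"
    and fib: "\<And>z k. z \<in> Z \<Longrightarrow> k \<in> hd0 ` S0 \<Longrightarrow> (\<And>t. t \<in> S0 \<Longrightarrow> z t \<noteq> \<zero> \<Longrightarrow> lev k \<le> lev (hd0 t)) \<Longrightarrow>
      \<exists>y\<in>carrier (free_module R S1). (\<forall>s\<in>S1. y s \<noteq> \<zero> \<longrightarrow> hd1 s = k) \<and> (\<forall>t\<in>S0. hd0 t = k \<longrightarrow> D y t = z t)"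
    and z: "z \<in> Z" and zl: "\<And>t. t \<in> S0 \<Longrightarrow> z t \<noteq> \<zero> \<Longrightarrow> l \<le> lev (hd0 t)"
  shows "\<exists>y\<in>carrier (free_module R S1). D y = z \<and> (\<forall>s\<in>S1. y s \<noteq> \<zero> \<longrightarrow> l \<le> lev (hd1 s))"
proof -
  interpret F1: Module.module R "free_module R S1" by (rule module_free_module)
  interpret F0: Module.module R "free_module R S0" by (rule module_free_module)
  note Zc = subsetD[OF ZC]
  have "\<exists>y\<in>carrier (free_module R S1). D y = z \<and> (\<forall>s\<in>S1. y s \<noteq> \<zero> \<longrightarrow> l \<le> lev (hd1 s))"
    if "d = Suc N - l" "z \<in> Z" "\<And>t. t \<in> S0 \<Longrightarrow> z t \<noteq> \<zero> \<Longrightarrow> l \<le> lev (hd0 t)" for d l z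
    using that
  proof (induction d arbitrary: l z)
    \<comment> \<open>The subtraction is truncated, so here \<open>l\<close> exceeds
      \<open>N\<close>. No generator has so large a level, and \<open>z\<close> must vanish.\<close>
    case 0
    have "z t = \<zero>" if "t \<in> S0" for t
      using 0 levN[OF that] that by (metis Suc_n_not_le_n diff_is_0_eq dual_order.trans)
    then have "z = \<zero>\<^bsub>free_module R S0\<^esub>"
      using Zc[OF 0(2)] by (intro free_module_eqI) auto
    then have "D \<zero>\<^bsub>free_module R S1\<^esub> = z"
      using module_hom_zero[OF module_free_module module_free_module D] by simp
    then show ?case by (intro bexI[of _ "\<zero>\<^bsub>free_module R S1\<^esub>"]) auto
  next
    case (Suc d)
    note outer = Suc.IH and d = Suc.prems(1)
    \<comment> \<open>The measure of the inner induction, finite because \<open>z\<close> has finite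
      support.\<close>
    let ?heads = "\<lambda>z. {hd0 t |t. t \<in> S0 \<and> z t \<noteq> \<zero> \<and> lev (hd0 t) = l}"
    have fin: "finite (?heads z)" if "z \<in> Z" for z
    proof (rule finite_subset)
      show "?heads z \<subseteq> hd0 ` {t \<in> S0. z t \<noteq> \<zero>}" by auto
      show "finite (hd0 ` {t \<in> S0. z t \<noteq> \<zero>})" using free_module_finite[OF Zc[OF that]] by simp
    qed
    have "\<exists>y\<in>carrier (free_module R S1). D y = z \<and> (\<forall>s\<in>S1. y s \<noteq> \<zero> \<longrightarrow> l \<le> lev (hd1 s))"
      if "card (?heads z) = c" "z \<in> Z" "\<And>t. t \<in> S0 \<Longrightarrow> z t \<noteq> \<zero> \<Longrightarrow> l \<le> lev (hd0 t)" for c z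
      using that
    proof (induction c arbitrary: z rule: less_induct)
      case (less c)
      show ?case
      proof (cases "?heads z = {}")
        case True
        have "Suc l \<le> lev (hd0 t)" if "t \<in> S0" "z t \<noteq> \<zero>" for t
        proof -
          have "l \<noteq> lev (hd0 t)" using True that by blast
          then show ?thesis using less.prems(3)[OF that] by simp
        qed
        then have "\<exists>y\<in>carrier (free_module R S1). D y = z \<and> (\<forall>s\<in>S1. y s \<noteq> \<zero> \<longrightarrow> Suc l \<le> lev (hd1 s))"
          using d less.prems(2) by (intro outer) auto
        then show ?thesis using Suc_leD by blast
      next
        case False
        then obtain k where k: "k \<in> ?heads z" by blast
        then have lk: "lev k = l" "k \<in> hd0 ` S0" by auto
        obtain y0 where y0: "y0 \<in> carrier (free_module R S1)" "\<And>s. s \<in> S1 \<Longrightarrow> y0 s \<noteq> \<zero> \<Longrightarrow> hd1 s = k"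
          "\<And>t. t \<in> S0 \<Longrightarrow> hd0 t = k \<Longrightarrow> D y0 t = z t"
          using fib[OF less.prems(2) lk(2)] less.prems(3) lk(1) by blast
        \<comment> \<open>The fibre of \<open>k\<close> is cancelled, and by \<open>tri\<close> no
          other coefficient of level \<open>l\<close> changes.\<close>
        let ?z = "z \<ominus>\<^bsub>free_module R S0\<^esub> D y0"
        have z': "?z \<in> Z" by (intro Zminus less.prems Zim y0)
        have c: "z \<in> carrier (free_module R S0)" "D y0 \<in> carrier (free_module R S0)"
          using Zc less.prems(2) Zim[OF y0(1)] by auto
        have zt: "?z t = z t \<ominus> D y0 t" if "t \<in> S0" for t using that c by simp
        have zero: "?z t = z t" if "t \<in> S0" "D y0 t = \<zero>" for t
          using zt[OF that(1)] that c by (simp add: a_minus_def)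
        have heads: "hd0 t \<in> ?heads z - {k}" if t: "t \<in> S0" "?z t \<noteq> \<zero>" "lev (hd0 t) = l" for t
        proof -
          have nk: "hd0 t \<noteq> k"
          proof
            assume "hd0 t = k"
            then have "?z t = \<zero>" using zt[OF t(1)] y0(3)[OF t(1)] t(1) c by (simp add: minus_eq_zero_iff)
            with t(2) show False by simp
          qed
          have "D y0 t = \<zero>"
          proof (rule ccontr)
            assume "D y0 t \<noteq> \<zero>"
            then have "hd0 t = k \<or> lev k < lev (hd0 t)"
              using tri[OF y0(1,2) t(1)] by blast
            then show False using nk lk t(3) by simp
          qed
          then show ?thesis using zero[OF t(1)] t nk by auto
        qed
        have "?heads ?z \<subseteq> ?heads z - {k}"
        proof
          fix h assume "h \<in> ?heads ?z"
          then obtain t where "h = hd0 t" "t \<in> S0" "?z t \<noteq> \<zero>" "lev (hd0 t) = l" by blast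
          then show "h \<in> ?heads z - {k}" using heads by simp
        qed
        then have "?heads ?z \<subset> ?heads z" using k by blast
        then have "card (?heads ?z) < card (?heads z)"
          by (rule psubset_card_mono[OF fin[OF less.prems(2)]])
        moreover have "l \<le> lev (hd0 t)" if t: "t \<in> S0" "?z t \<noteq> \<zero>" for t
        proof (cases "D y0 t = \<zero>")
          case True
          then show ?thesis using zero[OF t(1)] t less.prems(3)[OF t(1)] by simp
        next
          case False
          then have "hd0 t = k \<or> lev k < lev (hd0 t)" using tri[OF y0(1,2) t(1)] by blast
          then show ?thesis using lk by auto
        qed
        ultimately obtain y where y: "y \<in> carrier (free_module R S1)" "D y = ?z"
          "\<And>s. s \<in> S1 \<Longrightarrow> y s \<noteq> \<zero> \<Longrightarrow> l \<le> lev (hd1 s)"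
          using less.IH[of "card (?heads ?z)" ?z] less.prems(1) z' by blast
        have "D (y \<oplus>\<^bsub>free_module R S1\<^esub> y0) = ?z \<oplus>\<^bsub>free_module R S0\<^esub> D y0"
          using y y0 by (simp add: module_hom_add[OF D])
        also have "\<dots> = z" using c by (simp add: a_minus_def F0.a_assoc F0.l_neg)
        finally have "D (y \<oplus>\<^bsub>free_module R S1\<^esub> y0) = z" .
        moreover have "l \<le> lev (hd1 s)" if s: "s \<in> S1" "(y \<oplus>\<^bsub>free_module R S1\<^esub> y0) s \<noteq> \<zero>" for s
        proof (cases "y s = \<zero>")
          case True
          then have "y0 s \<noteq> \<zero>" using s by auto
          then show ?thesis using y0(2)[OF s(1)] lk by simp
        qed (use y(3) s in simp)
        ultimately show ?thesis using y y0 by (intro bexI[of _ "y \<oplus>\<^bsub>free_module R S1\<^esub> y0"]) auto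
      qed
    qed
    then show ?case using Suc.prems(2,3) by blast
  qed
  then show ?thesis using z zl by blast
qed

end

section \<open>Contramodules of finitely supported functions\<close>

lemma contramodule_module: "is_contramodule R G \<H> M \<Longrightarrow> X \<in> transitive_gsets G \<H> \<Longrightarrow> Module.module R (cval M X)"
  and contramodule_cmap_hom: "is_contramodule R G \<H> M \<Longrightarrow> X \<in> transitive_gsets G \<H> \<Longrightarrow> Y \<in> transitive_gsets G \<H> \<Longrightarrow>
    f \<in> gset_maps G X Y \<Longrightarrow> cmap M X Y f \<in> module_hom R (cval M Y) (cval M X)"
  and contramodule_id: "is_contramodule R G \<H> M \<Longrightarrow> X \<in> transitive_gsets G \<H> \<Longrightarrow> m \<in> carrier (cval M X) \<Longrightarrow>
    cmap M X X (\<lambda>x \<in> fst X. x) m = m"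
  and contramodule_comp: "is_contramodule R G \<H> M \<Longrightarrow> X \<in> transitive_gsets G \<H> \<Longrightarrow> Y \<in> transitive_gsets G \<H> \<Longrightarrow>
    Z \<in> transitive_gsets G \<H> \<Longrightarrow> f \<in> gset_maps G X Y \<Longrightarrow> g \<in> gset_maps G Y Z \<Longrightarrow> m \<in> carrier (cval M Z) \<Longrightarrow>
    cmap M X Z (compose (fst X) g f) m = cmap M X Y f (cmap M Y Z g m)"
  unfolding is_contramodule_def by blast+

lemma contramodule_homs_hom: "\<eta> \<in> contramodule_homs R G \<H> M N \<Longrightarrow> X \<in> transitive_gsets G \<H> \<Longrightarrow>
    \<eta> X \<in> module_hom R (cval M X) (cval N X)"
  and contramodule_homs_natural: "\<eta> \<in> contramodule_homs R G \<H> M N \<Longrightarrow> X \<in> transitive_gsets G \<H> \<Longrightarrow>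
    Y \<in> transitive_gsets G \<H> \<Longrightarrow> f \<in> gset_maps G X Y \<Longrightarrow> m \<in> carrier (cval M Y) \<Longrightarrow>
    \<eta> X (cmap M X Y f m) = cmap N X Y f (\<eta> Y m)"
  unfolding contramodule_homs_def by blast+

text \<open>The linearization of the presheaf of sets given by \<open>S\<close> on objects and
  \<open>p\<close> on maps.\<close>

definition linear_contramodule ::
  "('r, 'k) ring_scheme \<Rightarrow> ('g gset \<Rightarrow> 's set) \<Rightarrow> ('g gset \<Rightarrow> ('g set \<Rightarrow> 'g set) \<Rightarrow> 's \<Rightarrow> 's) \<Rightarrow> ('g, 'r, 's \<Rightarrow> 'r) contramodule" where
  "linear_contramodule R S p = \<lparr>cval = (\<lambda>X. free_module R (S X)), cmap = (\<lambda>X Y f. free_map R (S Y) (S X) (p X f))\<rparr>"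

locale bredon = cring R + G: subgroup_family G \<H>
  for R :: "('r, 'k) ring_scheme" (structure) and G :: "('g, 'l) monoid_scheme" and \<H>
begin

abbreviation "pullback X f h \<equiv> compose (fst X) h f"

lemma pullback_id:
  assumes "h \<in> extensional (fst X)"
  shows "pullback X (\<lambda>x\<in>fst X. x) h = h"
  using assms by (auto simp: compose_def extensional_def fun_eq_iff)

lemma pullback_comp:
  assumes "f \<in> gset_maps G X Y"
  shows "pullback X (pullback X f g) h = pullback X f (pullback Y g h)"
  using G.gset_maps_closed[OF assms] by (auto simp: compose_def)

lemma linear_contramodule_is_contramodule:
  fixes S :: "'g gset \<Rightarrow> 's set"
  assumes map: "\<And>X Y f s. X \<in> G.TG \<Longrightarrow> Y \<in> G.TG \<Longrightarrow> f \<in> gset_maps G X Y \<Longrightarrow> s \<in> S Y \<Longrightarrow> p X f s \<in> S X"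
    and id: "\<And>X s. X \<in> G.TG \<Longrightarrow> s \<in> S X \<Longrightarrow> p X (\<lambda>x\<in>fst X. x) s = s"
    and comp: "\<And>X Y Z f g s. X \<in> G.TG \<Longrightarrow> Y \<in> G.TG \<Longrightarrow> Z \<in> G.TG \<Longrightarrow> f \<in> gset_maps G X Y \<Longrightarrow>
      g \<in> gset_maps G Y Z \<Longrightarrow> s \<in> S Z \<Longrightarrow> p X (compose (fst X) g f) s = p X f (p Y g s)"
  shows "is_contramodule R G \<H> (linear_contramodule R S p)"
proof -
  have m: "p X f \<in> S Y \<rightarrow> S X" if "X \<in> G.TG" "Y \<in> G.TG" "f \<in> gset_maps G X Y" for X Y f
    using map[OF that] by blast
  show ?thesis
    unfolding is_contramodule_def
  proof (intro conjI ballI)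
    fix X Y Z f g and c :: "'s \<Rightarrow> 'r"
    assume X: "X \<in> G.TG" and Y: "Y \<in> G.TG" and Z: "Z \<in> G.TG" and f: "f \<in> gset_maps G X Y"
      and g: "g \<in> gset_maps G Y Z" and "c \<in> carrier (cval (linear_contramodule R S p) Z)"
    then have c: "c \<in> carrier (free_module R (S Z))" by (simp add: linear_contramodule_def)
    have "free_map R (S Y) (S X) (p X f) (free_map R (S Z) (S Y) (p Y g) c) =
      free_map R (S Z) (S X) (\<lambda>s. p X f (p Y g s)) c"
      by (rule free_map_comp[OF m[OF Y Z g] m[OF X Y f] c])
    also have "\<dots> = free_map R (S Z) (S X) (p X (compose (fst X) g f)) c"
      by (rule free_map_cong) (simp add: comp[OF X Y Z f g])
    finally show "cmap (linear_contramodule R S p) X Z (compose (fst X) g f) c =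
      cmap (linear_contramodule R S p) X Y f (cmap (linear_contramodule R S p) Y Z g c)"
      by (simp add: linear_contramodule_def)
  qed (simp_all add: linear_contramodule_def module_free_module m id free_map_hom free_map_id)
qed

text \<open>The free contramodule on generators indexed by pairs \<open>(H, b)\<close>, the one indexed by \<open>(H, b)\<close> having
  its generator in the value at \<open>G/H\<close>.\<close>

definition free_gens :: "'g set set \<Rightarrow> ('g set \<Rightarrow> 'p set) \<Rightarrow> 'g gset \<Rightarrow> ('g set \<times> ('g set \<Rightarrow> 'g set) \<times> 'p) set" where
  "free_gens I B X = {(H, h, b). H \<in> I \<and> h \<in> G.cmaps X H \<and> b \<in> B H}"

definition free_pull :: "'g gset \<Rightarrow> ('g set \<Rightarrow> 'g set) \<Rightarrow> 'g set \<times> ('g set \<Rightarrow> 'g set) \<times> 'p \<Rightarrow>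
    'g set \<times> ('g set \<Rightarrow> 'g set) \<times> 'p" where
  "free_pull X f = (\<lambda>(H, h, b). (H, pullback X f h, b))"

lemma free_gens_iff: "(H, h, b) \<in> free_gens I B X \<longleftrightarrow> H \<in> I \<and> h \<in> G.cmaps X H \<and> b \<in> B H"
  by (simp add: free_gens_def)

text \<open>The universal element of the Yoneda lemma: every \<open>h : X -> G/H\<close> is its
  pullback along \<open>h\<close> (\<open>pullback_id_map\<close>).\<close>

definition id_map :: "'g set \<Rightarrow> 'g set \<Rightarrow> 'g set" where
  "id_map H = (\<lambda>C\<in>lcosets\<^bsub>G\<^esub> H. C)"

lemma id_map_cmaps: "H \<in> \<H> \<Longrightarrow> id_map H \<in> G.cmaps (coset_gset G H) H"
  using G.gset_maps_id[OF G.coset_gset_transitive] by (simp add: id_map_def G.coset_gset_simps)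

lemma pullback_id_map: "h \<in> G.cmaps X H \<Longrightarrow> pullback X h (id_map H) = h"
  using G.cmaps_lcosets[of h X H] G.gset_maps_ext[of h X]
  by (auto simp: compose_def id_map_def extensional_def fun_eq_iff)

text \<open>The Yoneda extension: the universal generator for \<open>(H, b)\<close> goes to
  \<open>m H b\<close>, and naturality dictates the rest.\<close>

definition free_extend :: "'g set set \<Rightarrow> ('g set \<Rightarrow> 'p set) \<Rightarrow> ('g, 'r, 'm) contramodule \<Rightarrow>
    ('g set \<Rightarrow> 'p \<Rightarrow> 'm) \<Rightarrow> 'g gset \<Rightarrow> ('g set \<times> ('g set \<Rightarrow> 'g set) \<times> 'p \<Rightarrow> 'r) \<Rightarrow> 'm" where
  "free_extend I B M m X = free_lift (free_gens I B X) (cval M X)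
     (\<lambda>(H, h, b). cmap M X (coset_gset G H) h (m H b))"

context
  fixes I :: "'g set set" and B :: "'g set \<Rightarrow> 'p set"
  assumes I: "I \<subseteq> \<H>"
begin

lemma free_pull_closed: "X \<in> G.TG \<Longrightarrow> f \<in> gset_maps G X Y \<Longrightarrow> s \<in> free_gens I B Y \<Longrightarrow>
    free_pull X f s \<in> free_gens I B X"
  by (auto simp: free_gens_def free_pull_def intro: G.gset_maps_compose)

lemma free_contramodule_is_contramodule:
  "is_contramodule R G \<H> (linear_contramodule R (free_gens I B) free_pull)"
  by (rule linear_contramodule_is_contramodule)
     (auto simp: free_pull_closed free_pull_def free_gens_def pullback_comp intro!: pullback_id G.gset_maps_ext G.gset_maps_compose)

context
  fixes M :: "('g, 'r, 'm) contramodule" and m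
  assumes M: "is_contramodule R G \<H> M"
    and m: "\<And>H b. H \<in> I \<Longrightarrow> b \<in> B H \<Longrightarrow> m H b \<in> carrier (cval M (coset_gset G H))"
begin

lemma free_extend_gens:
  assumes X: "X \<in> G.TG"
  shows "(\<lambda>(H, h, b). cmap M X (coset_gset G H) h (m H b)) \<in> free_gens I B X \<rightarrow> carrier (cval M X)"
proof (rule funcsetI)
  fix s assume "s \<in> free_gens I B X"
  then obtain H h b where s: "s = (H, h, b)" "H \<in> I" "h \<in> G.cmaps X H" "b \<in> B H" by (auto simp: free_gens_def)
  then have "H \<in> \<H>" using I by blast
  then show "(case s of (H, h, b) \<Rightarrow> cmap M X (coset_gset G H) h (m H b)) \<in> carrier (cval M X)"
    using s module_hom_closed[OF contramodule_cmap_hom[OF M X G.coset_gset_transitive s(3)] m] by simp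
qed

lemma free_extend_hom:
  "X \<in> G.TG \<Longrightarrow> free_extend I B M m X \<in> module_hom R (free_module R (free_gens I B X)) (cval M X)"
  unfolding free_extend_def by (rule free_lift_hom[OF contramodule_module[OF M] free_extend_gens])

lemma free_extend_basis:
  assumes X: "X \<in> G.TG" and s: "(H, h, b) \<in> free_gens I B X"
  shows "free_extend I B M m X (free_basis R (free_gens I B X) (H, h, b)) = cmap M X (coset_gset G H) h (m H b)"
  unfolding free_extend_def
  using free_lift_basis[OF contramodule_module[OF M X] free_extend_gens[OF X] s] by simp

lemma free_extend_natural:
  assumes X: "X \<in> G.TG" and Y: "Y \<in> G.TG" and f: "f \<in> gset_maps G X Y"
    and c: "c \<in> carrier (free_module R (free_gens I B Y))"
  shows "free_extend I B M m X (free_map R (free_gens I B Y) (free_gens I B X) (free_pull X f) c) =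
    cmap M X Y f (free_extend I B M m Y c)"
proof -
  have map: "free_pull X f \<in> free_gens I B Y \<rightarrow> free_gens I B X" using free_pull_closed[OF X f] by blast
  show ?thesis
  proof (rule free_hom_eqI[where f="\<lambda>c. free_extend I B M m X (free_map R (free_gens I B Y) (free_gens I B X) (free_pull X f) c)"
        and g="\<lambda>c. cmap M X Y f (free_extend I B M m Y c)",
        OF contramodule_module[OF M X] module_hom_comp[OF free_map_hom[OF map] free_extend_hom[OF X]]
          module_hom_comp[OF free_extend_hom[OF Y] contramodule_cmap_hom[OF M X Y f]] _ c])
    fix s assume s: "s \<in> free_gens I B Y"
    then obtain H h b where e: "s = (H, h, b)" "H \<in> I" "h \<in> G.cmaps Y H" "b \<in> B H" by (auto simp: free_gens_def)
    have H: "H \<in> \<H>" using e I by blast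
    have "free_pull X f s \<in> free_gens I B X" by (rule free_pull_closed[OF X f s])
    then show "free_extend I B M m X (free_map R (free_gens I B Y) (free_gens I B X) (free_pull X f) (free_basis R (free_gens I B Y) s)) =
      cmap M X Y f (free_extend I B M m Y (free_basis R (free_gens I B Y) s))"
      using s e contramodule_comp[OF M X Y G.coset_gset_transitive[OF H] f e(3) m[OF e(2,4)]] map
      by (simp add: free_extend_basis[OF X] free_extend_basis[OF Y] free_pull_def)
  qed
qed

lemma free_extend_homs:
  "free_extend I B M m \<in> contramodule_homs R G \<H> (linear_contramodule R (free_gens I B) free_pull) M"
  by (auto simp: contramodule_homs_def linear_contramodule_def free_extend_hom free_extend_natural)

end

text \<open>The uniqueness half of Yoneda: each basis element \<open>(H, h, b)\<close> is the
  pullback of \<open>(H, id_map H, b)\<close> along \<open>h\<close>.\<close>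

lemma free_contramodule_hom_eqI:
  assumes M: "is_contramodule R G \<H> M"
    and \<eta>: "\<eta> \<in> contramodule_homs R G \<H> (linear_contramodule R (free_gens I B) free_pull) M"
    and \<eta>': "\<eta>' \<in> contramodule_homs R G \<H> (linear_contramodule R (free_gens I B) free_pull) M"
    and eq: "\<And>H b. H \<in> I \<Longrightarrow> b \<in> B H \<Longrightarrow>
      \<eta> (coset_gset G H) (free_basis R (free_gens I B (coset_gset G H)) (H, id_map H, b)) =
      \<eta>' (coset_gset G H) (free_basis R (free_gens I B (coset_gset G H)) (H, id_map H, b))"
    and X: "X \<in> G.TG" and c: "c \<in> carrier (free_module R (free_gens I B X))"
  shows "\<eta> X c = \<eta>' X c"
proof (rule free_hom_eqI[OF contramodule_module[OF M X] _ _ _ c])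
  show "\<eta> X \<in> module_hom R (free_module R (free_gens I B X)) (cval M X)"
    "\<eta>' X \<in> module_hom R (free_module R (free_gens I B X)) (cval M X)"
    using contramodule_homs_hom[OF \<eta> X] contramodule_homs_hom[OF \<eta>' X] by (simp_all add: linear_contramodule_def)
  fix s assume s: "s \<in> free_gens I B X"
  then obtain H h b where e: "s = (H, h, b)" "H \<in> I" "h \<in> G.cmaps X H" "b \<in> B H" by (auto simp: free_gens_def)
  have H: "H \<in> \<H>" using e I by blast
  let ?Y = "coset_gset G H"
  have Y: "?Y \<in> G.TG" by (rule G.coset_gset_transitive[OF H])
  have y: "(H, id_map H, b) \<in> free_gens I B ?Y" using e id_map_cmaps[OF H] by (simp add: free_gens_iff)
  have map: "free_pull X h \<in> free_gens I B ?Y \<rightarrow> free_gens I B X" using free_pull_closed[OF X e(3)] by blast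
  have "free_basis R (free_gens I B X) s =
      cmap (linear_contramodule R (free_gens I B) free_pull) X ?Y h (free_basis R (free_gens I B ?Y) (H, id_map H, b))"
    using free_map_basis[OF map y] e by (simp add: linear_contramodule_def free_pull_def pullback_id_map)
  then show "\<eta> X (free_basis R (free_gens I B X) s) = \<eta>' X (free_basis R (free_gens I B X) s)"
    using contramodule_homs_natural[OF \<eta> X Y e(3)] contramodule_homs_natural[OF \<eta>' X Y e(3)] eq[OF e(2,4)] y
    by (simp add: linear_contramodule_def)
qed

text \<open>An epimorphism is onto at \<open>G/H\<close>, so the images of the universal generators
  can be lifted there, and any choice of lifts extends to a map out of the free
  contramodule.\<close>

lemma free_contramodule_projective:
  "is_projective_contramodule TYPE('m) R G \<H> (linear_contramodule R (free_gens I B) free_pull)"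
  (is "is_projective_contramodule _ R G \<H> ?P")
  unfolding is_projective_contramodule_def
proof (intro conjI allI impI free_contramodule_is_contramodule)
  fix M N :: "('g, 'r, 'm) contramodule" and \<epsilon> \<phi>
  assume M: "is_contramodule R G \<H> M" and N: "is_contramodule R G \<H> N"
    and \<epsilon>: "\<epsilon> \<in> contramodule_epis R G \<H> M N" and \<phi>: "\<phi> \<in> contramodule_homs R G \<H> ?P N"
  from \<epsilon> have \<epsilon>h: "\<epsilon> \<in> contramodule_homs R G \<H> M N"
    and \<epsilon>s: "\<And>X. X \<in> G.TG \<Longrightarrow> \<epsilon> X ` carrier (cval M X) = carrier (cval N X)"
    by (auto simp: contramodule_epis_def)
  let ?y = "\<lambda>H b. \<phi> (coset_gset G H) (free_basis R (free_gens I B (coset_gset G H)) (H, id_map H, b))"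
  have "\<exists>m. m \<in> carrier (cval M (coset_gset G H)) \<and> \<epsilon> (coset_gset G H) m = ?y H b"
    if "H \<in> I" "b \<in> B H" for H b
  proof -
    have H: "H \<in> \<H>" using that I by blast
    have "(H, id_map H, b) \<in> free_gens I B (coset_gset G H)" using that id_map_cmaps[OF H] by (simp add: free_gens_iff)
    then have "?y H b \<in> carrier (cval N (coset_gset G H))"
      using module_hom_closed[OF contramodule_homs_hom[OF \<phi> G.coset_gset_transitive[OF H]]]
      by (simp add: linear_contramodule_def)
    then have "?y H b \<in> \<epsilon> (coset_gset G H) ` carrier (cval M (coset_gset G H))"
      using \<epsilon>s[OF G.coset_gset_transitive[OF H]] by simp
    then show ?thesis by (auto simp: image_iff)
  qed
  then obtain m where m: "\<And>H b. H \<in> I \<Longrightarrow> b \<in> B H \<Longrightarrow> m H b \<in> carrier (cval M (coset_gset G H))"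
    and \<epsilon>m: "\<And>H b. H \<in> I \<Longrightarrow> b \<in> B H \<Longrightarrow> \<epsilon> (coset_gset G H) (m H b) = ?y H b"
    by metis
  let ?\<psi> = "free_extend I B M m"
  have \<psi>: "?\<psi> \<in> contramodule_homs R G \<H> ?P M" by (rule free_extend_homs[OF M m])
  have comp: "(\<lambda>X x. \<epsilon> X (?\<psi> X x)) \<in> contramodule_homs R G \<H> ?P N"
    unfolding contramodule_homs_def
  proof (intro CollectI conjI ballI)
    fix X assume X: "X \<in> G.TG"
    show "(\<lambda>x. \<epsilon> X (?\<psi> X x)) \<in> module_hom R (cval ?P X) (cval N X)"
      by (rule module_hom_comp[OF contramodule_homs_hom[OF \<psi> X] contramodule_homs_hom[OF \<epsilon>h X]])
    fix Y f c assume Y: "Y \<in> G.TG" and f: "f \<in> gset_maps G X Y" and c: "c \<in> carrier (cval ?P Y)"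
    show "\<epsilon> X (?\<psi> X (cmap ?P X Y f c)) = cmap N X Y f (\<epsilon> Y (?\<psi> Y c))"
      using module_hom_closed[OF contramodule_homs_hom[OF \<psi> Y] c]
      by (simp add: contramodule_homs_natural[OF \<psi> X Y f c] contramodule_homs_natural[OF \<epsilon>h X Y f])
  qed
  have "\<epsilon> X (?\<psi> X x) = \<phi> X x" if X: "X \<in> G.TG" and x: "x \<in> carrier (cval ?P X)" for X x
  proof (rule free_contramodule_hom_eqI[where \<eta>="\<lambda>X x. \<epsilon> X (?\<psi> X x)", OF N comp \<phi> _ X])
    fix H b assume Hb: "H \<in> I" "b \<in> B H"
    have H: "H \<in> \<H>" using Hb I by blast
    have y: "(H, id_map H, b) \<in> free_gens I B (coset_gset G H)" using Hb id_map_cmaps[OF H] by (simp add: free_gens_iff)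
    have "cmap M (coset_gset G H) (coset_gset G H) (id_map H) (m H b) = m H b"
      using contramodule_id[OF M G.coset_gset_transitive[OF H] m[OF Hb]] by (simp add: id_map_def G.coset_gset_simps)
    then show "\<epsilon> (coset_gset G H) (?\<psi> (coset_gset G H) (free_basis R (free_gens I B (coset_gset G H)) (H, id_map H, b))) = ?y H b"
      using free_extend_basis[OF M m G.coset_gset_transitive[OF H] y] \<epsilon>m[OF Hb] by simp
  qed (use x in \<open>simp add: linear_contramodule_def\<close>)
  then show "\<exists>\<psi>\<in>contramodule_homs R G \<H> ?P M. \<forall>X\<in>G.TG. \<forall>x\<in>carrier (cval ?P X). \<epsilon> X (\<psi> X x) = \<phi> X x"
    using \<psi> by blast
qed

end

end

section \<open>Quasi-isomorphisms\<close>

lemma group_module_hom_module_hom: "f \<in> group_module_hom R W M N \<Longrightarrow> f \<in> module_hom R M N"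
  by (simp add: group_module_hom_def)

locale quasi_isomorphism =
  fixes R :: "('r, 'k) ring_scheme" and W :: "('w, 'l) monoid_scheme"
    and C :: "('r, 'a, 'w) group_complex" and D :: "('r, 'b, 'w) group_complex" and f
  assumes C: "is_group_complex R W C"
    and DM: "\<And>n. Module.module R (cterm D n)"
    and Dd: "\<And>n. cdiff D n \<in> module_hom R (cterm D (Suc n)) (cterm D n)"
    and f: "is_chain_map R W C D f"
    and qi: "is_quasi_iso C D f"
begin

lemma CM: "Module.module R (cterm C n)"
  using C by (simp add: is_group_complex_def is_group_module_def)

lemma Cd: "cdiff C n \<in> module_hom R (cterm C (Suc n)) (cterm C n)"
  using C unfolding is_group_complex_def by (intro group_module_hom_module_hom) blast

lemma Cdd: "x \<in> carrier (cterm C (Suc (Suc n))) \<Longrightarrow> cdiff C n (cdiff C (Suc n) x) = \<zero>\<^bsub>cterm C n\<^esub>"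
  using C by (simp add: is_group_complex_def)

lemma fh: "f n \<in> module_hom R (cterm C n) (cterm D n)"
  using f unfolding is_chain_map_def by (intro group_module_hom_module_hom) blast

lemma fd: "x \<in> carrier (cterm C (Suc n)) \<Longrightarrow> f n (cdiff C n x) = cdiff D n (f (Suc n) x)"
  using f by (simp add: is_chain_map_def)

lemma hmap_iso: "homology_map D f n \<in> iso (homology C n) (homology D n)"
  using qi by (simp add: is_quasi_iso_def)

lemma boundaries_C_cycles: "boundaries C n \<subseteq> cycles C n"
  using Cdd module_hom_closed[OF Cd] by (cases n) (auto simp: boundaries_def)

lemma cycles_carrier: "cycles E n \<subseteq> carrier (cterm E n)"
  by (cases n) auto

lemma boundaries_C_carrier: "b \<in> boundaries C n \<Longrightarrow> b \<in> carrier (cterm C n)"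
  by (rule subsetD[OF cycles_carrier subsetD[OF boundaries_C_cycles]])

lemma cycles_C_add:
  assumes "x \<in> cycles C n" "y \<in> cycles C n"
  shows "x \<oplus>\<^bsub>cterm C n\<^esub> y \<in> cycles C n"
proof -
  interpret M: Module.module R "cterm C n" by (rule CM)
  show ?thesis
  proof (cases n)
    case 0
    then show ?thesis using assms M.a_closed by simp
  next
    case (Suc m)
    interpret M': Module.module R "cterm C m" by (rule CM)
    show ?thesis using assms M.a_closed unfolding Suc by (simp add: module_hom_add[OF Cd])
  qed
qed

lemma boundaries_D:
  shows "\<zero>\<^bsub>cterm D n\<^esub> \<in> boundaries D n"
    and "b \<in> boundaries D n \<Longrightarrow> b' \<in> boundaries D n \<Longrightarrow> b \<oplus>\<^bsub>cterm D n\<^esub> b' \<in> boundaries D n"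
    and "b \<in> boundaries D n \<Longrightarrow> b' \<in> boundaries D n \<Longrightarrow> b \<ominus>\<^bsub>cterm D n\<^esub> b' \<in> boundaries D n"
    and "b \<in> boundaries D n \<Longrightarrow> b \<in> carrier (cterm D n)"
proof -
  interpret M: Module.module R "cterm D (Suc n)" by (rule DM)
  show "\<zero>\<^bsub>cterm D n\<^esub> \<in> boundaries D n"
    using module_hom_zero[OF DM DM Dd, of n] M.zero_closed unfolding boundaries_def by (metis imageI)
  show "b \<in> carrier (cterm D n)" if "b \<in> boundaries D n"
    using that module_hom_closed[OF Dd] by (auto simp: boundaries_def)
  assume "b \<in> boundaries D n" "b' \<in> boundaries D n"
  then obtain z z' where z: "z \<in> carrier (cterm D (Suc n))" "b = cdiff D n z"
    "z' \<in> carrier (cterm D (Suc n))" "b' = cdiff D n z'" by (auto simp: boundaries_def)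
  show "b \<oplus>\<^bsub>cterm D n\<^esub> b' \<in> boundaries D n" "b \<ominus>\<^bsub>cterm D n\<^esub> b' \<in> boundaries D n"
    using z module_hom_add[OF Dd z(1,3)] module_hom_minus[OF DM DM Dd z(1,3)] M.a_closed M.minus_closed
    unfolding boundaries_def by (metis imageI)+
qed

lemma boundaries_C_zero: "\<zero>\<^bsub>cterm C n\<^esub> \<in> boundaries C n"
proof -
  interpret M: Module.module R "cterm C (Suc n)" by (rule CM)
  show ?thesis
    using module_hom_zero[OF CM CM Cd, of n] M.zero_closed unfolding boundaries_def by (metis imageI)
qed

definition "coset E n x = {b \<oplus>\<^bsub>cterm E n\<^esub> x |b. b \<in> boundaries E n}"

lemma carrier_homology: "carrier (homology E n) = coset E n ` cycles E n"
  by (auto simp: homology_def carrier_FactGroup r_coset_def coset_def image_def)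

lemma homology_map_eq: "homology_map D f n X = {b \<oplus>\<^bsub>cterm D n\<^esub> f n x |b x. b \<in> boundaries D n \<and> x \<in> X}"
  by (auto simp: homology_map_def set_add_def set_mult_def)

text \<open>Injectivity in homology, in terms of elements: a cycle whose image bounds has the same
  image class as zero, hence the same class.\<close>

lemma boundary_if_image_boundary:
  assumes x: "x \<in> cycles C n" and fx: "f n x \<in> boundaries D n"
  shows "x \<in> boundaries C n"
proof -
  interpret M: Module.module R "cterm C n" by (rule CM)
  interpret D: Module.module R "cterm D n" by (rule DM)
  have xc: "x \<in> carrier (cterm C n)" by (rule subsetD[OF cycles_carrier x])
  \<comment> \<open>The image class is the group of boundaries itself, that is, the zero
    class.\<close>
  have img: "homology_map D f n (coset C n y) = boundaries D n"
    if y: "y \<in> cycles C n" "f n y \<in> boundaries D n" for y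
  proof
    have yc: "y \<in> carrier (cterm C n)" by (rule subsetD[OF cycles_carrier y(1)])
    have fb: "f n b \<in> boundaries D n" if "b \<in> boundaries C n" for b
      using that fd module_hom_closed[OF fh] by (auto simp: boundaries_def)
    show "homology_map D f n (coset C n y) \<subseteq> boundaries D n"
    proof
      fix z assume "z \<in> homology_map D f n (coset C n y)"
      then obtain b b' where "b \<in> boundaries D n" "b' \<in> boundaries C n" "z = b \<oplus>\<^bsub>cterm D n\<^esub> f n (b' \<oplus>\<^bsub>cterm C n\<^esub> y)"
        by (auto simp: homology_map_eq coset_def)
      moreover from this have "b' \<in> carrier (cterm C n)" by (intro boundaries_C_carrier)
      ultimately show "z \<in> boundaries D n"
        using yc y(2) fb boundaries_D by (simp add: module_hom_add[OF fh])
    qed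
    show "boundaries D n \<subseteq> homology_map D f n (coset C n y)"
    proof
      fix b assume b: "b \<in> boundaries D n"
      have "y = \<zero>\<^bsub>cterm C n\<^esub> \<oplus>\<^bsub>cterm C n\<^esub> y" using yc by simp
      then have "y \<in> coset C n y" using boundaries_C_zero unfolding coset_def by blast
      moreover have "b = (b \<ominus>\<^bsub>cterm D n\<^esub> f n y) \<oplus>\<^bsub>cterm D n\<^esub> f n y"
        using boundaries_D(4)[OF b] boundaries_D(4)[OF y(2)] by (simp add: a_minus_def D.a_assoc D.l_neg)
      ultimately show "b \<in> homology_map D f n (coset C n y)"
        using boundaries_D(3)[OF b y(2)] unfolding homology_map_eq by blast
    qed
  qed
  have z: "\<zero>\<^bsub>cterm C n\<^esub> \<in> cycles C n" using boundaries_C_zero boundaries_C_cycles by blast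
  have "f n \<zero>\<^bsub>cterm C n\<^esub> \<in> boundaries D n"
    using module_hom_zero[OF CM DM fh] boundaries_D(1) by simp
  then have "homology_map D f n (coset C n x) = homology_map D f n (coset C n \<zero>\<^bsub>cterm C n\<^esub>)"
    using img[OF x fx] img[OF z] by simp
  moreover have "inj_on (homology_map D f n) (carrier (homology C n))"
    using hmap_iso by (simp add: iso_def bij_betw_def)
  ultimately have "coset C n x = coset C n \<zero>\<^bsub>cterm C n\<^esub>"
    using x z by (auto simp: carrier_homology dest: inj_onD)
  moreover have "x \<in> coset C n x"
  proof -
    have "x = \<zero>\<^bsub>cterm C n\<^esub> \<oplus>\<^bsub>cterm C n\<^esub> x" using xc by simp
    then show ?thesis using boundaries_C_zero unfolding coset_def by blast
  qed
  ultimately obtain b where "b \<in> boundaries C n" "x = b \<oplus>\<^bsub>cterm C n\<^esub> \<zero>\<^bsub>cterm C n\<^esub>"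
    by (auto simp: coset_def)
  moreover from this have "b \<in> carrier (cterm C n)" by (intro boundaries_C_carrier)
  ultimately show ?thesis by simp
qed

text \<open>Surjectivity in homology, in terms of elements. The induced map runs over a whole coset,
  so the cycle found is \<open>b' + x\<close> with a boundary \<open>b'\<close>.\<close>

lemma cycle_homologous_to_image:
  assumes y: "y \<in> cycles D n"
  shows "\<exists>x\<in>cycles C n. \<exists>z\<in>carrier (cterm D (Suc n)). y = cdiff D n z \<oplus>\<^bsub>cterm D n\<^esub> f n x"
proof -
  interpret D: Module.module R "cterm D n" by (rule DM)
  have "coset D n y \<in> homology_map D f n ` carrier (homology C n)"
    using hmap_iso y by (auto simp: iso_def bij_betw_def carrier_homology)
  then obtain x where x: "x \<in> cycles C n" "coset D n y = homology_map D f n (coset C n x)"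
    by (auto simp: carrier_homology)
  have "y = \<zero>\<^bsub>cterm D n\<^esub> \<oplus>\<^bsub>cterm D n\<^esub> y" using subsetD[OF cycles_carrier y] by simp
  then have "y \<in> coset D n y" using boundaries_D(1) unfolding coset_def by blast
  then obtain b b' where b: "b \<in> boundaries D n" "b' \<in> boundaries C n"
    "y = b \<oplus>\<^bsub>cterm D n\<^esub> f n (b' \<oplus>\<^bsub>cterm C n\<^esub> x)"
    unfolding x(2) by (auto simp: homology_map_eq coset_def)
  have "b' \<oplus>\<^bsub>cterm C n\<^esub> x \<in> cycles C n" using b(2) x(1) boundaries_C_cycles by (intro cycles_C_add) auto
  then show ?thesis using b by (auto simp: boundaries_def)
qed

text \<open>Together, the next two statements say that the mapping cone of \<open>f\<close> is acyclic.\<close>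

lemma cone_acyclic_0:
  assumes "y \<in> carrier (cterm D 0)"
  shows "\<exists>u\<in>carrier (cterm C 0). \<exists>z\<in>carrier (cterm D (Suc 0)). y = cdiff D 0 z \<oplus>\<^bsub>cterm D 0\<^esub> f 0 u"
  using cycle_homologous_to_image[of y 0] assms by auto

lemma cone_acyclic:
  assumes u: "u \<in> cycles C n" and y: "y \<in> carrier (cterm D (Suc n))" and eq: "f n u = cdiff D n y"
  shows "\<exists>v\<in>carrier (cterm C (Suc n)). \<exists>z\<in>carrier (cterm D (Suc (Suc n))).
    cdiff C n v = u \<and> y = cdiff D (Suc n) z \<oplus>\<^bsub>cterm D (Suc n)\<^esub> f (Suc n) v"
proof -
  interpret M: Module.module R "cterm C (Suc n)" by (rule CM)
  interpret Mn: Module.module R "cterm C n" by (rule CM)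
  interpret D: Module.module R "cterm D (Suc n)" by (rule DM)
  interpret Dn: Module.module R "cterm D n" by (rule DM)
  have "f n u \<in> boundaries D n" using eq y by (auto simp: boundaries_def)
  from boundary_if_image_boundary[OF u this] obtain v where v: "v \<in> carrier (cterm C (Suc n))" "cdiff C n v = u"
    by (auto simp: boundaries_def)
  \<comment> \<open>Bounding \<open>u\<close> by \<open>v\<close> does not yet account for
    \<open>y\<close>. The difference \<open>y - f v\<close> is a cycle, hence homologous to the
    image of a cycle \<open>x\<close>, and \<open>x + v\<close> still bounds
    \<open>u\<close>.\<close>
  let ?y = "y \<ominus>\<^bsub>cterm D (Suc n)\<^esub> f (Suc n) v"
  have fv: "f (Suc n) v \<in> carrier (cterm D (Suc n))" using v module_hom_closed[OF fh] by blast
  have "cdiff D n ?y = cdiff D n y \<ominus>\<^bsub>cterm D n\<^esub> cdiff D n (f (Suc n) v)"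
    using y fv by (intro module_hom_minus[OF DM DM Dd])
  also have "cdiff D n (f (Suc n) v) = cdiff D n y" using fd[OF v(1)] v(2) eq by simp
  finally have "cdiff D n ?y = \<zero>\<^bsub>cterm D n\<^esub>" using module_hom_closed[OF Dd y] by (simp add: Dn.minus_eq_zero_iff)
  then have "?y \<in> cycles D (Suc n)" using y fv by simp
  from cycle_homologous_to_image[OF this] obtain x z where x: "x \<in> cycles C (Suc n)"
    and z: "z \<in> carrier (cterm D (Suc (Suc n)))" "?y = cdiff D (Suc n) z \<oplus>\<^bsub>cterm D (Suc n)\<^esub> f (Suc n) x"
    by blast
  have xc: "x \<in> carrier (cterm C (Suc n))" "cdiff C n x = \<zero>\<^bsub>cterm C n\<^esub>" using x by auto
  have c: "cdiff D (Suc n) z \<in> carrier (cterm D (Suc n))" "f (Suc n) x \<in> carrier (cterm D (Suc n))"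
    using module_hom_closed[OF Dd z(1)] module_hom_closed[OF fh xc(1)] by auto
  have "y = ?y \<oplus>\<^bsub>cterm D (Suc n)\<^esub> f (Suc n) v" using y fv by (simp add: a_minus_def D.a_assoc D.l_neg)
  also have "\<dots> = cdiff D (Suc n) z \<oplus>\<^bsub>cterm D (Suc n)\<^esub> f (Suc n) (x \<oplus>\<^bsub>cterm C (Suc n)\<^esub> v)"
    unfolding z(2) using c fv xc v by (simp add: module_hom_add[OF fh] D.a_assoc)
  finally have "y = cdiff D (Suc n) z \<oplus>\<^bsub>cterm D (Suc n)\<^esub> f (Suc n) (x \<oplus>\<^bsub>cterm C (Suc n)\<^esub> v)" .
  moreover have "cdiff C n (x \<oplus>\<^bsub>cterm C (Suc n)\<^esub> v) = u"
  proof -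
    have "u \<in> carrier (cterm C n)" by (rule subsetD[OF cycles_carrier u])
    then show ?thesis using xc v by (simp add: module_hom_add[OF Cd])
  qed
  ultimately show ?thesis using xc v z by (intro bexI[of _ "x \<oplus>\<^bsub>cterm C (Suc n)\<^esub> v"] bexI[of _ z]) auto
qed

end

section \<open>The mapping cone of a free resolution over the chains\<close>

context cring
begin

lemma module_hom_diff:
  assumes M: "Module.module R M" and N: "Module.module R N"
    and f: "f \<in> module_hom R M N" and g: "g \<in> module_hom R M N"
  shows "(\<lambda>x. f x \<ominus>\<^bsub>N\<^esub> g x) \<in> module_hom R M N"
proof -
  interpret N: Module.module R N by fact
  have m1: "\<ominus> \<one> \<in> carrier R" by simp
  show ?thesis
    by (rule module_hom_cong[OF module_hom_sum[OF M N f module_hom_scale[OF M N g m1]] _ M])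
       (simp add: a_minus_def N.smult_l_minus module_hom_closed[OF g])
qed

text \<open>By linearity a nonzero coefficient of \<open>f c\<close> must come from a basis element
  in the support of \<open>c\<close>. This reduces triangularity to single generators.\<close>

lemma free_hom_support:
  assumes f: "f \<in> module_hom R (free_module R S) (free_module R T)" and c: "c \<in> carrier (free_module R S)"
    and t: "t \<in> T" "f c t \<noteq> \<zero>"
  obtains s where "s \<in> S" "c s \<noteq> \<zero>" "f (free_basis R S s) t \<noteq> \<zero>"
proof -
  interpret S: Module.module R "free_module R S" by (rule module_free_module)
  have "f c t = \<zero>" if all: "\<forall>s\<in>S. c s \<noteq> \<zero> \<longrightarrow> f (free_basis R S s) t = \<zero>"
    using c
  proof (induction rule: free_module_supp_induct)
    case zero
    then show ?case using t by (simp add: module_hom_zero[OF module_free_module module_free_module f])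
  next
    case (add r s d)
    then show ?case
      using all t by (simp add: module_hom_add[OF f] module_hom_smult[OF f])
  qed
  then show ?thesis using that t by blast
qed

end

text \<open>The bases \<open>B\<close> are fixed here, since the cone needs an index set for its
  generators. Only the representatives in \<open>I\<close> will contribute generators.\<close>

locale bredon_resolution = bredon R G \<H>
  for R :: "('r, 'k) ring_scheme" (structure) and G :: "('g, 'l) monoid_scheme" and \<H> +
  fixes I :: "'g set set" and N :: nat and P :: "'g set \<Rightarrow> ('r, 'p, 'g set) group_complex"
    and q :: "'g set \<Rightarrow> nat \<Rightarrow> 'p \<Rightarrow> 'g set list \<Rightarrow> 'r" and B :: "'g set \<Rightarrow> nat \<Rightarrow> 'p set"
  assumes reps: "is_conjugacy_representatives G \<H> I"
    and bound: "H \<in> \<H> \<Longrightarrow> subgroup_length \<H> H \<le> enat N"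
    and resolution: "H \<in> \<H> \<Longrightarrow>
      is_free_resolution R (weyl_group G H) (P H) (suspended_augmented_chains R G \<H> H) (q H)"
    and based: "H \<in> \<H> \<Longrightarrow> based_group_ring_module R (weyl_group G H) (cterm (P H) n) (B H n)"
begin

abbreviation "W H \<equiv> weyl_group G H"
abbreviation "U H n \<equiv> cterm (P H) n"
abbreviation "A H n \<equiv> free_module R (simplices (above \<H> H) n)"
abbreviation "bdA H n \<equiv> simplex_boundary (above \<H> H) n"
abbreviation "WB H n \<equiv> carrier (W H) \<times> B H n"

definition "crd H n = based_group_ring_module.coord R (W H) (U H n) (B H n)"

lemma I_family: "H \<in> I \<Longrightarrow> H \<in> \<H>"
  using reps by (auto simp: is_conjugacy_representatives_def)

context
  fixes H assumes H: "H \<in> \<H>"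
begin

lemma module_U: "Module.module R (U H n)"
proof -
  interpret U: based_group_ring_module R "W H" "U H n" "B H n" by (rule based[OF H])
  show ?thesis by (rule U.module_U)
qed

lemma B_carrier: "b \<in> B H n \<Longrightarrow> b \<in> carrier (U H n)"
  using based_group_ring_module.B[OF based[OF H]] by blast

lemma crd_hom: "crd H n \<in> module_hom R (U H n) (free_module R (WB H n))"
  unfolding crd_def by (rule based_group_ring_module.coord_hom[OF based[OF H]])

lemma crd_closed: "u \<in> carrier (U H n) \<Longrightarrow> crd H n u \<in> carrier (free_module R (WB H n))"
  by (rule module_hom_closed[OF crd_hom])

lemma crd_inj: "u \<in> carrier (U H n) \<Longrightarrow> u' \<in> carrier (U H n) \<Longrightarrow> crd H n u = crd H n u' \<Longrightarrow> u = u'"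
  unfolding crd_def by (metis based_group_ring_module.synthesis_coord[OF based[OF H]])

lemma crd_surj:
  assumes c: "c \<in> carrier (free_module R (WB H n))"
  obtains u where "u \<in> carrier (U H n)" "crd H n u = c"
proof -
  interpret U: based_group_ring_module R "W H" "U H n" "B H n" by (rule based[OF H])
  show ?thesis
    using that[of "U.synthesis (B H n) c"] module_hom_closed[OF U.synthesis_hom[OF U.B] c] U.coord_synthesis[OF c]
    by (simp add: crd_def)
qed

lemma crd_gact_basis: "w \<in> carrier (W H) \<Longrightarrow> b \<in> B H n \<Longrightarrow>
    crd H n (gact (U H n) w b) = free_basis R (WB H n) (w, b)"
  unfolding crd_def by (rule based_group_ring_module.coord_gact_basis[OF based[OF H]])

lemma crd_gact: "w \<in> carrier (W H) \<Longrightarrow> u \<in> carrier (U H n) \<Longrightarrow>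
    crd H n (gact (U H n) w u) = free_map R (WB H n) (WB H n) (\<lambda>(v, b). (w \<otimes>\<^bsub>W H\<^esub> v, b)) (crd H n u)"
  unfolding crd_def by (rule based_group_ring_module.coord_gact[OF based[OF H]])

text \<open>The elements \<open>w b\<close> span \<open>P H n\<close> over \<open>R\<close>, so a
  linear map with a nonzero coefficient at \<open>t\<close> has one already on some
  \<open>w b\<close>.\<close>

lemma U_hom_support:
  assumes f: "f \<in> module_hom R (U H n) (free_module R T)" and u: "u \<in> carrier (U H n)"
    and t: "t \<in> T" "f u t \<noteq> \<zero>"
  obtains w b where "w \<in> carrier (W H)" "b \<in> B H n" "f (gact (U H n) w b) t \<noteq> \<zero>"
proof -
  interpret U: based_group_ring_module R "W H" "U H n" "B H n" by (rule based[OF H])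
  have "f (U.synthesis (B H n) (U.coord u)) t \<noteq> \<zero>" using u t by (simp add: U.synthesis_coord)
  from free_hom_support[where f="\<lambda>c. f (U.synthesis (B H n) c)", OF module_hom_comp[OF U.synthesis_hom[OF U.B] f] U.coord_closed[OF u] t(1) this]
  obtain s where s: "s \<in> WB H n" "f (U.synthesis (B H n) (free_basis R (WB H n) s)) t \<noteq> \<zero>" by blast
  then show ?thesis using that U.synthesis_basis[OF U.B] by (cases s) auto
qed

text \<open>The terms of the complex are extended records, so they are compared with
  \<open>A H n\<close> field by field. For \<open>module_hom\<close> these fields are
  enough.\<close>

lemma suspended_simps:
  "carrier (cterm (suspended_augmented_chains R G \<H> H) n) = carrier (A H n)"
  "add (cterm (suspended_augmented_chains R G \<H> H) n) = add (A H n)"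
  "\<zero>\<^bsub>cterm (suspended_augmented_chains R G \<H> H) n\<^esub> = \<zero>\<^bsub>A H n\<^esub>"
  "module.smult (cterm (suspended_augmented_chains R G \<H> H) n) = module.smult (A H n)"
  "gact (cterm (suspended_augmented_chains R G \<H> H) n) w =
     free_map R (simplices (above \<H> H) n) (simplices (above \<H> H) n) (map (weyl_conjugate G w))"
  "cdiff (suspended_augmented_chains R G \<H> H) n = bdA H n"
  by (simp_all add: suspended_augmented_chains_def Let_def module.defs boundary_def fun_eq_iff)

lemma module_hom_suspended:
  "module_hom R M (cterm (suspended_augmented_chains R G \<H> H) n) = module_hom R M (A H n)"
  "module_hom R (cterm (suspended_augmented_chains R G \<H> H) n) M' = module_hom R (A H n) M'"
  by (simp_all add: module_hom_def hom_def suspended_simps)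

lemma quasi_iso: "quasi_isomorphism R (W H) (P H) (suspended_augmented_chains R G \<H> H) (q H)"
proof (rule quasi_isomorphism.intro)
  show "is_group_complex R (W H) (P H)" "is_chain_map R (W H) (P H) (suspended_augmented_chains R G \<H> H) (q H)"
    "is_quasi_iso (P H) (suspended_augmented_chains R G \<H> H) (q H)"
    using resolution[OF H] by (auto simp: is_free_resolution_def)
  fix n
  interpret A: Module.module R "A H n" by (rule module_free_module)
  have "abelian_group (cterm (suspended_augmented_chains R G \<H> H) n)"
    by (rule abelian_groupI) (auto simp: suspended_simps A.a_ac intro!: bexI[of _ "\<ominus>\<^bsub>A H n\<^esub> x" for x] A.l_neg)
  then show "Module.module R (cterm (suspended_augmented_chains R G \<H> H) n)"
    by (rule moduleI[OF is_cring]) (auto simp: suspended_simps A.smult_l_distr A.smult_r_distr A.smult_assoc1)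
  show "cdiff (suspended_augmented_chains R G \<H> H) n \<in> module_hom R
      (cterm (suspended_augmented_chains R G \<H> H) (Suc n)) (cterm (suspended_augmented_chains R G \<H> H) n)"
    unfolding suspended_simps module_hom_suspended by (rule simplex_boundary_hom)
qed

lemma d_hom: "cdiff (P H) n \<in> module_hom R (U H (Suc n)) (U H n)"
  by (rule quasi_isomorphism.Cd[OF quasi_iso])

lemma d_closed: "u \<in> carrier (U H (Suc n)) \<Longrightarrow> cdiff (P H) n u \<in> carrier (U H n)"
  by (rule module_hom_closed[OF d_hom])

lemma d_d: "u \<in> carrier (U H (Suc (Suc n))) \<Longrightarrow> cdiff (P H) n (cdiff (P H) (Suc n) u) = \<zero>\<^bsub>U H n\<^esub>"
  by (rule quasi_isomorphism.Cdd[OF quasi_iso])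

lemma d_gact: "w \<in> carrier (W H) \<Longrightarrow> u \<in> carrier (U H (Suc n)) \<Longrightarrow>
    cdiff (P H) n (gact (U H (Suc n)) w u) = gact (U H n) w (cdiff (P H) n u)"
  using resolution[OF H] by (simp add: is_free_resolution_def is_group_complex_def group_module_hom_def)

lemma q_hom: "q H n \<in> module_hom R (U H n) (A H n)"
  using quasi_isomorphism.fh[OF quasi_iso, of n] by (simp add: module_hom_suspended)

lemma q_closed: "u \<in> carrier (U H n) \<Longrightarrow> q H n u \<in> carrier (A H n)"
  by (rule module_hom_closed[OF q_hom])

lemma q_gact: "w \<in> carrier (W H) \<Longrightarrow> u \<in> carrier (U H n) \<Longrightarrow> q H n (gact (U H n) w u) =
    free_map R (simplices (above \<H> H) n) (simplices (above \<H> H) n) (map (weyl_conjugate G w)) (q H n u)"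
  using resolution[OF H] by (simp add: is_free_resolution_def is_chain_map_def group_module_hom_def suspended_simps)

lemma q_d: "u \<in> carrier (U H (Suc n)) \<Longrightarrow> q H n (cdiff (P H) n u) = bdA H n (q H (Suc n) u)"
  using quasi_isomorphism.fd[OF quasi_iso, of u n] by (simp add: suspended_simps)

lemma acyclic_0:
  assumes "y \<in> carrier (A H 0)"
  shows "\<exists>u\<in>carrier (U H 0). \<exists>z\<in>carrier (A H (Suc 0)). y = bdA H 0 z \<oplus>\<^bsub>A H 0\<^esub> q H 0 u"
  using quasi_isomorphism.cone_acyclic_0[OF quasi_iso, of y] assms by (simp add: suspended_simps)

lemma acyclic:
  assumes "u \<in> cycles (P H) n" "y \<in> carrier (A H (Suc n))" "q H n u = bdA H n y"
  shows "\<exists>v\<in>carrier (U H (Suc n)). \<exists>z\<in>carrier (A H (Suc (Suc n))).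
    cdiff (P H) n v = u \<and> y = bdA H (Suc n) z \<oplus>\<^bsub>A H (Suc n)\<^esub> q H (Suc n) v"
  using quasi_isomorphism.cone_acyclic[OF quasi_iso, of u n y] assms by (simp add: suspended_simps)

end

end

section \<open>Generators of the cone and the leading part of its differential\<close>

context bredon_resolution
begin

abbreviation "gens n X \<equiv> free_gens I (\<lambda>H. B H n) X"
abbreviation "level \<equiv> G.level"

text \<open>\<open>S m X\<close> are the generators of the cone in degree \<open>m\<close>: those of \<open>P H (m - 1)\<close> and the chains with
  \<open>m + 1\<close> members. The cone is filtered by the level of the head \<open>hHh\<^sup>-\<^sup>1\<close> of a generator \<open>(H, h, b)\<close>
  and of the least member of a chain.\<close>

definition S :: "nat \<Rightarrow> 'g gset \<Rightarrow> (('g set \<times> ('g set \<Rightarrow> 'g set) \<times> 'p) + ('g set \<Rightarrow> 'g set list)) set" where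
  "S m X = Inl ` {s. \<exists>n. m = Suc n \<and> s \<in> gens n X} \<union> Inr ` G.chains (Suc m) X"

primrec pull :: "'g gset \<Rightarrow> ('g set \<Rightarrow> 'g set) \<Rightarrow> ('g set \<times> ('g set \<Rightarrow> 'g set) \<times> 'p) + ('g set \<Rightarrow> 'g set list) \<Rightarrow>
    ('g set \<times> ('g set \<Rightarrow> 'g set) \<times> 'p) + ('g set \<Rightarrow> 'g set list)" where
  "pull X f (Inl t) = Inl (free_pull X f t)"
| "pull X f (Inr \<sigma>) = Inr (pullback X f \<sigma>)"

text \<open>The head is read at a point \<open>x\<close>. Moving \<open>x\<close> by a group element
  conjugates it, so its level depends on the generator alone
  (\<open>level_head_invariant\<close>).\<close>

primrec head :: "'g set \<Rightarrow> ('g set \<times> ('g set \<Rightarrow> 'g set) \<times> 'p) + ('g set \<Rightarrow> 'g set list) \<Rightarrow> 'g set" where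
  "head x (Inl t) = (case t of (H, h, b) \<Rightarrow> weyl_conjugate G (h x) H)"
| "head x (Inr \<sigma>) = hd (\<sigma> x)"

lemma S_Inl: "Inl t \<in> S m X \<longleftrightarrow> (\<exists>n. m = Suc n \<and> t \<in> gens n X)"
  and S_Inr: "Inr \<sigma> \<in> S m X \<longleftrightarrow> \<sigma> \<in> G.chains (Suc m) X"
  by (auto simp: S_def)

lemma S_cases:
  assumes "s \<in> S m X"
  obtains (gen) n H h b where "m = Suc n" "s = Inl (H, h, b)" "H \<in> I" "h \<in> G.cmaps X H" "b \<in> B H n"
  | (chain) \<sigma> where "s = Inr \<sigma>" "\<sigma> \<in> G.chains (Suc m) X"
  using assms by (auto simp: S_def free_gens_def)

lemma pull_closed:
  assumes X: "X \<in> G.TG" and f: "f \<in> gset_maps G X Y" and s: "s \<in> S m Y"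
  shows "pull X f s \<in> S m X"
proof (cases s)
  case (Inl t)
  then obtain n where "m = Suc n" "t \<in> gens n Y" using s by (auto simp: S_Inl)
  then show ?thesis using free_pull_closed[OF subsetI[OF I_family] X f] Inl by (simp add: S_Inl)
next
  case (Inr \<sigma>)
  then show ?thesis using s G.chains_pull[OF X f] by (simp add: S_Inr)
qed

lemma pull_map: "X \<in> G.TG \<Longrightarrow> f \<in> gset_maps G X Y \<Longrightarrow> pull X f \<in> S m Y \<rightarrow> S m X"
  using pull_closed by blast

text \<open>Estimates for heads that are proved at \<open>G/H\<close> can thus be read at
  \<open>h x\<close> for any \<open>h : X -> G/H\<close>.\<close>

lemma head_pull: "x \<in> fst X \<Longrightarrow> head x (pull X f s) = head (f x) s"
  by (cases s) (auto simp: free_pull_def compose_def split: prod.split)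

text \<open>The embeddings of \<open>P\<^bsub>H\<^esub>\<close> and of the chains above \<open>H\<close> determined by a map \<open>h : X \<rightarrow> G/H\<close>.\<close>

abbreviation "ract X h w \<equiv> \<lambda>x\<in>fst X. h x <#>\<^bsub>G\<^esub> w"

definition \<kappa> where
  "\<kappa> n X H h u = free_map R (WB H n) (S (Suc n) X) (\<lambda>(w, b). Inl (H, ract X h w, b)) (crd H n u)"

definition \<mu> where
  "\<mu> m X H h y = free_map R (simplices (above \<H> H) m) (S m X) (\<lambda>\<tau>. Inr (G.orbit_chain X h (H # \<tau>))) y"

text \<open>The differential of the mapping cone on \<open>P\<^bsub>H\<^esub>\<close>, in degree \<open>m\<close>.\<close>

definition start where
  "start m X H h u = (case m of 0 \<Rightarrow> \<mu> 0 X H h (q H 0 u)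
    | Suc k \<Rightarrow> \<kappa> k X H h (cdiff (P H) k u) \<oplus>\<^bsub>free_module R (S m X)\<^esub> \<mu> m X H h (q H m u))"

lemma start_simps:
  "start 0 X H h u = \<mu> 0 X H h (q H 0 u)"
  "start (Suc k) X H h u = \<kappa> k X H h (cdiff (P H) k u) \<oplus>\<^bsub>free_module R (S (Suc k) X)\<^esub> \<mu> (Suc k) X H h (q H (Suc k) u)"
  by (simp_all add: start_def)

context
  fixes X H h assumes X: "X \<in> G.TG" and HI: "H \<in> I" and h: "h \<in> G.cmaps X H"
begin

lemma H: "H \<in> \<H>" by (rule I_family[OF HI])

lemma \<kappa>_map: "(\<lambda>(w, b). Inl (H, ract X h w, b)) \<in> WB H n \<rightarrow> S (Suc n) X"
  using G.cmaps_ract[OF H X h] HI by (auto simp: S_Inl free_gens_iff)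

lemma \<kappa>_hom: "\<kappa> n X H h \<in> module_hom R (U H n) (free_module R (S (Suc n) X))"
  unfolding \<kappa>_def by (rule module_hom_comp[OF crd_hom[OF H] free_map_hom[OF \<kappa>_map]])

lemma \<kappa>_closed: "u \<in> carrier (U H n) \<Longrightarrow> \<kappa> n X H h u \<in> carrier (free_module R (S (Suc n) X))"
  by (rule module_hom_closed[OF \<kappa>_hom])

lemma \<kappa>_gact_basis: "w \<in> carrier (W H) \<Longrightarrow> b \<in> B H n \<Longrightarrow>
    \<kappa> n X H h (gact (U H n) w b) = free_basis R (S (Suc n) X) (Inl (H, ract X h w, b))"
  unfolding \<kappa>_def by (simp add: crd_gact_basis[OF H] free_map_basis[OF \<kappa>_map])

lemma \<mu>_map: "(\<lambda>\<tau>. Inr (G.orbit_chain X h (H # \<tau>))) \<in> simplices (above \<H> H) m \<rightarrow> S m X"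
  using G.orbit_chain_chains[OF H X h G.Cons_above_upper[OF H]] by (auto simp: S_Inr)

lemma \<mu>_hom: "\<mu> m X H h \<in> module_hom R (A H m) (free_module R (S m X))"
  unfolding \<mu>_def by (rule free_map_hom[OF \<mu>_map])

lemma \<mu>_closed: "y \<in> carrier (A H m) \<Longrightarrow> \<mu> m X H h y \<in> carrier (free_module R (S m X))"
  by (rule module_hom_closed[OF \<mu>_hom])

lemma start_hom: "start m X H h \<in> module_hom R (U H m) (free_module R (S m X))"
proof (cases m)
  case 0
  have "(\<lambda>u. \<mu> 0 X H h (q H 0 u)) \<in> module_hom R (U H 0) (free_module R (S 0 X))"
    by (rule module_hom_comp[OF q_hom[OF H] \<mu>_hom])
  then show ?thesis using 0 by (simp add: start_simps(1)[abs_def] start_def)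
next
  case (Suc k)
  have "(\<lambda>u. \<kappa> k X H h (cdiff (P H) k u) \<oplus>\<^bsub>free_module R (S (Suc k) X)\<^esub> \<mu> (Suc k) X H h (q H (Suc k) u))
      \<in> module_hom R (U H (Suc k)) (free_module R (S (Suc k) X))"
    by (rule module_hom_sum[OF module_U[OF H] module_free_module module_hom_comp[OF d_hom[OF H] \<kappa>_hom]
          module_hom_comp[OF q_hom[OF H] \<mu>_hom]])
  moreover have "start (Suc k) X H h = (\<lambda>u. \<kappa> k X H h (cdiff (P H) k u) \<oplus>\<^bsub>free_module R (S (Suc k) X)\<^esub> \<mu> (Suc k) X H h (q H (Suc k) u))"
    by (rule ext) (rule start_simps)
  ultimately show ?thesis using Suc by simp
qed

lemma start_closed: "u \<in> carrier (U H m) \<Longrightarrow> start m X H h u \<in> carrier (free_module R (S m X))"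
  by (rule module_hom_closed[OF start_hom])

lemma ract_cmaps: "w \<in> carrier (W H) \<Longrightarrow> ract X h w \<in> G.cmaps X H"
  by (rule G.cmaps_ract[OF H X h])

text \<open>Since \<open>w\<close> comes from the normalizer of \<open>H\<close>, it does not change
  the head. Hence the whole image of \<open>\<kappa>\<close> lies in one fibre.\<close>

lemma weyl_conjugate_ract:
  assumes x: "x \<in> fst X" and w: "w \<in> carrier (W H)"
  shows "weyl_conjugate G (ract X h w x) H = weyl_conjugate G (h x) H"
proof -
  obtain k where k: "k \<in> carrier G" "conjugate G k H = H" "w = k <#\<^bsub>G\<^esub> H"
    using G.weyl_group_carrierE[OF G.family_subgroup[OF H] w] .
  obtain a where a: "a \<in> carrier G" "h x = a <#\<^bsub>G\<^esub> H" using G.cmaps_lcosets[OF h x] G.lcosetsE by metis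
  have "ract X h w x = (a \<otimes>\<^bsub>G\<^esub> k) <#\<^bsub>G\<^esub> H"
    using x k a G.lcoset_mult_weyl[OF G.family_subgroup[OF H] k(1,2) a(1)] by simp
  then show ?thesis
    using a k H G.family_carrier[OF H] by (simp add: G.weyl_conjugate_upper[OF H] G.conjugate_mult)
qed

lemma \<kappa>_head:
  assumes u: "u \<in> carrier (U H n)" and s: "s \<in> S (Suc n) X" "\<kappa> n X H h u s \<noteq> \<zero>" and x: "x \<in> fst X"
  shows "head x s = weyl_conjugate G (h x) H"
proof -
  obtain t where "t \<in> WB H n" "(\<lambda>(w, b). Inl (H, ract X h w, b)) t = s"
    using free_map_support[OF s(2)[unfolded \<kappa>_def] s(1)] by metis
  then obtain w b where "w \<in> carrier (W H)" "s = Inl (H, ract X h w, b)" by auto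
  then show ?thesis using weyl_conjugate_ract[OF x] by simp
qed

lemma orbit_chain_head:
  assumes x: "x \<in> fst X" and \<tau>: "\<tau> \<in> simplices (above \<H> H) m"
  shows "hd (G.orbit_chain X h (H # \<tau>) x) = weyl_conjugate G (h x) H"
  using x by (simp add: G.orbit_chain_def)

lemma \<mu>_head:
  assumes s: "s \<in> S m X" "\<mu> m X H h y s \<noteq> \<zero>" and x: "x \<in> fst X"
  shows "head x s = weyl_conjugate G (h x) H"
proof -
  obtain \<tau> where "\<tau> \<in> simplices (above \<H> H) m" "Inr (G.orbit_chain X h (H # \<tau>)) = s"
    using free_map_support[OF s(2)[unfolded \<mu>_def] s(1)] by metis
  then show ?thesis using orbit_chain_head[OF x] by auto
qed

lemma start_head:
  assumes u: "u \<in> carrier (U H m)" and s: "s \<in> S m X" "start m X H h u s \<noteq> \<zero>" and x: "x \<in> fst X"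
  shows "head x s = weyl_conjugate G (h x) H"
proof (cases m)
  case 0
  then show ?thesis using \<mu>_head[of s 0 "q H 0 u" x] s x by (simp add: start_simps)
next
  case (Suc k)
  have "\<kappa> k X H h (cdiff (P H) k u) s \<noteq> \<zero> \<or> \<mu> (Suc k) X H h (q H (Suc k) u) s \<noteq> \<zero>"
  proof (rule ccontr)
    assume "\<not> ?thesis"
    then have "start m X H h u s = \<zero>" using s(1) Suc by (simp add: start_simps)
    with s(2) show False by simp
  qed
  then show ?thesis
    using \<kappa>_head[OF d_closed[OF H]] \<mu>_head[of s "Suc k"] u s(1) x Suc by blast
qed

lemma level_head: "x \<in> fst X \<Longrightarrow> level (weyl_conjugate G (h x) H) = level H"
proof -
  assume x: "x \<in> fst X"
  obtain a where a: "a \<in> carrier G" "h x = a <#\<^bsub>G\<^esub> H" using G.cmaps_lcosets[OF h x] G.lcosetsE by metis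
  then show ?thesis
    using H by (simp add: G.weyl_conjugate_upper[OF H] G.level_conjugate G.family_carrier)
qed

text \<open>Both sides place a coordinate \<open>(v, b)\<close> at the map \<open>h w v\<close>; so
  \<open>\<kappa>\<close> is balanced over \<open>WH\<close> like
  \<open>h \<otimes> u\<close>.\<close>

lemma \<kappa>_ract:
  assumes w: "w \<in> carrier (W H)" and u: "u \<in> carrier (U H n)"
  shows "\<kappa> n X H (ract X h w) u = \<kappa> n X H h (gact (U H n) w u)"
proof -
  have m: "(\<lambda>(v, b). (w \<otimes>\<^bsub>W H\<^esub> v, b)) \<in> WB H n \<rightarrow> WB H n"
    using group.is_monoid[OF G.group_weyl_group[OF G.family_subgroup[OF H]]] w by (auto simp: monoid.m_closed)
  have "\<kappa> n X H h (gact (U H n) w u) =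
      free_map R (WB H n) (S (Suc n) X) (\<lambda>s. (\<lambda>(w, b). Inl (H, ract X h w, b)) ((\<lambda>(v, b). (w \<otimes>\<^bsub>W H\<^esub> v, b)) s)) (crd H n u)"
    unfolding \<kappa>_def crd_gact[OF H w u]
    by (rule free_map_comp[OF m \<kappa>_map crd_closed[OF H u]])
  also have "\<dots> = \<kappa> n X H (ract X h w) u"
    unfolding \<kappa>_def using G.cmaps_ract_mult[OF H X h w]
    by (intro free_map_cong) (auto split: prod.split)
  finally show ?thesis ..
qed

lemma \<mu>_ract:
  assumes w: "w \<in> carrier (W H)" and y: "y \<in> carrier (A H m)"
  shows "\<mu> m X H (ract X h w) y =
    \<mu> m X H h (free_map R (simplices (above \<H> H) m) (simplices (above \<H> H) m) (map (weyl_conjugate G w)) y)"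
proof -
  have m: "map (weyl_conjugate G w) \<in> simplices (above \<H> H) m \<rightarrow> simplices (above \<H> H) m"
    using G.weyl_simplices_above[OF H w] by blast
  have "\<mu> m X H h (free_map R (simplices (above \<H> H) m) (simplices (above \<H> H) m) (map (weyl_conjugate G w)) y) =
    free_map R (simplices (above \<H> H) m) (S m X) (\<lambda>\<tau>. Inr (G.orbit_chain X h (H # map (weyl_conjugate G w) \<tau>))) y"
    unfolding \<mu>_def by (rule free_map_comp[OF m \<mu>_map y])
  also have "\<dots> = \<mu> m X H (ract X h w) y"
    unfolding \<mu>_def
  proof (rule free_map_cong)
    fix \<tau> assume \<tau>: "\<tau> \<in> simplices (above \<H> H) m"
    show "Inr (G.orbit_chain X h (H # map (weyl_conjugate G w) \<tau>)) = Inr (G.orbit_chain X (ract X h w) (H # \<tau>))"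
      using G.orbit_chain_ract[OF H h w G.Cons_above_upper[OF H \<tau>]] G.weyl_self[OF H w] by simp
  qed
  finally show ?thesis ..
qed

text \<open>Balance over \<open>WH\<close>, from the equivariance of the differential of
  \<open>P H\<close> and of \<open>q H\<close>. It turns a statement about a translate
  \<open>w b\<close> into one about the basis element \<open>b\<close> at the map
  \<open>h w\<close>.\<close>

lemma start_ract:
  assumes w: "w \<in> carrier (W H)" and u: "u \<in> carrier (U H m)"
  shows "start m X H (ract X h w) u = start m X H h (gact (U H m) w u)"
proof (cases m)
  case 0
  then show ?thesis using u by (simp add: start_simps \<mu>_ract[OF w q_closed[OF H]] q_gact[OF H w])
next
  case (Suc k)
  then show ?thesis
    using u by (simp add: start_simps \<kappa>_ract[OF w d_closed[OF H]] \<mu>_ract[OF w q_closed[OF H]] q_gact[OF H w] d_gact[OF H w])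
qed

end

context
  fixes X Y H h f assumes X: "X \<in> G.TG" and Y: "Y \<in> G.TG" and HI: "H \<in> I" and h: "h \<in> G.cmaps Y H"
    and f: "f \<in> gset_maps G X Y"
begin

lemma pullback_ract: "pullback X f (ract Y h w) = ract X (pullback X f h) w"
  using G.gset_maps_closed[OF f] by (auto simp: compose_def intro!: restrict_ext)

lemma \<kappa>_pull:
  assumes u: "u \<in> carrier (U H n)"
  shows "free_map R (S (Suc n) Y) (S (Suc n) X) (pull X f) (\<kappa> n Y H h u) = \<kappa> n X H (pullback X f h) u"
proof -
  have "free_map R (S (Suc n) Y) (S (Suc n) X) (pull X f) (\<kappa> n Y H h u) =
    free_map R (WB H n) (S (Suc n) X) (\<lambda>s. pull X f ((\<lambda>(w, b). Inl (H, ract Y h w, b)) s)) (crd H n u)"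
    unfolding \<kappa>_def by (rule free_map_comp[OF \<kappa>_map[OF Y HI h] pull_map[OF X f] crd_closed[OF I_family[OF HI] u]])
  also have "\<dots> = \<kappa> n X H (pullback X f h) u"
    unfolding \<kappa>_def by (rule free_map_cong) (auto simp: free_pull_def pullback_ract split: prod.split)
  finally show ?thesis .
qed

lemma \<mu>_pull:
  assumes y: "y \<in> carrier (A H m)"
  shows "free_map R (S m Y) (S m X) (pull X f) (\<mu> m Y H h y) = \<mu> m X H (pullback X f h) y"
proof -
  have "free_map R (S m Y) (S m X) (pull X f) (\<mu> m Y H h y) =
    free_map R (simplices (above \<H> H) m) (S m X) (\<lambda>\<tau>. pull X f (Inr (G.orbit_chain Y h (H # \<tau>)))) y"
    unfolding \<mu>_def by (rule free_map_comp[OF \<mu>_map[OF Y HI h] pull_map[OF X f] y])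
  also have "\<dots> = \<mu> m X H (pullback X f h) y"
    unfolding \<mu>_def by (rule free_map_cong) (simp add: G.orbit_chain_pull[OF f])
  finally show ?thesis .
qed

text \<open>Naturality in \<open>X\<close>: the leading part at \<open>id_map H\<close> determines
  it at every \<open>h\<close>.\<close>

lemma start_pull:
  assumes u: "u \<in> carrier (U H m)"
  shows "free_map R (S m Y) (S m X) (pull X f) (start m Y H h u) = start m X H (pullback X f h) u"
proof (cases m)
  case 0
  then show ?thesis using \<mu>_pull[OF q_closed[OF I_family[OF HI] u]] by (simp add: start_simps)
next
  case (Suc k)
  have u': "u \<in> carrier (U H (Suc k))" using u Suc by simp
  show ?thesis
    unfolding Suc start_simps
    using \<kappa>_closed[OF Y HI h d_closed[OF I_family[OF HI] u']] \<mu>_closed[OF Y HI h q_closed[OF I_family[OF HI] u']]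
      \<mu>_pull[OF q_closed[OF I_family[OF HI] u']] \<kappa>_pull[OF d_closed[OF I_family[OF HI] u']]
    by (simp add: module_hom_add[OF free_map_hom[OF pull_map[OF X f]]])
qed

end

end

section \<open>The complex of equivariant chains and its exactness\<close>

context bredon
begin

text \<open>From \<open>n + 1\<close> members to \<open>n\<close> members; \<open>cbd 0\<close> is
  therefore the augmentation.\<close>

definition cbd :: "nat \<Rightarrow> 'g gset \<Rightarrow> (('g set \<Rightarrow> 'g set list) \<Rightarrow> 'r) \<Rightarrow> ('g set \<Rightarrow> 'g set list) \<Rightarrow> 'r" where
  "cbd n X = boundary (G.chains (Suc n) X) (G.chains n X) (\<lambda>i \<sigma>. \<lambda>x\<in>fst X. simplex_face i (\<sigma> x)) n"

abbreviation "CM n X \<equiv> free_module R (G.chains n X)"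

context
  fixes X assumes X: "X \<in> G.TG"
begin

lemma face_map: "i \<le> n \<Longrightarrow> (\<lambda>\<sigma>. \<lambda>x\<in>fst X. simplex_face i (\<sigma> x)) \<in> G.chains (Suc n) X \<rightarrow> G.chains n X"
  using G.chains_face[OF X] by blast

lemma cbd_hom: "cbd n X \<in> module_hom R (CM (Suc n) X) (CM n X)"
  unfolding cbd_def by (rule boundary_hom[OF face_map])

lemma cbd_closed: "c \<in> carrier (CM (Suc n) X) \<Longrightarrow> cbd n X c \<in> carrier (CM n X)"
  by (rule module_hom_closed[OF cbd_hom])

lemma cbd_basis_support:
  assumes \<sigma>: "\<sigma> \<in> G.chains (Suc n) X" and \<rho>: "\<rho> \<in> G.chains n X" "cbd n X (free_basis R (G.chains (Suc n) X) \<sigma>) \<rho> \<noteq> \<zero>"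
  obtains i where "i \<le> n" "\<rho> = (\<lambda>x\<in>fst X. simplex_face i (\<sigma> x))"
proof -
  interpret F: Module.module R "CM n X" by (rule module_free_module)
  let ?e = "\<lambda>i. free_basis R (G.chains n X) (\<lambda>x\<in>fst X. simplex_face i (\<sigma> x))"
  have e: "?e i \<in> carrier (CM n X)" if "i \<le> n" for i
    using face_map[OF that] \<sigma> by (intro free_basis_carrier) blast
  have "cbd n X (free_basis R (G.chains (Suc n) X) \<sigma>) \<rho> = (\<Oplus>i\<in>{..n}. ((\<ominus> \<one>) [^] i) \<otimes> ?e i \<rho>)"
    using e \<rho>(1) unfolding cbd_def
    by (simp add: boundary_basis[OF face_map \<sigma>] free_module_finsum_apply Pi_iff)
  moreover have "(\<Oplus>i\<in>{..n}. ((\<ominus> \<one>) [^] i) \<otimes> ?e i \<rho>) = \<zero>" if "\<And>i. i \<le> n \<Longrightarrow> \<rho> \<noteq> (\<lambda>x\<in>fst X. simplex_face i (\<sigma> x))"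
    using that \<rho>(1) by (intro add.finprod_one_eqI) (simp add: free_basis_apply)
  ultimately show ?thesis using that \<rho>(2) by metis
qed

lemma cbd_natural:
  assumes Y: "Y \<in> G.TG" and f: "f \<in> gset_maps G Y X" and c: "c \<in> carrier (CM (Suc n) X)"
  shows "free_map R (G.chains n X) (G.chains n Y) (pullback Y f) (cbd n X c) =
    boundary (G.chains (Suc n) Y) (G.chains n Y) (\<lambda>i \<sigma>. \<lambda>x\<in>fst Y. simplex_face i (\<sigma> x)) n
      (free_map R (G.chains (Suc n) X) (G.chains (Suc n) Y) (pullback Y f) c)"
  unfolding cbd_def
proof (rule boundary_natural)
  show "(\<lambda>\<sigma>. \<lambda>x\<in>fst Y. simplex_face i (\<sigma> x)) \<in> G.chains (Suc n) Y \<rightarrow> G.chains n Y" if "i \<le> n" for i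
    using G.chains_face[OF Y that] by blast
  show "pullback Y f (\<lambda>x\<in>fst X. simplex_face i (\<sigma> x)) = (\<lambda>y\<in>fst Y. simplex_face i (pullback Y f \<sigma> y))" for i \<sigma>
    using G.gset_maps_closed[OF f] by (auto simp: compose_def intro!: restrict_ext)
qed (use face_map G.chains_pull[OF Y f] c in auto)

context
  fixes x0 assumes x0: "x0 \<in> fst X"
begin

abbreviation "ev n \<equiv> free_map R (G.chains n X) (simplices (G.over X x0) n) (\<lambda>\<sigma>. \<sigma> x0)"

lemma ev_map: "(\<lambda>\<sigma>. \<sigma> x0) \<in> G.chains n X \<rightarrow> simplices (G.over X x0) n"
  using G.chains_simplices[OF _ x0] by blast

lemma ev_hom: "ev n \<in> module_hom R (CM n X) (chain_module (G.over X x0) n)"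
  by (rule free_map_hom[OF ev_map])

lemma ev_bij: "bij_betw (ev n) (carrier (CM n X)) (carrier (chain_module (G.over X x0) n))"
  by (rule free_map_bij[OF G.chains_eval_bij[OF X x0]])

lemma ev_cbd: "c \<in> carrier (CM (Suc n) X) \<Longrightarrow> ev n (cbd n X c) = simplex_boundary (G.over X x0) n (ev (Suc n) c)"
  unfolding cbd_def
  by (rule boundary_natural) (use face_map ev_map x0 in \<open>auto intro: simplices_face\<close>)

lemma ev_inj: "c \<in> carrier (CM n X) \<Longrightarrow> c' \<in> carrier (CM n X) \<Longrightarrow> ev n c = ev n c' \<Longrightarrow> c = c'"
  using ev_bij by (auto simp: bij_betw_def dest: inj_onD)

lemma ev_surj:
  assumes "b \<in> carrier (chain_module (G.over X x0) n)"
  obtains c where "c \<in> carrier (CM n X)" "ev n c = b"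
proof -
  have "b \<in> ev n ` carrier (CM n X)" using assms bij_betw_imp_surj_on[OF ev_bij] by simp
  then show ?thesis using that by blast
qed

end

lemma cbd_cbd: "c \<in> carrier (CM (Suc (Suc n)) X) \<Longrightarrow> cbd n X (cbd (Suc n) X c) = \<zero>\<^bsub>CM n X\<^esub>"
proof -
  assume c: "c \<in> carrier (CM (Suc (Suc n)) X)"
  interpret F: Module.module R "CM n X" by (rule module_free_module)
  obtain x0 where x0: "x0 \<in> fst X" using G.gset_nonempty[OF X] by blast
  have c': "cbd (Suc n) X c \<in> carrier (CM (Suc n) X)" by (rule cbd_closed[OF c])
  have "ev x0 n (cbd n X (cbd (Suc n) X c)) = ev x0 n \<zero>\<^bsub>CM n X\<^esub>"
    using ev_cbd[OF x0 c'] ev_cbd[OF x0 c] simplex_boundary_boundary[OF module_hom_closed[OF ev_hom[OF x0] c]]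
      module_hom_zero[OF module_free_module module_free_module ev_hom[OF x0]] by simp
  then show ?thesis using ev_inj[OF x0] cbd_closed[OF c'] by blast
qed

text \<open>Evaluation at \<open>x0\<close> is an isomorphism of complexes onto the chains of
  \<open>over X x0\<close>, from which the contraction onto the stabilizer is carried back.\<close>

lemma cbd_exact:
  assumes c: "c \<in> carrier (CM (Suc n) X)" and z: "cbd n X c = \<zero>\<^bsub>CM n X\<^esub>"
  shows "\<exists>b\<in>carrier (CM (Suc (Suc n)) X). cbd (Suc n) X b = c"
proof -
  obtain x0 where x0: "x0 \<in> fst X" using G.gset_nonempty[OF X] by blast
  have T: "G.stab X x0 \<in> G.over X x0" "\<forall>L\<in>G.over X x0. G.stab X x0 \<subseteq> L"
    using G.stab_family[OF X x0] by auto
  have "simplex_boundary (G.over X x0) n (ev x0 (Suc n) c) = \<zero>\<^bsub>chain_module (G.over X x0) n\<^esub>"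
    using ev_cbd[OF x0 c] z module_hom_zero[OF module_free_module module_free_module ev_hom[OF x0]] by simp
  from simplex_boundary_exact[OF T module_hom_closed[OF ev_hom[OF x0] c] this]
  obtain b where b: "b \<in> carrier (chain_module (G.over X x0) (Suc (Suc n)))"
    "simplex_boundary (G.over X x0) (Suc n) b = ev x0 (Suc n) c" by blast
  obtain b' where b': "b' \<in> carrier (CM (Suc (Suc n)) X)" "ev x0 (Suc (Suc n)) b' = b"
    using ev_surj[OF x0 b(1)] .
  have "ev x0 (Suc n) (cbd (Suc n) X b') = ev x0 (Suc n) c" using ev_cbd[OF x0 b'(1)] b b' by simp
  then show ?thesis using ev_inj[OF x0 cbd_closed[OF b'(1)] c] b' by blast
qed

text \<open>In degree 0 the homotopy formula has no second term, so the contraction is a right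
  inverse of the augmentation.\<close>

lemma cbd_0_surj:
  assumes c: "c \<in> carrier (CM 0 X)"
  shows "\<exists>b\<in>carrier (CM (Suc 0) X). cbd 0 X b = c"
proof -
  obtain x0 where x0: "x0 \<in> fst X" using G.gset_nonempty[OF X] by blast
  have T: "G.stab X x0 \<in> G.over X x0" "\<forall>L\<in>G.over X x0. G.stab X x0 \<subseteq> L"
    using G.stab_family[OF X x0] by auto
  let ?b = "contraction (G.stab X x0) (G.over X x0) 0 (ev x0 0 c)"
  have e: "ev x0 0 c \<in> carrier (chain_module (G.over X x0) 0)" by (rule module_hom_closed[OF ev_hom[OF x0] c])
  obtain b' where b': "b' \<in> carrier (CM (Suc 0) X)" "ev x0 (Suc 0) b' = ?b"
    using ev_surj[OF x0 module_hom_closed[OF contraction_hom[OF T] e]] .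
  have "ev x0 0 (cbd 0 X b') = ev x0 0 c"
    using ev_cbd[OF x0 b'(1)] b' boundary_contraction_0[OF T e] by simp
  then show ?thesis using ev_inj[OF x0 cbd_closed[OF b'(1)] c] b' by blast
qed

context
  fixes H h assumes H: "H \<in> \<H>" and h: "h \<in> G.cmaps X H"
begin

abbreviation "orb n \<equiv> free_map R (simplices (G.upper H) n) (G.chains n X) (G.orbit_chain X h)"

lemma orbit_map: "G.orbit_chain X h \<in> simplices (G.upper H) n \<rightarrow> G.chains n X"
  using G.orbit_chain_chains[OF H X h] by blast

lemma orb_hom: "orb n \<in> module_hom R (chain_module (G.upper H) n) (CM n X)"
  by (rule free_map_hom[OF orbit_map])

lemma orb_boundary: "c \<in> carrier (chain_module (G.upper H) (Suc n)) \<Longrightarrow>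
    cbd n X (orb (Suc n) c) = orb n (simplex_boundary (G.upper H) n c)"
  unfolding cbd_def
  by (rule boundary_natural[symmetric])
     (use face_map orbit_map in \<open>auto simp: G.orbit_chain_face intro: simplices_face\<close>)

text \<open>The formula \<open>d (H \<tau>) = \<tau> - H (d \<tau>)\<close> transported along
  \<open>h\<close>. The first term collects the chains from which the head was deleted.\<close>

lemma orb_cone_boundary:
  assumes y: "y \<in> carrier (chain_module (above \<H> H) (Suc n))"
  shows "cbd (Suc n) X (orb (Suc (Suc n)) (cone H (above \<H> H) (G.upper H) (Suc n) y)) =
    orb (Suc n) (enlarge (above \<H> H) (G.upper H) (Suc n) y) \<ominus>\<^bsub>CM (Suc n) X\<^esub>
    orb (Suc n) (cone H (above \<H> H) (G.upper H) n (simplex_boundary (above \<H> H) n y))"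
proof -
  have ab: "\<forall>L\<in>above \<H> H. H \<subset> L" "H \<in> G.upper H" "above \<H> H \<subseteq> G.upper H"
    using H by (auto simp: above_def)
  show ?thesis
    using module_hom_closed[OF cone_hom[OF ab] y] module_hom_closed[OF enlarge_hom[OF ab(3)] y]
      module_hom_closed[OF cone_hom[OF ab] simplex_boundary_closed[OF y]]
    by (simp add: orb_boundary boundary_cone_Suc[OF ab y] module_hom_minus[OF module_free_module module_free_module orb_hom])
qed

end

end

end

section \<open>The cone differential and its triangular form\<close>

context bredon_resolution
begin

abbreviation "KM m X \<equiv> free_module R (S m X)"

definition emb where "emb m X = free_map R (G.chains (Suc m) X) (S m X) Inr"

lemma Inr_map: "Inr \<in> G.chains (Suc m) X \<rightarrow> S m X"
  by (simp add: S_Inr)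

lemma emb_hom: "emb m X \<in> module_hom R (CM (Suc m) X) (KM m X)"
  unfolding emb_def by (rule free_map_hom[OF Inr_map])

lemma emb_closed: "c \<in> carrier (CM (Suc m) X) \<Longrightarrow> emb m X c \<in> carrier (KM m X)"
  by (rule module_hom_closed[OF emb_hom])

lemma emb_basis: "\<sigma> \<in> G.chains (Suc m) X \<Longrightarrow> emb m X (free_basis R (G.chains (Suc m) X) \<sigma>) = free_basis R (S m X) (Inr \<sigma>)"
  unfolding emb_def by (rule free_map_basis[OF Inr_map])

lemma emb_support:
  assumes "emb m X c s \<noteq> \<zero>" "s \<in> S m X"
  obtains \<sigma> where "\<sigma> \<in> G.chains (Suc m) X" "s = Inr \<sigma>" "c \<sigma> \<noteq> \<zero>"
  using free_map_support[OF assms(1)[unfolded emb_def] assms(2)] by metis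

text \<open>Factoring \<open>\<mu>\<close> through the simplicial cone with apex \<open>H\<close>
  makes the boundary formula for cones available.\<close>

lemma \<mu>_eq:
  assumes X: "X \<in> G.TG" and HI: "H \<in> I" and h: "h \<in> G.cmaps X H" and y: "y \<in> carrier (A H m)"
  shows "\<mu> m X H h y = emb m X (free_map R (simplices (G.upper H) (Suc m)) (G.chains (Suc m) X) (G.orbit_chain X h)
    (cone H (above \<H> H) (G.upper H) m y))"
proof -
  have H: "H \<in> \<H>" by (rule I_family[OF HI])
  have ab: "\<forall>L\<in>above \<H> H. H \<subset> L" "H \<in> G.upper H" "above \<H> H \<subseteq> G.upper H"
    using H by (auto simp: above_def)
  have "emb m X (free_map R (simplices (G.upper H) (Suc m)) (G.chains (Suc m) X) (G.orbit_chain X h)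
    (cone H (above \<H> H) (G.upper H) m y)) =
    emb m X (free_map R (simplices (above \<H> H) m) (G.chains (Suc m) X) (\<lambda>\<tau>. G.orbit_chain X h (H # \<tau>)) y)"
    unfolding cone_def using free_map_comp[OF cone_map[OF ab] orbit_map[OF X H h] y] by simp
  also have "\<dots> = \<mu> m X H h y"
    unfolding emb_def \<mu>_def
    by (rule free_map_comp[OF _ Inr_map y]) (use G.orbit_chain_chains[OF H X h G.Cons_above_upper[OF H]] in blast)
  finally show ?thesis ..
qed

text \<open>The cone differential determined by the images \<open>\<delta> H b\<close> of the basis elements.\<close>

definition D where
  "D m \<delta> X = free_lift (S (Suc m) X) (KM m X) (case_sum
     (\<lambda>(H, h, b). free_map R (S m (coset_gset G H)) (S m X) (pull X h) (\<delta> H b))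
     (\<lambda>\<sigma>. emb m X (cbd (Suc m) X (free_basis R (G.chains (Suc (Suc m)) X) \<sigma>))))"

text \<open>The image of a generator equals the mapping cone differential up to terms of larger
  level. The estimate is required at every coset \<open>C\<close>, because pulling back along
  \<open>h\<close> reads heads at \<open>C = h x\<close>.\<close>

definition admissible where
  "admissible m \<delta> \<longleftrightarrow> (\<forall>H\<in>I. \<forall>b\<in>B H m. \<delta> H b \<in> carrier (KM m (coset_gset G H)) \<and>
     (\<forall>s\<in>S m (coset_gset G H). \<forall>C\<in>lcosets\<^bsub>G\<^esub> H.
       (\<delta> H b \<ominus>\<^bsub>KM m (coset_gset G H)\<^esub> start m (coset_gset G H) H (id_map H) b) s \<noteq> \<zero> \<longrightarrow>
       level H < level (head C s)))"

context
  fixes m \<delta> assumes adm: "admissible m \<delta>"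
begin

lemma \<delta>_closed: "H \<in> I \<Longrightarrow> b \<in> B H m \<Longrightarrow> \<delta> H b \<in> carrier (KM m (coset_gset G H))"
  using adm by (simp add: admissible_def)

lemma D_gens:
  assumes X: "X \<in> G.TG"
  shows "case_sum (\<lambda>(H, h, b). free_map R (S m (coset_gset G H)) (S m X) (pull X h) (\<delta> H b))
     (\<lambda>\<sigma>. emb m X (cbd (Suc m) X (free_basis R (G.chains (Suc (Suc m)) X) \<sigma>))) \<in> S (Suc m) X \<rightarrow> carrier (KM m X)"
proof (rule funcsetI)
  fix s assume "s \<in> S (Suc m) X"
  then show "case_sum (\<lambda>(H, h, b). free_map R (S m (coset_gset G H)) (S m X) (pull X h) (\<delta> H b))
     (\<lambda>\<sigma>. emb m X (cbd (Suc m) X (free_basis R (G.chains (Suc (Suc m)) X) \<sigma>))) s \<in> carrier (KM m X)"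
  proof (cases rule: S_cases)
    case (gen n H h b)
    then show ?thesis using free_map_closed[OF pull_map[OF X gen(4)] \<delta>_closed[OF gen(3)]] by simp
  qed (simp add: emb_closed cbd_closed[OF X])
qed

lemma D_hom: "X \<in> G.TG \<Longrightarrow> D m \<delta> X \<in> module_hom R (KM (Suc m) X) (KM m X)"
  unfolding D_def by (rule free_lift_hom[OF module_free_module D_gens])

lemma D_closed: "X \<in> G.TG \<Longrightarrow> c \<in> carrier (KM (Suc m) X) \<Longrightarrow> D m \<delta> X c \<in> carrier (KM m X)"
  by (rule module_hom_closed[OF D_hom])

lemma D_Inl:
  assumes "X \<in> G.TG" "H \<in> I" "h \<in> G.cmaps X H" "b \<in> B H m"
  shows "D m \<delta> X (free_basis R (S (Suc m) X) (Inl (H, h, b))) =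
    free_map R (S m (coset_gset G H)) (S m X) (pull X h) (\<delta> H b)"
  unfolding D_def using assms by (subst free_lift_basis[OF module_free_module D_gens]) (auto simp: S_Inl free_gens_iff)

lemma D_emb:
  assumes X: "X \<in> G.TG" and c: "c \<in> carrier (CM (Suc (Suc m)) X)"
  shows "D m \<delta> X (emb (Suc m) X c) = emb m X (cbd (Suc m) X c)"
proof (rule free_hom_eqI[where f="\<lambda>c. D m \<delta> X (emb (Suc m) X c)" and g="\<lambda>c. emb m X (cbd (Suc m) X c)",
      OF module_free_module module_hom_comp[OF emb_hom D_hom[OF X]] module_hom_comp[OF cbd_hom[OF X] emb_hom] _ c])
  fix \<sigma> assume \<sigma>: "\<sigma> \<in> G.chains (Suc (Suc m)) X"
  show "D m \<delta> X (emb (Suc m) X (free_basis R (G.chains (Suc (Suc m)) X) \<sigma>)) =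
      emb m X (cbd (Suc m) X (free_basis R (G.chains (Suc (Suc m)) X) \<sigma>))"
    unfolding emb_basis[OF \<sigma>] unfolding D_def
    using \<sigma> by (subst free_lift_basis[OF module_free_module D_gens[OF X]]) (auto simp: S_Inr)
qed

text \<open>On generators this is functoriality of \<open>pull\<close>, on chains naturality of the
  boundary.\<close>

lemma D_natural:
  assumes X: "X \<in> G.TG" and Y: "Y \<in> G.TG" and f: "f \<in> gset_maps G X Y" and c: "c \<in> carrier (KM (Suc m) Y)"
  shows "D m \<delta> X (free_map R (S (Suc m) Y) (S (Suc m) X) (pull X f) c) =
    free_map R (S m Y) (S m X) (pull X f) (D m \<delta> Y c)"
proof (rule free_hom_eqI[where f="\<lambda>c. D m \<delta> X (free_map R (S (Suc m) Y) (S (Suc m) X) (pull X f) c)" and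
      g="\<lambda>c. free_map R (S m Y) (S m X) (pull X f) (D m \<delta> Y c)",
      OF module_free_module module_hom_comp[OF free_map_hom[OF pull_map[OF X f]] D_hom[OF X]]
        module_hom_comp[OF D_hom[OF Y] free_map_hom[OF pull_map[OF X f]]] _ c])
  fix s assume s: "s \<in> S (Suc m) Y"
  then show "D m \<delta> X (free_map R (S (Suc m) Y) (S (Suc m) X) (pull X f) (free_basis R (S (Suc m) Y) s)) =
    free_map R (S m Y) (S m X) (pull X f) (D m \<delta> Y (free_basis R (S (Suc m) Y) s))"
  proof (cases rule: S_cases)
    case (gen n H h b)
    then have b: "b \<in> B H m" by auto
    have "free_map R (S m Y) (S m X) (pull X f) (free_map R (S m (coset_gset G H)) (S m Y) (pull Y h) (\<delta> H b)) =
      free_map R (S m (coset_gset G H)) (S m X) (\<lambda>s. pull X f (pull Y h s)) (\<delta> H b)"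
      by (rule free_map_comp[OF pull_map[OF Y gen(4)] pull_map[OF X f] \<delta>_closed[OF gen(3) b]])
    also have "\<dots> = free_map R (S m (coset_gset G H)) (S m X) (pull X (pullback X f h)) (\<delta> H b)"
    proof (rule free_map_cong)
      fix s show "pull X f (pull Y h s) = pull X (pullback X f h) s"
        using f by (cases s) (auto simp: free_pull_def pullback_comp split: prod.split)
    qed
    finally show ?thesis
      using gen(2) D_Inl[OF Y gen(3,4) b] D_Inl[OF X gen(3) G.gset_maps_compose[OF X f gen(4)] b]
        free_map_basis[OF pull_map[OF X f] s] by (simp add: free_pull_def)
  next
    case (chain \<sigma>)
    have pb: "pullback X f \<in> G.chains n Y \<rightarrow> G.chains n X" for n using G.chains_pull[OF X f] by blast
    have nat: "free_map R (S n Y) (S n X) (pull X f) (emb n Y c) =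
        emb n X (free_map R (G.chains (Suc n) Y) (G.chains (Suc n) X) (pullback X f) c)"
      if "c \<in> carrier (CM (Suc n) Y)" for n c
      unfolding emb_def
      by (simp add: free_map_comp[OF Inr_map pull_map[OF X f] that] free_map_comp[OF pb Inr_map that])
    let ?e = "free_basis R (G.chains (Suc (Suc m)) Y) \<sigma>"
    have e: "?e \<in> carrier (CM (Suc (Suc m)) Y)" using chain by simp
    have "free_basis R (S (Suc m) Y) s = emb (Suc m) Y ?e" using chain emb_basis by simp
    then show ?thesis
      using nat[OF e] nat[OF cbd_closed[OF Y e]] D_emb[OF Y e] D_emb[OF X, of "free_map R (G.chains (Suc (Suc m)) Y) (G.chains (Suc (Suc m)) X) (pullback X f) ?e"]
        cbd_natural[OF Y X f e] free_map_closed[OF pb e] by (simp add: cbd_def)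
  qed
qed

text \<open>The defining estimate at \<open>G/H\<close>, pulled back along \<open>h\<close>, where
  \<open>start\<close> at \<open>id_map H\<close> becomes \<open>start\<close> at
  \<open>h\<close>.\<close>

lemma D_gen_leading:
  assumes X: "X \<in> G.TG" and HI: "H \<in> I" and h: "h \<in> G.cmaps X H" and b: "b \<in> B H m" and x: "x \<in> fst X"
    and s: "s \<in> S m X"
    and nz: "(D m \<delta> X (free_basis R (S (Suc m) X) (Inl (H, h, b))) \<ominus>\<^bsub>KM m X\<^esub> start m X H h b) s \<noteq> \<zero>"
  shows "level H < level (head x s)"
proof -
  have H: "H \<in> \<H>" by (rule I_family[OF HI])
  let ?Y = "coset_gset G H"
  have Y: "?Y \<in> G.TG" by (rule G.coset_gset_transitive[OF H])
  have id: "id_map H \<in> G.cmaps ?Y H" by (rule id_map_cmaps[OF H])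
  have bU: "b \<in> carrier (U H m)" by (rule B_carrier[OF H b])
  have st: "start m ?Y H (id_map H) b \<in> carrier (KM m ?Y)" by (rule start_closed[OF Y HI id bU])
  have "D m \<delta> X (free_basis R (S (Suc m) X) (Inl (H, h, b))) \<ominus>\<^bsub>KM m X\<^esub> start m X H h b =
    free_map R (S m ?Y) (S m X) (pull X h) (\<delta> H b \<ominus>\<^bsub>KM m ?Y\<^esub> start m ?Y H (id_map H) b)"
    using start_pull[OF X Y HI id h bU] pullback_id_map[OF h]
    by (simp add: D_Inl[OF X HI h b] module_hom_minus[OF module_free_module module_free_module
          free_map_hom[OF pull_map[OF X h]] \<delta>_closed[OF HI b] st])
  then obtain s0 where s0: "s0 \<in> S m ?Y" "pull X h s0 = s" "(\<delta> H b \<ominus>\<^bsub>KM m ?Y\<^esub> start m ?Y H (id_map H) b) s0 \<noteq> \<zero>"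
    using nz free_map_support[OF _ s] by metis
  have "level H < level (head (h x) s0)"
    using adm HI b s0 G.cmaps_lcosets[OF h x] by (simp add: admissible_def)
  then show ?thesis using head_pull[OF x] s0(2) by metis
qed

text \<open>Passes from basis elements to all of \<open>P H m\<close>: the error is linear in
  \<open>u\<close>, so it suffices to treat \<open>w b\<close>, and by \<open>start_ract\<close>
  this is \<open>b\<close> at the map \<open>h w\<close>.\<close>

lemma D_\<kappa>:
  assumes X: "X \<in> G.TG" and HI: "H \<in> I" and h: "h \<in> G.cmaps X H" and u: "u \<in> carrier (U H m)" and x: "x \<in> fst X"
    and s: "s \<in> S m X" and nz: "(D m \<delta> X (\<kappa> m X H h u) \<ominus>\<^bsub>KM m X\<^esub> start m X H h u) s \<noteq> \<zero>"
  shows "level H < level (head x s)"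
proof -
  have H: "H \<in> \<H>" by (rule I_family[OF HI])
  obtain w b where w: "w \<in> carrier (W H)" and b: "b \<in> B H m"
    and nz': "(D m \<delta> X (\<kappa> m X H h (gact (U H m) w b)) \<ominus>\<^bsub>KM m X\<^esub> start m X H h (gact (U H m) w b)) s \<noteq> \<zero>"
    using U_hom_support[where f="\<lambda>u. D m \<delta> X (\<kappa> m X H h u) \<ominus>\<^bsub>KM m X\<^esub> start m X H h u",
        OF H module_hom_diff[OF module_U[OF H] module_free_module module_hom_comp[OF \<kappa>_hom[OF X HI h] D_hom[OF X]]
          start_hom[OF X HI h]] u s nz] .
  have hw: "ract X h w \<in> G.cmaps X H" by (rule ract_cmaps[OF X HI h w])
  show ?thesis
    using D_gen_leading[OF X HI hw b x s] nz' start_ract[OF X HI h w B_carrier[OF H b]] \<kappa>_gact_basis[OF X HI h w b]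
    by simp
qed

text \<open>In \<open>d (H \<tau>) = \<tau> - H (d \<tau>)\<close> the first term has heads of
  larger level, by \<open>level_strict\<close>. Within the fibre the chain boundary is therefore
  \<open>- bdA\<close>, the sign expected in a mapping cone.\<close>

lemma D_\<mu>:
  assumes X: "X \<in> G.TG" and HI: "H \<in> I" and h: "h \<in> G.cmaps X H" and y: "y \<in> carrier (A H (Suc m))" and x: "x \<in> fst X"
    and s: "s \<in> S m X" and nz: "(D m \<delta> X (\<mu> (Suc m) X H h y) \<oplus>\<^bsub>KM m X\<^esub> \<mu> m X H h (bdA H m y)) s \<noteq> \<zero>"
  shows "level H < level (head x s)"
proof -
  have H: "H \<in> \<H>" by (rule I_family[OF HI])
  have ab: "\<forall>L\<in>above \<H> H. H \<subset> L" "H \<in> G.upper H" "above \<H> H \<subseteq> G.upper H"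
    using H by (auto simp: above_def)
  interpret KM: Module.module R "KM m X" by (rule module_free_module)
  let ?orb = "\<lambda>n. free_map R (simplices (G.upper H) n) (G.chains n X) (G.orbit_chain X h)"
  let ?c = "\<lambda>m y. ?orb (Suc m) (cone H (above \<H> H) (G.upper H) m y)"
  let ?i = "?orb (Suc m) (enlarge (above \<H> H) (G.upper H) (Suc m) y)"
  have c: "?c n z \<in> carrier (CM (Suc n) X)" if "z \<in> carrier (A H n)" for n z
    by (rule module_hom_closed[OF orb_hom[OF X H h] module_hom_closed[OF cone_hom[OF ab] that]])
  have i: "?i \<in> carrier (CM (Suc m) X)"
    by (rule module_hom_closed[OF orb_hom[OF X H h] module_hom_closed[OF enlarge_hom[OF ab(3)] y]])
  have by': "bdA H m y \<in> carrier (A H m)" using y by simp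
  have "D m \<delta> X (\<mu> (Suc m) X H h y) = emb m X ?i \<ominus>\<^bsub>KM m X\<^esub> \<mu> m X H h (bdA H m y)"
    unfolding \<mu>_eq[OF X HI h y] \<mu>_eq[OF X HI h by'] D_emb[OF X c[OF y]] orb_cone_boundary[OF X H h y]
    by (rule module_hom_minus[OF module_free_module module_free_module emb_hom i c[OF by']])
  then have "D m \<delta> X (\<mu> (Suc m) X H h y) \<oplus>\<^bsub>KM m X\<^esub> \<mu> m X H h (bdA H m y) = emb m X ?i"
    using emb_closed[OF i] \<mu>_closed[OF X HI h by'] by (simp add: a_minus_def KM.a_assoc KM.l_neg)
  then have "emb m X ?i s \<noteq> \<zero>" using nz by simp
  from emb_support[OF this s] obtain \<sigma> where \<sigma>: "\<sigma> \<in> G.chains (Suc m) X" "s = Inr \<sigma>" "?i \<sigma> \<noteq> \<zero>" .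
  obtain \<tau> where \<tau>: "\<tau> \<in> simplices (G.upper H) (Suc m)" "G.orbit_chain X h \<tau> = \<sigma>"
    "enlarge (above \<H> H) (G.upper H) (Suc m) y \<tau> \<noteq> \<zero>"
    using free_map_support[OF \<sigma>(3,1)] by metis
  have "\<tau> \<in> simplices (above \<H> H) (Suc m)"
    using free_map_support[OF \<tau>(3)[unfolded enlarge_def] \<tau>(1)] by metis
  then obtain L \<tau>' where L: "\<tau> = L # \<tau>'" "L \<in> above \<H> H" by (cases \<tau>) (auto simp: simplices_def)
  obtain a where a: "a \<in> carrier G" "h x = a <#\<^bsub>G\<^esub> H" using G.cmaps_lcosets[OF h x] G.lcosetsE by metis
  have "head x s = conjugate G a L"
    using \<sigma> \<tau> L x a ab(3) by (auto simp: G.orbit_chain_def G.weyl_conjugate_upper[OF H])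
  then have "level (head x s) = level L"
    using L a by (simp add: G.level_conjugate G.family_carrier above_def)
  then show ?thesis using G.level_strict[OF bound H, of L] L by (simp add: above_def)
qed

text \<open>For generators the leading part stays in the fibre and the corrections lie higher. For
  chains, dropping the least member raises the level, and every other face keeps the head.\<close>

lemma D_triangular:
  assumes X: "X \<in> G.TG" and x: "x \<in> fst X" and s: "s \<in> S (Suc m) X" and t: "t \<in> S m X"
    and nz: "D m \<delta> X (free_basis R (S (Suc m) X) s) t \<noteq> \<zero>"
  shows "head x t = head x s \<or> level (head x s) < level (head x t)"
  using s
proof (cases rule: S_cases)
  case (gen n H h b)
  then have b: "b \<in> B H m" by auto
  have H: "H \<in> \<H>" using gen I_family by blast
  have st: "start m X H h b \<in> carrier (KM m X)" by (rule start_closed[OF X gen(3,4) B_carrier[OF H b]])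
  have hs: "head x s = weyl_conjugate G (h x) H" using gen by simp
  have Dc: "D m \<delta> X (free_basis R (S (Suc m) X) s) \<in> carrier (KM m X)" using s by (intro D_closed X) simp
  show ?thesis
  proof (cases "(D m \<delta> X (free_basis R (S (Suc m) X) s) \<ominus>\<^bsub>KM m X\<^esub> start m X H h b) t = \<zero>")
    case True
    then have "start m X H h b t \<noteq> \<zero>"
      using nz t st Dc by (simp add: minus_eq_zero_iff)
    then show ?thesis using start_head[OF X gen(3,4) B_carrier[OF H b] t _ x] hs by simp
  next
    case False
    then have "level H < level (head x t)"
      using D_gen_leading[OF X gen(3,4) b x t] gen by simp
    then show ?thesis using hs level_head[OF X gen(3,4) x] by simp
  qed
next
  case (chain \<sigma>)
  let ?e = "free_basis R (G.chains (Suc (Suc m)) X) \<sigma>"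
  have e: "?e \<in> carrier (CM (Suc (Suc m)) X)" using chain by simp
  have "D m \<delta> X (free_basis R (S (Suc m) X) s) = emb m X (cbd (Suc m) X ?e)"
    using D_emb[OF X e] chain emb_basis by simp
  then obtain \<rho> where \<rho>: "\<rho> \<in> G.chains (Suc m) X" "t = Inr \<rho>" "cbd (Suc m) X ?e \<rho> \<noteq> \<zero>"
    using emb_support[OF _ t] nz by metis
  obtain i where i: "i \<le> Suc m" "\<rho> = (\<lambda>x\<in>fst X. simplex_face i (\<sigma> x))"
    using cbd_basis_support[OF X chain(2) \<rho>(1,3)] .
  have "\<sigma> x \<in> simplices (G.over X x) (Suc (Suc m))" by (rule G.chains_simplices[OF chain(2) x])
  \<comment> \<open>In degree \<open>Suc m\<close> a chain has at least two members, so face 0 still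
    has a head, namely \<open>L\<close>.\<close>
  then obtain K L \<tau> where KL: "\<sigma> x = K # L # \<tau>" "K \<subset> L" "K \<in> \<H>" "L \<in> \<H>"
    by (cases "\<sigma> x"; cases "tl (\<sigma> x)") (auto simp: simplices_def)
  show ?thesis
  proof (cases i)
    case 0
    then have "head x t = L" "head x s = K" using \<rho> i x KL chain by (simp_all add: simplex_face_def)
    then show ?thesis using G.level_strict[OF bound KL(3,4,2)] by simp
  next
    case (Suc j)
    then have "head x t = K" "head x s = K" using \<rho> i x KL chain by (simp_all add: simplex_face_def)
    then show ?thesis by simp
  qed
qed

end

end

context cring
begin

text \<open>Injectivity of \<open>\<phi>\<close> keeps the support finite.\<close>

lemma free_module_restrict:
  assumes \<phi>: "inj_on \<phi> S" "\<phi> \<in> S \<rightarrow> T" and c: "c \<in> carrier (free_module R T)"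
  shows "(\<lambda>s\<in>S. c (\<phi> s)) \<in> carrier (free_module R S)"
proof -
  have "inj_on \<phi> {s \<in> S. c (\<phi> s) \<noteq> \<zero>}" by (rule inj_on_subset[OF \<phi>(1)]) auto
  moreover have "\<phi> ` {s \<in> S. c (\<phi> s) \<noteq> \<zero>} \<subseteq> {t \<in> T. c t \<noteq> \<zero>}" using \<phi>(2) by auto
  ultimately have "finite {s \<in> S. c (\<phi> s) \<noteq> \<zero>}"
    using free_module_finite[OF c] by (meson finite_imageD finite_subset)
  moreover have "{s \<in> S. (\<lambda>s\<in>S. c (\<phi> s)) s \<noteq> \<zero>} = {s \<in> S. c (\<phi> s) \<noteq> \<zero>}" by auto
  moreover have "c (\<phi> s) \<in> carrier R" if "s \<in> S" for s
    by (rule free_module_closed[OF c]) (use that \<phi>(2) in blast)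
  ultimately show ?thesis
    by (simp add: free_module_carrier_iff[of _ S])
qed

end

section \<open>Exactness on a single fibre\<close>

context bredon_resolution
begin

context
  fixes X x0 H h g
  assumes X: "X \<in> G.TG" and x0: "x0 \<in> fst X" and HI: "H \<in> I" and h: "h \<in> G.cmaps X H"
    and g: "g \<in> carrier G" "h x0 = g <#\<^bsub>G\<^esub> H"
begin

abbreviation "fibre_head \<equiv> conjugate G g H"

lemma HF: "H \<in> \<H>" by (rule I_family[OF HI])

lemma fibre_head_eq: "weyl_conjugate G (h x0) H = fibre_head"
  using G.weyl_conjugate_upper[OF HF g(1), of H] HF g(2) by simp

lemma ract_at: "w \<in> carrier (W H) \<Longrightarrow> n \<in> carrier G \<Longrightarrow> conjugate G n H = H \<Longrightarrow> w = n <#\<^bsub>G\<^esub> H \<Longrightarrow>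
    ract X h w x0 = (g \<otimes>\<^bsub>G\<^esub> n) <#\<^bsub>G\<^esub> H"
  using x0 g G.lcoset_mult_weyl[OF G.family_subgroup[OF HF]] by simp

text \<open>At \<open>x0\<close> the translated map has the value \<open>g k H\<close>, which
  determines \<open>w = k H\<close>.\<close>

lemma \<kappa>_inj: "inj_on (\<lambda>(w, b). Inl (H, ract X h w, b)) (WB H n)"
proof (rule inj_onI, clarsimp)
  fix w w' assume w: "w \<in> carrier (W H)" "w' \<in> carrier (W H)" and eq: "ract X h w = ract X h w'"
  obtain k where k: "k \<in> carrier G" "conjugate G k H = H" "w = k <#\<^bsub>G\<^esub> H"
    using G.weyl_group_carrierE[OF G.family_subgroup[OF HF] w(1)] .
  obtain k' where k': "k' \<in> carrier G" "conjugate G k' H = H" "w' = k' <#\<^bsub>G\<^esub> H"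
    using G.weyl_group_carrierE[OF G.family_subgroup[OF HF] w(2)] .
  have "(g \<otimes>\<^bsub>G\<^esub> k) <#\<^bsub>G\<^esub> H = (g \<otimes>\<^bsub>G\<^esub> k') <#\<^bsub>G\<^esub> H"
    using ract_at[OF w(1) k] ract_at[OF w(2) k'] eq by simp
  then have "inv\<^bsub>G\<^esub> (g \<otimes>\<^bsub>G\<^esub> k) \<otimes>\<^bsub>G\<^esub> (g \<otimes>\<^bsub>G\<^esub> k') \<in> H"
    using g k k' by (subst (asm) G.lcoset_eq_iff[OF G.family_subgroup[OF HF]]) auto
  moreover have "inv\<^bsub>G\<^esub> (g \<otimes>\<^bsub>G\<^esub> k) \<otimes>\<^bsub>G\<^esub> (g \<otimes>\<^bsub>G\<^esub> k') = inv\<^bsub>G\<^esub> k \<otimes>\<^bsub>G\<^esub> k'"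
    using g k k' by (simp add: G.inv_mult_group G.m_assoc) (simp flip: G.m_assoc)
  ultimately show "w = w'"
    using k k' by (simp add: G.lcoset_eq_iff[OF G.family_subgroup[OF HF]])
qed

lemma \<mu>_inj: "inj_on (\<lambda>\<tau>. Inr (G.orbit_chain X h (H # \<tau>))) (simplices (above \<H> H) m)"
  using bij_betw_imp_inj_on[OF G.orbit_chain_bij[where h=h and n=m, OF HF X x0 h g]] by (auto simp: inj_on_def)

lemma fibre_Inr:
  assumes "Inr \<sigma> \<in> S m X" "head x0 (Inr \<sigma>) = fibre_head"
  obtains \<tau> where "\<tau> \<in> simplices (above \<H> H) m" "\<sigma> = G.orbit_chain X h (H # \<tau>)"
proof -
  have "\<sigma> \<in> {\<sigma> \<in> G.chains (Suc m) X. hd (\<sigma> x0) = fibre_head}" using assms by (simp add: S_Inr)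
  then have "\<sigma> \<in> (\<lambda>\<tau>. G.orbit_chain X h (H # \<tau>)) ` simplices (above \<H> H) m"
    using bij_betw_imp_surj_on[OF G.orbit_chain_bij[where h=h and n=m, OF HF X x0 h g]] by simp
  then show ?thesis using that by blast
qed

text \<open>\<open>I\<close> contains one representative of each conjugacy class, which forces
  \<open>H' = H\<close>. Then \<open>inv g \<otimes> a\<close> normalizes \<open>H\<close> and gives
  the required \<open>w\<close>, since equivariant maps that agree at \<open>x0\<close>
  agree.\<close>

lemma fibre_Inl:
  assumes t: "Inl t \<in> S m X" and hd: "head x0 (Inl t) = fibre_head"
  obtains n w b where "m = Suc n" "w \<in> carrier (W H)" "b \<in> B H n" "t = (H, ract X h w, b)"
proof -
  from t obtain n H' h' b where t': "m = Suc n" "t = (H', h', b)" "H' \<in> I" "h' \<in> G.cmaps X H'" "b \<in> B H' n"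
    by (auto simp: S_Inl free_gens_def)
  have H': "H' \<in> \<H>" by (rule I_family[OF t'(3)])
  obtain a where a: "a \<in> carrier G" "h' x0 = a <#\<^bsub>G\<^esub> H'" using G.cmaps_lcosets[OF t'(4) x0] G.lcosetsE by metis
  have eq: "conjugate G a H' = conjugate G g H"
    using hd t' a H' by (simp add: G.weyl_conjugate_upper[OF H'])
  have uniq: "\<exists>!L. L \<in> I \<and> (\<exists>k\<in>carrier G. conjugate G g H = conjugate G k L)"
    using reps G.family_conjugate[OF HF g(1)] by (simp add: is_conjugacy_representatives_def)
  then have HH: "H' = H"
    using t'(3) HI a(1) g(1) eq[symmetric] by (metis)
  let ?k = "inv\<^bsub>G\<^esub> g \<otimes>\<^bsub>G\<^esub> a"
  have k: "?k \<in> carrier G" using a g by simp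
  have cH: "conjugate G ?k H = H"
    using eq a g HH G.family_carrier[OF HF] by (simp add: G.conjugate_mult G.conjugate_inv)
  have w: "?k <#\<^bsub>G\<^esub> H \<in> carrier (W H)"
    by (rule G.weyl_group_carrierI[OF G.family_subgroup[OF HF] k cH])
  have "ract X h (?k <#\<^bsub>G\<^esub> H) x0 = (g \<otimes>\<^bsub>G\<^esub> ?k) <#\<^bsub>G\<^esub> H" by (rule ract_at[OF w k cH refl])
  also have "g \<otimes>\<^bsub>G\<^esub> ?k = a" using g a by (simp flip: G.m_assoc)
  finally have "ract X h (?k <#\<^bsub>G\<^esub> H) = h'"
    using G.gset_maps_eqI[OF X x0 ract_cmaps[OF X HI h w] t'(4)[unfolded HH]] a HH by simp
  then show ?thesis using that t' w HH by blast
qed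

lemma \<kappa>_at:
  assumes "u \<in> carrier (U H n)" "w \<in> carrier (W H)" "b \<in> B H n"
  shows "\<kappa> n X H h u (Inl (H, ract X h w, b)) = crd H n u (w, b)"
  using free_map_inj_apply[OF \<kappa>_inj \<kappa>_map[OF X HI h] crd_closed[OF HF assms(1)], of "(w, b)"] assms
  by (simp add: \<kappa>_def)

lemma \<kappa>_Inr:
  assumes "Inr \<sigma> \<in> S (Suc n) X"
  shows "\<kappa> n X H h u (Inr \<sigma>) = \<zero>"
proof (rule ccontr)
  assume "\<kappa> n X H h u (Inr \<sigma>) \<noteq> \<zero>"
  from free_map_support[OF this[unfolded \<kappa>_def] assms] show False by auto
qed

lemma \<mu>_at:
  assumes "y \<in> carrier (A H m)" "\<tau> \<in> simplices (above \<H> H) m"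
  shows "\<mu> m X H h y (Inr (G.orbit_chain X h (H # \<tau>))) = y \<tau>"
  unfolding \<mu>_def using free_map_inj_apply[OF \<mu>_inj \<mu>_map[OF X HI h] assms] .

lemma \<mu>_Inl:
  assumes "Inl t \<in> S m X"
  shows "\<mu> m X H h y (Inl t) = \<zero>"
proof (rule ccontr)
  assume "\<mu> m X H h y (Inl t) \<noteq> \<zero>"
  from free_map_support[OF this[unfolded \<mu>_def] assms] show False by auto
qed

lemma fibre_eq_0:
  assumes z: "z \<in> carrier (KM 0 X)"
  obtains y where "y \<in> carrier (A H 0)" "\<And>s. s \<in> S 0 X \<Longrightarrow> head x0 s = fibre_head \<Longrightarrow> z s = \<mu> 0 X H h y s"
proof -
  let ?y = "\<lambda>\<tau>\<in>simplices (above \<H> H) 0. z (Inr (G.orbit_chain X h (H # \<tau>)))"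
  have y: "?y \<in> carrier (A H 0)" by (rule free_module_restrict[OF \<mu>_inj \<mu>_map[OF X HI h] z])
  have "z s = \<mu> 0 X H h ?y s" if s: "s \<in> S 0 X" "head x0 s = fibre_head" for s
  proof (cases s)
    case (Inl t)
    then show ?thesis using s by (simp add: S_Inl)
  next
    case (Inr \<sigma>)
    obtain \<tau> where \<tau>: "\<tau> \<in> simplices (above \<H> H) 0" "\<sigma> = G.orbit_chain X h (H # \<tau>)"
      by (rule fibre_Inr[OF s[unfolded Inr]])
    then show ?thesis using \<mu>_at[OF y \<tau>(1)] Inr by simp
  qed
  then show ?thesis using that y by blast
qed

text \<open>The part of \<open>z\<close> on the fibre is an element \<open>(u, y)\<close> of the
  mapping cone of \<open>q H\<close>: the embeddings \<open>\<kappa>\<close> and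
  \<open>\<mu>\<close> relabel injectively and together reach the whole fibre, so \<open>u\<close>
  and \<open>y\<close> can be read off from the coefficients.\<close>

lemma fibre_eq_Suc:
  assumes z: "z \<in> carrier (KM (Suc n) X)"
  obtains u y where "u \<in> carrier (U H n)" "y \<in> carrier (A H (Suc n))"
    "\<And>s. s \<in> S (Suc n) X \<Longrightarrow> head x0 s = fibre_head \<Longrightarrow>
      z s = (\<kappa> n X H h u \<oplus>\<^bsub>KM (Suc n) X\<^esub> \<mu> (Suc n) X H h y) s"
proof -
  let ?y = "\<lambda>\<tau>\<in>simplices (above \<H> H) (Suc n). z (Inr (G.orbit_chain X h (H # \<tau>)))"
  have y: "?y \<in> carrier (A H (Suc n))" by (rule free_module_restrict[OF \<mu>_inj \<mu>_map[OF X HI h] z])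
  let ?c = "\<lambda>p\<in>WB H n. z ((\<lambda>(w, b). Inl (H, ract X h w, b)) p)"
  have c: "?c \<in> carrier (free_module R (WB H n))" by (rule free_module_restrict[OF \<kappa>_inj \<kappa>_map[OF X HI h] z])
  obtain u where u: "u \<in> carrier (U H n)" "crd H n u = ?c" using crd_surj[OF HF c] .
  have "z s = (\<kappa> n X H h u \<oplus>\<^bsub>KM (Suc n) X\<^esub> \<mu> (Suc n) X H h ?y) s"
    if s: "s \<in> S (Suc n) X" "head x0 s = fibre_head" for s
  proof (cases s)
    case (Inl t)
    obtain n' w b where "Suc n = Suc n'" and w': "w \<in> carrier (W H)" "b \<in> B H n'" "t = (H, ract X h w, b)"
      by (rule fibre_Inl[OF s[unfolded Inl]])
    then have w: "w \<in> carrier (W H)" "b \<in> B H n" "t = (H, ract X h w, b)" by auto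
    have "\<kappa> n X H h u s = z s" using \<kappa>_at[OF u(1) w(1,2)] w Inl by (simp add: u(2))
    moreover have "\<mu> (Suc n) X H h ?y s = \<zero>" using \<mu>_Inl s Inl by simp
    ultimately show ?thesis using s z by simp
  next
    case (Inr \<sigma>)
    obtain \<tau> where \<tau>: "\<tau> \<in> simplices (above \<H> H) (Suc n)" "\<sigma> = G.orbit_chain X h (H # \<tau>)"
      by (rule fibre_Inr[OF s[unfolded Inr]])
    have "\<mu> (Suc n) X H h ?y s = z s" using \<mu>_at[OF y \<tau>(1)] \<tau> Inr by simp
    moreover have "\<kappa> n X H h u s = \<zero>" using \<kappa>_Inr s Inr by simp
    ultimately show ?thesis using s z by simp
  qed
  then show ?thesis using that u y by blast
qed

lemma orbit_in_fibre:
  "\<tau> \<in> simplices (above \<H> H) m \<Longrightarrow> Inr (G.orbit_chain X h (H # \<tau>)) \<in> S m X \<and>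
    head x0 (Inr (G.orbit_chain X h (H # \<tau>))) = fibre_head"
  using \<mu>_map[OF X HI h] orbit_chain_head[OF X HI h x0, of \<tau> m] fibre_head_eq by auto

lemma gen_in_fibre:
  "w \<in> carrier (W H) \<Longrightarrow> b \<in> B H n \<Longrightarrow> Inl (H, ract X h w, b) \<in> S (Suc n) X \<and>
    head x0 (Inl (H, ract X h w, b)) = fibre_head"
  using funcset_mem[OF \<kappa>_map[OF X HI h, of n], of "(w, b)"] weyl_conjugate_ract[OF X HI h x0, of w] fibre_head_eq
  by simp

lemma fibre_zero_0:
  assumes y: "y \<in> carrier (A H 0)" and zero: "\<And>s. s \<in> S 0 X \<Longrightarrow> head x0 s = fibre_head \<Longrightarrow> \<mu> 0 X H h y s = \<zero>"
  shows "y = \<zero>\<^bsub>A H 0\<^esub>"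
proof (rule free_module_eqI[OF y])
  interpret A: Module.module R "A H 0" by (rule module_free_module)
  show "\<zero>\<^bsub>A H 0\<^esub> \<in> carrier (A H 0)" by simp
  fix \<tau> assume \<tau>: "\<tau> \<in> simplices (above \<H> H) 0"
  then show "y \<tau> = \<zero>\<^bsub>A H 0\<^esub> \<tau>"
    using \<mu>_at[OF y \<tau>] zero[of "Inr (G.orbit_chain X h (H # \<tau>))"] orbit_in_fibre[OF \<tau>] by simp
qed

text \<open>Complements \<open>fibre_eq_Suc\<close>: the pair \<open>(u, y)\<close> is determined by
  the coefficients on the fibre.\<close>

lemma fibre_zero_Suc:
  assumes u: "u \<in> carrier (U H n)" and y: "y \<in> carrier (A H (Suc n))"
    and zero: "\<And>s. s \<in> S (Suc n) X \<Longrightarrow> head x0 s = fibre_head \<Longrightarrow>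
      (\<kappa> n X H h u \<oplus>\<^bsub>KM (Suc n) X\<^esub> \<mu> (Suc n) X H h y) s = \<zero>"
  shows "u = \<zero>\<^bsub>U H n\<^esub>" "y = \<zero>\<^bsub>A H (Suc n)\<^esub>"
proof -
  interpret A: Module.module R "A H (Suc n)" by (rule module_free_module)
  interpret C: Module.module R "free_module R (WB H n)" by (rule module_free_module)
  interpret UM: Module.module R "U H n" by (rule module_U[OF HF])
  have kc: "\<kappa> n X H h u \<in> carrier (KM (Suc n) X)" "\<mu> (Suc n) X H h y \<in> carrier (KM (Suc n) X)"
    by (rule \<kappa>_closed[OF X HI h u], rule \<mu>_closed[OF X HI h y])
  show "y = \<zero>\<^bsub>A H (Suc n)\<^esub>"
  proof (rule free_module_eqI[OF y])
    fix \<tau> assume \<tau>: "\<tau> \<in> simplices (above \<H> H) (Suc n)"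
    let ?s = "Inr (G.orbit_chain X h (H # \<tau>))"
    have s: "?s \<in> S (Suc n) X" "head x0 ?s = fibre_head" using orbit_in_fibre[OF \<tau>] by auto
    have "\<kappa> n X H h u ?s \<oplus> \<mu> (Suc n) X H h y ?s = \<zero>" using zero[OF s] s(1) by simp
    then show "y \<tau> = \<zero>\<^bsub>A H (Suc n)\<^esub> \<tau>"
      using \<mu>_at[OF y \<tau>] \<kappa>_Inr[OF s(1)] y \<tau> by simp
  qed simp
  have "crd H n u = \<zero>\<^bsub>free_module R (WB H n)\<^esub>"
  proof (rule free_module_eqI[OF crd_closed[OF HF u]])
    fix p assume p: "p \<in> WB H n"
    then obtain w b where wb: "p = (w, b)" "w \<in> carrier (W H)" "b \<in> B H n" by auto
    let ?s = "Inl (H, ract X h w, b)"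
    have s: "?s \<in> S (Suc n) X" "head x0 ?s = fibre_head" using gen_in_fibre[OF wb(2,3)] by auto
    have "\<kappa> n X H h u ?s \<oplus> \<mu> (Suc n) X H h y ?s = \<zero>" using zero[OF s] s(1) by simp
    then show "crd H n u p = \<zero>\<^bsub>free_module R (WB H n)\<^esub> p"
      using \<kappa>_at[OF u wb(2,3)] \<mu>_Inl[OF s(1)] crd_closed[OF HF u] p wb by simp
  qed simp
  then have "crd H n u = crd H n \<zero>\<^bsub>U H n\<^esub>"
    using module_hom_zero[OF module_U[OF HF] module_free_module crd_hom[OF HF]] by simp
  then show "u = \<zero>\<^bsub>U H n\<^esub>" using crd_inj[OF HF u UM.zero_closed] by simp
qed

lemma level_fibre_head: "level fibre_head = level H"
  using level_head[OF X HI h x0] fibre_head_eq by simp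

text \<open>On the fibre, \<open>D\<close> is the differential of the mapping cone.\<close>

lemma D_fibre:
  assumes adm: "admissible m \<delta>" and u: "u \<in> carrier (U H m)" and y: "y \<in> carrier (A H (Suc m))"
    and s: "s \<in> S m X" "head x0 s = fibre_head"
  shows "D m \<delta> X (\<kappa> m X H h u \<oplus>\<^bsub>KM (Suc m) X\<^esub> \<mu> (Suc m) X H h y) s =
    start m X H h u s \<ominus> \<mu> m X H h (bdA H m y) s"
proof -
  have nl: "\<not> level H < level (head x0 s)" using s(2) level_fibre_head by simp
  have kc: "\<kappa> m X H h u \<in> carrier (KM (Suc m) X)" "\<mu> (Suc m) X H h y \<in> carrier (KM (Suc m) X)"
    by (rule \<kappa>_closed[OF X HI h u], rule \<mu>_closed[OF X HI h y])
  have Dc: "D m \<delta> X (\<kappa> m X H h u) \<in> carrier (KM m X)" "D m \<delta> X (\<mu> (Suc m) X H h y) \<in> carrier (KM m X)"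
    using kc by (auto intro: D_closed[OF adm X])
  have sc: "start m X H h u \<in> carrier (KM m X)" by (rule start_closed[OF X HI h u])
  have mc: "\<mu> m X H h (bdA H m y) \<in> carrier (KM m X)"
    using y by (intro \<mu>_closed[OF X HI h]) simp
  have "(D m \<delta> X (\<kappa> m X H h u) \<ominus>\<^bsub>KM m X\<^esub> start m X H h u) s = \<zero>"
    using D_\<kappa>[OF adm X HI h u x0 s(1)] nl by blast
  then have 1: "D m \<delta> X (\<kappa> m X H h u) s = start m X H h u s"
    using Dc(1) sc s(1) by (simp add: minus_eq_zero_iff)
  have "(D m \<delta> X (\<mu> (Suc m) X H h y) \<oplus>\<^bsub>KM m X\<^esub> \<mu> m X H h (bdA H m y)) s = \<zero>"
    using D_\<mu>[OF adm X HI h y x0 s(1)] nl by blast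
  then have "D m \<delta> X (\<mu> (Suc m) X H h y) s \<oplus> \<mu> m X H h (bdA H m y) s = \<zero>" using s(1) by simp
  then have 2: "D m \<delta> X (\<mu> (Suc m) X H h y) s = \<ominus> \<mu> m X H h (bdA H m y) s"
    using Dc(2) mc s(1) by (metis add.inv_equality free_module_closed minus_equality)
  show ?thesis
    using 1 2 s(1) kc by (simp add: module_hom_add[OF D_hom[OF adm X]] a_minus_def)
qed

lemma \<kappa>_\<mu>_support:
  assumes u: "u \<in> carrier (U H m)"
    and s: "s \<in> S (Suc m) X" "(\<kappa> m X H h u \<oplus>\<^bsub>KM (Suc m) X\<^esub> \<mu> (Suc m) X H h y) s \<noteq> \<zero>"
  shows "head x0 s = fibre_head"
proof -
  have "\<kappa> m X H h u s \<noteq> \<zero> \<or> \<mu> (Suc m) X H h y s \<noteq> \<zero>" using s by auto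
  then show ?thesis
    using \<kappa>_head[OF X HI h u s(1) _ x0] \<mu>_head[OF X HI h s(1) _ x0] fibre_head_eq by auto
qed

lemma fibre_exact_0:
  assumes adm: "admissible 0 \<delta>" and z: "z \<in> carrier (KM 0 X)"
  shows "\<exists>c\<in>carrier (KM (Suc 0) X). (\<forall>s\<in>S (Suc 0) X. c s \<noteq> \<zero> \<longrightarrow> head x0 s = fibre_head) \<and>
    (\<forall>t\<in>S 0 X. head x0 t = fibre_head \<longrightarrow> D 0 \<delta> X c t = z t)"
proof -
  interpret A0: Module.module R "A H 0" by (rule module_free_module)
  interpret A1: Module.module R "A H (Suc 0)" by (rule module_free_module)
  interpret K1: Module.module R "KM (Suc 0) X" by (rule module_free_module)
  obtain y where y: "y \<in> carrier (A H 0)" and zy: "\<And>s. s \<in> S 0 X \<Longrightarrow> head x0 s = fibre_head \<Longrightarrow> z s = \<mu> 0 X H h y s"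
    using fibre_eq_0[OF z] by metis
  obtain u b where u: "u \<in> carrier (U H 0)" and b: "b \<in> carrier (A H (Suc 0))"
    and eq: "y = bdA H 0 b \<oplus>\<^bsub>A H 0\<^esub> q H 0 u"
    using acyclic_0[OF HF y] by blast
  \<comment> \<open>The sign makes up for \<open>D\<close> acting on the chains of the fibre as
    \<open>- bdA\<close>.\<close>
  let ?b = "\<ominus>\<^bsub>A H (Suc 0)\<^esub> b"
  let ?c = "\<kappa> 0 X H h u \<oplus>\<^bsub>KM (Suc 0) X\<^esub> \<mu> (Suc 0) X H h ?b"
  have b': "?b \<in> carrier (A H (Suc 0))" using b by simp
  have bb: "bdA H 0 b \<in> carrier (A H 0)" "q H 0 u \<in> carrier (A H 0)" using b q_closed[OF HF u] by simp_all
  have mneg: "\<mu> 0 X H h (bdA H 0 ?b) = \<ominus>\<^bsub>KM 0 X\<^esub> \<mu> 0 X H h (bdA H 0 b)"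
    using bb(1) by (simp add: module_hom_a_inv[OF module_free_module module_free_module simplex_boundary_hom b]
        module_hom_a_inv[OF module_free_module module_free_module \<mu>_hom[OF X HI h]])
  have "D 0 \<delta> X ?c t = z t" if t: "t \<in> S 0 X" "head x0 t = fibre_head" for t
  proof -
    interpret K0: Module.module R "KM 0 X" by (rule module_free_module)
    have c: "\<mu> 0 X H h (bdA H 0 b) \<in> carrier (KM 0 X)" "\<mu> 0 X H h (q H 0 u) \<in> carrier (KM 0 X)"
      using bb by (auto intro: \<mu>_closed[OF X HI h])
    have neg: "(\<ominus>\<^bsub>KM 0 X\<^esub> \<mu> 0 X H h (bdA H 0 b)) t = \<ominus> \<mu> 0 X H h (bdA H 0 b) t"
      using free_module_minus_apply[OF t(1) K0.zero_closed c(1)] t(1) c(1) by (simp add: a_minus_def)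
    have "D 0 \<delta> X ?c t = \<mu> 0 X H h (q H 0 u) t \<ominus> (\<ominus> \<mu> 0 X H h (bdA H 0 b) t)"
      using D_fibre[OF adm u b' t] by (simp add: start_simps mneg neg)
    also have "\<dots> = \<mu> 0 X H h y t"
      unfolding eq module_hom_add[OF \<mu>_hom[OF X HI h] bb] using t c by (simp add: a_minus_def a_comm)
    finally show ?thesis using zy[OF t] by simp
  qed
  moreover have "?c \<in> carrier (KM (Suc 0) X)"
    using \<kappa>_closed[OF X HI h u] \<mu>_closed[OF X HI h b'] by simp
  ultimately show ?thesis using \<kappa>_\<mu>_support[OF u] by blast
qed

text \<open>Because \<open>z\<close> has nothing below the level of the fibre, its part
  \<open>(u, y)\<close> there is a cycle of the mapping cone of \<open>q H\<close>. Acyclicity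
  yields a preimage \<open>(v, b)\<close>, which gives \<open>c\<close> after a change of sign of
  \<open>b\<close>.\<close>

lemma fibre_exact_Suc:
  assumes adm: "admissible (Suc m) \<delta>" and adm': "admissible m \<delta>'" and z: "z \<in> carrier (KM (Suc m) X)"
    and Dz: "D m \<delta>' X z = \<zero>\<^bsub>KM m X\<^esub>"
    and lev: "\<And>s. s \<in> S (Suc m) X \<Longrightarrow> z s \<noteq> \<zero> \<Longrightarrow> level fibre_head \<le> level (head x0 s)"
  shows "\<exists>c\<in>carrier (KM (Suc (Suc m)) X). (\<forall>s\<in>S (Suc (Suc m)) X. c s \<noteq> \<zero> \<longrightarrow> head x0 s = fibre_head) \<and>
    (\<forall>t\<in>S (Suc m) X. head x0 t = fibre_head \<longrightarrow> D (Suc m) \<delta> X c t = z t)"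
proof -
  interpret A0: Module.module R "A H m" by (rule module_free_module)
  interpret A2: Module.module R "A H (Suc (Suc m))" by (rule module_free_module)
  interpret K0: Module.module R "KM m X" by (rule module_free_module)
  interpret K1: Module.module R "KM (Suc m) X" by (rule module_free_module)
  obtain u y where u: "u \<in> carrier (U H m)" and y: "y \<in> carrier (A H (Suc m))"
    and zz: "\<And>s. s \<in> S (Suc m) X \<Longrightarrow> head x0 s = fibre_head \<Longrightarrow>
      z s = (\<kappa> m X H h u \<oplus>\<^bsub>KM (Suc m) X\<^esub> \<mu> (Suc m) X H h y) s"
    using fibre_eq_Suc[OF z] by metis
  let ?z = "\<kappa> m X H h u \<oplus>\<^bsub>KM (Suc m) X\<^esub> \<mu> (Suc m) X H h y"
  have z0: "?z \<in> carrier (KM (Suc m) X)" by (rule K1.a_closed[OF \<kappa>_closed[OF X HI h u] \<mu>_closed[OF X HI h y]])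
  \<comment> \<open>The terms of \<open>z\<close> off the fibre have a different head of at least
    the same level, so by triangularity their images miss the fibre.\<close>
  have rest: "D m \<delta>' X (z \<ominus>\<^bsub>KM (Suc m) X\<^esub> ?z) t = \<zero>" if t: "t \<in> S m X" "head x0 t = fibre_head" for t
  proof (rule ccontr)
    assume nz: "D m \<delta>' X (z \<ominus>\<^bsub>KM (Suc m) X\<^esub> ?z) t \<noteq> \<zero>"
    have dc: "z \<ominus>\<^bsub>KM (Suc m) X\<^esub> ?z \<in> carrier (KM (Suc m) X)" by (rule K1.minus_closed[OF z z0])
    obtain s where s: "s \<in> S (Suc m) X" "(z \<ominus>\<^bsub>KM (Suc m) X\<^esub> ?z) s \<noteq> \<zero>" "D m \<delta>' X (free_basis R (S (Suc m) X) s) t \<noteq> \<zero>"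
      by (rule free_hom_support[where f="D m \<delta>' X", OF D_hom[OF adm' X] dc t(1) nz])
    have sub: "(z \<ominus>\<^bsub>KM (Suc m) X\<^esub> ?z) s = z s \<ominus> ?z s" by (rule free_module_minus_apply[OF s(1) z z0])
    have ne: "z s \<noteq> ?z s"
      using s(2) sub free_module_closed[OF z s(1)] free_module_closed[OF z0 s(1)] minus_eq_zero_iff by metis
    then have nh: "head x0 s \<noteq> fibre_head" using zz[OF s(1)] by blast
    then have "?z s = \<zero>" using \<kappa>_\<mu>_support[OF u s(1)] by blast
    then have "level fibre_head \<le> level (head x0 s)" using lev[OF s(1)] ne by auto
    moreover have "head x0 t = head x0 s \<or> level (head x0 s) < level (head x0 t)"
      by (rule D_triangular[OF adm' X x0 s(1) t(1) s(3)])
    ultimately show False using nh t(2) by auto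
  qed
  have Dz0: "D m \<delta>' X ?z t = \<zero>" if t: "t \<in> S m X" "head x0 t = fibre_head" for t
  proof -
    have "D m \<delta>' X (z \<ominus>\<^bsub>KM (Suc m) X\<^esub> ?z) t = \<zero> \<ominus> D m \<delta>' X ?z t"
      using module_hom_minus[OF module_free_module module_free_module D_hom[OF adm' X] z z0] Dz
        free_module_minus_apply[OF t(1) K0.zero_closed D_closed[OF adm' X z0]] t(1) by simp
    then have "\<zero> \<ominus> D m \<delta>' X ?z t = \<zero>" using rest[OF t] by (rule trans[OF sym])
    then show ?thesis
      using minus_eq_zero_iff[OF zero_closed free_module_closed[OF D_closed[OF adm' X z0] t(1)]] by metis
  qed
  have qb: "q H m u \<in> carrier (A H m)" "bdA H m y \<in> carrier (A H m)" by (rule q_closed[OF HF u], rule simplex_boundary_closed[OF y])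
  \<comment> \<open>Vanishing of \<open>D\<close> on the fibre, read in its two components:
    \<open>u\<close> is a cycle, and \<open>q u\<close> is the boundary of \<open>y\<close>. In
    degree 0 there is only the second.\<close>
  have d: "u \<in> cycles (P H) m \<and> q H m u = bdA H m y"
  proof (cases m)
    case 0
    have "q H m u \<ominus>\<^bsub>A H m\<^esub> bdA H m y = \<zero>\<^bsub>A H m\<^esub>"
      unfolding 0
    proof (rule fibre_zero_0)
      show "q H 0 u \<ominus>\<^bsub>A H 0\<^esub> bdA H 0 y \<in> carrier (A H 0)" using qb 0 A0.minus_closed by simp
      fix t assume t: "t \<in> S 0 X" "head x0 t = fibre_head"
      have "\<mu> 0 X H h (q H 0 u \<ominus>\<^bsub>A H 0\<^esub> bdA H 0 y) t = start 0 X H h u t \<ominus> \<mu> 0 X H h (bdA H 0 y) t"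
        using qb 0 t(1) \<mu>_closed[OF X HI h, of _ 0]
        by (simp add: start_simps module_hom_minus[OF module_free_module module_free_module \<mu>_hom[OF X HI h]])
      also have "\<dots> = D 0 \<delta>' X (\<kappa> 0 X H h u \<oplus>\<^bsub>KM (Suc 0) X\<^esub> \<mu> (Suc 0) X H h y) t"
        using D_fibre[of 0 \<delta>' u y t] adm' u y t 0 by simp
      finally show "\<mu> 0 X H h (q H 0 u \<ominus>\<^bsub>A H 0\<^esub> bdA H 0 y) t = \<zero>" using Dz0 t 0 by simp
    qed
    then have "q H m u = bdA H m y" by (simp only: A0.minus_eq_zero_iff[OF qb])
    then show ?thesis using u 0 by simp
  next
    case (Suc k)
    have du: "cdiff (P H) k u \<in> carrier (U H k)" using d_closed[OF HF] u Suc by simp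
    have qy: "q H m u \<ominus>\<^bsub>A H m\<^esub> bdA H m y \<in> carrier (A H m)" by (rule A0.minus_closed[OF qb])
    have "(\<kappa> k X H h (cdiff (P H) k u) \<oplus>\<^bsub>KM m X\<^esub> \<mu> m X H h (q H m u \<ominus>\<^bsub>A H m\<^esub> bdA H m y)) t = \<zero>"
      if t: "t \<in> S m X" "head x0 t = fibre_head" for t
    proof -
      have kc: "\<kappa> k X H h (cdiff (P H) k u) \<in> carrier (KM m X)" using \<kappa>_closed[OF X HI h du] Suc by simp
      have mc: "\<mu> m X H h (q H m u) \<in> carrier (KM m X)" "\<mu> m X H h (bdA H m y) \<in> carrier (KM m X)"
        using qb by (auto intro: \<mu>_closed[OF X HI h])
      have "(\<kappa> k X H h (cdiff (P H) k u) \<oplus>\<^bsub>KM m X\<^esub> \<mu> m X H h (q H m u \<ominus>\<^bsub>A H m\<^esub> bdA H m y)) t =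
        \<kappa> k X H h (cdiff (P H) k u) t \<oplus> (\<mu> m X H h (q H m u) t \<ominus> \<mu> m X H h (bdA H m y) t)"
        using t(1) mc by (simp add: module_hom_minus[OF module_free_module module_free_module \<mu>_hom[OF X HI h] qb])
      also have "\<dots> = (\<kappa> k X H h (cdiff (P H) k u) t \<oplus> \<mu> m X H h (q H m u) t) \<ominus> \<mu> m X H h (bdA H m y) t"
        using free_module_closed[OF kc t(1)] free_module_closed[OF mc(1) t(1)] free_module_closed[OF mc(2) t(1)]
        by (simp add: a_minus_def a_assoc)
      also have "\<dots> = start m X H h u t \<ominus> \<mu> m X H h (bdA H m y) t"
        using t(1) Suc by (simp add: start_simps)
      also have "\<dots> = D m \<delta>' X ?z t" by (rule D_fibre[OF adm' u y t, symmetric])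
      finally show ?thesis using Dz0[OF t] by simp
    qed
    then have "cdiff (P H) k u = \<zero>\<^bsub>U H k\<^esub>" "q H m u \<ominus>\<^bsub>A H m\<^esub> bdA H m y = \<zero>\<^bsub>A H m\<^esub>"
      using fibre_zero_Suc[OF du qy[unfolded Suc]] Suc by auto
    then have "cdiff (P H) k u = \<zero>\<^bsub>U H k\<^esub>" "q H m u = bdA H m y"
      by (simp_all only: A0.minus_eq_zero_iff[OF qb])
    then show ?thesis using u Suc by simp
  qed
  obtain v b where v: "v \<in> carrier (U H (Suc m))" and b: "b \<in> carrier (A H (Suc (Suc m)))"
    and dv: "cdiff (P H) m v = u" and eq: "y = bdA H (Suc m) b \<oplus>\<^bsub>A H (Suc m)\<^esub> q H (Suc m) v"
    using acyclic[OF HF conjunct1[OF d] y conjunct2[OF d]] by blast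
  let ?b = "\<ominus>\<^bsub>A H (Suc (Suc m))\<^esub> b"
  let ?c = "\<kappa> (Suc m) X H h v \<oplus>\<^bsub>KM (Suc (Suc m)) X\<^esub> \<mu> (Suc (Suc m)) X H h ?b"
  have b': "?b \<in> carrier (A H (Suc (Suc m)))" using b by simp
  have bb: "bdA H (Suc m) b \<in> carrier (A H (Suc m))" "q H (Suc m) v \<in> carrier (A H (Suc m))"
    by (rule simplex_boundary_closed[OF b], rule q_closed[OF HF v])
  have mneg: "\<mu> (Suc m) X H h (bdA H (Suc m) ?b) = \<ominus>\<^bsub>KM (Suc m) X\<^esub> \<mu> (Suc m) X H h (bdA H (Suc m) b)"
    using bb(1) by (simp add: module_hom_a_inv[OF module_free_module module_free_module simplex_boundary_hom b]
        module_hom_a_inv[OF module_free_module module_free_module \<mu>_hom[OF X HI h]])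
  have "D (Suc m) \<delta> X ?c t = z t" if t: "t \<in> S (Suc m) X" "head x0 t = fibre_head" for t
  proof -
    have c: "\<mu> (Suc m) X H h (bdA H (Suc m) b) \<in> carrier (KM (Suc m) X)"
      "\<mu> (Suc m) X H h (q H (Suc m) v) \<in> carrier (KM (Suc m) X)" "\<kappa> m X H h u \<in> carrier (KM (Suc m) X)"
      using bb by (auto intro: \<mu>_closed[OF X HI h] \<kappa>_closed[OF X HI h u])
    note ct = free_module_closed[OF c(1) t(1)] free_module_closed[OF c(2) t(1)] free_module_closed[OF c(3) t(1)]
    have neg: "(\<ominus>\<^bsub>KM (Suc m) X\<^esub> \<mu> (Suc m) X H h (bdA H (Suc m) b)) t = \<ominus> \<mu> (Suc m) X H h (bdA H (Suc m) b) t"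
      using free_module_minus_apply[OF t(1) K1.zero_closed c(1)] t(1) c(1) by (simp add: a_minus_def)
    have "D (Suc m) \<delta> X ?c t = start (Suc m) X H h v t \<ominus> (\<ominus> \<mu> (Suc m) X H h (bdA H (Suc m) b) t)"
      using D_fibre[OF adm v b' t] by (simp add: mneg neg)
    also have "\<dots> = \<kappa> m X H h u t \<oplus> (\<mu> (Suc m) X H h (bdA H (Suc m) b) t \<oplus> \<mu> (Suc m) X H h (q H (Suc m) v) t)"
      using t(1) ct by (simp add: start_simps dv a_minus_def a_ac)
    also have "\<dots> = ?z t"
      unfolding eq module_hom_add[OF \<mu>_hom[OF X HI h] bb] using t(1) by simp
    finally show ?thesis using zz[OF t] by simp
  qed
  moreover have "?c \<in> carrier (KM (Suc (Suc m)) X)"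
    by (rule abelian_monoid.a_closed[OF abelian_group.axioms(1)[OF module.axioms(2)[OF module_free_module]]
          \<kappa>_closed[OF X HI h v] \<mu>_closed[OF X HI h b']])
  ultimately show ?thesis using \<kappa>_\<mu>_support[OF v] by blast
qed

end

end

section \<open>Construction of the differentials, degree by degree\<close>

context bredon_resolution
begin

lemma head_family:
  assumes X: "X \<in> G.TG" and x: "x \<in> fst X" and s: "s \<in> S m X"
  shows "head x s \<in> G.over X x"
  using s
proof (cases rule: S_cases)
  case (gen n H h b)
  have H: "H \<in> \<H>" using gen I_family by blast
  obtain a where a: "a \<in> carrier G" "h x = a <#\<^bsub>G\<^esub> H" using G.cmaps_lcosets[OF gen(4) x] G.lcosetsE by metis
  then show ?thesis
    using gen H G.stab_cmap[OF H gen(4) x a] by (simp add: G.weyl_conjugate_upper[OF H] G.family_conjugate)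
next
  case (chain \<sigma>)
  have "\<sigma> x \<in> simplices (G.over X x) (Suc m)" by (rule G.chains_simplices[OF chain(2) x])
  then show ?thesis using chain by (cases "\<sigma> x") (auto simp: simplices_def)
qed

lemma level_head_le:
  assumes "X \<in> G.TG" "x \<in> fst X" "s \<in> S m X"
  shows "level (head x s) \<le> N"
proof -
  have "head x s \<in> \<H>" using head_family[OF assms] by simp
  then show ?thesis by (rule G.level_le[OF bound])
qed

text \<open>Every member of \<H> is conjugate to a representative \<open>H\<close>, and containing
  the stabilizer of \<open>x\<close> is just what a map \<open>X -> G/H\<close> with the right value
  at \<open>x\<close> requires.\<close>

lemma fibre_map:
  assumes X: "X \<in> G.TG" and x: "x \<in> fst X" and k: "k \<in> G.over X x"
  obtains H h g where "H \<in> I" "h \<in> G.cmaps X H" "g \<in> carrier G" "h x = g <#\<^bsub>G\<^esub> H" "k = conjugate G g H"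
proof -
  have "\<exists>!H. H \<in> I \<and> (\<exists>g\<in>carrier G. k = conjugate G g H)"
    using reps k by (simp add: is_conjugacy_representatives_def)
  then obtain H g where H: "H \<in> I" and g: "g \<in> carrier G" "k = conjugate G g H"
    by (elim ex1E conjE bexE)
  have "G.stab X x \<subseteq> conjugate G g H" using k g by simp
  from G.cmaps_exists[OF I_family[OF H] X x g(1) this] obtain h where "h \<in> G.cmaps X H" "h x = g <#\<^bsub>G\<^esub> H" .
  then show ?thesis by (rule that[OF H _ g(1) _ g(2)])
qed

lemma D_D_emb:
  assumes "admissible (Suc m) \<delta>" "admissible m \<delta>'" and X: "X \<in> G.TG" and c: "c \<in> carrier (CM (Suc (Suc (Suc m))) X)"
  shows "D m \<delta>' X (D (Suc m) \<delta> X (emb (Suc (Suc m)) X c)) = \<zero>\<^bsub>KM m X\<^esub>"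
  using c cbd_closed[OF X c] cbd_cbd[OF X c] module_hom_zero[OF module_free_module module_free_module emb_hom]
  by (simp add: D_emb[OF assms(1) X] D_emb[OF assms(2) X])

text \<open>On chains this is the simplicial identity; on generators naturality brings it down to
  the universal ones at \<open>G/H\<close>, where it is assumed.\<close>

lemma D_D:
  assumes adm: "admissible (Suc m) \<delta>" and adm': "admissible m \<delta>'"
    and gens: "\<And>H b. H \<in> I \<Longrightarrow> b \<in> B H (Suc m) \<Longrightarrow> D m \<delta>' (coset_gset G H) (\<delta> H b) = \<zero>\<^bsub>KM m (coset_gset G H)\<^esub>"
    and X: "X \<in> G.TG" and c: "c \<in> carrier (KM (Suc (Suc m)) X)"
  shows "D m \<delta>' X (D (Suc m) \<delta> X c) = \<zero>\<^bsub>KM m X\<^esub>"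
proof (rule free_hom_eqI[where f="\<lambda>c. D m \<delta>' X (D (Suc m) \<delta> X c)" and g="\<lambda>c. \<zero>\<^bsub>KM m X\<^esub>",
      OF module_free_module module_hom_comp[OF D_hom[OF adm X] D_hom[OF adm' X]]
        module_hom_const_zero[OF module_free_module] _ c])
  fix s assume s: "s \<in> S (Suc (Suc m)) X"
  then show "D m \<delta>' X (D (Suc m) \<delta> X (free_basis R (S (Suc (Suc m)) X) s)) = \<zero>\<^bsub>KM m X\<^esub>"
  proof (cases rule: S_cases)
    case (gen n H h b)
    then have b: "b \<in> B H (Suc m)" by auto
    have Y: "coset_gset G H \<in> G.TG" by (rule G.coset_gset_transitive[OF I_family[OF gen(3)]])
    have "D (Suc m) \<delta> X (free_basis R (S (Suc (Suc m)) X) s) =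
        free_map R (S (Suc m) (coset_gset G H)) (S (Suc m) X) (pull X h) (\<delta> H b)"
      using D_Inl[OF adm X gen(3,4) b] gen(2) by simp
    then have "D m \<delta>' X (D (Suc m) \<delta> X (free_basis R (S (Suc (Suc m)) X) s)) =
        free_map R (S m (coset_gset G H)) (S m X) (pull X h) (D m \<delta>' (coset_gset G H) (\<delta> H b))"
      using D_natural[OF adm' X Y gen(4) \<delta>_closed[OF adm gen(3) b]] by simp
    then show ?thesis
      using gens[OF gen(3) b] module_hom_zero[OF module_free_module module_free_module free_map_hom[OF pull_map[OF X gen(4)]]]
      by simp
  next
    case (chain \<sigma>)
    then have "free_basis R (S (Suc (Suc m)) X) s = emb (Suc (Suc m)) X (free_basis R (G.chains (Suc (Suc (Suc m))) X) \<sigma>)"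
      using emb_basis by simp
    then show ?thesis using D_D_emb[OF adm adm' X] chain by simp
  qed
qed

text \<open>Degree 0 has no cycle condition, so every element is a right-hand side.\<close>

lemma D_exact_0:
  assumes adm: "admissible 0 \<delta>" and X: "X \<in> G.TG" and x: "x \<in> fst X" and z: "z \<in> carrier (KM 0 X)"
    and zl: "\<And>t. t \<in> S 0 X \<Longrightarrow> z t \<noteq> \<zero> \<Longrightarrow> l \<le> level (head x t)"
  shows "\<exists>y\<in>carrier (KM (Suc 0) X). D 0 \<delta> X y = z \<and> (\<forall>s\<in>S (Suc 0) X. y s \<noteq> \<zero> \<longrightarrow> l \<le> level (head x s))"
proof -
  interpret K0: Module.module R "KM 0 X" by (rule module_free_module)
  show ?thesis
  proof (rule exact_of_fibres[where Z="carrier (KM 0 X)" and ?hd1.0="head x" and ?hd0.0="head x" and lev=level and N=N, OF D_hom[OF adm X]])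
    show "level (head x t) \<le> N" if "t \<in> S 0 X" for t by (rule level_head_le[OF X x that])
  next
    fix y k t assume y: "y \<in> carrier (KM (Suc 0) X)" "\<And>s. s \<in> S (Suc 0) X \<Longrightarrow> y s \<noteq> \<zero> \<Longrightarrow> head x s = k"
      and t: "t \<in> S 0 X" "D 0 \<delta> X y t \<noteq> \<zero>"
    obtain s where s: "s \<in> S (Suc 0) X" "y s \<noteq> \<zero>" "D 0 \<delta> X (free_basis R (S (Suc 0) X) s) t \<noteq> \<zero>"
      by (rule free_hom_support[where f="D 0 \<delta> X", OF D_hom[OF adm X] y(1) t])
    then show "head x t = k \<or> level k < level (head x t)"
      using D_triangular[OF adm X x s(1) t(1) s(3)] y(2) by auto
  next
    fix z' k assume z': "z' \<in> carrier (KM 0 X)" and "k \<in> head x ` S 0 X"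
    then have "k \<in> G.over X x" using head_family[OF X x] by blast
    then obtain H h g where "H \<in> I" "h \<in> G.cmaps X H" "g \<in> carrier G" "h x = g <#\<^bsub>G\<^esub> H" "k = conjugate G g H"
      by (rule fibre_map[OF X x])
    then show "\<exists>y\<in>carrier (KM (Suc 0) X). (\<forall>s\<in>S (Suc 0) X. y s \<noteq> \<zero> \<longrightarrow> head x s = k) \<and>
        (\<forall>t\<in>S 0 X. head x t = k \<longrightarrow> D 0 \<delta> X y t = z' t)"
      using fibre_exact_0[where h=h, OF X x _ _ _ _ adm z'] by simp
  qed (use z zl D_closed[OF adm X] K0.minus_closed in auto)
qed

text \<open>The right-hand sides are the cycles of the previous differential. That images are
  cycles, as \<open>exact_of_fibres\<close> demands, is \<open>D_D\<close>.\<close>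

lemma D_exact_Suc:
  assumes adm: "admissible (Suc m) \<delta>" and adm': "admissible m \<delta>'"
    and gens: "\<And>H b. H \<in> I \<Longrightarrow> b \<in> B H (Suc m) \<Longrightarrow> D m \<delta>' (coset_gset G H) (\<delta> H b) = \<zero>\<^bsub>KM m (coset_gset G H)\<^esub>"
    and X: "X \<in> G.TG" and x: "x \<in> fst X" and z: "z \<in> carrier (KM (Suc m) X)" and Dz: "D m \<delta>' X z = \<zero>\<^bsub>KM m X\<^esub>"
    and zl: "\<And>t. t \<in> S (Suc m) X \<Longrightarrow> z t \<noteq> \<zero> \<Longrightarrow> l \<le> level (head x t)"
  shows "\<exists>y\<in>carrier (KM (Suc (Suc m)) X). D (Suc m) \<delta> X y = z \<and>
    (\<forall>s\<in>S (Suc (Suc m)) X. y s \<noteq> \<zero> \<longrightarrow> l \<le> level (head x s))"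
proof -
  interpret K0: Module.module R "KM m X" by (rule module_free_module)
  interpret K1: Module.module R "KM (Suc m) X" by (rule module_free_module)
  let ?Z = "{z \<in> carrier (KM (Suc m) X). D m \<delta>' X z = \<zero>\<^bsub>KM m X\<^esub>}"
  show ?thesis
  proof (rule exact_of_fibres[where Z="?Z" and ?hd1.0="head x" and ?hd0.0="head x" and lev=level and N=N, OF D_hom[OF adm X]])
    show "level (head x t) \<le> N" if "t \<in> S (Suc m) X" for t by (rule level_head_le[OF X x that])
  next
    fix y assume "y \<in> carrier (KM (Suc (Suc m)) X)"
    then show "D (Suc m) \<delta> X y \<in> ?Z" using D_D[OF adm adm' gens X] D_closed[OF adm X] by simp
  next
    fix z z' assume "z \<in> ?Z" "z' \<in> ?Z"
    then show "z \<ominus>\<^bsub>KM (Suc m) X\<^esub> z' \<in> ?Z"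
      using module_hom_minus[OF module_free_module module_free_module D_hom[OF adm' X], of z z'] K1.minus_closed[of z z']
        K0.minus_eq_zero_iff[OF K0.zero_closed K0.zero_closed] by simp
  next
    fix y k t assume y: "y \<in> carrier (KM (Suc (Suc m)) X)" "\<And>s. s \<in> S (Suc (Suc m)) X \<Longrightarrow> y s \<noteq> \<zero> \<Longrightarrow> head x s = k"
      and t: "t \<in> S (Suc m) X" "D (Suc m) \<delta> X y t \<noteq> \<zero>"
    obtain s where s: "s \<in> S (Suc (Suc m)) X" "y s \<noteq> \<zero>" "D (Suc m) \<delta> X (free_basis R (S (Suc (Suc m)) X) s) t \<noteq> \<zero>"
      by (rule free_hom_support[where f="D (Suc m) \<delta> X", OF D_hom[OF adm X] y(1) t])
    then show "head x t = k \<or> level k < level (head x t)"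
      using D_triangular[OF adm X x s(1) t(1) s(3)] y(2) by auto
  next
    fix z' k assume z': "z' \<in> ?Z" and k: "k \<in> head x ` S (Suc m) X"
      and lev: "\<And>t. t \<in> S (Suc m) X \<Longrightarrow> z' t \<noteq> \<zero> \<Longrightarrow> level k \<le> level (head x t)"
    from k have "k \<in> G.over X x" using head_family[OF X x] by blast
    then obtain H h g where *: "H \<in> I" "h \<in> G.cmaps X H" "g \<in> carrier G" "h x = g <#\<^bsub>G\<^esub> H" and kg: "k = conjugate G g H"
      by (rule fibre_map[OF X x])
    show "\<exists>y\<in>carrier (KM (Suc (Suc m)) X). (\<forall>s\<in>S (Suc (Suc m)) X. y s \<noteq> \<zero> \<longrightarrow> head x s = k) \<and>
        (\<forall>t\<in>S (Suc m) X. head x t = k \<longrightarrow> D (Suc m) \<delta> X y t = z' t)"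
      using fibre_exact_Suc[where h=h, OF X x * adm adm', of z'] z' lev unfolding kg by blast
  qed (use z Dz zl in auto)
qed

text \<open>The differentials are built one degree at a time: \<open>extendable m \<delta>\<close> says that the leading part of
  the next one can be corrected by terms of higher level.\<close>

definition extendable where
  "extendable m \<delta> \<longleftrightarrow> admissible m \<delta> \<and> (\<forall>H\<in>I. \<forall>b\<in>B H (Suc m). \<exists>c\<in>carrier (KM (Suc m) (coset_gset G H)).
     (\<forall>s\<in>S (Suc m) (coset_gset G H). \<forall>C\<in>lcosets\<^bsub>G\<^esub> H. c s \<noteq> \<zero> \<longrightarrow> level H < level (head C s)) \<and>
     D m \<delta> (coset_gset G H) c = D m \<delta> (coset_gset G H) (start (Suc m) (coset_gset G H) H (id_map H) b))"

text \<open>A group element taking \<open>x\<close> to \<open>y\<close> conjugates the heads, and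
  \<open>level\<close> is invariant under conjugation.\<close>

lemma level_head_invariant:
  assumes X: "X \<in> G.TG" and x: "x \<in> fst X" "y \<in> fst X" and s: "s \<in> S m X"
  shows "level (head x s) = level (head y s)"
proof -
  obtain k where k: "k \<in> carrier G" "snd X k x = y" using G.act_transitive[OF X x] .
  from s show ?thesis
  proof (cases rule: S_cases)
    case (gen n H h b)
    then show ?thesis using level_head[OF X gen(3,4) x(1)] level_head[OF X gen(3,4) x(2)] by simp
  next
    case (chain \<sigma>)
    have "\<sigma> x \<in> simplices (G.over X x) (Suc m)" by (rule G.chains_simplices[OF chain(2) x(1)])
    then obtain L \<tau> where L: "\<sigma> x = L # \<tau>" "L \<in> \<H>" by (cases "\<sigma> x") (auto simp: simplices_def)
    then have "\<sigma> y = conjugate G k L # map (conjugate G k) \<tau>"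
      using G.chains_equiv[OF chain(2) k(1) x(1)] k(2) by simp
    then show ?thesis using L chain k by (simp add: G.level_conjugate G.family_carrier)
  qed
qed

text \<open>On the fibre two successive mapping cone differentials cancel: \<open>d d = 0\<close>
  removes the generator part, and \<open>q d = bdA q\<close> makes the two chain parts cancel. What
  is left has larger level and can be corrected.\<close>

lemma D_start_0:
  assumes adm: "admissible m \<delta>" and HI: "H \<in> I" and b: "b \<in> B H (Suc m)" and C: "C \<in> lcosets\<^bsub>G\<^esub> H"
    and s: "s \<in> S m (coset_gset G H)"
    and nz: "D m \<delta> (coset_gset G H) (start (Suc m) (coset_gset G H) H (id_map H) b) s \<noteq> \<zero>"
  shows "level H < level (head C s)"
proof (rule ccontr)
  let ?Y = "coset_gset G H" and ?h = "id_map H"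
  assume nl: "\<not> level H < level (head C s)"
  have H: "H \<in> \<H>" by (rule I_family[OF HI])
  have Y: "?Y \<in> G.TG" by (rule G.coset_gset_transitive[OF H])
  have h: "?h \<in> G.cmaps ?Y H" by (rule id_map_cmaps[OF H])
  have C': "C \<in> fst ?Y" using C by (simp add: G.coset_gset_simps)
  obtain g where g: "g \<in> carrier G" "C = g <#\<^bsub>G\<^esub> H" using C by (rule G.lcosetsE)
  have hC: "?h C = g <#\<^bsub>G\<^esub> H" using C g by (simp add: id_map_def)
  have bU: "b \<in> carrier (U H (Suc m))" by (rule B_carrier[OF H b])
  have du: "cdiff (P H) m b \<in> carrier (U H m)" and qb: "q H (Suc m) b \<in> carrier (A H (Suc m))"
    using d_closed[OF H bU] q_closed[OF H bU] by auto
  interpret K0: Module.module R "KM m ?Y" by (rule module_free_module)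
  interpret K1: Module.module R "KM (Suc m) ?Y" by (rule module_free_module)
  interpret A: Module.module R "A H m" by (rule module_free_module)
  have kc: "\<kappa> m ?Y H ?h (cdiff (P H) m b) \<oplus>\<^bsub>KM (Suc m) ?Y\<^esub> \<mu> (Suc m) ?Y H ?h (q H (Suc m) b) \<in> carrier (KM (Suc m) ?Y)"
    by (rule K1.a_closed[OF \<kappa>_closed[OF Y HI h du] \<mu>_closed[OF Y HI h qb]])
  have st: "start (Suc m) ?Y H ?h b = \<kappa> m ?Y H ?h (cdiff (P H) m b) \<oplus>\<^bsub>KM (Suc m) ?Y\<^esub> \<mu> (Suc m) ?Y H ?h (q H (Suc m) b)"
    by (rule start_simps)
  \<comment> \<open>If the level is not larger, triangularity leaves only the head of the fibre
    itself, where \<open>D_fibre\<close> applies.\<close>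
  have hd: "head C s = conjugate G g H"
  proof -
    obtain s' where s': "s' \<in> S (Suc m) ?Y" "start (Suc m) ?Y H ?h b s' \<noteq> \<zero>"
      "D m \<delta> ?Y (free_basis R (S (Suc m) ?Y) s') s \<noteq> \<zero>"
      by (rule free_hom_support[where f="D m \<delta> ?Y", OF D_hom[OF adm Y] start_closed[OF Y HI h bU] s nz])
    have "head C s' = conjugate G g H"
      using start_head[OF Y HI h bU s'(1,2) C'] hC g H by (simp add: G.weyl_conjugate_upper[OF H])
    moreover have "head C s = head C s' \<or> level (head C s') < level (head C s)"
      by (rule D_triangular[OF adm Y C' s'(1) s s'(3)])
    ultimately show ?thesis using nl g H by (auto simp: G.level_conjugate G.family_carrier)
  qed
  have "D m \<delta> ?Y (start (Suc m) ?Y H ?h b) s = start m ?Y H ?h (cdiff (P H) m b) s \<ominus> \<mu> m ?Y H ?h (bdA H m (q H (Suc m) b)) s"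
    unfolding st by (rule D_fibre[where h="?h", OF Y C' HI h g(1) hC adm du qb s hd])
  also have "start m ?Y H ?h (cdiff (P H) m b) = \<mu> m ?Y H ?h (bdA H m (q H (Suc m) b))"
  proof (cases m)
    case 0
    then show ?thesis using q_d[OF H bU] by (simp add: start_simps)
  next
    case (Suc k)
    have "\<kappa> k ?Y H ?h (cdiff (P H) k (cdiff (P H) m b)) = \<zero>\<^bsub>KM (Suc k) ?Y\<^esub>"
      using d_d[OF H, of b k] bU Suc module_hom_zero[OF module_U[OF H] module_free_module \<kappa>_hom[OF Y HI h]] by simp
    then show ?thesis
      using q_d[OF H bU] \<mu>_closed[OF Y HI h, of "bdA H m (q H (Suc m) b)" m] qb K0.l_zero unfolding Suc
      by (simp add: start_simps)
  qed
  finally have "D m \<delta> ?Y (start (Suc m) ?Y H ?h b) s = \<zero>"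
    using free_module_closed[OF \<mu>_closed[OF Y HI h, of "bdA H m (q H (Suc m) b)" m] s] qb
    by (simp add: minus_eq_zero_iff)
  with nz show False by simp
qed

lemma coset_base: "H \<in> \<H> \<Longrightarrow> H \<in> lcosets\<^bsub>G\<^esub> H"
  using G.lcosetsI[OF G.one_closed, of H] G.family_carrier[of H] by (simp add: G.lcos_mult_one)

text \<open>In degree 0 nothing has to be corrected. The corrections for the next degree exist
  because the differential into degree 0 is onto in every step of the filtration.\<close>

lemma extendable_0: "extendable 0 (\<lambda>H b. start 0 (coset_gset G H) H (id_map H) b)"
proof -
  let ?\<delta> = "\<lambda>H b. start 0 (coset_gset G H) H (id_map H) b"
  have adm: "admissible 0 ?\<delta>"
    unfolding admissible_def
  proof (intro ballI conjI impI)
    fix H b assume HI: "H \<in> I" and b: "b \<in> B H 0"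
    have H: "H \<in> \<H>" by (rule I_family[OF HI])
    show st: "start 0 (coset_gset G H) H (id_map H) b \<in> carrier (KM 0 (coset_gset G H))"
      by (rule start_closed[OF G.coset_gset_transitive[OF H] HI id_map_cmaps[OF H] B_carrier[OF H b]])
    fix s C assume s: "s \<in> S 0 (coset_gset G H)"
      and nz: "(start 0 (coset_gset G H) H (id_map H) b \<ominus>\<^bsub>KM 0 (coset_gset G H)\<^esub> start 0 (coset_gset G H) H (id_map H) b) s \<noteq> \<zero>"
    then show "level H < level (head C s)" using st by (simp add: minus_eq_zero_iff)
  qed
  show ?thesis
    unfolding extendable_def
  proof (intro conjI ballI adm)
    fix H b assume HI: "H \<in> I" and b: "b \<in> B H (Suc 0)"
    let ?Y = "coset_gset G H"
    have H: "H \<in> \<H>" by (rule I_family[OF HI])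
    have Y: "?Y \<in> G.TG" by (rule G.coset_gset_transitive[OF H])
    have x: "H \<in> fst ?Y" using coset_base[OF H] by (simp add: G.coset_gset_simps)
    have st: "start (Suc 0) ?Y H (id_map H) b \<in> carrier (KM (Suc 0) ?Y)"
      by (rule start_closed[OF Y HI id_map_cmaps[OF H] B_carrier[OF H b]])
    obtain c where c: "c \<in> carrier (KM (Suc 0) ?Y)" "D 0 ?\<delta> ?Y c = D 0 ?\<delta> ?Y (start (Suc 0) ?Y H (id_map H) b)"
      "\<And>s. s \<in> S (Suc 0) ?Y \<Longrightarrow> c s \<noteq> \<zero> \<Longrightarrow> Suc (level H) \<le> level (head H s)"
      using D_exact_0[OF adm Y x D_closed[OF adm Y st], of "Suc (level H)"]
        D_start_0[OF adm HI b coset_base[OF H]] Suc_leI by blast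
    have "level H < level (head C s)" if "s \<in> S (Suc 0) ?Y" "C \<in> lcosets\<^bsub>G\<^esub> H" "c s \<noteq> \<zero>" for s C
      using c(3)[OF that(1,3)] level_head_invariant[OF Y x _ that(1), of C] that(2) by (simp add: G.coset_gset_simps)
    then show "\<exists>c\<in>carrier (KM (Suc 0) ?Y). (\<forall>s\<in>S (Suc 0) ?Y. \<forall>C\<in>lcosets\<^bsub>G\<^esub> H. c s \<noteq> \<zero> \<longrightarrow> level H < level (head C s)) \<and>
      D 0 ?\<delta> ?Y c = D 0 ?\<delta> ?Y (start (Suc 0) ?Y H (id_map H) b)"
      using c by blast
  qed
qed

text \<open>Subtracting the correction \<open>c\<close> leaves the leading part intact, since
  \<open>c\<close> has larger level, and makes the image of each generator a cycle. The next
  corrections then exist by \<open>D_start_0\<close> and exactness.\<close>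

lemma extendable_Suc:
  assumes ext: "extendable m \<delta>"
  shows "\<exists>\<delta>'. extendable (Suc m) \<delta>' \<and>
    (\<forall>H\<in>I. \<forall>b\<in>B H (Suc m). D m \<delta> (coset_gset G H) (\<delta>' H b) = \<zero>\<^bsub>KM m (coset_gset G H)\<^esub>)"
proof -
  have adm: "admissible m \<delta>" using ext by (simp add: extendable_def)
  let ?st = "\<lambda>H b. start (Suc m) (coset_gset G H) H (id_map H) b"
  let ?corrects = "\<lambda>H b c. c \<in> carrier (KM (Suc m) (coset_gset G H)) \<and>
     (\<forall>s\<in>S (Suc m) (coset_gset G H). \<forall>C\<in>lcosets\<^bsub>G\<^esub> H. c s \<noteq> \<zero> \<longrightarrow> level H < level (head C s)) \<and>
     D m \<delta> (coset_gset G H) c = D m \<delta> (coset_gset G H) (?st H b)"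
  define c where "c H b = (SOME c. ?corrects H b c)" for H b
  have corrects: "?corrects H b (c H b)" if "H \<in> I" "b \<in> B H (Suc m)" for H b
  proof -
    have "\<exists>c. ?corrects H b c" using ext that unfolding extendable_def by (simp add: Bex_def)
    then show ?thesis unfolding c_def by (rule someI_ex)
  qed
  have c: "c H b \<in> carrier (KM (Suc m) (coset_gset G H))" if "H \<in> I" "b \<in> B H (Suc m)" for H b
    using corrects[OF that] by (rule conjunct1)
  have cl: "level H < level (head C s)" if "H \<in> I" "b \<in> B H (Suc m)" "s \<in> S (Suc m) (coset_gset G H)"
    "C \<in> lcosets\<^bsub>G\<^esub> H" "c H b s \<noteq> \<zero>" for H b s C
    using corrects[OF that(1,2)] that(3-5) by blast
  have cD: "D m \<delta> (coset_gset G H) (c H b) = D m \<delta> (coset_gset G H) (?st H b)" if "H \<in> I" "b \<in> B H (Suc m)" for H b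
    using corrects[OF that] by (elim conjE)
  define \<delta>' where "\<delta>' H b = ?st H b \<ominus>\<^bsub>KM (Suc m) (coset_gset G H)\<^esub> c H b" for H b
  have st: "?st H b \<in> carrier (KM (Suc m) (coset_gset G H))" if "H \<in> I" "b \<in> B H (Suc m)" for H b
    using that I_family by (intro start_closed G.coset_gset_transitive id_map_cmaps B_carrier) auto
  have \<delta>'c: "\<delta>' H b \<in> carrier (KM (Suc m) (coset_gset G H))" if "H \<in> I" "b \<in> B H (Suc m)" for H b
  proof -
    interpret K1: Module.module R "KM (Suc m) (coset_gset G H)" by (rule module_free_module)
    show ?thesis unfolding \<delta>'_def by (rule K1.minus_closed[OF st[OF that] c[OF that]])
  qed
  have adm': "admissible (Suc m) \<delta>'"
    unfolding admissible_def
  proof (intro ballI conjI impI)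
    fix H b assume Hb: "H \<in> I" "b \<in> B H (Suc m)"
    show "\<delta>' H b \<in> carrier (KM (Suc m) (coset_gset G H))" by (rule \<delta>'c[OF Hb])
    fix s C assume s: "s \<in> S (Suc m) (coset_gset G H)" and C: "C \<in> lcosets\<^bsub>G\<^esub> H"
      and nz: "(\<delta>' H b \<ominus>\<^bsub>KM (Suc m) (coset_gset G H)\<^esub> ?st H b) s \<noteq> \<zero>"
    note sc = free_module_closed[OF st[OF Hb] s] free_module_closed[OF c[OF Hb] s]
    have eq: "(\<delta>' H b \<ominus>\<^bsub>KM (Suc m) (coset_gset G H)\<^esub> ?st H b) s = (?st H b s \<ominus> c H b s) \<ominus> ?st H b s"
      unfolding free_module_minus_apply[OF s \<delta>'c[OF Hb] st[OF Hb]]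
      unfolding \<delta>'_def free_module_minus_apply[OF s st[OF Hb] c[OF Hb]] ..
    have "c H b s \<noteq> \<zero>"
    proof
      assume "c H b s = \<zero>"
      then have "(\<delta>' H b \<ominus>\<^bsub>KM (Suc m) (coset_gset G H)\<^esub> ?st H b) s = \<zero>"
        unfolding eq using sc(1) by (simp add: a_minus_def r_neg)
      with nz show False by simp
    qed
    then show "level H < level (head C s)" using cl[OF Hb s C] by simp
  qed
  have D0: "D m \<delta> (coset_gset G H) (\<delta>' H b) = \<zero>\<^bsub>KM m (coset_gset G H)\<^esub>" if Hb: "H \<in> I" "b \<in> B H (Suc m)" for H b
  proof -
    interpret K0: Module.module R "KM m (coset_gset G H)" by (rule module_free_module)
    have Y: "coset_gset G H \<in> G.TG" by (rule G.coset_gset_transitive[OF I_family[OF Hb(1)]])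
    show ?thesis
      unfolding \<delta>'_def module_hom_minus[OF module_free_module module_free_module D_hom[OF adm Y] st[OF Hb] c[OF Hb]] cD[OF Hb]
      by (simp only: K0.minus_eq_zero_iff[OF D_closed[OF adm Y st[OF Hb]] D_closed[OF adm Y st[OF Hb]]])
  qed
  have "extendable (Suc m) \<delta>'"
    unfolding extendable_def
  proof (intro conjI ballI adm')
    fix H b assume HI: "H \<in> I" and b: "b \<in> B H (Suc (Suc m))"
    let ?Y = "coset_gset G H"
    have H: "H \<in> \<H>" by (rule I_family[OF HI])
    have Y: "?Y \<in> G.TG" by (rule G.coset_gset_transitive[OF H])
    have x: "H \<in> fst ?Y" using coset_base[OF H] by (simp add: G.coset_gset_simps)
    have st2: "start (Suc (Suc m)) ?Y H (id_map H) b \<in> carrier (KM (Suc (Suc m)) ?Y)"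
      by (rule start_closed[OF Y HI id_map_cmaps[OF H] B_carrier[OF H b]])
    \<comment> \<open>The bound \<open>Suc (level H)\<close> in the exactness statement is what
      makes the correction strictly larger in level than \<open>H\<close>.\<close>
    obtain c where c: "c \<in> carrier (KM (Suc (Suc m)) ?Y)"
      "D (Suc m) \<delta>' ?Y c = D (Suc m) \<delta>' ?Y (start (Suc (Suc m)) ?Y H (id_map H) b)"
      "\<And>s. s \<in> S (Suc (Suc m)) ?Y \<Longrightarrow> c s \<noteq> \<zero> \<Longrightarrow> Suc (level H) \<le> level (head H s)"
      using D_exact_Suc[OF adm' adm D0 Y x D_closed[OF adm' Y st2] D_D[OF adm' adm D0 Y st2], of "Suc (level H)"]
        D_start_0[OF adm' HI b coset_base[OF H]] Suc_leI by blast
    have "level H < level (head C s)" if "s \<in> S (Suc (Suc m)) ?Y" "C \<in> lcosets\<^bsub>G\<^esub> H" "c s \<noteq> \<zero>" for s C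
      using c(3)[OF that(1,3)] level_head_invariant[OF Y x _ that(1), of C] that(2) by (simp add: G.coset_gset_simps)
    then show "\<exists>c\<in>carrier (KM (Suc (Suc m)) ?Y). (\<forall>s\<in>S (Suc (Suc m)) ?Y. \<forall>C\<in>lcosets\<^bsub>G\<^esub> H. c s \<noteq> \<zero> \<longrightarrow> level H < level (head C s)) \<and>
      D (Suc m) \<delta>' ?Y c = D (Suc m) \<delta>' ?Y (start (Suc (Suc m)) ?Y H (id_map H) b)"
      using c by blast
  qed
  then show ?thesis using D0 by blast
qed

text \<open>Each differential depends on the previous one, so they come from dependent choice.
  Exactness of the whole cone is the case of the lower bound 0 on the level.\<close>

theorem cone_differential:
  obtains \<delta> where "\<And>m. admissible m (\<delta> m)"
    "\<And>m X c. X \<in> G.TG \<Longrightarrow> c \<in> carrier (KM (Suc (Suc m)) X) \<Longrightarrow> D m (\<delta> m) X (D (Suc m) (\<delta> (Suc m)) X c) = \<zero>\<^bsub>KM m X\<^esub>"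
    "\<And>X z. X \<in> G.TG \<Longrightarrow> z \<in> carrier (KM 0 X) \<Longrightarrow> \<exists>y\<in>carrier (KM (Suc 0) X). D 0 (\<delta> 0) X y = z"
    "\<And>m X z. X \<in> G.TG \<Longrightarrow> z \<in> carrier (KM (Suc m) X) \<Longrightarrow> D m (\<delta> m) X z = \<zero>\<^bsub>KM m X\<^esub> \<Longrightarrow>
      \<exists>y\<in>carrier (KM (Suc (Suc m)) X). D (Suc m) (\<delta> (Suc m)) X y = z"
proof -
  obtain \<delta> where ext: "\<And>m. extendable m (\<delta> m)"
    and gens: "\<And>m. \<forall>H\<in>I. \<forall>b\<in>B H (Suc m). D m (\<delta> m) (coset_gset G H) (\<delta> (Suc m) H b) = \<zero>\<^bsub>KM m (coset_gset G H)\<^esub>"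
    using dependent_nat_choice[of extendable "\<lambda>m \<delta> \<delta>'. \<forall>H\<in>I. \<forall>b\<in>B H (Suc m).
        D m \<delta> (coset_gset G H) (\<delta>' H b) = \<zero>\<^bsub>KM m (coset_gset G H)\<^esub>"] extendable_0 extendable_Suc by blast
  have adm: "admissible m (\<delta> m)" for m using ext by (simp add: extendable_def)
  have g: "D m (\<delta> m) (coset_gset G H) (\<delta> (Suc m) H b) = \<zero>\<^bsub>KM m (coset_gset G H)\<^esub>" if "H \<in> I" "b \<in> B H (Suc m)" for m H b
    using gens that by blast
  show ?thesis
  proof (rule that)
    fix X z assume X: "X \<in> G.TG" and z: "z \<in> carrier (KM 0 X)"
    obtain x where x: "x \<in> fst X" using G.gset_nonempty[OF X] by blast
    show "\<exists>y\<in>carrier (KM (Suc 0) X). D 0 (\<delta> 0) X y = z"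
      using D_exact_0[OF adm X x z, of 0] by auto
  next
    fix m X z assume X: "X \<in> G.TG" and z: "z \<in> carrier (KM (Suc m) X)" "D m (\<delta> m) X z = \<zero>\<^bsub>KM m X\<^esub>"
    obtain x where x: "x \<in> fst X" using G.gset_nonempty[OF X] by blast
    show "\<exists>y\<in>carrier (KM (Suc (Suc m)) X). D (Suc m) (\<delta> (Suc m)) X y = z"
      using D_exact_Suc[OF adm adm g X x z, of 0] by auto
  qed (use adm D_D[OF adm adm g] in auto)
qed

end

section \<open>The resolution by free contramodules\<close>

lemma a_kernel_eq: "a_kernel M M' f = {x \<in> carrier M. f x = \<zero>\<^bsub>M'\<^esub>}"
  by (simp add: a_kernel_def')

context cring
begin

lemma free_module_restrict_hom:
  assumes \<phi>: "inj_on \<phi> S" "\<phi> \<in> S \<rightarrow> T"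
  shows "(\<lambda>c. \<lambda>s\<in>S. c (\<phi> s)) \<in> module_hom R (free_module R T) (free_module R S)"
proof -
  interpret T: Module.module R "free_module R T" by (rule module_free_module)
  interpret F: Module.module R "free_module R S" by (rule module_free_module)
  note cl = free_module_restrict[OF \<phi>]
  have \<phi>': "\<phi> s \<in> T" if "s \<in> S" for s using \<phi>(2) that by blast
  show ?thesis
  proof (rule module_homI)
    fix x y assume x: "x \<in> carrier (free_module R T)" and y: "y \<in> carrier (free_module R T)"
    show "(\<lambda>s\<in>S. (x \<oplus>\<^bsub>free_module R T\<^esub> y) (\<phi> s)) = (\<lambda>s\<in>S. x (\<phi> s)) \<oplus>\<^bsub>free_module R S\<^esub> (\<lambda>s\<in>S. y (\<phi> s))"
      by (rule free_module_eqI[OF cl[OF T.a_closed[OF x y]] F.a_closed[OF cl[OF x] cl[OF y]]]) (simp add: \<phi>')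
  next
    fix r x assume r: "r \<in> carrier R" and x: "x \<in> carrier (free_module R T)"
    show "(\<lambda>s\<in>S. (r \<odot>\<^bsub>free_module R T\<^esub> x) (\<phi> s)) = r \<odot>\<^bsub>free_module R S\<^esub> (\<lambda>s\<in>S. x (\<phi> s))"
      by (rule free_module_eqI[OF cl[OF T.smult_closed[OF r x]] F.smult_closed[OF r cl[OF x]]]) (simp add: \<phi>')
  qed (rule cl)
qed

end

context bredon_resolution
begin

definition inl where "inl n X = free_map R (gens n X) (S (Suc n) X) Inl"
text \<open>With \<open>chainpart\<close>, the projections of the cone onto its two summands.
  \<open>genpart n\<close> starts in cone degree \<open>n + 1\<close>, where \<open>P H n\<close>
  sits.\<close>

definition genpart :: "nat \<Rightarrow> 'g gset \<Rightarrow> _" where "genpart n X c = (\<lambda>s\<in>gens n X. c (Inl s))"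
definition chainpart :: "nat \<Rightarrow> 'g gset \<Rightarrow> _" where "chainpart m X c = (\<lambda>\<sigma>\<in>G.chains (Suc m) X. c (Inr \<sigma>))"

abbreviation "Em n X \<equiv> free_module R (gens n X)"

lemma Inl_map: "Inl \<in> gens n X \<rightarrow> S (Suc n) X"
  by (auto simp: S_Inl)

lemma inl_hom: "inl n X \<in> module_hom R (Em n X) (KM (Suc n) X)"
  unfolding inl_def by (rule free_map_hom[OF Inl_map])

lemma inl_closed: "c \<in> carrier (Em n X) \<Longrightarrow> inl n X c \<in> carrier (KM (Suc n) X)"
  by (rule module_hom_closed[OF inl_hom])

lemma genpart_hom: "genpart n X \<in> module_hom R (KM (Suc n) X) (Em n X)"
  unfolding genpart_def[abs_def] by (rule free_module_restrict_hom[OF _ Inl_map]) simp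

lemma genpart_closed: "c \<in> carrier (KM (Suc n) X) \<Longrightarrow> genpart n X c \<in> carrier (Em n X)"
  by (rule module_hom_closed[OF genpart_hom])

lemma chainpart_hom: "chainpart m X \<in> module_hom R (KM m X) (CM (Suc m) X)"
  unfolding chainpart_def[abs_def] by (rule free_module_restrict_hom[OF _ Inr_map]) simp

lemma chainpart_closed: "c \<in> carrier (KM m X) \<Longrightarrow> chainpart m X c \<in> carrier (CM (Suc m) X)"
  by (rule module_hom_closed[OF chainpart_hom])

lemma inl_Inl: "c \<in> carrier (Em n X) \<Longrightarrow> s \<in> gens n X \<Longrightarrow> inl n X c (Inl s) = c s"
  unfolding inl_def by (rule free_map_inj_apply[OF _ Inl_map]) simp_all

lemma inl_Inr: "Inr \<sigma> \<in> S (Suc n) X \<Longrightarrow> inl n X c (Inr \<sigma>) = \<zero>"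
  unfolding inl_def by (rule ccontr) (erule free_map_support, auto)

lemma emb_Inr: "c \<in> carrier (CM (Suc m) X) \<Longrightarrow> \<sigma> \<in> G.chains (Suc m) X \<Longrightarrow> emb m X c (Inr \<sigma>) = c \<sigma>"
  unfolding emb_def by (rule free_map_inj_apply[OF _ Inr_map]) simp_all

lemma emb_Inl: "Inl s \<in> S m X \<Longrightarrow> emb m X c (Inl s) = \<zero>"
  unfolding emb_def by (rule ccontr) (erule free_map_support, auto)

lemma genpart_inl: "c \<in> carrier (Em n X) \<Longrightarrow> genpart n X (inl n X c) = c"
  by (rule free_module_eqI[OF genpart_closed[OF inl_closed]]) (auto simp: genpart_def inl_Inl)

lemma chainpart_inl: "c \<in> carrier (Em n X) \<Longrightarrow> chainpart (Suc n) X (inl n X c) = \<zero>\<^bsub>CM (Suc (Suc n)) X\<^esub>"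
proof -
  assume c: "c \<in> carrier (Em n X)"
  interpret C: Module.module R "CM (Suc (Suc n)) X" by (rule module_free_module)
  show ?thesis
    by (rule free_module_eqI[OF chainpart_closed[OF inl_closed[OF c]] C.zero_closed]) (simp add: chainpart_def inl_Inr S_Inr)
qed

lemma chainpart_emb: "c \<in> carrier (CM (Suc m) X) \<Longrightarrow> chainpart m X (emb m X c) = c"
  by (rule free_module_eqI[OF chainpart_closed[OF emb_closed]]) (auto simp: chainpart_def emb_Inr)

lemma genpart_emb: "c \<in> carrier (CM (Suc (Suc n)) X) \<Longrightarrow> genpart n X (emb (Suc n) X c) = \<zero>\<^bsub>Em n X\<^esub>"
proof -
  assume c: "c \<in> carrier (CM (Suc (Suc n)) X)"
  interpret E: Module.module R "Em n X" by (rule module_free_module)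
  show ?thesis
    by (rule free_module_eqI[OF genpart_closed[OF emb_closed[OF c]] E.zero_closed]) (simp add: genpart_def emb_Inl S_Inl)
qed

lemma decompose_0: "k \<in> carrier (KM 0 X) \<Longrightarrow> k = emb 0 X (chainpart 0 X k)"
proof (rule free_module_eqI[OF _ emb_closed[OF chainpart_closed]])
  fix s assume k: "k \<in> carrier (KM 0 X)" and s: "s \<in> S 0 X"
  then obtain \<sigma> where "s = Inr \<sigma>" "\<sigma> \<in> G.chains (Suc 0) X" by (auto simp: S_def)
  then show "k s = emb 0 X (chainpart 0 X k) s"
    using emb_Inr[OF chainpart_closed[OF k]] by (simp add: chainpart_def)
qed

lemma decompose_Suc:
  assumes k: "k \<in> carrier (KM (Suc n) X)"
  shows "k = inl n X (genpart n X k) \<oplus>\<^bsub>KM (Suc n) X\<^esub> emb (Suc n) X (chainpart (Suc n) X k)"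
proof -
  interpret KM: Module.module R "KM (Suc n) X" by (rule module_free_module)
  have c: "inl n X (genpart n X k) \<in> carrier (KM (Suc n) X)" "emb (Suc n) X (chainpart (Suc n) X k) \<in> carrier (KM (Suc n) X)"
    by (rule inl_closed[OF genpart_closed[OF k]], rule emb_closed[OF chainpart_closed[OF k]])
  show ?thesis
  proof (rule free_module_eqI[OF k KM.a_closed[OF c]])
    fix s assume s: "s \<in> S (Suc n) X"
    show "k s = (inl n X (genpart n X k) \<oplus>\<^bsub>KM (Suc n) X\<^esub> emb (Suc n) X (chainpart (Suc n) X k)) s"
    proof (cases s)
      case (Inl t)
      then have t: "t \<in> gens n X" using s by (simp add: S_Inl)
      have "inl n X (genpart n X k) s = k s" using inl_Inl[OF genpart_closed[OF k] t] t Inl by (simp add: genpart_def)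
      moreover have "emb (Suc n) X (chainpart (Suc n) X k) s = \<zero>" using emb_Inl s Inl by simp
      ultimately show ?thesis using s k by simp
    next
      case (Inr \<sigma>)
      then have \<sigma>: "\<sigma> \<in> G.chains (Suc (Suc n)) X" using s by (simp add: S_Inr)
      have "emb (Suc n) X (chainpart (Suc n) X k) s = k s"
        using emb_Inr[OF chainpart_closed[OF k] \<sigma>] \<sigma> Inr by (simp add: chainpart_def)
      moreover have "inl n X (genpart n X k) s = \<zero>" using inl_Inr s Inr by simp
      ultimately show ?thesis using s k by simp
    qed
  qed
qed

lemma free_pull_map: "X \<in> G.TG \<Longrightarrow> f \<in> gset_maps G X Y \<Longrightarrow> free_pull X f \<in> gens n Y \<rightarrow> gens n X"
  using free_pull_closed[OF subsetI[OF I_family]] by blast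

context
  fixes X Y f assumes X: "X \<in> G.TG" and Y: "Y \<in> G.TG" and f: "f \<in> gset_maps G X Y"
begin

lemma inl_natural:
  assumes c: "c \<in> carrier (Em n Y)"
  shows "free_map R (S (Suc n) Y) (S (Suc n) X) (pull X f) (inl n Y c) =
    inl n X (free_map R (gens n Y) (gens n X) (free_pull X f) c)"
  unfolding inl_def
  by (simp add: free_map_comp[OF Inl_map pull_map[OF X f] c] free_map_comp[OF free_pull_map[OF X f] Inl_map c])

lemma emb_natural:
  assumes c: "c \<in> carrier (CM (Suc m) Y)"
  shows "free_map R (S m Y) (S m X) (pull X f) (emb m Y c) =
    emb m X (free_map R (G.chains (Suc m) Y) (G.chains (Suc m) X) (pullback X f) c)"
proof -
  have pb: "pullback X f \<in> G.chains (Suc m) Y \<rightarrow> G.chains (Suc m) X" using G.chains_pull[OF X f] by blast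
  show ?thesis
    unfolding emb_def by (simp add: free_map_comp[OF Inr_map pull_map[OF X f] c] free_map_comp[OF pb Inr_map c])
qed

text \<open>Pulling back respects the decomposition into generators and chains, hence also the two
  projections.\<close>

lemma parts_natural_Suc:
  assumes k: "k \<in> carrier (KM (Suc n) Y)"
  shows "genpart n X (free_map R (S (Suc n) Y) (S (Suc n) X) (pull X f) k) =
      free_map R (gens n Y) (gens n X) (free_pull X f) (genpart n Y k)"
    and "chainpart (Suc n) X (free_map R (S (Suc n) Y) (S (Suc n) X) (pull X f) k) =
      free_map R (G.chains (Suc (Suc n)) Y) (G.chains (Suc (Suc n)) X) (pullback X f) (chainpart (Suc n) Y k)"
proof -
  interpret E: Module.module R "Em n X" by (rule module_free_module)
  interpret C: Module.module R "CM (Suc (Suc n)) X" by (rule module_free_module)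
  let ?a = "free_map R (gens n Y) (gens n X) (free_pull X f) (genpart n Y k)"
  let ?b = "free_map R (G.chains (Suc (Suc n)) Y) (G.chains (Suc (Suc n)) X) (pullback X f) (chainpart (Suc n) Y k)"
  have pb: "pullback X f \<in> G.chains (Suc (Suc n)) Y \<rightarrow> G.chains (Suc (Suc n)) X" using G.chains_pull[OF X f] by blast
  have a: "?a \<in> carrier (Em n X)" by (rule free_map_closed[OF free_pull_map[OF X f] genpart_closed[OF k]])
  have b: "?b \<in> carrier (CM (Suc (Suc n)) X)" by (rule free_map_closed[OF pb chainpart_closed[OF k]])
  have "free_map R (S (Suc n) Y) (S (Suc n) X) (pull X f)
      (inl n Y (genpart n Y k) \<oplus>\<^bsub>KM (Suc n) Y\<^esub> emb (Suc n) Y (chainpart (Suc n) Y k)) =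
    inl n X ?a \<oplus>\<^bsub>KM (Suc n) X\<^esub> emb (Suc n) X ?b"
    unfolding module_hom_add[OF free_map_hom[OF pull_map[OF X f]] inl_closed[OF genpart_closed[OF k]] emb_closed[OF chainpart_closed[OF k]]]
      inl_natural[OF genpart_closed[OF k]] emb_natural[OF chainpart_closed[OF k]] ..
  then have eq: "free_map R (S (Suc n) Y) (S (Suc n) X) (pull X f) k = inl n X ?a \<oplus>\<^bsub>KM (Suc n) X\<^esub> emb (Suc n) X ?b"
    using decompose_Suc[OF k] by simp
  show "genpart n X (free_map R (S (Suc n) Y) (S (Suc n) X) (pull X f) k) = ?a"
    unfolding eq module_hom_add[OF genpart_hom inl_closed[OF a] emb_closed[OF b]] genpart_inl[OF a] genpart_emb[OF b]
    by (rule E.r_zero[OF a])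
  show "chainpart (Suc n) X (free_map R (S (Suc n) Y) (S (Suc n) X) (pull X f) k) = ?b"
    unfolding eq module_hom_add[OF chainpart_hom inl_closed[OF a] emb_closed[OF b]] chainpart_inl[OF a] chainpart_emb[OF b]
    by (rule C.l_zero[OF b])
qed

lemma chainpart_natural_0:
  assumes k: "k \<in> carrier (KM 0 Y)"
  shows "chainpart 0 X (free_map R (S 0 Y) (S 0 X) (pull X f) k) =
      free_map R (G.chains (Suc 0) Y) (G.chains (Suc 0) X) (pullback X f) (chainpart 0 Y k)"
proof -
  have pb: "pullback X f \<in> G.chains (Suc 0) Y \<rightarrow> G.chains (Suc 0) X" using G.chains_pull[OF X f] by blast
  have "chainpart 0 X (free_map R (S 0 Y) (S 0 X) (pull X f) (emb 0 Y (chainpart 0 Y k))) =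
    free_map R (G.chains (Suc 0) Y) (G.chains (Suc 0) X) (pullback X f) (chainpart 0 Y k)"
    unfolding emb_natural[OF chainpart_closed[OF k]]
    by (rule chainpart_emb[OF free_map_closed[OF pb chainpart_closed[OF k]]])
  then show ?thesis using decompose_0[OF k] by simp
qed

end

definition empty_chain :: "'g gset \<Rightarrow> 'g set \<Rightarrow> 'g set list" where "empty_chain X = (\<lambda>x\<in>fst X. [])"

lemma chains_0:
  assumes "X \<in> G.TG"
  shows "G.chains 0 X = {empty_chain X}"
proof -
  have "\<sigma> = empty_chain X" if \<sigma>: "\<sigma> \<in> G.chains 0 X" for \<sigma>
    using G.chains_simplices[OF \<sigma>] G.chains_ext[OF \<sigma>]
    by (auto simp: empty_chain_def simplices_def intro!: extensionalityI[of _ "fst X"])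
  moreover have "empty_chain X \<in> G.chains 0 X"
    using G.act_closed[OF assms] by (simp add: G.chains_def empty_chain_def simplices_def)
  ultimately show ?thesis by blast
qed

text \<open>\<open>chains 0 X\<close> has a single element, so its coefficient identifies
  \<open>CM 0 X\<close> with \<open>R\<close>.\<close>

definition augment where "augment X c = cbd 0 X c (empty_chain X)"

context
  fixes X assumes X: "X \<in> G.TG"
begin

lemma augment_hom: "augment X \<in> module_hom R (CM (Suc 0) X) (regular_module R)"
proof -
  have "empty_chain X \<in> G.chains 0 X" using chains_0[OF X] by simp
  from module_hom_comp[OF cbd_hom[OF X] free_module_eval_hom[OF this]] show ?thesis
    by (simp add: augment_def[abs_def])
qed

lemma augment_zero_iff: "c \<in> carrier (CM (Suc 0) X) \<Longrightarrow> augment X c = \<zero> \<longleftrightarrow> cbd 0 X c = \<zero>\<^bsub>CM 0 X\<^esub>"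
proof -
  assume c: "c \<in> carrier (CM (Suc 0) X)"
  interpret C: Module.module R "CM 0 X" by (rule module_free_module)
  have e: "empty_chain X \<in> G.chains 0 X" using chains_0[OF X] by simp
  show ?thesis
  proof
    assume "augment X c = \<zero>"
    then show "cbd 0 X c = \<zero>\<^bsub>CM 0 X\<^esub>"
      by (intro free_module_eqI[OF cbd_closed[OF X c] C.zero_closed]) (simp add: augment_def chains_0[OF X])
  qed (simp add: augment_def e)
qed

lemma augment_surj:
  assumes r: "r \<in> carrier R"
  obtains b where "b \<in> carrier (CM (Suc 0) X)" "augment X b = r"
proof -
  interpret C: Module.module R "CM 0 X" by (rule module_free_module)
  have e: "empty_chain X \<in> G.chains 0 X" using chains_0[OF X] by simp
  let ?c = "r \<odot>\<^bsub>CM 0 X\<^esub> free_basis R (G.chains 0 X) (empty_chain X)"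
  have "?c \<in> carrier (CM 0 X)" by (rule C.smult_closed[OF r free_basis_carrier[OF e]])
  from cbd_0_surj[OF X this] obtain b where "b \<in> carrier (CM (Suc 0) X)" "cbd 0 X b = ?c" by blast
  then show ?thesis using that e r by (simp add: augment_def free_basis_apply)
qed

end

lemma augment_natural:
  assumes X: "X \<in> G.TG" and Y: "Y \<in> G.TG" and f: "f \<in> gset_maps G X Y" and c: "c \<in> carrier (CM (Suc 0) Y)"
  shows "augment X (free_map R (G.chains (Suc 0) Y) (G.chains (Suc 0) X) (pullback X f) c) = augment Y c"
proof -
  have pb: "pullback X f \<in> G.chains 0 Y \<rightarrow> G.chains 0 X" using G.chains_pull[OF X f] by blast
  have e: "empty_chain Y \<in> G.chains 0 Y" using chains_0[OF Y] by simp
  have "pullback X f (empty_chain Y) = empty_chain X"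
    using funcset_mem[OF pb e] chains_0[OF X] by simp
  then have "augment X (free_map R (G.chains (Suc 0) Y) (G.chains (Suc 0) X) (pullback X f) c) =
      free_map R (G.chains 0 Y) (G.chains 0 X) (pullback X f) (cbd 0 Y c) (pullback X f (empty_chain Y))"
    using cbd_natural[OF Y X f c] by (simp add: augment_def cbd_def[of 0 X])
  also have "\<dots> = cbd 0 Y c (empty_chain Y)"
    by (rule free_map_inj_apply[OF _ pb cbd_closed[OF Y c] e]) (simp add: chains_0[OF Y])
  finally show ?thesis by (simp add: augment_def)
qed

definition "FC n = linear_contramodule R (free_gens I (\<lambda>H. B H n)) free_pull"

lemma FC_simps: "cval (FC n) X = Em n X" "cmap (FC n) X Y f = free_map R (gens n Y) (gens n X) (free_pull X f)"
  by (simp_all add: FC_def linear_contramodule_def)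

lemma constant_simps: "cval (constant_contramodule R) X = regular_module R" "cmap (constant_contramodule R) X Y f r = r"
  by (simp_all add: constant_contramodule_def)

text \<open>Written in components, the vanishing of the square of the cone differential makes
  \<open>d\<close> a differential and \<open>\<phi>\<close>, up to sign, a chain map to the chains.
  Exactness of the cone and of the augmented chains then gives exactness of \<open>d\<close>, with
  \<open>\<phi>\<close> followed by the augmentation as \<open>\<epsilon>\<close>.\<close>

theorem free_resolution:
  "\<exists>d \<epsilon>. is_projective_resolution TYPE('m) R G \<H> FC d \<epsilon> (constant_contramodule R)"
proof -
  obtain \<delta> where adm: "\<And>m. admissible m (\<delta> m)"
    and DD: "\<And>m X c. X \<in> G.TG \<Longrightarrow> c \<in> carrier (KM (Suc (Suc m)) X) \<Longrightarrow> D m (\<delta> m) X (D (Suc m) (\<delta> (Suc m)) X c) = \<zero>\<^bsub>KM m X\<^esub>"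
    and ex0: "\<And>X z. X \<in> G.TG \<Longrightarrow> z \<in> carrier (KM 0 X) \<Longrightarrow> \<exists>y\<in>carrier (KM (Suc 0) X). D 0 (\<delta> 0) X y = z"
    and exS: "\<And>m X z. X \<in> G.TG \<Longrightarrow> z \<in> carrier (KM (Suc m) X) \<Longrightarrow> D m (\<delta> m) X z = \<zero>\<^bsub>KM m X\<^esub> \<Longrightarrow>
      \<exists>y\<in>carrier (KM (Suc (Suc m)) X). D (Suc m) (\<delta> (Suc m)) X y = z"
    using cone_differential by blast
  define \<Delta> where "\<Delta> m = D m (\<delta> m)" for m
  define d where "d n X x = genpart n X (\<Delta> (Suc n) X (inl (Suc n) X x))" for n X x
  define \<phi> where "\<phi> n X x = chainpart n X (\<Delta> n X (inl n X x))" for n X x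
  define \<epsilon> where "\<epsilon> X x = augment X (\<phi> 0 X x)" for X x
  note \<Delta>_hom = D_hom[OF adm, folded \<Delta>_def] and \<Delta>_closed = D_closed[OF adm, folded \<Delta>_def]
    and \<Delta>_emb = D_emb[OF adm, folded \<Delta>_def] and \<Delta>_natural = D_natural[OF adm, folded \<Delta>_def]
  note DD = DD[folded \<Delta>_def] and ex0 = ex0[folded \<Delta>_def] and exS = exS[folded \<Delta>_def]
  have d_hom: "d n X \<in> module_hom R (Em (Suc n) X) (Em n X)" if "X \<in> G.TG" for n X
    unfolding d_def[abs_def]
    by (rule module_hom_comp[OF module_hom_comp[OF inl_hom \<Delta>_hom[OF that]] genpart_hom])
  have \<phi>_hom: "\<phi> n X \<in> module_hom R (Em n X) (CM (Suc n) X)" if "X \<in> G.TG" for n X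
    unfolding \<phi>_def[abs_def]
    by (rule module_hom_comp[OF module_hom_comp[OF inl_hom \<Delta>_hom[OF that]] chainpart_hom])
  have \<epsilon>_hom: "\<epsilon> X \<in> module_hom R (Em 0 X) (regular_module R)" if "X \<in> G.TG" for X
    unfolding \<epsilon>_def[abs_def] by (rule module_hom_comp[OF \<phi>_hom[OF that] augment_hom[OF that]])
  note dc = module_hom_closed[OF d_hom] and \<phi>c = module_hom_closed[OF \<phi>_hom]
  have \<Delta>_inl_0: "\<Delta> 0 X (inl 0 X x) = emb 0 X (\<phi> 0 X x)" if "X \<in> G.TG" "x \<in> carrier (Em 0 X)" for X x
    unfolding \<phi>_def by (rule decompose_0[OF \<Delta>_closed[OF that(1) inl_closed[OF that(2)]]])
  have \<Delta>_inl_Suc: "\<Delta> (Suc n) X (inl (Suc n) X x) = inl n X (d n X x) \<oplus>\<^bsub>KM (Suc n) X\<^esub> emb (Suc n) X (\<phi> (Suc n) X x)"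
    if "X \<in> G.TG" "x \<in> carrier (Em (Suc n) X)" for n X x
    unfolding d_def \<phi>_def by (rule decompose_Suc[OF \<Delta>_closed[OF that(1) inl_closed[OF that(2)]]])
  \<comment> \<open>Both components of the cone equation at once; \<open>chain_rel\<close> and
    \<open>dd\<close> are its two projections.\<close>
  have rel: "\<Delta> n X (inl n X (d n X x)) \<oplus>\<^bsub>KM n X\<^esub> emb n X (cbd (Suc n) X (\<phi> (Suc n) X x)) = \<zero>\<^bsub>KM n X\<^esub>"
    if X: "X \<in> G.TG" and x: "x \<in> carrier (Em (Suc n) X)" for n X x
  proof -
    have "\<Delta> n X (\<Delta> (Suc n) X (inl (Suc n) X x)) = \<zero>\<^bsub>KM n X\<^esub>" by (rule DD[OF X inl_closed[OF x]])
    then show ?thesis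
      unfolding \<Delta>_inl_Suc[OF X x] module_hom_add[OF \<Delta>_hom[OF X] inl_closed[OF dc[OF X x]] emb_closed[OF \<phi>c[OF X x]]]
        \<Delta>_emb[OF X \<phi>c[OF X x]] .
  qed
  have chain_rel: "\<phi> n X (d n X x) \<oplus>\<^bsub>CM (Suc n) X\<^esub> cbd (Suc n) X (\<phi> (Suc n) X x) = \<zero>\<^bsub>CM (Suc n) X\<^esub>"
    if X: "X \<in> G.TG" and x: "x \<in> carrier (Em (Suc n) X)" for n X x
  proof -
    have b: "cbd (Suc n) X (\<phi> (Suc n) X x) \<in> carrier (CM (Suc n) X)" by (rule cbd_closed[OF X \<phi>c[OF X x]])
    have "chainpart n X (\<Delta> n X (inl n X (d n X x)) \<oplus>\<^bsub>KM n X\<^esub> emb n X (cbd (Suc n) X (\<phi> (Suc n) X x))) = \<zero>\<^bsub>CM (Suc n) X\<^esub>"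
      unfolding rel[OF X x] by (rule module_hom_zero[OF module_free_module module_free_module chainpart_hom])
    then show ?thesis
      unfolding module_hom_add[OF chainpart_hom \<Delta>_closed[OF X inl_closed[OF dc[OF X x]]] emb_closed[OF b]]
        chainpart_emb[OF b] by (simp add: \<phi>_def)
  qed
  have dd: "d n X (d (Suc n) X x) = \<zero>\<^bsub>Em n X\<^esub>" if X: "X \<in> G.TG" and x: "x \<in> carrier (Em (Suc (Suc n)) X)" for n X x
  proof -
    interpret E: Module.module R "Em n X" by (rule module_free_module)
    have b: "cbd (Suc (Suc n)) X (\<phi> (Suc (Suc n)) X x) \<in> carrier (CM (Suc (Suc n)) X)" by (rule cbd_closed[OF X \<phi>c[OF X x]])
    have "genpart n X (\<Delta> (Suc n) X (inl (Suc n) X (d (Suc n) X x)) \<oplus>\<^bsub>KM (Suc n) X\<^esub>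
        emb (Suc n) X (cbd (Suc (Suc n)) X (\<phi> (Suc (Suc n)) X x))) = \<zero>\<^bsub>Em n X\<^esub>"
      unfolding rel[OF X x] by (rule module_hom_zero[OF module_free_module module_free_module genpart_hom])
    then show ?thesis
      unfolding module_hom_add[OF genpart_hom \<Delta>_closed[OF X inl_closed[OF dc[OF X x]]] emb_closed[OF b]]
        genpart_emb[OF b] using E.r_zero[OF dc[OF X dc[OF X x]]] by (simp add: d_def)
  qed
  \<comment> \<open>The diagram chase. Exactness of the chains gives \<open>w\<close> with boundary
    \<open>\<phi> x\<close>; then \<open>x - w\<close> is a cycle of the cone, hence a boundary, and
    the generator part of this equation reads \<open>d g = x\<close>.\<close>
  have lift: "\<exists>y\<in>carrier (Em (Suc n) X). d n X y = x"
    if X: "X \<in> G.TG" and x: "x \<in> carrier (Em n X)" and \<Delta>x: "\<Delta> n X (inl n X x) = emb n X (\<phi> n X x)"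
      and z: "cbd n X (\<phi> n X x) = \<zero>\<^bsub>CM n X\<^esub>" for n X x
  proof -
    interpret E: Module.module R "Em n X" by (rule module_free_module)
    interpret K0: Module.module R "KM n X" by (rule module_free_module)
    interpret K1: Module.module R "KM (Suc n) X" by (rule module_free_module)
    obtain w where w: "w \<in> carrier (CM (Suc (Suc n)) X)" "cbd (Suc n) X w = \<phi> n X x"
      using cbd_exact[OF X \<phi>c[OF X x] z] by blast
    let ?k = "inl n X x \<ominus>\<^bsub>KM (Suc n) X\<^esub> emb (Suc n) X w"
    have k: "?k \<in> carrier (KM (Suc n) X)" by (rule K1.minus_closed[OF inl_closed[OF x] emb_closed[OF w(1)]])
    have "\<Delta> n X ?k = \<zero>\<^bsub>KM n X\<^esub>"
      unfolding module_hom_minus[OF module_free_module module_free_module \<Delta>_hom[OF X] inl_closed[OF x] emb_closed[OF w(1)]]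
        \<Delta>_emb[OF X w(1)] \<Delta>x w(2)
      by (simp only: K0.minus_eq_zero_iff[OF emb_closed[OF \<phi>c[OF X x]] emb_closed[OF \<phi>c[OF X x]]])
    from exS[OF X k this] obtain y where y: "y \<in> carrier (KM (Suc (Suc n)) X)" "\<Delta> (Suc n) X y = ?k" by blast
    let ?g = "genpart (Suc n) X y" and ?c = "chainpart (Suc (Suc n)) X y"
    have g: "?g \<in> carrier (Em (Suc n) X)" and c: "?c \<in> carrier (CM (Suc (Suc (Suc n))) X)"
      by (rule genpart_closed[OF y(1)], rule chainpart_closed[OF y(1)])
    have "\<Delta> (Suc n) X y = \<Delta> (Suc n) X (inl (Suc n) X ?g) \<oplus>\<^bsub>KM (Suc n) X\<^esub> emb (Suc n) X (cbd (Suc (Suc n)) X ?c)"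
      unfolding \<Delta>_emb[OF X c, symmetric] module_hom_add[OF \<Delta>_hom[OF X] inl_closed[OF g] emb_closed[OF c], symmetric]
        decompose_Suc[OF y(1), symmetric] ..
    then have "genpart n X (\<Delta> (Suc n) X y) = d n X ?g"
      using module_hom_add[OF genpart_hom \<Delta>_closed[OF X inl_closed[OF g]] emb_closed[OF cbd_closed[OF X c]]]
        genpart_emb[OF cbd_closed[OF X c]] E.r_zero[OF dc[OF X g]] by (simp add: d_def)
    moreover have "genpart n X ?k = x \<ominus>\<^bsub>Em n X\<^esub> \<zero>\<^bsub>Em n X\<^esub>"
      unfolding module_hom_minus[OF module_free_module module_free_module genpart_hom inl_closed[OF x] emb_closed[OF w(1)]]
        genpart_inl[OF x] genpart_emb[OF w(1)] ..
    ultimately have "d n X ?g = x"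
      using y(2) x by (simp add: a_minus_def E.add.inv_one[folded a_inv_def])
    then show ?thesis using g by blast
  qed
  have proj: "is_projective_contramodule TYPE('m) R G \<H> (FC n)" for n
    unfolding FC_def by (rule free_contramodule_projective) (use I_family in blast)
  have d_homs: "d n \<in> contramodule_homs R G \<H> (FC (Suc n)) (FC n)" for n
  proof -
    have "d n X (free_map R (gens (Suc n) Y) (gens (Suc n) X) (free_pull X f) c) = free_map R (gens n Y) (gens n X) (free_pull X f) (d n Y c)"
      if X: "X \<in> G.TG" and Y: "Y \<in> G.TG" and f: "f \<in> gset_maps G X Y" and c: "c \<in> carrier (Em (Suc n) Y)" for X Y f c
      unfolding d_def inl_natural[OF X Y f c, symmetric] \<Delta>_natural[OF X Y f inl_closed[OF c]]
      by (rule parts_natural_Suc(1)[OF X Y f \<Delta>_closed[OF Y inl_closed[OF c]]])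
    then show ?thesis using d_hom by (simp add: contramodule_homs_def FC_simps)
  qed
  have \<epsilon>_homs: "\<epsilon> \<in> contramodule_homs R G \<H> (FC 0) (constant_contramodule R)"
  proof -
    have "\<epsilon> X (free_map R (gens 0 Y) (gens 0 X) (free_pull X f) c) = \<epsilon> Y c"
      if X: "X \<in> G.TG" and Y: "Y \<in> G.TG" and f: "f \<in> gset_maps G X Y" and c: "c \<in> carrier (Em 0 Y)" for X Y f c
    proof -
      have cl: "\<Delta> 0 Y (inl 0 Y c) \<in> carrier (KM 0 Y)" by (rule \<Delta>_closed[OF Y inl_closed[OF c]])
      have "\<phi> 0 X (free_map R (gens 0 Y) (gens 0 X) (free_pull X f) c) =
        free_map R (G.chains (Suc 0) Y) (G.chains (Suc 0) X) (pullback X f) (\<phi> 0 Y c)"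
        unfolding \<phi>_def inl_natural[OF X Y f c, symmetric] \<Delta>_natural[OF X Y f inl_closed[OF c]]
        by (rule chainpart_natural_0[OF X Y f cl])
      then show ?thesis unfolding \<epsilon>_def using augment_natural[OF X Y f \<phi>c[OF Y c]] by simp
    qed
    then show ?thesis using \<epsilon>_hom by (simp add: contramodule_homs_def FC_simps constant_simps)
  qed
  have \<epsilon>_surj: "\<epsilon> X ` carrier (Em 0 X) = carrier R" if X: "X \<in> G.TG" for X
  proof
    show "\<epsilon> X ` carrier (Em 0 X) \<subseteq> carrier R" using module_hom_closed[OF \<epsilon>_hom[OF X]] by auto
    show "carrier R \<subseteq> \<epsilon> X ` carrier (Em 0 X)"
    proof
      fix r assume r: "r \<in> carrier R"
      obtain b where b: "b \<in> carrier (CM (Suc 0) X)" "augment X b = r" by (rule augment_surj[OF X r])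
      \<comment> \<open>Exactness of the cone in degree 0 writes \<open>b\<close> as
        \<open>\<phi> g\<close> plus a boundary, and the augmentation kills boundaries.\<close>
      obtain y where y: "y \<in> carrier (KM (Suc 0) X)" "\<Delta> 0 X y = emb 0 X b" using ex0[OF X emb_closed[OF b(1)]] by blast
      let ?g = "genpart 0 X y" and ?c = "chainpart (Suc 0) X y"
      have g: "?g \<in> carrier (Em 0 X)" and c: "?c \<in> carrier (CM (Suc (Suc 0)) X)"
        by (rule genpart_closed[OF y(1)], rule chainpart_closed[OF y(1)])
      have cb: "cbd (Suc 0) X ?c \<in> carrier (CM (Suc 0) X)" by (rule cbd_closed[OF X c])
      have "\<Delta> 0 X y = emb 0 X (\<phi> 0 X ?g) \<oplus>\<^bsub>KM 0 X\<^esub> emb 0 X (cbd (Suc 0) X ?c)"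
        unfolding \<Delta>_inl_0[OF X g, symmetric] \<Delta>_emb[OF X c, symmetric]
          module_hom_add[OF \<Delta>_hom[OF X] inl_closed[OF g] emb_closed[OF c], symmetric] decompose_Suc[OF y(1), symmetric] ..
      then have "b = chainpart 0 X (emb 0 X (\<phi> 0 X ?g) \<oplus>\<^bsub>KM 0 X\<^esub> emb 0 X (cbd (Suc 0) X ?c))"
        using chainpart_emb[OF b(1)] y(2) by simp
      then have "b = \<phi> 0 X ?g \<oplus>\<^bsub>CM (Suc 0) X\<^esub> cbd (Suc 0) X ?c"
        unfolding module_hom_add[OF chainpart_hom emb_closed[OF \<phi>c[OF X g]] emb_closed[OF cb]]
          chainpart_emb[OF \<phi>c[OF X g]] chainpart_emb[OF cb] .
      then have "r = \<epsilon> X ?g \<oplus> augment X (cbd (Suc 0) X ?c)"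
        using b(2) module_hom_add[OF augment_hom[OF X] \<phi>c[OF X g] cb] by (simp add: \<epsilon>_def)
      moreover have "augment X (cbd (Suc 0) X ?c) = \<zero>"
        using cbd_cbd[OF X c] augment_zero_iff[OF X cb] by simp
      ultimately have "r = \<epsilon> X ?g" using module_hom_closed[OF \<epsilon>_hom[OF X] g] by simp
      then show "r \<in> \<epsilon> X ` carrier (Em 0 X)" using g by blast
    qed
  qed
  have exact_0: "d 0 X ` carrier (Em (Suc 0) X) = {x \<in> carrier (Em 0 X). \<epsilon> X x = \<zero>}" if X: "X \<in> G.TG" for X
  proof
    show "d 0 X ` carrier (Em (Suc 0) X) \<subseteq> {x \<in> carrier (Em 0 X). \<epsilon> X x = \<zero>}"
    proof (rule image_subsetI)
      fix x assume x: "x \<in> carrier (Em (Suc 0) X)"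
      have b: "cbd (Suc 0) X (\<phi> (Suc 0) X x) \<in> carrier (CM (Suc 0) X)" by (rule cbd_closed[OF X \<phi>c[OF X x]])
      have "augment X (\<phi> 0 X (d 0 X x) \<oplus>\<^bsub>CM (Suc 0) X\<^esub> cbd (Suc 0) X (\<phi> (Suc 0) X x)) = \<zero>"
        unfolding chain_rel[OF X x]
        using module_hom_zero[OF module_free_module module_regular_module augment_hom[OF X]] by simp
      then have "\<epsilon> X (d 0 X x) \<oplus> augment X (cbd (Suc 0) X (\<phi> (Suc 0) X x)) = \<zero>"
        using module_hom_add[OF augment_hom[OF X] \<phi>c[OF X dc[OF X x]] b] by (simp add: \<epsilon>_def)
      moreover have "augment X (cbd (Suc 0) X (\<phi> (Suc 0) X x)) = \<zero>"
        using cbd_cbd[OF X \<phi>c[OF X x]] augment_zero_iff[OF X b] by simp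
      ultimately show "d 0 X x \<in> {x \<in> carrier (Em 0 X). \<epsilon> X x = \<zero>}"
        using dc[OF X x] module_hom_closed[OF \<epsilon>_hom[OF X] dc[OF X x]] by simp
    qed
    show "{x \<in> carrier (Em 0 X). \<epsilon> X x = \<zero>} \<subseteq> d 0 X ` carrier (Em (Suc 0) X)"
    proof
      fix x assume "x \<in> {x \<in> carrier (Em 0 X). \<epsilon> X x = \<zero>}"
      then have x: "x \<in> carrier (Em 0 X)" "augment X (\<phi> 0 X x) = \<zero>" by (auto simp: \<epsilon>_def)
      have "\<exists>y\<in>carrier (Em (Suc 0) X). d 0 X y = x"
        using x(2) augment_zero_iff[OF X \<phi>c[OF X x(1)]] by (intro lift[OF X x(1) \<Delta>_inl_0[OF X x(1)]]) simp
      then show "x \<in> d 0 X ` carrier (Em (Suc 0) X)" by blast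
    qed
  qed
  have exact_Suc: "d (Suc n) X ` carrier (Em (Suc (Suc n)) X) = {x \<in> carrier (Em (Suc n) X). d n X x = \<zero>\<^bsub>Em n X\<^esub>}"
    if X: "X \<in> G.TG" for n X
  proof
    show "d (Suc n) X ` carrier (Em (Suc (Suc n)) X) \<subseteq> {x \<in> carrier (Em (Suc n) X). d n X x = \<zero>\<^bsub>Em n X\<^esub>}"
      using dd[OF X] dc[OF X] by auto
    show "{x \<in> carrier (Em (Suc n) X). d n X x = \<zero>\<^bsub>Em n X\<^esub>} \<subseteq> d (Suc n) X ` carrier (Em (Suc (Suc n)) X)"
    proof
      fix x assume "x \<in> {x \<in> carrier (Em (Suc n) X). d n X x = \<zero>\<^bsub>Em n X\<^esub>}"
      then have x: "x \<in> carrier (Em (Suc n) X)" "d n X x = \<zero>\<^bsub>Em n X\<^esub>" by auto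
      interpret C: Module.module R "CM (Suc n) X" by (rule module_free_module)
      interpret K1: Module.module R "KM (Suc n) X" by (rule module_free_module)
      have "\<Delta> (Suc n) X (inl (Suc n) X x) = emb (Suc n) X (\<phi> (Suc n) X x)"
        unfolding \<Delta>_inl_Suc[OF X x(1)] x(2) module_hom_zero[OF module_free_module module_free_module inl_hom]
        by (rule K1.l_zero[OF emb_closed[OF \<phi>c[OF X x(1)]]])
      moreover have "cbd (Suc n) X (\<phi> (Suc n) X x) = \<zero>\<^bsub>CM (Suc n) X\<^esub>"
        using chain_rel[OF X x(1)] C.l_zero[OF cbd_closed[OF X \<phi>c[OF X x(1)]]]
          module_hom_zero[OF module_free_module module_free_module \<phi>_hom[OF X]] unfolding x(2) by simp
      ultimately have "\<exists>y\<in>carrier (Em (Suc (Suc n)) X). d (Suc n) X y = x" by (rule lift[OF X x(1)])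
      then show "x \<in> d (Suc n) X ` carrier (Em (Suc (Suc n)) X)" by blast
    qed
  qed
  have "is_projective_resolution TYPE('m) R G \<H> FC d \<epsilon> (constant_contramodule R)"
    unfolding is_projective_resolution_def
    using proj d_homs \<epsilon>_homs \<epsilon>_surj exact_0 exact_Suc
    by (simp add: contramodule_epis_def a_kernel_eq FC_simps constant_simps)
  then show ?thesis by blast
qed

end

section \<open>Induced contramodules\<close>

lemma contramodule_homs_comp:
  assumes "\<eta> \<in> contramodule_homs R G \<H> L M" "\<theta> \<in> contramodule_homs R G \<H> M N"
  shows "(\<lambda>X x. \<theta> X (\<eta> X x)) \<in> contramodule_homs R G \<H> L N"
  unfolding contramodule_homs_def
proof (intro CollectI conjI ballI)
  fix X assume X: "X \<in> transitive_gsets G \<H>"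
  show "(\<lambda>x. \<theta> X (\<eta> X x)) \<in> module_hom R (cval L X) (cval N X)"
    by (rule module_hom_comp[OF contramodule_homs_hom[OF assms(1) X] contramodule_homs_hom[OF assms(2) X]])
  fix Y f m assume Y: "Y \<in> transitive_gsets G \<H>" and f: "f \<in> gset_maps G X Y" and m: "m \<in> carrier (cval L Y)"
  have "\<eta> Y m \<in> carrier (cval M Y)" by (rule module_hom_closed[OF contramodule_homs_hom[OF assms(1) Y] m])
  then show "\<theta> X (\<eta> X (cmap L X Y f m)) = cmap N X Y f (\<theta> Y (\<eta> Y m))"
    using contramodule_homs_natural[OF assms(1) X Y f m] contramodule_homs_natural[OF assms(2) X Y f] by simp
qed

text \<open>On the side of \<open>E\<close> only modules and a natural bijection are given; that
  \<open>E\<close> is a contramodule, and that projectivity passes to it, is carried over from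
  \<open>M\<close>.\<close>

locale contramodule_iso = bredon R G \<H>
  for R :: "('r, 'k) ring_scheme" (structure) and G :: "('g, 'l) monoid_scheme" and \<H> +
  fixes M :: "('g, 'r, 'a) contramodule" and E :: "('g, 'r, 'b) contramodule" and \<Theta>
  assumes contramodule: "is_contramodule R G \<H> M"
    and module_E: "X \<in> G.TG \<Longrightarrow> Module.module R (cval E X)"
    and hom: "X \<in> G.TG \<Longrightarrow> \<Theta> X \<in> module_hom R (cval M X) (cval E X)"
    and bij: "X \<in> G.TG \<Longrightarrow> bij_betw (\<Theta> X) (carrier (cval M X)) (carrier (cval E X))"
    and natural: "X \<in> G.TG \<Longrightarrow> Y \<in> G.TG \<Longrightarrow> f \<in> gset_maps G X Y \<Longrightarrow> c \<in> carrier (cval M Y) \<Longrightarrow>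
      \<Theta> X (cmap M X Y f c) = cmap E X Y f (\<Theta> Y c)"
begin

definition "\<Psi> X = inv_into (carrier (cval M X)) (\<Theta> X)"

lemma \<Psi>_hom: "X \<in> G.TG \<Longrightarrow> \<Psi> X \<in> module_hom R (cval E X) (cval M X)"
  unfolding \<Psi>_def by (rule module_hom_inv[OF contramodule_module[OF contramodule] hom bij])

lemma \<Psi>_closed: "X \<in> G.TG \<Longrightarrow> y \<in> carrier (cval E X) \<Longrightarrow> \<Psi> X y \<in> carrier (cval M X)"
  by (rule module_hom_closed[OF \<Psi>_hom])

lemma \<Theta>_closed: "X \<in> G.TG \<Longrightarrow> c \<in> carrier (cval M X) \<Longrightarrow> \<Theta> X c \<in> carrier (cval E X)"
  by (rule module_hom_closed[OF hom])

lemma \<Theta>_\<Psi>: "X \<in> G.TG \<Longrightarrow> y \<in> carrier (cval E X) \<Longrightarrow> \<Theta> X (\<Psi> X y) = y"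
  using bij[of X] by (simp add: \<Psi>_def bij_betw_def f_inv_into_f)

lemma \<Psi>_\<Theta>: "X \<in> G.TG \<Longrightarrow> c \<in> carrier (cval M X) \<Longrightarrow> \<Psi> X (\<Theta> X c) = c"
  using bij[of X] by (simp add: \<Psi>_def bij_betw_def inv_into_f_f)

text \<open>In this conjugated form the functor laws of \<open>E\<close> follow from those of
  \<open>M\<close>.\<close>

lemma cmap_eq:
  "X \<in> G.TG \<Longrightarrow> Y \<in> G.TG \<Longrightarrow> f \<in> gset_maps G X Y \<Longrightarrow> y \<in> carrier (cval E Y) \<Longrightarrow>
    cmap E X Y f y = \<Theta> X (cmap M X Y f (\<Psi> Y y))"
  by (simp add: natural \<Psi>_closed \<Theta>_\<Psi>)

lemma cmap_closed: "X \<in> G.TG \<Longrightarrow> Y \<in> G.TG \<Longrightarrow> f \<in> gset_maps G X Y \<Longrightarrow> c \<in> carrier (cval M Y) \<Longrightarrow>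
    cmap M X Y f c \<in> carrier (cval M X)"
  by (rule module_hom_closed[OF contramodule_cmap_hom[OF contramodule]])

lemma \<Theta>_homs: "\<Theta> \<in> contramodule_homs R G \<H> M E"
  by (simp add: contramodule_homs_def hom natural)

lemma \<Psi>_homs: "\<Psi> \<in> contramodule_homs R G \<H> E M"
  by (simp add: contramodule_homs_def \<Psi>_hom cmap_eq \<Psi>_\<Theta> cmap_closed \<Psi>_closed)

lemma is_contramodule_E: "is_contramodule R G \<H> E"
  unfolding is_contramodule_def
proof (intro conjI ballI)
  fix X Y f assume X: "X \<in> G.TG" and Y: "Y \<in> G.TG" and f: "f \<in> gset_maps G X Y"
  show "cmap E X Y f \<in> module_hom R (cval E Y) (cval E X)"
    by (rule module_hom_cong[OF module_hom_comp[OF module_hom_comp[OF \<Psi>_hom[OF Y]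
            contramodule_cmap_hom[OF contramodule X Y f]] hom[OF X]] _ module_E[OF Y]])
       (simp add: cmap_eq[OF X Y f])
  fix Z g m assume Z: "Z \<in> G.TG" and g: "g \<in> gset_maps G Y Z" and m: "m \<in> carrier (cval E Z)"
  show "cmap E X Z (compose (fst X) g f) m = cmap E X Y f (cmap E Y Z g m)"
    unfolding cmap_eq[OF X Z G.gset_maps_compose[OF X f g] m] cmap_eq[OF Y Z g m]
    by (simp add: cmap_eq[OF X Y f] \<Theta>_closed[OF Y] \<Psi>_\<Theta>[OF Y] cmap_closed[OF Y Z g] \<Psi>_closed[OF Z m]
        contramodule_comp[OF contramodule X Y Z f g])
next
  fix X m assume X: "X \<in> G.TG" and m: "m \<in> carrier (cval E X)"
  show "cmap E X X (\<lambda>x\<in>fst X. x) m = m"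
    unfolding cmap_eq[OF X X G.gset_maps_id[OF X] m]
    by (simp add: contramodule_id[OF contramodule X \<Psi>_closed[OF X m]] \<Theta>_\<Psi>[OF X m])
qed (rule module_E)

lemma projective:
  assumes "is_projective_contramodule TYPE('m) R G \<H> M"
  shows "is_projective_contramodule TYPE('m) R G \<H> E"
  unfolding is_projective_contramodule_def
proof (intro conjI allI impI is_contramodule_E)
  fix L N :: "('g, 'r, 'm) contramodule" and \<epsilon> \<phi>
  assume L: "is_contramodule R G \<H> L" "is_contramodule R G \<H> N" "\<epsilon> \<in> contramodule_epis R G \<H> L N"
    and \<phi>: "\<phi> \<in> contramodule_homs R G \<H> E N"
  from assms have "\<exists>\<psi>\<in>contramodule_homs R G \<H> M L. \<forall>X\<in>G.TG. \<forall>x\<in>carrier (cval M X). \<epsilon> X (\<psi> X x) = \<phi> X (\<Theta> X x)"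
    unfolding is_projective_contramodule_def
    by (elim conjE allE impE) (rule L contramodule_homs_comp[OF \<Theta>_homs \<phi>] | assumption)+
  then obtain \<psi> where \<psi>: "\<psi> \<in> contramodule_homs R G \<H> M L"
    and eq: "\<And>X x. X \<in> G.TG \<Longrightarrow> x \<in> carrier (cval M X) \<Longrightarrow> \<epsilon> X (\<psi> X x) = \<phi> X (\<Theta> X x)"
    by blast
  have "\<epsilon> X (\<psi> X (\<Psi> X x)) = \<phi> X x" if "X \<in> G.TG" "x \<in> carrier (cval E X)" for X x
    using eq[OF that(1) \<Psi>_closed[OF that]] \<Theta>_\<Psi>[OF that] by simp
  then show "\<exists>\<psi>\<in>contramodule_homs R G \<H> E L. \<forall>X\<in>G.TG. \<forall>x\<in>carrier (cval E X). \<epsilon> X (\<psi> X x) = \<phi> X x"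
    by (intro bexI[OF _ contramodule_homs_comp[OF \<Psi>_homs \<psi>]]) simp
qed

lemma \<Psi>_image: "X \<in> G.TG \<Longrightarrow> \<Psi> X ` carrier (cval E X) = carrier (cval M X)"
  unfolding \<Psi>_def by (rule bij_betw_imp_surj_on[OF bij_betw_inv_into[OF bij]])

text \<open>Two predicates are allowed because the kernel condition of the transported differential
  reads \<open>\<Theta> (d c) = 0\<close>, which is equivalent but not identical to
  \<open>d c = 0\<close>.\<close>

lemma \<Theta>_kernel:
  assumes X: "X \<in> G.TG" and K: "\<And>c. c \<in> carrier (cval M X) \<Longrightarrow> K c \<longleftrightarrow> K' c"
  shows "\<Theta> X ` {c \<in> carrier (cval M X). K c} = {y \<in> carrier (cval E X). K' (\<Psi> X y)}"
proof
  show "\<Theta> X ` {c \<in> carrier (cval M X). K c} \<subseteq> {y \<in> carrier (cval E X). K' (\<Psi> X y)}"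
    using K by (auto simp: \<Theta>_closed[OF X] \<Psi>_\<Theta>[OF X])
  show "{y \<in> carrier (cval E X). K' (\<Psi> X y)} \<subseteq> \<Theta> X ` {c \<in> carrier (cval M X). K c}"
  proof
    fix y assume "y \<in> {y \<in> carrier (cval E X). K' (\<Psi> X y)}"
    then have "y = \<Theta> X (\<Psi> X y)" "\<Psi> X y \<in> {c \<in> carrier (cval M X). K c}"
      using K by (simp_all add: \<Psi>_closed[OF X] \<Theta>_\<Psi>[OF X])
    then show "y \<in> \<Theta> X ` {c \<in> carrier (cval M X). K c}" by (rule image_eqI)
  qed
qed

lemma \<Theta>_zero_iff:
  assumes X: "X \<in> G.TG" and c: "c \<in> carrier (cval M X)"
  shows "\<Theta> X c = \<zero>\<^bsub>cval E X\<^esub> \<longleftrightarrow> c = \<zero>\<^bsub>cval M X\<^esub>"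
proof -
  note M = contramodule_module[OF contramodule X] and E = module_E[OF X]
  have "\<Psi> X (\<Theta> X c) = \<Psi> X \<zero>\<^bsub>cval E X\<^esub> \<longleftrightarrow> \<Theta> X c = \<zero>\<^bsub>cval E X\<^esub>"
    using inj_on_eq_iff[OF bij_betw_imp_inj_on[OF bij_betw_inv_into[OF bij[OF X]]] \<Theta>_closed[OF X c]
        abelian_monoid.zero_closed[OF abelian_group.axioms(1)[OF Module.module.axioms(2)[OF E]]]]
    unfolding \<Psi>_def[symmetric] .
  then show ?thesis unfolding \<Psi>_\<Theta>[OF X c] module_hom_zero[OF E M \<Psi>_hom[OF X]] by (rule sym)
qed

end

text \<open>Conjugating the differentials with the isomorphisms preserves exactness. The resolved
  contramodule \<open>M\<close> stays as it is, so \<open>\<epsilon>\<close> is only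
  precomposed.\<close>

lemma projective_resolution_transport:
  assumes iso: "\<And>n. contramodule_iso R G \<H> (F n) (E n) (\<Theta> n)"
    and res: "is_projective_resolution TYPE('m) R G \<H> F d \<epsilon> M"
  shows "\<exists>d \<epsilon>. is_projective_resolution TYPE('m) R G \<H> E d \<epsilon> M"
proof -
  define \<Psi> where "\<Psi> n = contramodule_iso.\<Psi> (F n) (\<Theta> n)" for n
  define d' where "d' n X x = \<Theta> n X (d n X (\<Psi> (Suc n) X x))" for n X x
  define \<epsilon>' where "\<epsilon>' X x = \<epsilon> X (\<Psi> 0 X x)" for X x
  note iso_facts = iso[THEN contramodule_iso.\<Psi>_homs, folded \<Psi>_def] iso[THEN contramodule_iso.\<Theta>_homs]
    iso[THEN contramodule_iso.projective]
  note im = iso[THEN contramodule_iso.\<Psi>_image, folded \<Psi>_def]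
    and ker = iso[THEN contramodule_iso.\<Theta>_kernel, folded \<Psi>_def]
  from res have proj: "\<forall>n. is_projective_contramodule TYPE('m) R G \<H> (F n)"
    and ds: "\<forall>n. d n \<in> contramodule_homs R G \<H> (F (Suc n)) (F n)"
    and epi: "\<epsilon> \<in> contramodule_epis R G \<H> (F 0) M"
    and exact: "\<forall>X\<in>transitive_gsets G \<H>.
        d 0 X ` carrier (cval (F 1) X) = {x \<in> carrier (cval (F 0) X). \<epsilon> X x = \<zero>\<^bsub>cval M X\<^esub>} \<and>
        (\<forall>n. d (Suc n) X ` carrier (cval (F (Suc (Suc n))) X) =
          {x \<in> carrier (cval (F (Suc n)) X). d n X x = \<zero>\<^bsub>cval (F n) X\<^esub>})"
    unfolding is_projective_resolution_def a_kernel_eq by - (elim conjE, assumption)+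
  note d = ds[rule_format] and ex0 = exact[THEN bspec, THEN conjunct1]
    and exS = exact[THEN bspec, THEN conjunct2, THEN spec]
  from epi have \<epsilon>: "\<epsilon> \<in> contramodule_homs R G \<H> (F 0) M"
    and \<epsilon>_surj: "\<And>X. X \<in> transitive_gsets G \<H> \<Longrightarrow> \<epsilon> X ` carrier (cval (F 0) X) = carrier (cval M X)"
    by (simp_all add: contramodule_epis_def)
  have d': "d' n \<in> contramodule_homs R G \<H> (E (Suc n)) (E n)" for n
    unfolding d'_def[abs_def]
    by (rule contramodule_homs_comp[OF contramodule_homs_comp[OF iso_facts(1) d] iso_facts(2)])
  have \<epsilon>': "\<epsilon>' \<in> contramodule_homs R G \<H> (E 0) M"
    unfolding \<epsilon>'_def[abs_def] by (rule contramodule_homs_comp[OF iso_facts(1) \<epsilon>])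
  have im_d: "d' n X ` carrier (cval (E (Suc n)) X) = \<Theta> n X ` d n X ` carrier (cval (F (Suc n)) X)"
    if "X \<in> transitive_gsets G \<H>" for n X
    unfolding im[OF that, symmetric] d'_def image_image ..
  have "is_projective_resolution TYPE('m) R G \<H> E d' \<epsilon>' M"
    unfolding is_projective_resolution_def contramodule_epis_def a_kernel_eq
  proof (intro conjI allI ballI CollectI d' \<epsilon>')
    fix X assume X: "X \<in> transitive_gsets G \<H>"
    show "\<epsilon>' X ` carrier (cval (E 0) X) = carrier (cval M X)"
      unfolding \<epsilon>_surj[OF X, symmetric] im[OF X, symmetric] \<epsilon>'_def image_image ..
    show "d' 0 X ` carrier (cval (E 1) X) = {x \<in> carrier (cval (E 0) X). \<epsilon>' X x = \<zero>\<^bsub>cval M X\<^esub>}"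
      unfolding One_nat_def im_d[OF X] ex0[OF X, unfolded One_nat_def] \<epsilon>'_def by (rule ker[OF X refl])
    fix n
    show "d' (Suc n) X ` carrier (cval (E (Suc (Suc n))) X) =
        {x \<in> carrier (cval (E (Suc n)) X). d' n X x = \<zero>\<^bsub>cval (E n) X\<^esub>}"
      unfolding im_d[OF X] exS[OF X] d'_def
      by (rule ker[OF X], rule contramodule_iso.\<Theta>_zero_iff[OF iso X, symmetric])
        (rule module_hom_closed[OF contramodule_homs_hom[OF d X]])
  qed (rule iso_facts(3)[OF proj[rule_format]])
  then show ?thesis by blast
qed

context cring
begin

lemma direct_sum_hom:
  assumes M: "Module.module R M" and f: "\<And>i. i \<in> I \<Longrightarrow> f i \<in> module_hom R M (N i)"
    and fin: "\<And>x. x \<in> carrier M \<Longrightarrow> finite {i \<in> I. f i x \<noteq> \<zero>\<^bsub>N i\<^esub>}"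
  shows "(\<lambda>x. \<lambda>i\<in>I. f i x) \<in> module_hom R M (direct_sum I N)"
proof (rule module_homI)
  fix x assume x: "x \<in> carrier M"
  have "{i \<in> I. (\<lambda>i\<in>I. f i x) i \<noteq> \<zero>\<^bsub>N i\<^esub>} = {i \<in> I. f i x \<noteq> \<zero>\<^bsub>N i\<^esub>}" by auto
  then show "(\<lambda>i\<in>I. f i x) \<in> carrier (direct_sum I N)"
    using fin[OF x] module_hom_closed[OF f x] by (simp add: direct_sum_carrier_iff)
  fix y assume y: "y \<in> carrier M"
  show "(\<lambda>i\<in>I. f i (x \<oplus>\<^bsub>M\<^esub> y)) = (\<lambda>i\<in>I. f i x) \<oplus>\<^bsub>direct_sum I N\<^esub> (\<lambda>i\<in>I. f i y)"
    using module_hom_add[OF f x y] by (simp add: direct_sum_def cong: restrict_cong)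
next
  fix r x assume "r \<in> carrier R" and x: "x \<in> carrier M"
  then show "(\<lambda>i\<in>I. f i (r \<odot>\<^bsub>M\<^esub> x)) = r \<odot>\<^bsub>direct_sum I N\<^esub> (\<lambda>i\<in>I. f i x)"
    using module_hom_smult[OF f] by (simp add: direct_sum_def cong: restrict_cong)
qed

end

lemma (in bredon) free_tensor_cmaps:
  assumes H: "H \<in> \<H>" and X: "X \<in> G.TG" and U: "based_group_ring_module R (weyl_group G H) U B"
  shows "free_tensor R (weyl_group G H) U B (G.cmaps X H) (\<lambda>h w. \<lambda>x\<in>fst X. h x <#>\<^bsub>G\<^esub> w)"
  using U G.cmaps_ract[OF H X] G.cmaps_ract_one[OF H X] G.cmaps_ract_mult[OF H X]
  by (simp add: free_tensor_def free_tensor_axioms_def)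

lemma ind_tau_cval: "cval (ind_tau R G H U) X = tensor R (weyl_group G H) (free_module R (gset_maps G X (coset_gset G H)))
    (\<lambda>a w. free_map R (gset_maps G X (coset_gset G H)) (gset_maps G X (coset_gset G H)) (\<lambda>h. \<lambda>x\<in>fst X. h x <#>\<^bsub>G\<^esub> w) a) U"
  by (simp add: ind_tau_def free_contramodule_def free_contramodule_ract_def[abs_def])

section \<open>The sum of induced contramodules as a free contramodule\<close>

context bredon
begin

context
  fixes I :: "'g set set" and U :: "'g set \<Rightarrow> ('r, 'p, 'g set) group_module" and B :: "'g set \<Rightarrow> 'p set"
  assumes I: "I \<subseteq> \<H>" and based: "H \<in> I \<Longrightarrow> based_group_ring_module R (weyl_group G H) (U H) (B H)"
begin

definition ind_iso where
  "ind_iso H X = free_tensor.\<Theta> R (weyl_group G H) (U H) (B H) (G.cmaps X H) (\<lambda>h w. \<lambda>x\<in>fst X. h x <#>\<^bsub>G\<^esub> w)"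

definition slice :: "'g set \<Rightarrow> 'g gset \<Rightarrow> ('g set \<times> ('g set \<Rightarrow> 'g set) \<times> 'p \<Rightarrow> 'r) \<Rightarrow> ('g set \<Rightarrow> 'g set) \<times> 'p \<Rightarrow> 'r" where
  "slice H X c = (\<lambda>p\<in>G.cmaps X H \<times> B H. c (H, p))"

abbreviation "ind_sum \<equiv> contramodule_sum I (\<lambda>H. ind_tau R G H (U H))"

lemma ind_iso_hom: "H \<in> I \<Longrightarrow> X \<in> G.TG \<Longrightarrow>
    ind_iso H X \<in> module_hom R (free_module R (G.cmaps X H \<times> B H)) (cval (ind_tau R G H (U H)) X)"
  and ind_iso_bij: "H \<in> I \<Longrightarrow> X \<in> G.TG \<Longrightarrow>
    bij_betw (ind_iso H X) (carrier (free_module R (G.cmaps X H \<times> B H))) (carrier (cval (ind_tau R G H (U H)) X))"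
  and ind_tau_module: "H \<in> I \<Longrightarrow> X \<in> G.TG \<Longrightarrow> Module.module R (cval (ind_tau R G H (U H)) X)"
proof -
  assume H: "H \<in> I" and X: "X \<in> G.TG"
  interpret ft: free_tensor R "weyl_group G H" "U H" "B H" "G.cmaps X H" "\<lambda>h w. \<lambda>x\<in>fst X. h x <#>\<^bsub>G\<^esub> w"
    by (rule free_tensor_cmaps[OF subsetD[OF I H] X based[OF H]])
  show "ind_iso H X \<in> module_hom R (free_module R (G.cmaps X H \<times> B H)) (cval (ind_tau R G H (U H)) X)"
    unfolding ind_iso_def ind_tau_cval by (rule ft.\<Theta>_hom)
  show "bij_betw (ind_iso H X) (carrier (free_module R (G.cmaps X H \<times> B H))) (carrier (cval (ind_tau R G H (U H)) X))"
    unfolding ind_iso_def ind_tau_cval by (rule ft.\<Theta>_bij)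
  show "Module.module R (cval (ind_tau R G H (U H)) X)"
    unfolding ind_tau_cval by (rule ft.module_T)
qed

text \<open>Composition with \<open>f\<close> commutes with the right action of \<open>WH\<close>,
  so \<open>tensor_map_hom\<close> applies. On \<open>h \<otimes> b\<close> the induced map changes
  \<open>h\<close> only, which is the rule of \<open>free_pull\<close>.\<close>

lemma ind_tau_cmap:
  assumes H: "H \<in> I" and X: "X \<in> G.TG" and Y: "Y \<in> G.TG" and f: "f \<in> gset_maps G X Y"
  shows "cmap (ind_tau R G H (U H)) X Y f \<in> module_hom R (cval (ind_tau R G H (U H)) Y) (cval (ind_tau R G H (U H)) X)"
    and "h \<in> G.cmaps Y H \<Longrightarrow> b \<in> B H \<Longrightarrow>
      cmap (ind_tau R G H (U H)) X Y f (ind_iso H Y (free_basis R (G.cmaps Y H \<times> B H) (h, b))) =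
      ind_iso H X (free_basis R (G.cmaps X H \<times> B H) (pullback X f h, b))"
proof -
  note H' = subsetD[OF I H]
  let ?r = "\<lambda>X h w. \<lambda>x\<in>fst X. h x <#>\<^bsub>G\<^esub> w"
  interpret X: free_tensor R "weyl_group G H" "U H" "B H" "G.cmaps X H" "?r X"
    by (rule free_tensor_cmaps[OF H' X based[OF H]])
  interpret Y: free_tensor R "weyl_group G H" "U H" "B H" "G.cmaps Y H" "?r Y"
    by (rule free_tensor_cmaps[OF H' Y based[OF H]])
  have pull: "pullback X f \<in> G.cmaps Y H \<rightarrow> G.cmaps X H" using G.gset_maps_compose[OF X f] by blast
  have ract: "(\<lambda>h. ?r Z h w) \<in> G.cmaps Z H \<rightarrow> G.cmaps Z H" if "Z \<in> G.TG" "w \<in> carrier (weyl_group G H)" for Z w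
    using G.cmaps_ract[OF H' that(1) _ that(2)] by blast
  let ?p = "free_map R (G.cmaps Y H) (G.cmaps X H) (pullback X f)"
  have equiv: "?p (free_map R (G.cmaps Y H) (G.cmaps Y H) (\<lambda>h. ?r Y h w) a) =
      free_map R (G.cmaps X H) (G.cmaps X H) (\<lambda>h. ?r X h w) (?p a)"
    if a: "a \<in> carrier (free_module R (G.cmaps Y H))" and w: "w \<in> carrier (weyl_group G H)" for a w
    unfolding free_map_comp[OF ract[OF Y w] pull a] free_map_comp[OF pull ract[OF X w] a]
  proof (rule free_map_cong)
    fix h
    show "pullback X f (?r Y h w) = ?r X (pullback X f h) w"
    proof
      fix x show "pullback X f (?r Y h w) x = ?r X (pullback X f h) w x"
        using G.gset_maps_closed[OF f, of x] by (cases "x \<in> fst X") (simp_all add: compose_def)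
    qed
  qed
  note tm = tensor_map_hom[OF Y.tensor_product_axioms X.tensor_product_axioms free_map_hom[OF pull]]
  have cmap: "cmap (ind_tau R G H (U H)) X Y f = tensor_map R (weyl_group G H) (free_module R (G.cmaps Y H))
      (free_module R (G.cmaps X H)) (\<lambda>a w. free_map R (G.cmaps X H) (G.cmaps X H) (\<lambda>h. ?r X h w) a) (U H) ?p"
    by (simp add: ind_tau_def free_contramodule_def free_contramodule_ract_def[abs_def])
  show "cmap (ind_tau R G H (U H)) X Y f \<in> module_hom R (cval (ind_tau R G H (U H)) Y) (cval (ind_tau R G H (U H)) X)"
    unfolding cmap ind_tau_cval by (rule tm(1)) (rule equiv)
  assume h: "h \<in> G.cmaps Y H" and b: "b \<in> B H"
  show "cmap (ind_tau R G H (U H)) X Y f (ind_iso H Y (free_basis R (G.cmaps Y H \<times> B H) (h, b))) =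
      ind_iso H X (free_basis R (G.cmaps X H \<times> B H) (pullback X f h, b))"
    unfolding ind_iso_def Y.\<Theta>_basis[OF h b] X.\<Theta>_basis[OF funcset_mem[OF pull h] b] cmap
      free_map_basis[OF pull h, symmetric]
    by (rule tm(2)[OF _ free_basis_carrier[OF h] subsetD[OF based_group_ring_module.B[OF based[OF H]] b]]) (rule equiv)
qed

lemma Pair_gens: "H \<in> I \<Longrightarrow> Pair H \<in> G.cmaps X H \<times> B H \<rightarrow> free_gens I B X"
  by (auto simp: free_gens_iff)

lemma slice_hom: "H \<in> I \<Longrightarrow> slice H X \<in> module_hom R (free_module R (free_gens I B X)) (free_module R (G.cmaps X H \<times> B H))"
  unfolding slice_def[abs_def] by (rule free_module_restrict_hom[OF _ Pair_gens]) (auto simp: inj_on_def)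

lemma slice_closed: "H \<in> I \<Longrightarrow> c \<in> carrier (free_module R (free_gens I B X)) \<Longrightarrow>
    slice H X c \<in> carrier (free_module R (G.cmaps X H \<times> B H))"
  by (rule module_hom_closed[OF slice_hom])

lemma slice_basis:
  assumes H: "H \<in> I" and s: "(K, h, b) \<in> free_gens I B X"
  shows "slice H X (free_basis R (free_gens I B X) (K, h, b)) =
    (if H = K then free_basis R (G.cmaps X H \<times> B H) (h, b) else \<zero>\<^bsub>free_module R (G.cmaps X H \<times> B H)\<^esub>)"
proof -
  interpret F: Module.module R "free_module R (G.cmaps X H \<times> B H)" by (rule module_free_module)
  show ?thesis
  proof (cases "H = K")
    case True
    then have "(h, b) \<in> G.cmaps X H \<times> B H" using s by (simp add: free_gens_iff)
    then have "slice H X (free_basis R (free_gens I B X) (K, h, b)) = free_basis R (G.cmaps X H \<times> B H) (h, b)"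
      by (intro free_module_eqI[OF slice_closed[OF H free_basis_carrier[OF s]] free_basis_carrier])
         (use H True in \<open>auto simp: slice_def free_basis_apply free_gens_iff split: if_splits\<close>)
    then show ?thesis using True by simp
  next
    case False
    have "slice H X (free_basis R (free_gens I B X) (K, h, b)) = \<zero>\<^bsub>free_module R (G.cmaps X H \<times> B H)\<^esub>"
    proof (rule free_module_eqI[OF slice_closed[OF H free_basis_carrier[OF s]] F.zero_closed])
      fix p assume p: "p \<in> G.cmaps X H \<times> B H"
      have "(H, p) \<in> free_gens I B X" by (rule funcset_mem[OF Pair_gens[OF H] p])
      then show "slice H X (free_basis R (free_gens I B X) (K, h, b)) p = \<zero>\<^bsub>free_module R (G.cmaps X H \<times> B H)\<^esub> p"
        using p False by (simp add: slice_def free_basis_apply)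
    qed
    then show ?thesis using False by simp
  qed
qed

text \<open>A finitely supported \<open>c\<close> involves only finitely many \<open>H\<close>; the
  direct sum requires this of the image.\<close>

lemma finite_slices:
  assumes c: "c \<in> carrier (free_module R (free_gens I B X))"
  shows "finite {H \<in> I. slice H X c \<noteq> \<zero>\<^bsub>free_module R (G.cmaps X H \<times> B H)\<^esub>}"
proof (rule finite_subset)
  show "{H \<in> I. slice H X c \<noteq> \<zero>\<^bsub>free_module R (G.cmaps X H \<times> B H)\<^esub>} \<subseteq> fst ` {s \<in> free_gens I B X. c s \<noteq> \<zero>}"
  proof
    fix H assume "H \<in> {H \<in> I. slice H X c \<noteq> \<zero>\<^bsub>free_module R (G.cmaps X H \<times> B H)\<^esub>}"
    then have H: "H \<in> I" and ne: "slice H X c \<noteq> \<zero>\<^bsub>free_module R (G.cmaps X H \<times> B H)\<^esub>" by auto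
    interpret F: Module.module R "free_module R (G.cmaps X H \<times> B H)" by (rule module_free_module)
    obtain p where p: "p \<in> G.cmaps X H \<times> B H" "slice H X c p \<noteq> \<zero>\<^bsub>free_module R (G.cmaps X H \<times> B H)\<^esub> p"
      using free_module_eqI[OF slice_closed[OF H c] F.zero_closed] ne by blast
    then have "(H, p) \<in> {s \<in> free_gens I B X. c s \<noteq> \<zero>}"
      using funcset_mem[OF Pair_gens[OF H] p(1)] by (simp add: slice_def)
    then show "H \<in> fst ` {s \<in> free_gens I B X. c s \<noteq> \<zero>}" by force
  qed
  show "finite (fst ` {s \<in> free_gens I B X. c s \<noteq> \<zero>})" using c by (simp add: free_module_carrier_iff)
qed

definition "ind_sum_iso X c = (\<lambda>H\<in>I. ind_iso H X (slice H X c))"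

lemma ind_sum_simps: "cval ind_sum X = direct_sum I (\<lambda>H. cval (ind_tau R G H (U H)) X)"
  "cmap ind_sum X Y f = (\<lambda>m. \<lambda>H\<in>I. cmap (ind_tau R G H (U H)) X Y f (m H))"
  by (simp_all add: contramodule_sum_def)

lemma ind_sum_iso_hom:
  assumes X: "X \<in> G.TG"
  shows "ind_sum_iso X \<in> module_hom R (free_module R (free_gens I B X)) (cval ind_sum X)"
  unfolding ind_sum_iso_def[abs_def] ind_sum_simps
proof (rule direct_sum_hom[OF module_free_module])
  fix H assume H: "H \<in> I"
  show "(\<lambda>c. ind_iso H X (slice H X c)) \<in> module_hom R (free_module R (free_gens I B X)) (cval (ind_tau R G H (U H)) X)"
    by (rule module_hom_comp[OF slice_hom[OF H] ind_iso_hom[OF H X]])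
next
  fix c assume "c \<in> carrier (free_module R (free_gens I B X))"
  then show "finite {H \<in> I. ind_iso H X (slice H X c) \<noteq> \<zero>\<^bsub>cval (ind_tau R G H (U H)) X\<^esub>}"
    by (rule finite_subset[rotated, OF finite_slices])
       (use module_hom_zero[OF module_free_module ind_tau_module[OF _ X] ind_iso_hom[OF _ X]] in auto)
qed

lemma ind_sum_iso_bij:
  assumes X: "X \<in> G.TG"
  shows "bij_betw (ind_sum_iso X) (carrier (free_module R (free_gens I B X))) (carrier (cval ind_sum X))"
proof (rule bij_betwI')
  fix c c' assume c: "c \<in> carrier (free_module R (free_gens I B X))" and c': "c' \<in> carrier (free_module R (free_gens I B X))"
  show "ind_sum_iso X c = ind_sum_iso X c' \<longleftrightarrow> c = c'"
  proof
    assume eq: "ind_sum_iso X c = ind_sum_iso X c'"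
    show "c = c'"
    proof (rule free_module_eqI[OF c c'])
      fix s assume "s \<in> free_gens I B X"
      then obtain H p where s: "s = (H, p)" "H \<in> I" "p \<in> G.cmaps X H \<times> B H" by (auto simp: free_gens_def)
      have "ind_iso H X (slice H X c) = ind_iso H X (slice H X c')"
        using fun_cong[OF eq, of H] s(2) by (simp add: ind_sum_iso_def)
      then have "slice H X c = slice H X c'"
        using bij_betw_imp_inj_on[OF ind_iso_bij[OF s(2) X]] slice_closed[OF s(2) c] slice_closed[OF s(2) c']
        by (simp add: inj_on_eq_iff)
      then have "slice H X c p = slice H X c' p" by (rule fun_cong)
      then show "c s = c' s" using s by (simp add: slice_def)
    qed
  qed simp
next
  fix c assume "c \<in> carrier (free_module R (free_gens I B X))"
  then show "ind_sum_iso X c \<in> carrier (cval ind_sum X)" by (rule module_hom_closed[OF ind_sum_iso_hom[OF X]])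
next
  fix y assume y: "y \<in> carrier (cval ind_sum X)"
  define z where "z H = inv_into (carrier (free_module R (G.cmaps X H \<times> B H))) (ind_iso H X) (y H)" for H
  \<comment> \<open>The preimage is glued from the preimages \<open>z H\<close> of the components.
    Its support is finite because \<open>y\<close> has finitely many nonzero components, and
    \<open>z H\<close> vanishes for the others.\<close>
  define c where "c = (\<lambda>s\<in>free_gens I B X. z (fst s) (snd s))"
  have y': "y H \<in> carrier (cval (ind_tau R G H (U H)) X)" if "H \<in> I" for H
    using y that by (simp add: ind_sum_simps direct_sum_carrier_iff)
  have z_hom: "inv_into (carrier (free_module R (G.cmaps X H \<times> B H))) (ind_iso H X) \<in>
      module_hom R (cval (ind_tau R G H (U H)) X) (free_module R (G.cmaps X H \<times> B H))" if "H \<in> I" for H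
    by (rule module_hom_inv[OF module_free_module ind_iso_hom[OF that X] ind_iso_bij[OF that X]])
  have z: "z H \<in> carrier (free_module R (G.cmaps X H \<times> B H))" if "H \<in> I" for H
    unfolding z_def by (rule module_hom_closed[OF z_hom[OF that] y'[OF that]])
  have z_zero: "z H p = \<zero>" if "H \<in> I" "y H = \<zero>\<^bsub>cval (ind_tau R G H (U H)) X\<^esub>" "p \<in> G.cmaps X H \<times> B H" for H p
    unfolding z_def that(2) module_hom_zero[OF ind_tau_module[OF that(1) X] module_free_module z_hom[OF that(1)]]
    by (rule free_module_apply(1)[OF that(3)])
  have c_apply: "c (H, p) = z H p" if "H \<in> I" "p \<in> G.cmaps X H \<times> B H" for H p
    using funcset_mem[OF Pair_gens[OF that(1)] that(2)] by (simp add: c_def)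
  have c: "c \<in> carrier (free_module R (free_gens I B X))"
    unfolding free_module_carrier_iff
  proof (intro conjI ballI)
    show "c \<in> extensional (free_gens I B X)" by (simp add: c_def)
    fix s assume "s \<in> free_gens I B X"
    then obtain H p where s: "s = (H, p)" "H \<in> I" "p \<in> G.cmaps X H \<times> B H" by (auto simp: free_gens_def)
    then show "c s \<in> carrier R" using free_module_closed[OF z[OF s(2)] s(3)] by (simp add: c_apply)
  next
    show "finite {s \<in> free_gens I B X. c s \<noteq> \<zero>}"
    proof (rule finite_subset)
      show "{s \<in> free_gens I B X. c s \<noteq> \<zero>} \<subseteq> (SIGMA H:{H \<in> I. y H \<noteq> \<zero>\<^bsub>cval (ind_tau R G H (U H)) X\<^esub>}.
          {p \<in> G.cmaps X H \<times> B H. z H p \<noteq> \<zero>})"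
      proof
        fix s assume s: "s \<in> {s \<in> free_gens I B X. c s \<noteq> \<zero>}"
        then obtain H p where e: "s = (H, p)" "H \<in> I" "p \<in> G.cmaps X H \<times> B H" by (auto simp: free_gens_def)
        with s have "z H p \<noteq> \<zero>" by (simp add: c_apply)
        then show "s \<in> (SIGMA H:{H \<in> I. y H \<noteq> \<zero>\<^bsub>cval (ind_tau R G H (U H)) X\<^esub>}. {p \<in> G.cmaps X H \<times> B H. z H p \<noteq> \<zero>})"
          using e z_zero by blast
      qed
      show "finite (SIGMA H:{H \<in> I. y H \<noteq> \<zero>\<^bsub>cval (ind_tau R G H (U H)) X\<^esub>}. {p \<in> G.cmaps X H \<times> B H. z H p \<noteq> \<zero>})"
      proof (rule finite_SigmaI)
        show "finite {H \<in> I. y H \<noteq> \<zero>\<^bsub>cval (ind_tau R G H (U H)) X\<^esub>}"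
          using y by (simp add: ind_sum_simps direct_sum_carrier_iff)
        fix H assume "H \<in> {H \<in> I. y H \<noteq> \<zero>\<^bsub>cval (ind_tau R G H (U H)) X\<^esub>}"
        then have "z H \<in> carrier (free_module R (G.cmaps X H \<times> B H))" using z by simp
        then show "finite {p \<in> G.cmaps X H \<times> B H. z H p \<noteq> \<zero>}" by (simp add: free_module_carrier_iff)
      qed
    qed
  qed
  have "ind_sum_iso X c = y"
  proof
    fix H show "ind_sum_iso X c H = y H"
    proof (cases "H \<in> I")
      case True
      have "slice H X c = z H"
        by (rule free_module_eqI[OF slice_closed[OF True c] z[OF True]]) (simp add: slice_def c_apply[OF True])
      then show ?thesis
        using True y'[OF True] ind_iso_bij[OF True X]
        by (simp add: ind_sum_iso_def z_def bij_betw_def f_inv_into_f)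
    next
      case False
      then show ?thesis using y by (simp add: ind_sum_iso_def ind_sum_simps direct_sum_carrier_iff extensional_def)
    qed
  qed
  then show "\<exists>c\<in>carrier (free_module R (free_gens I B X)). y = ind_sum_iso X c" using c by blast
qed

text \<open>Compared one component \<open>H\<close> at a time on basis elements: for a generator
  over another subgroup both sides vanish, and otherwise \<open>ind_tau_cmap\<close>
  applies.\<close>

lemma ind_sum_iso_natural:
  assumes X: "X \<in> G.TG" and Y: "Y \<in> G.TG" and f: "f \<in> gset_maps G X Y"
    and c: "c \<in> carrier (free_module R (free_gens I B Y))"
  shows "ind_sum_iso X (free_map R (free_gens I B Y) (free_gens I B X) (free_pull X f) c) = cmap ind_sum X Y f (ind_sum_iso Y c)"
proof -
  have map: "free_pull X f \<in> free_gens I B Y \<rightarrow> free_gens I B X" using free_pull_closed[OF I X f] by blast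
  have "ind_iso H X (slice H X (free_map R (free_gens I B Y) (free_gens I B X) (free_pull X f) c)) =
      cmap (ind_tau R G H (U H)) X Y f (ind_iso H Y (slice H Y c))" if H: "H \<in> I" for H
  proof (rule free_hom_eqI[where f="\<lambda>c. ind_iso H X (slice H X (free_map R (free_gens I B Y) (free_gens I B X) (free_pull X f) c))"
        and g="\<lambda>c. cmap (ind_tau R G H (U H)) X Y f (ind_iso H Y (slice H Y c))",
        OF ind_tau_module[OF H X] module_hom_comp[OF module_hom_comp[OF free_map_hom[OF map] slice_hom[OF H]] ind_iso_hom[OF H X]]
          module_hom_comp[OF module_hom_comp[OF slice_hom[OF H] ind_iso_hom[OF H Y]] ind_tau_cmap(1)[OF H X Y f]] _ c])
    fix s assume s: "s \<in> free_gens I B Y"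
    then obtain K h b where e: "s = (K, h, b)" by (cases s)
    note s' = s[unfolded e] and p = funcset_mem[OF map s, unfolded e free_pull_def prod.case]
    have z: "ind_iso H Z \<zero>\<^bsub>free_module R (G.cmaps Z H \<times> B H)\<^esub> = \<zero>\<^bsub>cval (ind_tau R G H (U H)) Z\<^esub>" if "Z \<in> G.TG" for Z
      by (rule module_hom_zero[OF module_free_module ind_tau_module[OF H that] ind_iso_hom[OF H that]])
    show "ind_iso H X (slice H X (free_map R (free_gens I B Y) (free_gens I B X) (free_pull X f) (free_basis R (free_gens I B Y) s))) =
        cmap (ind_tau R G H (U H)) X Y f (ind_iso H Y (slice H Y (free_basis R (free_gens I B Y) s)))"
    proof (cases "H = K")
      case True
      then show ?thesis
        using s' ind_tau_cmap(2)[OF H X Y f]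
        unfolding e free_map_basis[OF map s'] slice_basis[OF H s']
        unfolding free_pull_def prod.case slice_basis[OF H p]
        by (simp add: free_gens_iff)
    next
      case False
      then show ?thesis
        using s' module_hom_zero[OF ind_tau_module[OF H Y] ind_tau_module[OF H X] ind_tau_cmap(1)[OF H X Y f]]
        unfolding e free_map_basis[OF map s'] slice_basis[OF H s']
        unfolding free_pull_def prod.case slice_basis[OF H p]
        by (simp add: z X Y)
    qed
  qed
  then show ?thesis by (simp add: ind_sum_iso_def ind_sum_simps cong: restrict_cong)
qed

lemma contramodule_iso_ind_sum:
  "contramodule_iso R G \<H> (linear_contramodule R (free_gens I B) free_pull) ind_sum ind_sum_iso"
proof (intro contramodule_iso.intro contramodule_iso_axioms.intro bredon_axioms free_contramodule_is_contramodule[OF I])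
  fix X assume X: "X \<in> G.TG"
  show "Module.module R (cval ind_sum X)"
    unfolding ind_sum_simps by (rule module_direct_sum[OF ind_tau_module[OF _ X]])
qed (simp_all add: linear_contramodule_def ind_sum_iso_hom ind_sum_iso_bij ind_sum_iso_natural)

end

end

theorem theorem2p5:
  fixes R :: "('r, 'k) ring_scheme"
    and G :: "('g, 'l) monoid_scheme"
    and \<H> :: "'g set set"
    and I :: "'g set set"
    and P :: "'g set \<Rightarrow> ('r, 'p, 'g set) group_complex"
    and q :: "'g set \<Rightarrow> nat \<Rightarrow> 'p \<Rightarrow> 'g set list \<Rightarrow> 'r"
  assumes "cring R"
    and "group G"
    and "\<And>H. H \<in> \<H> \<Longrightarrow> subgroup H G"
    and "\<And>H g. H \<in> \<H> \<Longrightarrow> g \<in> carrier G \<Longrightarrow> conjugate G g H \<in> \<H>"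
    and "\<exists>N :: nat. \<forall>H \<in> \<H>. subgroup_length \<H> H \<le> enat N"
    and "\<And>H. H \<in> \<H> \<Longrightarrow>
      is_free_resolution R (weyl_group G H) (P H) (suspended_augmented_chains R G \<H> H) (q H)"
    and "is_conjugacy_representatives G \<H> I"
  shows "\<exists>d \<epsilon>. is_projective_resolution TYPE('m) R G \<H>
           (\<lambda>n. contramodule_sum I (\<lambda>H. ind_tau R G H (cterm (P H) n))) d \<epsilon>
           (constant_contramodule R)"
proof -
  have family: "subgroup_family G \<H>"
    using assms(2-4) by (intro subgroup_family.intro subgroup_family_axioms.intro)
  obtain N where N: "\<And>H. H \<in> \<H> \<Longrightarrow> subgroup_length \<H> H \<le> enat N" using assms(5) by blast
  \<comment> \<open>Freeness provides a basis for each \<open>H\<close> and \<open>n\<close>; the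
    choice of all of them at once follows.\<close>
  have "\<exists>B. based_group_ring_module R (weyl_group G H) (cterm (P H) n) B" if H: "H \<in> \<H>" for H n
  proof -
    have free: "is_free_group_module R (weyl_group G H) (cterm (P H) n)"
      using assms(6)[OF H] by (simp add: is_free_resolution_def)
    interpret group_ring_module R "weyl_group G H" "cterm (P H) n"
      using free by (intro group_ring_module.intro group_ring_module_axioms.intro assms(1)
          group.group_weyl_group[OF assms(2) assms(3)[OF H]]) (simp add: is_free_group_module_def)
    show ?thesis
      by (rule free_group_module_basis[OF free])
         (blast intro: based_group_ring_module.intro based_group_ring_module_axioms.intro group_ring_module_axioms)
  qed
  then obtain B where B: "\<And>H n. H \<in> \<H> \<Longrightarrow> based_group_ring_module R (weyl_group G H) (cterm (P H) n) (B H n)"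
    by metis
  interpret bredon_resolution R G \<H> I N P q B
    by (intro bredon_resolution.intro bredon_resolution_axioms.intro bredon.intro assms(1,6,7) family N B)
  have I: "I \<subseteq> \<H>" using I_family by blast
  \<comment> \<open>The resolution is found for the free contramodules \<open>FC n\<close>;
    degreewise isomorphisms are enough to transport it to the induced ones.\<close>
  have "contramodule_iso R G \<H> (FC n) (contramodule_sum I (\<lambda>H. ind_tau R G H (cterm (P H) n)))
      (ind_sum_iso I (\<lambda>H. cterm (P H) n) (\<lambda>H. B H n))" for n
    unfolding FC_def by (rule contramodule_iso_ind_sum[OF I B[OF I_family]])
  then show ?thesis
    using free_resolution[where ?'m = 'm] by (elim exE) (rule projective_resolution_transport)
qed

end
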